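(* For a positive integer $\rho$, let $U(\rho)$ be the set of all integers $n$ for which a $\rho$-regular sign-unbalanced nut graph of order $n$ exists. Then (with $k$ ranging over the integers): 1. $U(1)=\emptyset$; 2. $U(2)=\emptyset$; 3. $U(3)=\{2k\mid k\ge 6\}$; 4. $U(4)=\{5\}\cup\{k\mid k\ge 7\}$; 5. $U(5)=\{2k\mid k\ge 5\}$; 6. $U(6)=\{k\mid k\ge 8\}$; 7. $U(7)=\{2k\mid k\ge 5\}$; 8. $U(8)=\{k\mid k\ge 9\}$; 9. $U(9)=\{2k\mid k\ge 6\}$; 10. $U(10)=\{k\mid k\ge 12\}$; 11. $U(11)=\{2k\mid k\ge 7\}$.
   Context: All graphs are finite and simple. A signed graph $\Gamma=(G,\Sigma)$ is a graph $G=(V,E)$ (the underlying graph) with a distinguished set $\Sigma\subseteq E$ of negative edges. Its order is $|V|$, and it is $\rho$-regular if $G$ is $\rho$-regular. Its adjacency matrix $A(\Gamma)$ is obtained from the $0$-$1$ adjacency matrix of $G$ by replacing $1$ by $-1$ at entries corresponding to negative edges. A vector indexed by $V$ is full if it has no zero entry. $\Gamma$ is a signed nut graph if $\dim\ker A(\Gamma)=1$ and $\ker A(\Gamma)$ contains a full vector. Switching $\Gamma$ at $U\subseteq V$ produces $\Gamma^U=(G,\Sigma\,\triangle\,\partial U)$, where $\triangle$ is symmetric difference and $\partial U=\{uv\in E: u\in U, v\notin U\}$; two signed graphs over the same $G$ are switching equivalent if one is obtained from the other by a switching. $\Gamma=(G,\Sigma)$ is sign-balanced if it is switching equivalent to $(G,\emptyset)$,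 and sign-unbalanced otherwise. A sign-unbalanced nut graph is a signed nut graph that is sign-unbalanced. *)

theory Defs
  imports Complex_Main "HOL-Library.Function_Algebras"
begin

section \<open>Signed graphs\<close>

record 'a signed_graph =
  verts :: "'a set"
  edges :: "'a set set"
  neg_edges :: "'a set set"

definition signed_graph :: "'a signed_graph \<Rightarrow> bool" where
  "signed_graph \<Gamma> \<longleftrightarrow>
     finite (verts \<Gamma>) \<and>
     edges \<Gamma> \<subseteq> {e. e \<subseteq> verts \<Gamma> \<and> card e = 2} \<and>
     neg_edges \<Gamma> \<subseteq> edges \<Gamma>"

definition order :: "'a signed_graph \<Rightarrow> nat" where
  "order \<Gamma> = card (verts \<Gamma>)"

definition degree :: "'a signed_graph \<Rightarrow> 'a \<Rightarrow> nat" where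
  "degree \<Gamma> v = card {e \<in> edges \<Gamma>. v \<in> e}"

definition regular :: "nat \<Rightarrow> 'a signed_graph \<Rightarrow> bool" where
  "regular \<rho> \<Gamma> \<longleftrightarrow> (\<forall>v \<in> verts \<Gamma>. degree \<Gamma> v = \<rho>)"

definition adj_matrix :: "'a signed_graph \<Rightarrow> 'a \<Rightarrow> 'a \<Rightarrow> real" where
  "adj_matrix \<Gamma> u v =
     (if {u, v} \<in> neg_edges \<Gamma> then - 1 else if {u, v} \<in> edges \<Gamma> then 1 else 0)"


section \<open>Nut graphs\<close>

global_interpretation real_fun: vector_space "\<lambda>(c::real) (f :: 'a \<Rightarrow> real). (\<lambda>x. c * f x)"
  by unfold_locales (auto simp: fun_eq_iff algebra_simps)

text \<open>
  A vector indexed by the vertex set is represented by a function that vanishes outside the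
  vertex set, so that the dimension below is that of the kernel in the usual sense.
\<close>

definition ker_adj :: "'a signed_graph \<Rightarrow> ('a \<Rightarrow> real) set" where
  "ker_adj \<Gamma> = {x. (\<forall>v. v \<notin> verts \<Gamma> \<longrightarrow> x v = 0) \<and>
                  (\<forall>u \<in> verts \<Gamma>. (\<Sum>v \<in> verts \<Gamma>. adj_matrix \<Gamma> u v * x v) = 0)}"

definition full_vector :: "'a signed_graph \<Rightarrow> ('a \<Rightarrow> real) \<Rightarrow> bool" where
  "full_vector \<Gamma> x \<longleftrightarrow> (\<forall>v \<in> verts \<Gamma>. x v \<noteq> 0)"

definition signed_nut_graph :: "'a signed_graph \<Rightarrow> bool" where
  "signed_nut_graph \<Gamma> \<longleftrightarrow>
     signed_graph \<Gamma> \<and> real_fun.dim (ker_adj \<Gamma>) = 1 \<and> (\<exists>x \<in> ker_adj \<Gamma>. full_vector \<Gamma> x)"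


section \<open>Switching and balance\<close>

definition boundary :: "'a signed_graph \<Rightarrow> 'a set \<Rightarrow> 'a set set" where
  "boundary \<Gamma> U = {{u, v} | u v. {u, v} \<in> edges \<Gamma> \<and> u \<in> U \<and> v \<notin> U}"

definition switching :: "'a signed_graph \<Rightarrow> 'a set \<Rightarrow> 'a signed_graph" where
  "switching \<Gamma> U = \<Gamma>\<lparr>neg_edges := sym_diff (neg_edges \<Gamma>) (boundary \<Gamma> U)\<rparr>"

definition switching_equivalent :: "'a signed_graph \<Rightarrow> 'a signed_graph \<Rightarrow> bool" where
  "switching_equivalent \<Gamma> \<Delta> \<longleftrightarrow> (\<exists>U \<subseteq> verts \<Gamma>. \<Delta> = switching \<Gamma> U)"

definition sign_balanced :: "'a signed_graph \<Rightarrow> bool" where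
  "sign_balanced \<Gamma> \<longleftrightarrow> switching_equivalent \<Gamma> (\<Gamma>\<lparr>neg_edges := {}\<rparr>)"

definition sign_unbalanced_nut_graph :: "'a signed_graph \<Rightarrow> bool" where
  "sign_unbalanced_nut_graph \<Gamma> \<longleftrightarrow> signed_nut_graph \<Gamma> \<and> \<not> sign_balanced \<Gamma>"

text \<open>
  Every finite graph is isomorphic to one whose vertices are natural numbers, so quantifying over
  that vertex type loses no orders.
\<close>

definition unbalanced_nut_orders :: "nat \<Rightarrow> int set" where
  "unbalanced_nut_orders \<rho> =
     {n. \<exists>\<Gamma> :: nat signed_graph.
           sign_unbalanced_nut_graph \<Gamma> \<and> regular \<rho> \<Gamma> \<and> int (order \<Gamma>) = n}"

end

theory Submission
  imports Defs
begin

text \<open>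
  The kernel of an integer matrix has a basis of rational vectors, so the kernel of a nut graph is
  spanned by a vector of non-zero integers. Everything is therefore done with symmetric integer
  matrices, with entries \<open>-1\<close>, \<open>0\<close>, \<open>1\<close>, over which a kernel vector with one zero entry vanishes
  (locale \<open>nut_matrix\<close>).

  Existence. A vertex of degree \<open>\<rho> \<ge> 3\<close> can be blown up into a piece with \<open>2 * \<rho>\<close> additional
  vertices, which preserves regularity, the nut property and unbalance (\<open>enlarge_order\<close>). Hence one
  graph in each admissible residue class modulo \<open>2 * \<rho>\<close> suffices. These seeds are explicit. The
  nut property of a seed is certified by its kernel vector together with Gaussian elimination over
  the field with three elements, which bounds the rank from below, and unbalance by a negative
  triangle (\<open>nut_certificate_sound\<close>).

  Non-existence. The number of edges gives \<open>even (\<rho> * n)\<close>, and \<open>\<rho> < n\<close> is clear. For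
  degrees one and two the rows of the kernel equation are too short: a single term cannot vanish,
  and two cancelling terms pair the edges up so that part of the kernel vector is again a kernel
  vector (\<open>not_2_regular\<close>). All other cases rest on the parity of a kernel vector \<open>x\<close>. One may
  divide \<open>x\<close> by its greatest common divisor and switch so that all its odd entries are 1 modulo 4
  (\<open>normalise\<close>). Then some entry is odd, every vertex has an even number of neighbours with odd
  entry, and the odd vertices span an even number of edges (\<open>odd_induced_edges\<close>), because the
  quadratic form vanishes at \<open>x\<close>. For a complete graph this forces \<open>4 dvd \<rho>\<close>
  (\<open>complete_degree\<close>), which excludes order \<open>\<rho> + 1\<close> for the degrees 3, 5, 6, 7, 9, 10, 11.

  Three kinds of graphs remain: degree four on six vertices, which is the octahedron
  (\<open>not_4_regular_order_6\<close>), degree five on eight vertices (\<open>not_5_regular_order_8\<close>), and cubic graphs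
  on at most ten vertices (\<open>cubic_order\<close>). In each of them parity determines the adjacencies up
  to a few patterns. A row modulo 4 constrains the signs towards odd neighbours, and in all
  patterns but two these constraints lead to a contradiction, often through a second kernel
  vector that is supported on two vertices with the same neighbourhood. The two exceptional patterns
  consist of cubic graphs of order ten, of which parity leaves eight. For these, a table with one vector for
  every signature up to switching shows that no signature gives a nut graph (\<open>not_refuted\<close>).
\<close>

section \<open>Integer matrices of signed graphs\<close>

text \<open>The condition \<open>uniq\<close> says that the kernel is a line, in a form that is preserved by
  relabelling, switching and enlarging and that is contradicted by exhibiting a single vector.\<close>

locale nut_matrix =
  fixes V :: "'a set" and a :: "'a \<Rightarrow> 'a \<Rightarrow> int" and x :: "'a \<Rightarrow> int"
  assumes fin: "finite V" and nonempty: "V \<noteq> {}"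
    and sym: "a u v = a v u" and loopfree: "a v v = 0" and entry: "a u v \<in> {-1, 0, 1}"
    and ker: "u \<in> V \<Longrightarrow> (\<Sum>v\<in>V. a u v * x v) = 0"
    and full: "v \<in> V \<Longrightarrow> x v \<noteq> 0"
    and uniq: "\<lbrakk>\<And>u. u \<in> V \<Longrightarrow> (\<Sum>v\<in>V. a u v * y v) = 0; w \<in> V; y w = 0; v \<in> V\<rbrakk> \<Longrightarrow> y v = 0"

definition nbrs :: "'a set \<Rightarrow> ('a \<Rightarrow> 'a \<Rightarrow> int) \<Rightarrow> 'a \<Rightarrow> 'a set" where
  "nbrs V a u = {v \<in> V. a u v \<noteq> 0}"

text \<open>Balance is the existence of a sign function \<open>d\<close>, the indicator of the switching set,
  that turns all edges positive.\<close>

definition unbalanced :: "'a set \<Rightarrow> ('a \<Rightarrow> 'a \<Rightarrow> int) \<Rightarrow> bool" where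
  "unbalanced V a \<longleftrightarrow>
     \<not> (\<exists>d :: 'a \<Rightarrow> int. (\<forall>v. d v \<in> {-1, 1}) \<and> (\<forall>u\<in>V. \<forall>v\<in>V. a u v \<noteq> 0 \<longrightarrow> a u v = d u * d v))"

subsection \<open>Integer kernel vectors from real ones\<close>

interpretation rat_fun: vector_space_pair "\<lambda>(q::rat) (r::real). of_rat q * r" "\<lambda>(q::rat) (r::rat). q * r"
  by unfold_locales (auto simp: algebra_simps of_rat_add of_rat_mult)

text \<open>The rational line through \<open>r\<close> splits off from the rational vector space of the reals.
  Applying the projection to every entry turns a real solution of integer equations into a rational solution
  that is non-zero at a prescribed place.\<close>

lemma rational_functional:
  fixes r :: real
  assumes "r \<noteq> 0"
  shows "\<exists>f :: real \<Rightarrow> rat. f r = 1 \<and> f 0 = 0 \<and> (\<forall>s t. f (s + t) = f s + f t) \<and>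
    (\<forall>k s. f (of_int k * s) = of_int k * f s)"
proof -
  have "rat_fun.vs1.independent {r}" using assms by simp
  from rat_fun.linear_independent_extend[OF this, of "\<lambda>_. 1"]
  obtain f where lin: "Vector_Spaces.linear (\<lambda>q r. of_rat q * r) (\<lambda>q r. q * r) f" and "f r = 1"
    by auto
  interpret f: Vector_Spaces.linear "\<lambda>(q::rat) (r::real). of_rat q * r" "\<lambda>(q::rat) (r::rat). q * r" f
    by (fact lin)
  have "f (of_int k * s) = of_int k * f s" for k s
    using f.scale[of "of_int k" s] by (simp only: of_rat_of_int_eq)
  then show ?thesis using \<open>f r = 1\<close> f.zero f.add by (intro exI[of _ f] conjI allI)
qed

lemma common_denominator:
  fixes z :: "'a \<Rightarrow> rat"
  assumes "finite V"
  shows "\<exists>d::int. d \<noteq> 0 \<and> (\<forall>v\<in>V. of_int d * z v \<in> \<int>)"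
  using assms
proof induction
    case (insert v V)
    then obtain d :: int where d: "d \<noteq> 0" "\<forall>v\<in>V. of_int d * z v \<in> \<int>" by auto
    obtain p q where "quotient_of (z v) = (p, q)" by (cases "quotient_of (z v)")
    then have pq: "z v = of_int p / of_int q" "q > 0"
      by (simp_all add: quotient_of_div quotient_of_denom_pos)
    have "of_int (d * q) * z v = of_int (d * p)" using pq by simp
    then have "of_int (d * q) * z v \<in> \<int>" by (simp only: Ints_of_int)
    moreover have "of_int (d * q) * z w \<in> \<int>" if "w \<in> V" for w
    proof -
      have "of_int d * z w \<in> \<int>" using d(2) that by blast
      then have "of_int q * (of_int d * z w) \<in> \<int>" by (rule Ints_mult[OF Ints_of_int])
      moreover have "of_int q * (of_int d * z w) = of_int (d * q) * z w" by simp
      ultimately show ?thesis by (simp only:)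
    qed
    ultimately have "\<forall>w\<in>insert v V. of_int (d * q) * z w \<in> \<int>" by blast
    then show ?case using d(1) pq(2) by (intro exI[of _ "d * q"]) auto
qed (auto intro: exI[of _ 1])

lemma integer_kernel_vector:
  fixes a :: "'a \<Rightarrow> 'a \<Rightarrow> int" and y :: "'a \<Rightarrow> real"
  assumes fin: "finite V" and v: "v \<in> V" "y v \<noteq> 0"
    and ker: "\<And>u. u \<in> V \<Longrightarrow> (\<Sum>w\<in>V. of_int (a u w) * y w) = 0"
  obtains z :: "'a \<Rightarrow> int" where "\<And>u. u \<in> V \<Longrightarrow> (\<Sum>w\<in>V. a u w * z w) = 0" "z v \<noteq> 0"
    "\<And>w. y w = 0 \<Longrightarrow> z w = 0"
proof -
  obtain f :: "real \<Rightarrow> rat" where f1: "f (y v) = 1" and f0: "f 0 = 0"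
    and f_add: "\<forall>s t. f (s + t) = f s + f t" and f_scale: "\<forall>k s. f (of_int k * s) = of_int k * f s"
    using rational_functional[OF v(2)] by (elim exE conjE)
  obtain d :: int where d0: "d \<noteq> 0" and d: "\<forall>w\<in>V. of_int d * f (y w) \<in> \<int>"
    using common_denominator[OF fin, of "\<lambda>w. f (y w)"] by (elim exE conjE)
  define z where "z w = \<lfloor>of_int d * f (y w)\<rfloor>" for w
  have z: "of_int (z w) = of_int d * f (y w)" if "w \<in> V" for w
    using bspec[OF d that] by (auto simp: z_def Ints_def)
  show ?thesis
  proof (rule that[of z])
    fix u assume u: "u \<in> V"
    have sum_f: "f (\<Sum>w\<in>W. g w) = (\<Sum>w\<in>W. f (g w))" for g and W :: "'a set"
      by (induction W rule: infinite_finite_induct) (simp_all add: f0 f_add)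
    have "(of_int (\<Sum>w\<in>V. a u w * z w) :: rat) = (\<Sum>w\<in>V. of_int (a u w) * (of_int d * f (y w)))"
      by (simp add: z)
    also have "\<dots> = of_int d * (\<Sum>w\<in>V. of_int (a u w) * f (y w))"
      unfolding sum_distrib_left by (intro sum.cong refl mult.left_commute)
    also have "\<dots> = of_int d * f (\<Sum>w\<in>V. of_int (a u w) * y w)"
      by (simp only: sum_f f_scale)
    finally show "(\<Sum>w\<in>V. a u w * z w) = 0" using ker[OF u] f0 by (simp del: of_int_sum)
  next
    show "z v \<noteq> 0" using z[OF v(1)] f1 d0 by auto
  qed (simp add: z_def f0)
qed

subsection \<open>Nut graphs and nut matrices\<close>

lemma real_fun_span_singleton: "y \<in> real_fun.span {b} \<longleftrightarrow> (\<exists>c. y = (\<lambda>v. c * b v))"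
  by (auto simp: real_fun.span_singleton)

lemma ker_adj_subspace: "real_fun.subspace (ker_adj \<Gamma>)"
  unfolding real_fun.subspace_def ker_adj_def
  by (auto simp: algebra_simps sum.distrib simp flip: sum_distrib_left)

lemma boundary_iff: "{u, v} \<in> boundary \<Gamma> U \<longleftrightarrow> {u, v} \<in> edges \<Gamma> \<and> (u \<in> U) \<noteq> (v \<in> U)"
proof
  assume "{u, v} \<in> boundary \<Gamma> U"
  then obtain p q where pq: "{u, v} = {p, q}" "{p, q} \<in> edges \<Gamma>" "p \<in> U" "q \<notin> U"
    unfolding boundary_def by blast
  then have "u = p \<and> v = q \<or> u = q \<and> v = p" by (simp add: doubleton_eq_iff)
  with pq show "{u, v} \<in> edges \<Gamma> \<and> (u \<in> U) \<noteq> (v \<in> U)" by auto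
next
  assume e: "{u, v} \<in> edges \<Gamma> \<and> (u \<in> U) \<noteq> (v \<in> U)"
  have "{v, u} = {u, v}" by auto
  with e show "{u, v} \<in> boundary \<Gamma> U" unfolding boundary_def by (cases "u \<in> U") force+
qed

text \<open>The kernel is spanned by a full real vector, hence by a rational one and, after clearing
  denominators, by an integer one.\<close>

lemma nut_order_matrix:
  assumes "n \<in> unbalanced_nut_orders \<rho>"
  obtains V :: "nat set" and a x where "nut_matrix V a x" "\<forall>u\<in>V. card (nbrs V a u) = \<rho>" "unbalanced V a" "int (card V) = n"
proof -
  obtain \<Gamma> :: "nat signed_graph" where G: "sign_unbalanced_nut_graph \<Gamma>" "regular \<rho> \<Gamma>" "int (order \<Gamma>) = n"
    using assms by (auto simp: unbalanced_nut_orders_def)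
  have sg: "signed_graph \<Gamma>" and dim: "real_fun.dim (ker_adj \<Gamma>) = 1"
    using G by (auto simp: sign_unbalanced_nut_graph_def signed_nut_graph_def)
  obtain x0 where x0: "x0 \<in> ker_adj \<Gamma>" "full_vector \<Gamma> x0"
    using G by (auto simp: sign_unbalanced_nut_graph_def signed_nut_graph_def)
  obtain B where B: "B \<subseteq> ker_adj \<Gamma>" "real_fun.independent B" "ker_adj \<Gamma> \<subseteq> real_fun.span B" "card B = 1"
    using real_fun.basis_exists[of "ker_adj \<Gamma>"] dim by metis
  obtain b where b: "B = {b}" using B(4) card_1_singletonE by blast
  have line: "\<exists>c. y = (\<lambda>v. c * b v)" if "y \<in> ker_adj \<Gamma>" for y
    using that B(3) by (auto simp: b real_fun_span_singleton)
  have b0: "b \<noteq> 0" using B(2) real_fun.dependent_zero[of B] b by auto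
  define V where "V = verts \<Gamma>"
  define a :: "nat \<Rightarrow> nat \<Rightarrow> int" where "a u v =
     (if {u, v} \<in> neg_edges \<Gamma> then - 1 else if {u, v} \<in> edges \<Gamma> then 1 else 0)" for u v
  have adj: "adj_matrix \<Gamma> u v = of_int (a u v)" for u v by (simp add: adj_matrix_def a_def)
  have fin: "finite V" and ed: "\<And>e. e \<in> edges \<Gamma> \<Longrightarrow> e \<subseteq> V \<and> card e = 2" and neg: "neg_edges \<Gamma> \<subseteq> edges \<Gamma>"
    using sg by (auto simp: signed_graph_def V_def)
  have ker_iff: "y \<in> ker_adj \<Gamma> \<longleftrightarrow> (\<forall>v. v \<notin> V \<longrightarrow> y v = 0) \<and> (\<forall>u\<in>V. (\<Sum>v\<in>V. of_int (a u v) * y v) = 0)" for y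
    by (simp add: ker_adj_def adj V_def)
  have bout: "b v = 0" if "v \<notin> V" for v using that B(1) b ker_iff by auto
  have bfull: "b v \<noteq> 0" if "v \<in> V" for v
    using line[OF x0(1)] x0(2) that by (auto simp: full_vector_def V_def)
  have ne: "V \<noteq> {}"
    using b0 bout by (auto simp: fun_eq_iff)
  then obtain v0 where v0: "v0 \<in> V" by auto
  obtain z where z: "\<And>u. u \<in> V \<Longrightarrow> (\<Sum>w\<in>V. a u w * z w) = 0" "z v0 \<noteq> 0" "\<And>w. b w = 0 \<Longrightarrow> z w = 0"
    using integer_kernel_vector[where y = b and a = a, OF fin v0 bfull[OF v0]] B(1) b ker_iff by blast
  have int_ker: "\<exists>c. \<forall>v\<in>V. of_int (y v) = c * b v"
    if "\<And>u. u \<in> V \<Longrightarrow> (\<Sum>w\<in>V. a u w * y w) = 0" for y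
  proof -
    have "(\<lambda>v. if v \<in> V then of_int (y v) else 0) \<in> ker_adj \<Gamma>"
      using that by (auto simp: ker_iff simp flip: of_int_mult of_int_sum)
    from line[OF this] show ?thesis by (metis (no_types, lifting))
  qed
  show ?thesis
  proof (rule that[of V a z])
    show "nut_matrix V a z"
    proof
      show "finite V" "V \<noteq> {}" by fact+
      show "a u v = a v u" for u v by (simp add: a_def insert_commute)
      show "a v v = 0" for v using ed[of "{v}"] neg by (auto simp: a_def)
      show "a u v \<in> {-1, 0, 1}" for u v by (simp add: a_def)
      show "(\<Sum>v\<in>V. a u v * z v) = 0" if "u \<in> V" for u using z(1)[OF that] .
      obtain c where c: "\<forall>v\<in>V. of_int (z v) = c * b v" using int_ker[OF z(1)] by auto
      then have "c \<noteq> 0" using v0 z(2) by force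
      then show "z v \<noteq> 0" if "v \<in> V" for v using c bfull that by force
      show "y v = 0" if y: "\<And>u. u \<in> V \<Longrightarrow> (\<Sum>w\<in>V. a u w * y w) = 0" "w \<in> V" "y w = 0" "v \<in> V" for y w v
      proof -
        obtain c where c: "\<forall>v\<in>V. of_int (y v) = c * b v" using int_ker[OF y(1)] by auto
        then have "c = 0" using y(2,3) bfull by force
        then show ?thesis using c y(4) by force
      qed
    qed
    show "\<forall>u\<in>V. card (nbrs V a u) = \<rho>"
    proof
      fix u assume u: "u \<in> V"
      have "bij_betw (\<lambda>v. {u, v}) (nbrs V a u) {e \<in> edges \<Gamma>. u \<in> e}"
      proof (rule bij_betwI')
        fix v w assume "v \<in> nbrs V a u" "w \<in> nbrs V a u"
        show "({u, v} = {u, w}) = (v = w)" by (auto simp: doubleton_eq_iff)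
      next
        fix v assume "v \<in> nbrs V a u"
        then show "{u, v} \<in> {e \<in> edges \<Gamma>. u \<in> e}"
          using neg by (auto simp: nbrs_def a_def split: if_splits)
      next
        fix e assume e: "e \<in> {e \<in> edges \<Gamma>. u \<in> e}"
        then have "card e = 2" "e \<subseteq> V" using ed by auto
        then obtain p q where pq: "e = {p, q}" by (auto simp: card_2_iff)
        then obtain v where "e = {u, v}" using e by auto
        then show "\<exists>v\<in>nbrs V a u. e = {u, v}" using e \<open>e \<subseteq> V\<close>
          by (intro bexI[of _ v]) (auto simp: nbrs_def a_def)
      qed
      then have "card (nbrs V a u) = degree \<Gamma> u" unfolding degree_def by (rule bij_betw_same_card)
      then show "card (nbrs V a u) = \<rho>" using G(2) u by (simp add: regular_def V_def)
    qed
    show "unbalanced V a"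
      unfolding unbalanced_def
    proof (rule notI, elim exE conjE)
      fix d :: "nat \<Rightarrow> int"
      assume d: "\<forall>v. d v \<in> {-1, 1}" and eq: "\<forall>u\<in>V. \<forall>v\<in>V. a u v \<noteq> 0 \<longrightarrow> a u v = d u * d v"
      define U where "U = {v \<in> V. d v = - 1}"
      have "e \<in> neg_edges \<Gamma> \<longleftrightarrow> e \<in> boundary \<Gamma> U" for e
      proof (cases "e \<in> edges \<Gamma>")
        case True
        then obtain u v where uv: "e = {u, v}" "u \<in> V" "v \<in> V"
          using ed[OF True] by (auto simp: card_2_iff)
        then have "a u v \<noteq> 0" using True by (simp add: a_def)
        then have "a u v = d u * d v" using eq uv by blast
        moreover have "d u = 1 \<or> d u = - 1" "d v = 1 \<or> d v = - 1" using d by blast+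
        ultimately have "a u v = - 1 \<longleftrightarrow> (u \<in> U) \<noteq> (v \<in> U)" using uv by (auto simp: U_def)
        moreover have "a u v = - 1 \<longleftrightarrow> e \<in> neg_edges \<Gamma>" using uv by (simp add: a_def)
        ultimately show ?thesis using boundary_iff[of u v \<Gamma> U] uv True by simp
      next
        case False
        then show ?thesis using neg by (auto simp: boundary_def)
      qed
      then have "neg_edges \<Gamma> = boundary \<Gamma> U" by blast
      then have "\<Gamma>\<lparr>neg_edges := {}\<rparr> = switching \<Gamma> U" by (simp add: switching_def)
      moreover have "U \<subseteq> verts \<Gamma>" by (auto simp: U_def V_def)
      ultimately have "sign_balanced \<Gamma>"
        by (auto simp: sign_balanced_def switching_equivalent_def)
      then show False using G(1) by (simp add: sign_unbalanced_nut_graph_def)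
    qed
    show "int (card V) = n" using G(3) by (simp add: order_def V_def)
  qed
qed

text \<open>Conversely, a real kernel vector that vanishes somewhere would, by
  \<open>integer_kernel_vector\<close>, give an integer one that vanishes there, so uniqueness over the
  integers carries over to the reals.\<close>

lemma nut_matrix_order:
  fixes V :: "nat set"
  assumes "nut_matrix V a x" and reg: "\<forall>u\<in>V. card (nbrs V a u) = \<rho>" and unb: "unbalanced V a"
  shows "int (card V) \<in> unbalanced_nut_orders \<rho>"
proof -
  interpret nut_matrix V a x by fact
  define \<Gamma> where "\<Gamma> = \<lparr>verts = V, edges = {{u, v} | u v. u \<in> V \<and> v \<in> V \<and> a u v \<noteq> 0},
     neg_edges = {{u, v} | u v. u \<in> V \<and> v \<in> V \<and> a u v = - 1}\<rparr>"
  have sl [simp]: "verts \<Gamma> = V" by (simp add: \<Gamma>_def)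
  have ed: "{u, v} \<in> edges \<Gamma> \<longleftrightarrow> u \<in> V \<and> v \<in> V \<and> a u v \<noteq> 0" for u v
    using sym[of u v] by (auto simp: \<Gamma>_def doubleton_eq_iff)
  have ng: "{u, v} \<in> neg_edges \<Gamma> \<longleftrightarrow> u \<in> V \<and> v \<in> V \<and> a u v = - 1" for u v
    using sym[of u v] by (auto simp: \<Gamma>_def doubleton_eq_iff)
  have adj: "adj_matrix \<Gamma> u v = of_int (a u v)" if "u \<in> V" "v \<in> V" for u v
    using that entry[of u v] by (auto simp: adj_matrix_def ed ng)
  have ker_iff: "y \<in> ker_adj \<Gamma> \<longleftrightarrow> (\<forall>v. v \<notin> V \<longrightarrow> y v = 0) \<and> (\<forall>u\<in>V. (\<Sum>v\<in>V. of_int (a u v) * y v) = 0)" for y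
    by (simp add: ker_adj_def adj)
  have sg: "signed_graph \<Gamma>"
    unfolding signed_graph_def
  proof (intro conjI subsetI)
    show "finite (verts \<Gamma>)" using fin by simp
    fix e assume e: "e \<in> edges \<Gamma>"
    then obtain u v where "e = {u, v}" "u \<in> V" "v \<in> V" "a u v \<noteq> 0" by (auto simp: \<Gamma>_def)
    moreover from this have "u \<noteq> v" using loopfree by auto
    ultimately show "e \<in> {e. e \<subseteq> verts \<Gamma> \<and> card e = 2}" by simp
  next
    fix e assume "e \<in> neg_edges \<Gamma>"
    then obtain u v where "e = {u, v}" "u \<in> V" "v \<in> V" "a u v = - 1" by (auto simp: \<Gamma>_def)
    then show "e \<in> edges \<Gamma>" by (simp add: ed)
  qed
  define X where "X v = (if v \<in> V then real_of_int (x v) else 0)" for v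
  have X: "X \<in> ker_adj \<Gamma>"
    using ker by (auto simp: ker_iff X_def simp flip: of_int_mult of_int_sum)
  have Xfull: "X v \<noteq> 0" if "v \<in> V" for v using full[OF that] that by (simp add: X_def)
  obtain v0 where v0: "v0 \<in> V" using nonempty by auto
  have "ker_adj \<Gamma> \<subseteq> real_fun.span {X}"
  proof
    fix y assume y: "y \<in> ker_adj \<Gamma>"
    define c where "c = y v0 / X v0"
    define y' where "y' v = y v - c * X v" for v
    have "y' = y - (\<lambda>v. c * X v)" by (auto simp: y'_def)
    then have y': "y' \<in> ker_adj \<Gamma>"
      using ker_adj_subspace[of \<Gamma>] y X by (simp add: real_fun.subspace_diff real_fun.subspace_scale)
    have y0: "y' v0 = 0" using Xfull[OF v0] by (simp add: y'_def c_def)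
    have "y' v = 0" for v
    proof (rule ccontr)
      assume nz: "y' v \<noteq> 0"
      then have v: "v \<in> V" using y' by (auto simp: ker_iff)
      obtain z where z: "\<And>u. u \<in> V \<Longrightarrow> (\<Sum>w\<in>V. a u w * z w) = 0" "z v \<noteq> 0" "\<And>w. y' w = 0 \<Longrightarrow> z w = 0"
        using integer_kernel_vector[where y = y' and a = a, OF fin v nz] y' ker_iff by blast
      then show False using uniq[of z v0 v] v0 v y0 by auto
    qed
    then have "y = (\<lambda>v. c * X v)" by (auto simp: y'_def)
    then show "y \<in> real_fun.span {X}" by (auto simp: real_fun_span_singleton)
  qed
  moreover have "real_fun.independent {X}"
    using Xfull[OF v0] by (auto simp: fun_eq_iff)
  ultimately have "real_fun.dim (ker_adj \<Gamma>) = 1"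
    using real_fun.dim_unique[of "{X}" "ker_adj \<Gamma>" 1] X by simp
  then have nut: "signed_nut_graph \<Gamma>"
    using sg X Xfull by (auto simp: signed_nut_graph_def full_vector_def)
  have "\<not> sign_balanced \<Gamma>"
  proof
    assume "sign_balanced \<Gamma>"
    then obtain U where U: "\<Gamma>\<lparr>neg_edges := {}\<rparr> = switching \<Gamma> U"
      by (auto simp: sign_balanced_def switching_equivalent_def)
    have "neg_edges (\<Gamma>\<lparr>neg_edges := {}\<rparr>) = neg_edges (switching \<Gamma> U)" by (simp only: U)
    then have eq: "neg_edges \<Gamma> = boundary \<Gamma> U" by (auto simp: switching_def)
    define d where "d v = (if v \<in> U then - 1 else 1 :: int)" for v
    have "a u v = d u * d v" if "u \<in> V" "v \<in> V" "a u v \<noteq> 0" for u v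
    proof -
      have "a u v = - 1 \<longleftrightarrow> (u \<in> U) \<noteq> (v \<in> U)"
        using eq boundary_iff[of u v \<Gamma> U] ng[of u v] ed[of u v] that by blast
      then show ?thesis using entry[of u v] that by (auto simp: d_def)
    qed
    then have "\<not> unbalanced V a" unfolding unbalanced_def not_not
      by (intro exI[of _ d]) (auto simp: d_def)
    then show False using unb by simp
  qed
  moreover have "regular \<rho> \<Gamma>"
    unfolding regular_def
  proof
    fix u assume u: "u \<in> verts \<Gamma>"
    have "bij_betw (\<lambda>v. {u, v}) (nbrs V a u) {e \<in> edges \<Gamma>. u \<in> e}"
    proof (rule bij_betwI')
      fix v w show "({u, v} = {u, w}) = (v = w)" by (auto simp: doubleton_eq_iff)
    next
      fix v assume "v \<in> nbrs V a u"
      then show "{u, v} \<in> {e \<in> edges \<Gamma>. u \<in> e}" using u by (auto simp: nbrs_def ed)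
    next
      fix e assume e: "e \<in> {e \<in> edges \<Gamma>. u \<in> e}"
      then obtain p q where pq: "e = {p, q}" by (auto simp: \<Gamma>_def)
      then obtain v where "e = {u, v}" using e by auto
      then show "\<exists>v\<in>nbrs V a u. e = {u, v}" using e
        by (intro bexI[of _ v]) (auto simp: nbrs_def ed)
    qed
    then have "card (nbrs V a u) = degree \<Gamma> u" unfolding degree_def by (rule bij_betw_same_card)
    then show "degree \<Gamma> u = \<rho>" using reg u by simp
  qed
  ultimately show ?thesis using nut
    by (auto simp: unbalanced_nut_orders_def sign_unbalanced_nut_graph_def order_def intro!: exI[of _ \<Gamma>])
qed

section \<open>Gaussian elimination over the field with three elements\<close>

datatype trit = Zero | Plus | Minus

fun val :: "trit \<Rightarrow> int" where
  "val Zero = 0" | "val Plus = 1" | "val Minus = - 1"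

fun neg :: "trit \<Rightarrow> trit" where
  "neg Zero = Zero" | "neg Plus = Minus" | "neg Minus = Plus"

fun add :: "trit \<Rightarrow> trit \<Rightarrow> trit" where
  "add Zero t = t"
| "add s Zero = s"
| "add Plus Plus = Minus"
| "add Minus Minus = Plus"
| "add Plus Minus = Zero"
| "add Minus Plus = Zero"

fun sub :: "trit \<Rightarrow> trit \<Rightarrow> trit" where
  "sub s Zero = s"
| "sub Zero Plus = Minus"
| "sub Zero Minus = Plus"
| "sub Plus Plus = Zero"
| "sub Minus Minus = Zero"
| "sub Plus Minus = Minus"
| "sub Minus Plus = Plus"

fun zip_with :: "('a \<Rightarrow> 'b \<Rightarrow> 'c) \<Rightarrow> 'a list \<Rightarrow> 'b list \<Rightarrow> 'c list" where
  "zip_with f (s # ss) (t # ts) = f s t # zip_with f ss ts"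
| "zip_with f _ _ = []"

text \<open>Searches a row with a non-zero leading coefficient and scales it to have leading coefficient one;
  the leading coefficient itself is dropped, as in the argument \<open>r\<close> of
  \<open>reduce\<close>.\<close>

fun pivot :: "trit list list \<Rightarrow> trit list list \<Rightarrow> (trit list \<times> trit list list) option" where
  "pivot acc ((Plus # r) # M) = Some (r, acc @ M)"
| "pivot acc ((Minus # r) # M) = Some (map neg r, acc @ M)"
| "pivot acc (r # M) = pivot (r # acc) M"
| "pivot acc [] = None"

fun reduce :: "trit list \<Rightarrow> trit list \<Rightarrow> trit list" where
  "reduce r (Zero # s) = s"
| "reduce r (Plus # s) = zip_with sub s r"
| "reduce r (Minus # s) = zip_with add s r"
| "reduce r [] = []"

text \<open>Gaussian elimination, one column per step. Success means that the columns are linearly independent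
  modulo 3.\<close>

fun full_rank :: "nat \<Rightarrow> trit list list \<Rightarrow> bool" where
  "full_rank 0 M = True"
| "full_rank (Suc m) M =
     (case pivot [] M of None \<Rightarrow> False | Some (r, M') \<Rightarrow> full_rank m (map (reduce r) M'))"

fun dot :: "trit list \<Rightarrow> int list \<Rightarrow> int" where
  "dot (Zero # r) (k # z) = dot r z"
| "dot (Plus # r) (k # z) = k + dot r z"
| "dot (Minus # r) (k # z) = dot r z - k"
| "dot _ _ = 0"

lemma length_zip_with [simp]: "length (zip_with f s t) = min (length s) (length t)"
  by (induction f s t rule: zip_with.induct) auto

lemma dot_Cons: "dot (t # r) (k # z) = val t * k + dot r z"
  by (cases t) auto

lemma dot_neg: "dot (map neg r) z = - dot r z"
  by (induction r z rule: dot.induct) auto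

text \<open>Adding rows over the field with three elements only agrees with integer addition modulo 3.\<close>

lemma dot_add: "length r = length s \<Longrightarrow> 3 dvd dot (zip_with add r s) z - (dot r z + dot s z)"
proof (induction r s arbitrary: z rule: list_induct2)
  case (Cons t r u s)
  show ?case
  proof (cases z)
    case (Cons k z')
    have "\<exists>c. val (add t u) = val t + val u + 3 * c"
      by (cases t; cases u) (auto intro: exI[of _ 0] exI[of _ 1] exI[of _ "-1"])
    then obtain c where "val (add t u) = val t + val u + 3 * c" by auto
    then have "dot (zip_with add (t # r) (u # s)) z - (dot (t # r) z + dot (u # s) z)
      = 3 * (c * k) + (dot (zip_with add r s) z' - (dot r z' + dot s z'))"
      by (simp add: Cons dot_Cons algebra_simps)
    then show ?thesis using Cons.IH[of z'] by (metis dvd_add dvd_triv_left)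
  qed auto
qed auto

lemma zip_with_sub: "length r = length s \<Longrightarrow> zip_with sub r s = zip_with add r (map neg s)"
proof (induction r s rule: list_induct2)
  case (Cons t r u s) then show ?case by (cases t; cases u) auto
qed auto

definition mod3_kernel :: "trit list list \<Rightarrow> int list \<Rightarrow> bool" where
  "mod3_kernel M z \<longleftrightarrow> (\<forall>r\<in>set M. length r = length z \<and> 3 dvd dot r z)"

lemma mod3_kernel_simps [simp]:
  "mod3_kernel [] z" "mod3_kernel (r # M) z \<longleftrightarrow> length r = length z \<and> 3 dvd dot r z \<and> mod3_kernel M z"
  "mod3_kernel (M @ M') z \<longleftrightarrow> mod3_kernel M z \<and> mod3_kernel M' z"
  by (auto simp: mod3_kernel_def)

lemma pivot_mod3_kernel:
  assumes "pivot acc M = Some (r, M')" "mod3_kernel M z" "mod3_kernel acc z"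
  shows "mod3_kernel M' z \<and> length (Plus # r) = length z \<and> 3 dvd dot (Plus # r) z"
  using assms
proof (induction acc M rule: pivot.induct)
  case (2 acc s M)
  then have "r = map neg s" "length z = Suc (length s)" by auto
  moreover obtain k z' where "z = k # z'" using calculation(2) by (cases z) auto
  ultimately show ?case using 2 dvd_minus_iff[of 3 "dot s z' - k"] by (auto simp: dot_neg)
qed (auto split: if_splits)

lemma reduce_mod3_kernel:
  assumes "mod3_kernel M (k # z)" "length r = length z" "3 dvd k + dot r z"
  shows "mod3_kernel (map (reduce r) M) z"
proof -
  have "length (reduce r s) = length z \<and> 3 dvd dot (reduce r s) z" if "s \<in> set M" for s
  proof -
    have s: "length s = length (k # z)" "3 dvd dot s (k # z)" using assms(1) that by (auto simp: mod3_kernel_def)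
    then obtain t s' where st: "s = t # s'" "length s' = length z" by (cases s) auto
    have "3 dvd dot (zip_with add s' (map neg r)) z - (dot s' z + dot (map neg r) z)"
      "3 dvd dot (zip_with add s' r) z - (dot s' z + dot r z)"
      using st assms(2) by (simp_all add: dot_add)
    then show ?thesis using st s assms
      by (cases t) (auto simp: zip_with_sub dot_neg, presburger+)
  qed
  then show ?thesis by (auto simp: mod3_kernel_def)
qed

lemma full_rank_kernel:
  assumes "full_rank (length z) M" "mod3_kernel M z" "k \<in> set z"
  shows "3 dvd k"
  using assms
proof (induction z arbitrary: M k)
  case (Cons k' z)
  obtain r M' where M': "pivot [] M = Some (r, M')" "full_rank (length z) (map (reduce r) M')"
    using Cons.prems(1) by (auto split: option.splits)
  have piv: "mod3_kernel M' (k' # z)" "length r = length z" "3 dvd k' + dot r z"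
    using pivot_mod3_kernel[OF M'(1) Cons.prems(2)] by auto
  have z: "3 dvd l" if "l \<in> set z" for l
    using Cons.IH[OF M'(2) reduce_mod3_kernel[OF piv] that] .
  have "3 dvd dot r z" using z
    by (induction r z rule: dot.induct) auto
  then have "3 dvd k'" using piv(3) by presburger
  then show ?case using Cons.prems(3) z by auto
qed auto

section \<open>Explicit signed graphs\<close>

text \<open>A graph is given by the strict upper triangle of its matrix, row by row, so that symmetry and the
  zero diagonal hold by construction.\<close>

fun symmetric_rows :: "trit list list \<Rightarrow> trit list list" where
  "symmetric_rows [] = []"
| "symmetric_rows (r # T) = (Zero # r) # zip_with (#) r (symmetric_rows T)"

definition trit_of_char :: "char \<Rightarrow> trit" where
  "trit_of_char c = (if c = CHR ''+'' then Plus else if c = CHR ''-'' then Minus else Zero)"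

fun triangular :: "'a list list \<Rightarrow> bool" where
  "triangular [] = True"
| "triangular (r # T) \<longleftrightarrow> length r = length T \<and> triangular T"

text \<open>Inspects the first three vertices only: the predicate fails exactly if they span a triangle with
  an odd number of negative edges, and such a triangle stays negative under switching.\<close>

fun positive_triangle :: "trit list list \<Rightarrow> bool" where
  "positive_triangle ((r # s # _) # (t # _) # _) \<longleftrightarrow> val r * val s * val t \<noteq> - 1"
| "positive_triangle _ = True"

text \<open>Deleting the first column must leave columns that are independent modulo 3: then a kernel vector
  that vanishes at the first vertex is zero.\<close>

definition nut_certificate :: "nat \<Rightarrow> string list \<Rightarrow> int list \<Rightarrow> bool" where
  "nut_certificate \<rho> T z \<longleftrightarrow>
     (let T' = map (map trit_of_char) T; M = symmetric_rows T' in
      triangular T' \<and> length z = length T' \<and> list_all (\<lambda>k. k \<noteq> 0) z \<and>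
      list_all (\<lambda>r. dot r z = 0) M \<and> list_all (\<lambda>r. length (filter (\<lambda>t. t \<noteq> Zero) r) = \<rho>) M \<and>
      full_rank (length T' - 1) (map tl M) \<and> \<not> positive_triangle T')"

definition row_entry :: "trit list list \<Rightarrow> nat \<Rightarrow> nat \<Rightarrow> int" where
  "row_entry M i j = (if i < length M \<and> j < length M then val (M ! i ! j) else 0)"

lemma nth_zip_with [simp]:
  "i < length s \<Longrightarrow> i < length t \<Longrightarrow> zip_with f s t ! i = f (s ! i) (t ! i)"
proof (induction f s t arbitrary: i rule: zip_with.induct)
  case (1 f s ss t ts i) then show ?case by (cases i) auto
qed auto

lemma length_symmetric_rows: "triangular T \<Longrightarrow> length (symmetric_rows T) = length T"
  by (induction T) auto

lemma length_symmetric_row: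
  "triangular T \<Longrightarrow> i < length T \<Longrightarrow> length (symmetric_rows T ! i) = length T"
proof (induction T arbitrary: i)
  case (Cons r T)
  then show ?case by (cases i) (auto simp: length_symmetric_rows)
qed auto

lemma symmetric_rows_sym:
  "triangular T \<Longrightarrow> i < length T \<Longrightarrow> j < length T \<Longrightarrow> symmetric_rows T ! i ! j = symmetric_rows T ! j ! i"
proof (induction T arbitrary: i j)
  case (Cons r T)
  then show ?case by (cases i; cases j) (auto simp: length_symmetric_rows)
qed auto

lemma symmetric_rows_diag:
  "triangular T \<Longrightarrow> i < length T \<Longrightarrow> symmetric_rows T ! i ! i = Zero"
proof (induction T arbitrary: i)
  case (Cons r T)
  then show ?case by (cases i) (auto simp: length_symmetric_rows)
qed auto

lemma dot_sum: "length r = length z \<Longrightarrow> dot r z = (\<Sum>j<length z. val (r ! j) * z ! j)"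
proof (induction r z rule: list_induct2)
  case (Cons t r k z)
  then show ?case by (simp add: dot_Cons sum.lessThan_Suc_shift del: sum.lessThan_Suc)
qed simp

lemma val_eq_0 [simp]: "val t = 0 \<longleftrightarrow> t = Zero"
  by (cases t) auto

lemma power_dvd_bound:
  fixes k :: int
  assumes "\<And>e. 3 ^ e dvd k"
  shows "k = 0"
proof (rule ccontr)
  assume "k \<noteq> 0"
  with assms[of "nat \<bar>k\<bar>"] have "(3::int) ^ nat \<bar>k\<bar> \<le> \<bar>k\<bar>"
    by (metis dvd_imp_le_int abs_of_nonneg zero_le_numeral zero_le_power)
  moreover have "m < 3 ^ m" for m :: nat by (induction m) auto
  then have "int (nat \<bar>k\<bar>) < int (3 ^ nat \<bar>k\<bar>)" by (simp only: of_nat_less_iff)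
  then have "\<bar>k\<bar> < 3 ^ nat \<bar>k\<bar>" by simp
  ultimately show False by simp
qed

text \<open>Independence modulo 3 passes to the integers by infinite descent: a kernel vector that vanishes at
  the first vertex is divisible by 3, and so is its quotient by 3, so it is divisible by all powers of 3. Any
  kernel vector \<open>y\<close> is then a multiple of the certified vector \<open>z\<close>, because
  \<open>z\<^sub>0 y - y\<^sub>0 z\<close> vanishes at the first vertex.\<close>

lemma nut_certificate_sound:
  assumes cert: "nut_certificate \<rho> T z" and pos: "T \<noteq> []"
  shows "int (length T) \<in> unbalanced_nut_orders \<rho>"
proof -
  define T' where "T' = map (map trit_of_char) T"
  define M where "M = symmetric_rows T'"
  define n where "n = length T"
  define a where "a = row_entry M"
  have tri: "triangular T'" and lz: "length z = n" and z0: "\<And>k. k \<in> set z \<Longrightarrow> k \<noteq> 0"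
    and rows: "\<And>r. r \<in> set M \<Longrightarrow> dot r z = 0"
    and deg: "\<And>r. r \<in> set M \<Longrightarrow> length (filter (\<lambda>t. t \<noteq> Zero) r) = \<rho>"
    and rank: "full_rank (n - 1) (map tl M)" and triangle: "\<not> positive_triangle T'"
    using cert by (auto simp: nut_certificate_def Let_def T'_def M_def n_def list_all_iff)
  have lT: "length T' = n" and lM: "length M = n"
    using tri by (auto simp: T'_def M_def n_def length_symmetric_rows)
  have row_length: "length (M ! i) = n" if "i < n" for i
    using that tri lT by (simp add: M_def length_symmetric_row)
  have a_val: "a i j = val (M ! i ! j)" if "i < n" "j < n" for i j
    using that lM by (simp add: a_def row_entry_def)
  have n0: "0 < n" using pos by (simp add: n_def)
  have row_dot: "(\<Sum>j<n. a i j * y j) = dot (M ! i) (map y [0..<n])" if "i < n" for i y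
    using that row_length[OF that] by (simp add: dot_sum a_val)
  have zero_first: "y i = 0"
    if ker_y: "\<And>i. i < n \<Longrightarrow> (\<Sum>j<n. a i j * y j) = 0" and "y 0 = 0" and "i < n" for y i
  proof -
    have "\<exists>w. \<forall>i<n. y i = 3 ^ e * w i" for e
    proof (induction e)
      case (Suc e)
      then obtain w where w: "\<And>i. i < n \<Longrightarrow> y i = 3 ^ e * w i" by auto
      define w' where "w' = map w [1..<n]"
      have "dot (tl (M ! i)) w' = 0" if i: "i < n" for i
      proof -
        have "3 ^ e * (\<Sum>j<n. a i j * w j) = (\<Sum>j<n. a i j * y j)"
          by (simp add: w sum_distrib_left mult.left_commute)
        then have "(\<Sum>j<n. a i j * w j) = 0" using ker_y[OF i] by simp
        then have "dot (M ! i) (map w [0..<n]) = 0" using row_dot[OF i] by simp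
        moreover have "map w [0..<n] = w 0 # w'" using n0 by (simp add: w'_def upt_rec)
        moreover have "w 0 = 0" using w[OF n0] \<open>y 0 = 0\<close> by simp
        moreover obtain t r where "M ! i = t # r" using row_length[OF i] n0 by (cases "M ! i") auto
        ultimately show ?thesis by (simp add: dot_Cons)
      qed
      then have "mod3_kernel (map tl M) w'"
        using lM row_length by (auto simp: mod3_kernel_def w'_def in_set_conv_nth)
      moreover have "full_rank (length w') (map tl M)" using rank by (simp add: w'_def)
      ultimately have "3 dvd k" if "k \<in> set w'" for k using full_rank_kernel that by blast
      moreover have "w 0 = 0" using w[OF n0] \<open>y 0 = 0\<close> by simp
      ultimately have "3 dvd w i" if "i < n" for i
        using that by (cases "i = 0") (auto simp: w'_def)
      then have "\<forall>i<n. y i = 3 ^ Suc e * (w i div 3)" using w by auto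
      then show ?case by (rule exI[of _ "\<lambda>i. w i div 3"])
    qed (auto intro: exI[of _ y])
    then have "3 ^ e dvd y i" for e using \<open>i < n\<close> by (metis dvd_triv_left)
    then show ?thesis by (rule power_dvd_bound)
  qed
  have "nut_matrix {..<n} a (\<lambda>i. z ! i)"
  proof
    show "finite {..<n}" "{..<n} \<noteq> {}" using n0 by auto
    show "a u v = a v u" for u v
      using symmetric_rows_sym[OF tri] lT lM by (auto simp: a_def row_entry_def M_def)
    show "a v v = 0" for v
      using symmetric_rows_diag[OF tri] lT lM by (auto simp: a_def row_entry_def M_def)
    show "a u v \<in> {- 1, 0, 1}" for u v
      by (cases "M ! u ! v") (auto simp: a_def row_entry_def)
    show ker: "(\<Sum>v<n. a u v * z ! v) = 0" if "u \<in> {..<n}" for u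
    proof -
      have "map ((!) z) [0..<n] = z" using lz map_nth by blast
      then show ?thesis using row_dot[of u "\<lambda>i. z ! i"] rows[of "M ! u"] that lM by simp
    qed
    show full: "z ! v \<noteq> 0" if "v \<in> {..<n}" for v using z0 lz that by simp
    show "y v = 0" if y: "\<And>u. u \<in> {..<n} \<Longrightarrow> (\<Sum>v<n. a u v * y v) = 0"
      "w \<in> {..<n}" "y w = 0" "v \<in> {..<n}" for y w v
    proof -
      have proportional: "z ! 0 * y i - y 0 * z ! i = 0" if "i < n" for i
      proof (rule zero_first[of "\<lambda>i. z ! 0 * y i - y 0 * z ! i"])
        fix u assume "u < n"
        have "(\<Sum>j<n. a u j * (z ! 0 * y j - y 0 * z ! j))
          = z ! 0 * (\<Sum>j<n. a u j * y j) - y 0 * (\<Sum>j<n. a u j * z ! j)"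
          by (simp add: sum_distrib_left sum_subtractf algebra_simps)
        then show "(\<Sum>j<n. a u j * (z ! 0 * y j - y 0 * z ! j)) = 0"
          using ker y(1) \<open>u < n\<close> by simp
      qed (use that in auto)
      have "y 0 = 0" using proportional[of w] y(2,3) full by simp
      then show ?thesis using proportional[of v] y(4) full[of 0] n0 by simp
    qed
  qed
  moreover have "\<forall>u\<in>{..<n}. card (nbrs {..<n} a u) = \<rho>"
  proof
    fix u assume "u \<in> {..<n}"
    then have u: "u < n" by simp
    have "nbrs {..<n} a u = {j. j < length (M ! u) \<and> M ! u ! j \<noteq> Zero}"
      using u row_length[OF u] a_val by (auto simp: nbrs_def)
    then show "card (nbrs {..<n} a u) = \<rho>"
      using deg[of "M ! u"] u lM by (simp add: length_filter_conv_card)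
  qed
  moreover have "unbalanced {..<n} a"
    unfolding unbalanced_def
  proof (rule notI, elim exE conjE)
    fix d :: "nat \<Rightarrow> int"
    assume d: "\<forall>v. d v \<in> {- 1, 1}" and eq: "\<forall>u\<in>{..<n}. \<forall>v\<in>{..<n}. a u v \<noteq> 0 \<longrightarrow> a u v = d u * d v"
    obtain r s rs t ts Ts where T'_eq: "T' = (r # s # rs) # (t # ts) # Ts" and prod: "val r * val s * val t = - 1"
      using triangle by (auto elim!: positive_triangle.elims)
    have n3: "2 < n" using tri T'_eq lT by (cases Ts) auto
    have "a 0 1 = val r" "a 0 2 = val s"
      using n3 by (simp_all add: a_val M_def T'_eq)
    moreover have "a 1 2 = val t"
      using n3 tri lT length_symmetric_rows[of Ts]
      by (cases Ts) (simp_all add: a_val M_def T'_eq numeral_2_eq_2)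
    ultimately have "a 0 1 * a 0 2 * a 1 2 = - 1" using prod by simp
    moreover from this have "a 0 1 = d 0 * d 1" "a 0 2 = d 0 * d 2" "a 1 2 = d 1 * d 2"
      using eq n3 by (metis lessThan_iff less_trans mult_zero_left mult_zero_right neg_0_equal_iff_equal one_neq_zero one_less_numeral_iff semiring_norm(76) zero_less_numeral)+
    moreover have "d 0 = 1 \<or> d 0 = - 1" "d 1 = 1 \<or> d 1 = - 1" "d 2 = 1 \<or> d 2 = - 1" using d by blast+
    ultimately show False by auto
  qed
  ultimately have "int (card {..<n}) \<in> unbalanced_nut_orders \<rho>" by (rule nut_matrix_order)
  then show ?thesis by (simp add: n_def)
qed

section \<open>Enlarging a graph at a vertex\<close>

lemma nut_matrix_order_any:
  fixes V :: "'a set"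
  assumes nut: "nut_matrix V a x" and reg: "\<forall>u\<in>V. card (nbrs V a u) = \<rho>" and unb: "unbalanced V a"
  shows "int (card V) \<in> unbalanced_nut_orders \<rho>"
proof -
  interpret nut_matrix V a x by fact
  obtain f where f: "bij_betw f {0..<card V} V" using ex_bij_betw_nat_finite[OF fin] by blast
  define W where "W = {0..<card V}"
  define g where "g = inv_into W f"
  have fg: "f (g v) = v" "g v \<in> W" if "v \<in> V" for v
    using that f inv_into_into[of v f W] f_inv_into_f[of v f W] by (simp_all add: g_def W_def bij_betw_def)
  have gf: "g (f i) = i" "f i \<in> V" if "i \<in> W" for i
    using that f by (auto simp: g_def W_def bij_betw_def)
  define b where "b i j = a (f i) (f j)" for i j
  have sum_W: "(\<Sum>j\<in>W. h (f j)) = (\<Sum>v\<in>V. h v)" for h :: "'a \<Rightarrow> int"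
    using f unfolding W_def by (rule sum.reindex_bij_betw)
  have "nut_matrix W b (\<lambda>i. x (f i))"
  proof
    show "finite W" "W \<noteq> {}" using nonempty fin by (auto simp: W_def card_gt_0_iff)
    show "b u v = b v u" "b v v = 0" "b u v \<in> {- 1, 0, 1}" for u v
      using sym loopfree entry by (auto simp: b_def)
    show "(\<Sum>v\<in>W. b u v * x (f v)) = 0" if "u \<in> W" for u
      using sum_W[of "\<lambda>v. a (f u) v * x v"] ker gf(2)[OF that] by (simp add: b_def)
    show "x (f v) \<noteq> 0" if "v \<in> W" for v using full gf(2)[OF that] .
    show "y v = 0" if y: "\<And>u. u \<in> W \<Longrightarrow> (\<Sum>v\<in>W. b u v * y v) = 0" "w \<in> W" "y w = 0" "v \<in> W" for y w v
    proof -
      have "(\<Sum>v\<in>V. a u v * y (g v)) = 0" if "u \<in> V" for u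
        using y(1)[OF fg(2)[OF that]] sum_W[of "\<lambda>v. a u v * y (g v)"] fg(1)[OF that]
        by (simp add: b_def gf)
      then have "y (g (f v)) = 0"
        using uniq[of "\<lambda>v. y (g v)" "f w" "f v"] gf y by simp
      then show ?thesis using gf(1) y(4) by simp
    qed
  qed
  moreover have "\<forall>i\<in>W. card (nbrs W b i) = \<rho>"
  proof
    fix i assume i: "i \<in> W"
    have "bij_betw f (nbrs W b i) (nbrs V a (f i))"
    proof (rule bij_betw_byWitness[where f' = g])
      show "g ` nbrs V a (f i) \<subseteq> nbrs W b i" using fg by (auto simp: nbrs_def b_def)
    qed (use gf fg in \<open>auto simp: nbrs_def b_def\<close>)
    then show "card (nbrs W b i) = \<rho>" using reg gf(2)[OF i] bij_betw_same_card by fastforce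
  qed
  moreover have "unbalanced W b"
    unfolding unbalanced_def
  proof (rule notI, elim exE conjE)
    fix d :: "nat \<Rightarrow> int"
    assume d: "\<forall>v. d v \<in> {- 1, 1}" "\<forall>i\<in>W. \<forall>j\<in>W. b i j \<noteq> 0 \<longrightarrow> b i j = d i * d j"
    have "\<forall>u\<in>V. \<forall>v\<in>V. a u v \<noteq> 0 \<longrightarrow> a u v = d (g u) * d (g v)"
      using d(2) fg by (metis b_def)
    moreover have "\<forall>u. d (g u) \<in> {- 1, 1}" using d(1) by blast
    ultimately have "\<not> unbalanced V a" unfolding unbalanced_def not_not
      by (intro exI[of _ "\<lambda>u. d (g u)"] conjI)
    then show False using unb by simp
  qed
  ultimately have "int (card W) \<in> unbalanced_nut_orders \<rho>" by (rule nut_matrix_order)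
  then show ?thesis by (simp add: W_def)
qed

text \<open>To enlarge a graph at a vertex \<open>v\<close> with neighbourhood \<open>N\<close>, take two
  copies \<open>Inner\<close> and \<open>Outer\<close> of \<open>N\<close>, join them by a complete bipartite
  graph without the perfect matching \<open>Inner w\<close>, \<open>Outer w\<close>, attach \<open>v\<close>
  to all inner vertices in place of its old neighbours, and attach each old neighbour \<open>w\<close> to
  \<open>Outer w\<close> with the sign of the lost edge. All degrees stay equal.\<close>

datatype 'a enlarged = Old 'a | Inner 'a | Outer 'a

fun enlarged_matrix :: "('a \<Rightarrow> 'a \<Rightarrow> int) \<Rightarrow> 'a \<Rightarrow> 'a enlarged \<Rightarrow> 'a enlarged \<Rightarrow> int" where
  "enlarged_matrix a v (Old u) (Old w) = (if u = v \<or> w = v then 0 else a u w)"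
| "enlarged_matrix a v (Old u) (Inner w) = (if u = v then 1 else 0)"
| "enlarged_matrix a v (Inner w) (Old u) = (if u = v then 1 else 0)"
| "enlarged_matrix a v (Inner u) (Outer w) = (if u = w then 0 else 1)"
| "enlarged_matrix a v (Outer u) (Inner w) = (if u = w then 0 else 1)"
| "enlarged_matrix a v (Outer w) (Old u) = (if u = w then a v w else 0)"
| "enlarged_matrix a v (Old u) (Outer w) = (if u = w then a v w else 0)"
| "enlarged_matrix a v _ _ = 0"

text \<open>The inner rows force a kernel vector to be constant, say \<open>p\<close>, on the outer copy, and
  to be \<open>(1 - \<rho>) p\<close> at \<open>v\<close>; the outer rows determine the inner entries from the
  old neighbours, and their sum vanishes by the row of \<open>v\<close>. Placing \<open>p\<close> at
  \<open>v\<close> therefore recovers exactly a kernel vector of the old graph. A sign function that balances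
  the enlarged graph is constant on the new vertices together with \<open>v\<close>, since the edges between
  them are positive and connect them, so it balances the old graph.\<close>

lemma enlarge_order:
  assumes "n \<in> unbalanced_nut_orders \<rho>" "3 \<le> \<rho>"
  shows "n + 2 * int \<rho> \<in> unbalanced_nut_orders \<rho>"
proof -
  obtain V :: "nat set" and a x where nut: "nut_matrix V a x" and reg: "\<forall>u\<in>V. card (nbrs V a u) = \<rho>"
    and unb: "unbalanced V a" and n: "int (card V) = n"
    using nut_order_matrix[OF assms(1)] .
  interpret nut_matrix V a x by fact
  obtain v where v: "v \<in> V" using nonempty by auto
  define N where "N = nbrs V a v"
  have N: "N \<subseteq> V" "v \<notin> N" "finite N" "card N = \<rho>" using reg v fin loopfree by (auto simp: N_def nbrs_def)
  have N_iff: "w \<in> N \<longleftrightarrow> a v w \<noteq> 0" if "w \<in> V" for w using that by (simp add: N_def nbrs_def)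
  define W where "W = Old ` V \<union> Inner ` N \<union> Outer ` N"
  define b where "b = enlarged_matrix a v"
  have b_simps: "b (Old u) (Old w) = (if u = v \<or> w = v then 0 else a u w)"
    "b (Old u) (Inner w) = (if u = v then 1 else 0)" "b (Inner w) (Old u) = (if u = v then 1 else 0)"
    "b (Inner u) (Outer w) = (if u = w then 0 else 1)" "b (Outer u) (Inner w) = (if u = w then 0 else 1)"
    "b (Outer w) (Old u) = (if u = w then a v w else 0)" "b (Old u) (Outer w) = (if u = w then a v w else 0)"
    "b (Inner u) (Inner w) = 0" "b (Outer u) (Outer w) = 0" for u w
    by (simp_all add: b_def)
  have sum_W: "(\<Sum>t\<in>W. h t) = (\<Sum>u\<in>V. h (Old u)) + (\<Sum>w\<in>N. h (Inner w)) + (\<Sum>w\<in>N. h (Outer w))"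
    for h :: "nat enlarged \<Rightarrow> int"
  proof -
    have "(\<Sum>t\<in>W. h t) = sum h (Old ` V) + sum h (Inner ` N) + sum h (Outer ` N)"
      using fin N(3) unfolding W_def by (subst sum.union_disjoint; auto)+
    then show ?thesis by (simp add: sum.reindex inj_on_def)
  qed
  have row_v: "(\<Sum>t\<in>W. b (Old v) t * y t) = (\<Sum>w\<in>N. y (Inner w))" for y
    using N by (auto simp: sum_W b_simps intro!: sum.neutral)
  have row_old: "(\<Sum>t\<in>W. b (Old u) t * y t) = (\<Sum>w\<in>V. a u w * (if w = v then y (Outer u) else y (Old w)))"
    if u: "u \<in> V" "u \<noteq> v" for u y
  proof -
    have "(\<Sum>w\<in>N. b (Old u) (Outer w) * y (Outer w)) = (if u \<in> N then a v u * y (Outer u) else 0)"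
      using N(3) by (simp add: b_simps if_distrib[of "\<lambda>k. k * _"] cong: if_cong)
    also have "\<dots> = a u v * y (Outer u)" using N_iff[OF u(1)] sym[of u v] by simp
    finally have "(\<Sum>t\<in>W. b (Old u) t * y t)
      = a u v * y (Outer u) + (\<Sum>w\<in>V. if w = v then 0 else a u w * y (Old w))"
      using u by (simp add: sum_W b_simps if_distrib[of "\<lambda>k. k * _"] cong: if_cong)
    also have "\<dots> = (\<Sum>w\<in>V. a u w * (if w = v then y (Outer u) else y (Old w)))"
      using fin v by (simp add: sum.remove[of V v] cong: if_cong)
    finally show ?thesis .
  qed
  have row_inner: "(\<Sum>t\<in>W. b (Inner w) t * y t) = y (Old v) + (\<Sum>w'\<in>N. y (Outer w')) - y (Outer w)"
    if w: "w \<in> N" for w y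
    using w N(3) fin v by (simp add: sum_W b_simps if_distrib[of "\<lambda>k. k * _"] sum.remove[of N w] cong: if_cong)
  have row_outer: "(\<Sum>t\<in>W. b (Outer w) t * y t) = a v w * y (Old w) + (\<Sum>w'\<in>N. y (Inner w')) - y (Inner w)"
    if w: "w \<in> N" for w y
    using w N(1,3) fin by (auto simp: sum_W b_simps if_distrib[of "\<lambda>k. k * _"] sum.remove[of N w] cong: if_cong)
  have sign: "a v w = 1 \<or> a v w = - 1" if "w \<in> N" for w
    using that N N_iff entry[of v w] by auto
  have sum_v: "(\<Sum>w\<in>N. a v w * h w) = (\<Sum>w\<in>V. a v w * h w)" for h :: "nat \<Rightarrow> int"
    using fin N N_iff by (intro sum.mono_neutral_left) auto
  define X where "X t = (case t of Old u \<Rightarrow> if u = v then - (int \<rho> - 1) * x v else x u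
     | Inner w \<Rightarrow> a v w * x w | Outer w \<Rightarrow> x v)" for t
  have "nut_matrix W b X"
  proof
    show "finite W" "W \<noteq> {}" using fin N(3) v by (auto simp: W_def)
    show "b s t = b t s" for s t using sym by (cases s; cases t) (auto simp: b_simps)
    show "b t t = 0" for t using loopfree by (cases t) (auto simp: b_simps)
    show "b s t \<in> {- 1, 0, 1}" for s t using entry by (cases s; cases t) (auto simp: b_simps)
    show "(\<Sum>t\<in>W. b s t * X t) = 0" if s: "s \<in> W" for s
    proof (cases s)
      case (Old u)
      then have u: "u \<in> V" using s by (auto simp: W_def)
      show ?thesis
      proof (cases "u = v")
        case True
        then show ?thesis using Old row_v[of X] sum_v[of x] ker[OF v] by (simp add: X_def)
      next
        case False
        have "(\<Sum>t\<in>W. b s t * X t) = (\<Sum>w\<in>V. a u w * x w)"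
          unfolding Old row_old[OF u False, of X] by (intro sum.cong) (auto simp: X_def)
        then show ?thesis using ker[OF u] by simp
      qed
    next
      case (Inner w)
      then have "w \<in> N" using s by (auto simp: W_def)
      then show ?thesis using Inner row_inner[of w X] N(4) by (simp add: X_def algebra_simps)
    next
      case (Outer w)
      then have w: "w \<in> N" using s by (auto simp: W_def)
      then have "w \<noteq> v" using N(2) by auto
      then show ?thesis using Outer row_outer[OF w, of X] sum_v[of x] ker[OF v] by (simp add: X_def)
    qed
    show "X t \<noteq> 0" if t: "t \<in> W" for t
    proof (cases t)
      case (Old u)
      then have "u \<in> V" using t by (auto simp: W_def)
      then show ?thesis using Old full assms(2) by (auto simp: X_def)
    next
      case (Inner w)
      then have w: "w \<in> N" "w \<in> V" using t N(1) by (auto simp: W_def)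
      then show ?thesis using Inner full[of w] sign[of w] by (auto simp: X_def)
    next
      case (Outer w)
      then show ?thesis using full[OF v] by (simp add: X_def)
    qed
    show "y t = 0" if y: "\<And>s. s \<in> W \<Longrightarrow> (\<Sum>t\<in>W. b s t * y t) = 0" "z \<in> W" "y z = 0" "t \<in> W" for y z t
    proof -
      define p where "p = y (Old v) + (\<Sum>w\<in>N. y (Outer w))"
      have outer: "y (Outer w) = p" if "w \<in> N" for w
        using y(1)[of "Inner w"] row_inner[OF that, of y] that by (simp add: W_def p_def)
      have old_v: "y (Old v) = - (int \<rho> - 1) * p"
        using p_def N(4) by (simp add: outer algebra_simps)
      have sum_inner: "(\<Sum>w\<in>N. y (Inner w)) = 0" using y(1)[of "Old v"] row_v[of y] v by (simp add: W_def)
      have inner: "y (Inner w) = a v w * y (Old w)" if "w \<in> N" for w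
        using y(1)[of "Outer w"] row_outer[OF that, of y] that sum_inner by (simp add: W_def)
      define y' where "y' u = (if u = v then p else y (Old u))" for u
      have ker': "(\<Sum>w\<in>V. a u w * y' w) = 0" if u: "u \<in> V" for u
      proof (cases "u = v")
        case True
        have "(\<Sum>w\<in>N. a v w * y' w) = (\<Sum>w\<in>N. y (Inner w))"
          using N(2) by (intro sum.cong) (auto simp: inner y'_def)
        then show ?thesis using sum_v[of y'] sum_inner True by simp
      next
        case False
        have "(\<Sum>w\<in>V. a u w * y' w) = (\<Sum>w\<in>V. a u w * (if w = v then y (Outer u) else y (Old w)))"
        proof (rule sum.cong)
          fix w assume "w \<in> V"
          then show "a u w * y' w = a u w * (if w = v then y (Outer u) else y (Old w))"
            using N_iff[OF u] sym[of u v] outer by (cases "u \<in> N") (auto simp: y'_def)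
        qed simp
        then show ?thesis using row_old[OF u False, of y] y(1)[of "Old u"] u by (simp add: W_def)
      qed
      have "\<exists>u\<in>V. y' u = 0"
      proof (cases z)
        case (Old u)
        then show ?thesis using y(2,3) old_v assms(2) by (auto simp: W_def y'_def intro!: bexI[of _ u])
      next
        case (Inner w)
        then have "w \<in> N" using y(2) by (auto simp: W_def)
        then show ?thesis using Inner y(3) inner[of w] sign[of w] N by (intro bexI[of _ w]) (auto simp: y'_def)
      next
        case (Outer w)
        then show ?thesis using y(2,3) outer[of w] v by (intro bexI[of _ v]) (auto simp: W_def y'_def)
      qed
      then have y'0: "y' u = 0" if "u \<in> V" for u using uniq[of y', OF ker'] that by blast
      have "p = 0" using y'0[OF v] by (simp add: y'_def)
      then have old: "y (Old u) = 0" if "u \<in> V" for u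
        using y'0[OF that] old_v by (cases "u = v") (simp_all add: y'_def)
      then have "y (Inner w) = 0" if "w \<in> N" for w using inner[OF that] that N(1) by auto
      then show ?thesis using y(4) old outer \<open>p = 0\<close> by (cases t) (auto simp: W_def)
    qed
  qed
  moreover have "\<forall>t\<in>W. card (nbrs W b t) = \<rho>"
  proof
    fix t assume t: "t \<in> W"
    show "card (nbrs W b t) = \<rho>"
    proof (cases t)
      case (Old u)
      then have u: "u \<in> V" using t by (auto simp: W_def)
      define f where "f w = (if u = v then Inner w else if w = v then Outer u else Old w)" for w
      have "s \<in> nbrs W b t \<longleftrightarrow> s \<in> f ` nbrs V a u" for s
        using Old u v N(1,2) N_iff sym[of u v] loopfree[of v]
        by (cases s) (auto simp: nbrs_def W_def b_simps f_def image_iff split: if_splits)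
      then have "nbrs W b t = f ` nbrs V a u" by blast
      moreover have "inj_on f (nbrs V a u)" by (auto simp: inj_on_def f_def)
      ultimately show ?thesis using reg u by (simp add: card_image)
    next
      case (Inner w)
      then have w: "w \<in> N" using t by (auto simp: W_def)
      have "s \<in> nbrs W b t \<longleftrightarrow> s \<in> insert (Old v) (Outer ` (N - {w}))" for s
        using Inner v by (cases s) (auto simp: nbrs_def W_def b_simps split: if_splits)
      then have "nbrs W b t = insert (Old v) (Outer ` (N - {w}))" by blast
      then show ?thesis using w N(3,4) assms(2) by (auto simp: card_insert_if card_image inj_on_def)
    next
      case (Outer w)
      then have w: "w \<in> N" using t by (auto simp: W_def)
      have "s \<in> nbrs W b t \<longleftrightarrow> s \<in> insert (Old w) (Inner ` (N - {w}))" for s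
        using Outer w N(1) sign[OF w] by (cases s) (auto simp: nbrs_def W_def b_simps split: if_splits)
      then have "nbrs W b t = insert (Old w) (Inner ` (N - {w}))" by blast
      then show ?thesis using w N(3,4) assms(2) by (auto simp: card_insert_if card_image inj_on_def)
    qed
  qed
  moreover have "unbalanced W b"
    unfolding unbalanced_def
  proof (rule notI, elim exE conjE)
    fix d :: "nat enlarged \<Rightarrow> int"
    assume d: "\<forall>t. d t \<in> {- 1, 1}" and eq: "\<forall>s\<in>W. \<forall>t\<in>W. b s t \<noteq> 0 \<longrightarrow> b s t = d s * d t"
    have dsq: "d t * d t = 1" and d0: "d t = 1 \<or> d t = - 1" for t using spec[OF d, of t] by auto
    have edge: "d s * d t = b s t" if "s \<in> W" "t \<in> W" "b s t \<noteq> 0" for s t using eq that by force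
    have d_inner: "d (Inner w) = d (Old v)" if "w \<in> N" for w
      using edge[of "Old v" "Inner w"] v that d0[of "Inner w"] d0[of "Old v"] by (auto simp: W_def b_simps)
    have d_outer: "d (Outer w) = d (Old v)" if w: "w \<in> N" for w
    proof -
      have "card (N - {w}) \<noteq> 0" using N w assms(2) by simp
      then obtain w' where w': "w' \<in> N" "w' \<noteq> w" by (metis Diff_iff all_not_in_conv card.empty singletonI)
      then show ?thesis
        using edge[of "Outer w" "Inner w'"] w d_inner[OF w'(1)] d0[of "Outer w"] d0[of "Old v"]
        by (auto simp: W_def b_simps)
    qed
    have star: "a v w = d (Old v) * d (Old w)" if w: "w \<in> N" for w
      using edge[of "Outer w" "Old w"] w N(1) d_outer[OF w] sign[OF w] by (auto simp: W_def b_simps)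
    have "a u w = d (Old u) * d (Old w)" if uw: "u \<in> V" "w \<in> V" "a u w \<noteq> 0" for u w
    proof (cases "u = v \<or> w = v")
      case True
      then show ?thesis using star[of u] star[of w] uw N_iff sym[of u w] by (auto simp: mult.commute)
    next
      case False
      then show ?thesis using edge[of "Old u" "Old w"] uw by (auto simp: W_def b_simps)
    qed
    moreover have "\<forall>u. d (Old u) \<in> {- 1, 1}" using d by blast
    ultimately have "\<not> unbalanced V a" unfolding unbalanced_def not_not
      by (intro exI[of _ "\<lambda>u. d (Old u)"] conjI ballI impI)
    then show False using unb by simp
  qed
  ultimately have "int (card W) \<in> unbalanced_nut_orders \<rho>" by (rule nut_matrix_order_any)
  moreover have "card W = card V + \<rho> + \<rho>"
    using fin N(3,4) unfolding W_def
    by (subst card_Un_disjoint; auto simp: card_image inj_on_def)+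
  ultimately show ?thesis using n by (simp add: algebra_simps)
qed

section \<open>Seed graphs\<close>

definition nut_seeds :: "nat \<Rightarrow> nat list \<Rightarrow> (string list \<times> int list) list \<Rightarrow> bool" where
  "nut_seeds \<rho> ns S \<longleftrightarrow>
     map (\<lambda>s. length (fst s)) S = ns \<and> list_all (\<lambda>s. nut_certificate \<rho> (fst s) (snd s)) S"

lemma nut_seeds_orders:
  assumes "nut_seeds \<rho> ns S" "n \<in> set ns" "n \<noteq> 0"
  shows "int n \<in> unbalanced_nut_orders \<rho>"
proof -
  obtain T z where Tz: "(T, z) \<in> set S" "n = length T"
    using assms(1,2) by (force simp: nut_seeds_def)
  then have "nut_certificate \<rho> T z" using assms(1) by (force simp: nut_seeds_def list_all_iff)
  then show ?thesis using nut_certificate_sound Tz(2) assms(3) by auto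
qed

text \<open>The predicate \<open>P\<close> is the parity condition on the order. The seeds cover one period of
  length \<open>2 * \<rho>\<close>.\<close>

lemma seeds_generate:
  assumes seeds: "nut_seeds \<rho> ns S" and "3 \<le> \<rho>" and "start \<noteq> 0" "0 \<notin> set ns"
    and cover: "\<And>n. start \<le> n \<Longrightarrow> n < start + 2 * \<rho> \<Longrightarrow> P n \<Longrightarrow> n \<in> set ns"
    and period: "\<And>n. P (n + 2 * \<rho>) \<Longrightarrow> P n"
    and n: "start \<le> n" "P n"
  shows "int n \<in> unbalanced_nut_orders \<rho>"
  using n
proof (induction n rule: less_induct)
  case (less n)
  show ?case
  proof (cases "n < start + 2 * \<rho>")
    case True
    then show ?thesis using nut_seeds_orders[OF seeds] cover less.prems assms(3) by fastforce
  next
    case False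
    define m where "m = n - 2 * \<rho>"
    have m: "n = m + 2 * \<rho>" "m < n" "start \<le> m" using False assms(2) by (auto simp: m_def)
    then have "int m \<in> unbalanced_nut_orders \<rho>" using less period by simp
    then show ?thesis using enlarge_order[OF _ assms(2)] m(1) by force
  qed
qed

definition seeds_3 :: "(string list \<times> int list) list" where
  "seeds_3 = [
   ([
    ''++.-.......'', ''-.....-...'', ''......-..'', ''.-...++.'', ''.+....+'', ''.++...'',
    ''.-..-'', ''..--'', ''...'', ''-.'', ''.'', ''''],
    [2, 1, 1, 2, 2, 2, 1, 1, 1, 1, 1, 1]),
   ([
    ''--.-.........'', ''-.......+...'', ''......-....'', ''.-+-......'', ''-...+....'',
    ''...-....'', ''-....+.'', ''...-..'', ''.++.+'', ''....'', ''.+.'', ''.+'', ''-'', ''''],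
    [1, 1, 1, 4, -2, -3, -1, 2, 1, -2, 2, -3, -2, 1]),
   ([
    ''+-...........+.'', ''+...+.........'', ''....-........'', ''.....-.-..-.'',
    ''+-...+.....'', ''....-..+..'', ''.....-...'', ''++......'', ''..+..-.'', ''..-...'',
    ''....+'', ''...-'', ''-..'', ''.+'', ''.'', ''''],
    [-1, 2, 3, -3, -4, 1, -2, 3, 2, 1, -3, -2, 6, 1, 1, 5])]"

lemma seeds_3: "nut_seeds 3 [12, 14, 16] seeds_3"
  by code_simp

definition seeds_4 :: "(string list \<times> int list) list" where
  "seeds_4 = [
   ([
    ''+--+'', ''+--'', ''+-'', ''+'', ''''],
    [1, 1, 1, 1, 1]),
   ([
    ''-+..-+'', ''+.+.-'', ''--..'', ''++-'', ''-.'', ''+'', ''''],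
    [1, 1, 1, 1, 1, 1, 1]),
   ([
    ''-+-...+'', ''+.-+..'', ''.-.-.'', ''++.-'', ''.+.'', ''--'', ''+'', ''''],
    [1, 1, 1, 1, 1, 1, 1, 1]),
   ([
    ''+-.-+...'', ''+-..-..'', ''..-.+.'', ''.++-.'', ''.+-+'', ''..-'', ''.-'', ''+'', ''''],
    [1, 1, 1, 1, 1, 1, 1, 1, 1]),
   ([
    ''+-.+...-.'', ''+-.-....'', ''...+..-'', ''.++-..'', ''+-.-.'', ''.-..'', ''..-'', ''++'',
    ''+'', ''''],
    [1, 1, 1, 1, 1, 1, 1, 1, 1, 1]),
   ([
    ''++......--'', ''-....+-..'', ''-+......'', ''.+.-..+'', ''.-..+-'', ''--+..'', ''.+.+'',
    ''.+.'', ''-.'', ''.'', ''''],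
    [1, 1, 1, 1, 1, 1, 1, 1, 1, 1, 1]),
   ([
    ''--..+.+....'', ''-.....+..+'', ''.+.....+.'', ''..--++..'', ''.+...--'', ''+..--.'',
    ''..-..'', ''-+..'', ''..-'', ''..'', ''+'', ''''],
    [1, 1, 1, 1, 1, 1, 1, 1, 1, 1, 1, 1]),
   ([
    ''++.-.....-..'', ''-...-.+....'', ''+........-'', ''.--.+....'', ''+.+-....'', ''..-..+.'',
    ''..++..'', ''.--+.'', ''....'', ''.-+'', ''.+'', ''-'', ''''],
    [1, 1, 1, 1, 1, 1, 1, 1, 1, 1, 1, 1, 1]),
   ([
    ''-++-.........'', ''+..+..-.....'', ''.......-.-.'', ''......-.+-'', ''..++-....'',
    ''.+-....-'', ''-.+.-+.'', ''.-....'', ''....+'', ''.+..'', ''+.+'', ''-.'', ''.'', ''''],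
    [1, 1, 1, 1, 1, 1, 1, 1, 1, 1, 1, 1, 1, 1])]"

lemma seeds_4: "nut_seeds 4 [5, 7, 8, 9, 10, 11, 12, 13, 14] seeds_4"
  by code_simp

definition seeds_5 :: "(string list \<times> int list) list" where
  "seeds_5 = [
   ([
    ''-++.-..-.'', ''+....-++'', ''..---..'', ''-.-+.-'', ''++.+-'', ''+..+'', ''.+.'', ''-+'',
    ''.'', ''''],
    [2, 1, 1, 2, 1, 1, 1, 1, 1, 1]),
   ([
    ''-+....+.-+.'', ''+..+.-.+..'', ''.-.....--'', ''+-.-.+.-'', ''+-.-...'', ''-..-..'',
    ''.+.++'', ''+..+'', ''.-+'', ''-.'', ''.'', ''''],
    [2, 2, 1, 2, 2, 1, 1, 1, 1, 1, 1, 1]),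
   ([
    ''++.-....-.-..'', ''-..+-.-.....'', ''..+....-.-.'', ''.-.-+...++'', ''.+.+...-+'',
    ''-......-'', ''+..+...'', ''-++...'', ''..-..'', ''.++-'', ''+.-'', ''+.'', ''.'', ''''],
    [2, 2, 2, 2, 2, 2, 1, 1, 1, 1, 1, 1, 1, 1]),
   ([
    ''+-+.......-...-'', ''+...-...--....'', ''-.+.......+..'', ''...-..+.-...'',
    ''-+..-..+.+.'', ''..+...+-..'', ''.-..+..-.'', ''.+-+.+..'', ''.-..-.+'', ''++..-.'',
    ''.....'', ''....'', ''.--'', ''.+'', ''+'', ''''],
    [2, 1, 1, 2, 2, 2, 1, 1, 1, 1, 1, 1, 1, 1, 1, 1]),
   ([
    ''++...-.-........+'', ''-.......--....-.'', ''.........-.-..-'', ''+.+-....-..-..'',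
    ''...+....--..-'', ''+..--..+...-'', ''......-+...'', ''+..-..+.+.'', ''+....-...'',
    ''+..+..-.'', ''.+..+..'', ''.+.++.'', ''..+.+'', ''....'', ''...'', ''-.'', ''.'', ''''],
    [4, 1, 1, 2, 2, 2, 2, 2, 1, 1, 1, 1, 1, 1, 1, 1, 1, 1])]"

lemma seeds_5: "nut_seeds 5 [10, 12, 14, 16, 18] seeds_5"
  by code_simp

definition seeds_6 :: "(string list \<times> int list) list" where
  "seeds_6 = [
   ([
    ''-+.--++'', ''+--.++'', ''-+--.'', ''+++-'', ''+.-'', ''-+'', ''-'', ''''],
    [1, 1, 1, 1, 1, 1, 1, 1]),
   ([
    ''-++-+..-'', ''+..--++'', ''--.--.'', ''+-.-+'', ''+++.'', ''+.-'', ''++'', ''-'', ''''],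
    [2, 2, 2, 1, 1, 1, 1, 1, 1]),
   ([
    ''++-...-+-'', ''--+.-..+'', ''..-++-.'', ''+..+-+'', ''+-.--'', ''+-+-'', ''-+.'', ''.+'',
    ''.'', ''''],
    [1, 1, 1, 1, 1, 1, 1, 1, 1, 1]),
   ([
    ''--...-++.+'', ''-+-+....+'', ''..++.-+.'', ''+--..+-'', ''-+.+-.'', ''++...'', ''-...'',
    ''---'', ''--'', ''+'', ''''],
    [2, 1, 1, 2, 2, 2, 1, 1, 1, 1, 1]),
   ([
    ''+-.+.-.-.+.'', ''+-...+-.-.'', ''+.-..+..-'', ''--...+.+'', ''+..-+.-'', ''+-..+.'',
    ''-.+-+'', ''+-.+'', ''.+.'', ''--'', ''.'', ''''],
    [1, 1, 1, 1, 1, 1, 1, 1, 1, 1, 1, 1]),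
   ([
    ''-+.-.+.+.+..'', ''+.+--....+.'', ''--....-..+'', ''.+.-+.-.+'', ''..+...+-'', ''+..+-.-'',
    ''.-+.-.'', ''--+.+'', ''-.-.'', ''+..'', ''-.'', ''-'', ''''],
    [2, 2, 1, 2, 2, 1, 1, 1, 1, 1, 1, 1, 1]),
   ([
    ''+-...+.-.+.-.'', ''+-.-...+...-'', ''....-..-.++'', ''+-...-+..+'', ''+-+-..-..'',
    ''..+-+...'', ''-.+.+-.'', ''...++-'', ''..++-'', ''.-.+'', ''--.'', ''..'', ''.'', ''''],
    [1, 1, 1, 1, 1, 1, 1, 1, 1, 1, 1, 1, 1, 1]),
   ([
    ''++.-..+..-..-.'', ''-..--.....+.+'', ''....+-...-+.'', ''-+.-+..-.+.'', ''.+.+++....'',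
    ''...+.+-.-'', ''...+-+.-'', ''--+....'', ''...--.'', ''--.-.'', ''...-'', ''.++'', ''.+'',
    ''.'', ''''],
    [2, 2, 1, 2, 2, 2, 1, 1, 1, 1, 1, 1, 1, 1, 1]),
   ([
    ''+-...+.....--.+'', ''+.--......-.+.'', ''-...+-...+...'', ''.--.+...+..+'',
    ''..-.++..-+.'', ''++..+....-'', ''..-.+..-.'', ''.+-.-...'', ''.+-.+.-'', ''-+..-.'',
    ''...-.'', ''+-.-'', ''...'', ''++'', ''.'', ''''],
    [1, 1, 1, 1, 1, 1, 1, 1, 1, 1, 1, 1, 1, 1, 1, 1]),
   ([
    ''++-......+....--'', ''-..-..-...+...+'', ''...+..+.--....'', ''+.-+.-...+...'',
    ''-+-+.-......'', ''...+..++.+.'', ''...+..--..'', ''...+--..+'', ''..-..++-'', ''....+--'',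
    ''+-.-..'', ''.-..+'', ''.-..'', ''.-.'', ''+.'', ''.'', ''''],
    [2, 2, 1, 2, 2, 2, 1, 1, 1, 1, 1, 1, 1, 1, 1, 1, 1]),
   ([
    ''--.+.......-..+.+'', ''-....-.+..+..+..'', ''..-.+...+....+.'', ''-+......-+-+..'',
    ''...-....++.-.'', ''-.+.....+..-'', ''...+-.-..++'', ''...+.+.--.'', ''+...--.+.'',
    ''.-+.-..-'', ''+.-+--.'', ''.....-'', ''..-.+'', ''....'', ''...'', ''..'', ''.'', ''''],
    [1, 1, 1, 1, 1, 1, 1, 1, 1, 1, 1, 1, 1, 1, 1, 1, 1, 1]),
   ([
    ''--.........+..-.++'', ''-....+.....+.+..-'', ''.+.......+-+....'', ''+.+.-....-..--.'',
    ''..-.+-.-......'', ''-++...-+....-'', ''...+.+...--.'', ''.-.....-.+.'', ''.+-.-..+..'',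
    ''....-++.-'', ''--....+.'', ''.+-.+.+'', ''......'', ''.....'', ''++-.'', ''..+'', ''..'',
    ''.'', ''''],
    [2, 1, 1, 2, 2, 2, 2, 2, 1, 1, 1, 1, 1, 1, 1, 1, 1, 1, 1])]"

lemma seeds_6: "nut_seeds 6 [8, 9, 10, 11, 12, 13, 14, 15, 16, 17, 18, 19] seeds_6"
  by code_simp

definition seeds_7 :: "(string list \<times> int list) list" where
  "seeds_7 = [
   ([
    ''-+..-+-++'', ''+-++-..-'', ''..--+--'', ''-+++-+'', ''+--+-'', ''.--.'', ''+.+'', ''+.'',
    ''+'', ''''],
    [2, 2, 2, 2, 2, 2, 1, 1, 1, 1]),
   ([
    ''-+-++..-.+.'', ''++..-.+-.-'', ''--..-.+.-'', ''+...+-.+'', ''--+-...'', ''---.++'',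
    ''++++.'', ''.+-+'', ''.-.'', ''-+'', ''-'', ''''],
    [2, 2, 2, 2, 1, 1, 1, 1, 1, 1, 1, 1]),
   ([
    ''++-.-.+...-+.'', ''-.-.+...+.--'', ''.-..--...++'', ''+.-.+++..-'', ''-..+-..+.'',
    ''+.-+++..'', ''+-.-+..'', ''.---.+'', ''..+-.'', ''--.+'', ''.-.'', ''.+'', ''-'', ''''],
    [2, 1, 1, 2, 1, 1, 1, 1, 1, 1, 1, 1, 1, 1]),
   ([
    ''++--.....+-...-'', ''-++...--.....-'', ''-.++-....+...'', ''+........+-+'',
    ''-.-.....+-.'', ''+..+..---.'', ''+-.--.-..'', ''+.+-..+.'', ''..+-.++'', ''-++-.+'',
    ''.--+.'', ''.+.+'', ''.+-'', ''..'', ''.'', ''''],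
    [2, 2, 2, 2, 1, 1, 1, 1, 1, 1, 1, 1, 1, 1, 1, 1]),
   ([
    ''+-....+...-+.--..'', ''++-....--....-..'', ''+...-.....-..-+'', ''..-...+.--...-'',
    ''+..-.-.+..++.'', ''--.+-..+-...'', ''.+.++..+..-'', ''.+.+-...-.'', ''..-+..+-+'',
    ''+....--+'', ''..+....'', ''-++...'', ''.-...'', ''+..-'', ''.+.'', ''++'', ''.'', ''''],
    [2, 2, 1, 2, 2, 1, 1, 1, 1, 1, 1, 1, 1, 1, 1, 1, 1, 1]),
   ([
    ''-+-.........-.++..+'', ''+.-+..-..+.....+..'', ''.....+....-..--.-'', ''..-.++..-.+...+.'',
    ''+.+........---+'', ''....--....-.+-'', ''+....+-.+.+-.'', ''..--.+.-.-..'',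
    ''-..+.--....'', ''+-+..-..-.'', ''+..-.+.+.'', ''..+..+..'', ''+--....'', ''+....+'',
    ''....-'', ''+...'', ''+..'', ''..'', ''-'', ''''],
    [2, 1, 1, 2, 2, 2, 1, 1, 1, 1, 1, 1, 1, 1, 1, 1, 1, 1, 1, 1]),
   ([
    ''-+...+......+..--...+'', ''+++-..-..-..........'', ''.-......-+..-.....-'',
    ''..--.+....-...+.-.'', ''.+...-.-..+...-..'', ''..+.....++.-.+.-'', ''....+--......-.'',
    ''..-++.+..-..+.'', ''-++...+.....-'', ''-...-.++.-..'', ''...+.+....+'', ''.+.-......'',
    ''....+-+..'', ''-.-+-...'', ''....+..'', ''-.-...'', ''+..+.'', ''....'', ''++-'', ''-.'',
    ''+'', ''''],
    [2, 2, 1, 2, 2, 1, 1, 1, 1, 1, 1, 1, 1, 1, 1, 1, 1, 1, 1, 1, 1, 1])]"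

lemma seeds_7: "nut_seeds 7 [10, 12, 14, 16, 18, 20, 22] seeds_7"
  by code_simp

definition seeds_8 :: "(string list \<times> int list) list" where
  "seeds_8 = [
   ([
    ''-+--++-+'', ''++--+-+'', ''-+--+-'', ''++-+-'', ''+--+'', ''-+-'', ''++'', ''-'', ''''],
    [1, 1, 1, 1, 1, 1, 1, 1, 1]),
   ([
    ''-+-+.-+-+'', ''++--.++-'', ''-.-+--+'', ''++-+-.'', ''+--+-'', ''+-+-'', ''-++'', ''.+'',
    ''-'', ''''],
    [1, 1, 1, 1, 1, 1, 1, 1, 1, 1]),
   ([
    ''-++--..-++'', ''+-+.++.--'', ''+.+---.-'', ''.--+.-+'', ''+-++--'', ''++-.-'', ''-++.'',
    ''--.'', ''++'', ''+'', ''''],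
    [1, 1, 1, 1, 1, 1, 1, 1, 1, 1, 1]),
   ([
    ''+-.++.--+.-'', ''+--+--...+'', ''+..-+.--+'', ''++--+-..'', ''+..-+--'', ''-.---.'',
    ''++.++'', ''+.+-'', ''-+.'', ''++'', ''-'', ''''],
    [1, 1, 1, 1, 1, 1, 1, 1, 1, 1, 1, 1]),
   ([
    ''-+...+-+--.+'', ''+.+..-.++--'', ''-++..--.-.'', ''--+-+..++'', ''.-++..--'', ''--.+++-'',
    ''+-+-..'', ''...++'', ''+-.-'', ''--.'', ''++'', ''.'', ''''],
    [1, 1, 1, 1, 1, 1, 1, 1, 1, 1, 1, 1, 1]),
   ([
    ''+-.+..+-+--..'', ''+-.-+-.+.-..'', ''+.-..-+..-+'', ''+..++.-.--'', ''--.--.+.+'',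
    ''+..-+++.'', ''--.+.-+'', ''++-..-'', ''..++.'', ''..--'', ''-++'', ''+-'', ''.'', ''''],
    [1, 1, 1, 1, 1, 1, 1, 1, 1, 1, 1, 1, 1, 1]),
   ([
    ''-+..++.+--.-..'', ''+-+.-..+...+-'', ''++....-.--.-'', ''+.+...--+-.'', ''..--+.--..'',
    ''.+-+.---+'', ''-.--.++.'', ''+.+.+--'', ''-++.-.'', ''+....'', ''+..-'', ''.++'', ''.+'',
    ''+'', ''''],
    [1, 1, 1, 1, 1, 1, 1, 1, 1, 1, 1, 1, 1, 1, 1]),
   ([
    ''++.-...+-.+..--'', ''-+--+....+...-'', ''.-+.-...-+.+.'', ''+.---+.-+...'',
    ''+++....-...'', ''..-.-.++.-'', ''..+-+-.-.'', ''.++-.-+.'', ''-+.+-.+'', ''...--+'',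
    ''-.+-+'', ''..+.'', ''-.-'', ''++'', ''.'', ''''],
    [1, 1, 1, 1, 1, 1, 1, 1, 1, 1, 1, 1, 1, 1, 1, 1]),
   ([
    ''-+.....++-...--+'', ''+..-.-..+++-...'', ''-+..-...-+...-'', ''-.+-.+..++..-'',
    ''.-.--+....++'', ''.---++.+..+'', ''++..-+-.-.'', ''+....++..'', ''-..-.+..'', ''.+.-+..'',
    ''-.--.+'', ''..-+.'', ''.---'', ''.+.'', ''+.'', ''-'', ''''],
    [1, 1, 1, 1, 1, 1, 1, 1, 1, 1, 1, 1, 1, 1, 1, 1, 1]),
   ([
    ''--++-+..-....+...'', ''-.-+++.-....+...'', ''.+-.....++..-+.'', ''..-+-+-+..-...'',
    ''.+-....-...+-'', ''-.-+...+...+'', ''...+....-.-'', ''+..-.--.+.'', ''.+-..++.-'',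
    ''.+--+...'', ''+-+.--.'', ''...--.'', ''.-+++'', ''-+-+'', ''...'', ''.+'', ''-'', ''''],
    [1, 1, 1, 1, 1, 1, 1, 1, 1, 1, 1, 1, 1, 1, 1, 1, 1, 1]),
   ([
    ''--.....++-+-....+.'', ''-+.+...-.+..-..+.'', ''..-+.+.+...-...+'', ''-....+.-.-..+-+'',
    ''+.-.+-.+.+.-..'', ''+.....+-...--'', ''.+.--...+--.'', ''+-.--+.+..+'', ''.-..-.-..-'',
    ''+......--'', ''.+...+..'', ''.-.+.+.'', ''..--.+'', ''+++..'', ''-++-'', ''-..'', ''..'',
    ''.'', ''''],
    [1, 1, 1, 1, 1, 1, 1, 1, 1, 1, 1, 1, 1, 1, 1, 1, 1, 1, 1]),
   ([
    ''--...+++.-......-+.'', ''-..+.-+-....+.+...'', ''..+..-..-.+....++'', ''.-+.--..++..-.+.'',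
    ''+...+.--..+-.-+'', ''.-...-.-..+...'', ''-+.+-.-...-..'', ''..+.-.+..+..'',
    ''.-......+-.'', ''++..-+...-'', ''+...--...'', ''+..+....'', ''-+-.+..'', ''-.+..+'',
    ''-..-+'', ''.-+.'', ''+.-'', ''.-'', ''-'', ''''],
    [1, 1, 1, 1, 1, 1, 1, 1, 1, 1, 1, 1, 1, 1, 1, 1, 1, 1, 1, 1]),
   ([
    ''+-.+...-+......+.-.-'', ''+-..-..-+...+....-.'', ''.++........+.--.-.'',
    ''...+++.---....+..'', ''+..-.....---...+'', ''..-..+.+--..-..'', ''-.++.+....+.--'',
    ''..-+.+...--.+'', ''.-.+...++...'', ''..+..--.-..'', ''+--......+'', ''---...+..'',
    ''.-..+...'', ''.+.-.+.'', ''...++.'', ''+.++-'', ''..+-'', ''.-+'', ''..'', ''.'', ''''],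
    [1, 1, 1, 1, 1, 1, 1, 1, 1, 1, 1, 1, 1, 1, 1, 1, 1, 1, 1, 1, 1]),
   ([
    ''-+.......+-..-+-....+'', ''++.++-..-..........-'', ''.....--...+..-+..-.'',
    ''.-..-...+..-.-++..'', ''+.+..--+..-+-....'', ''+......-..-+-...'', ''..+....+.-.---.'',
    ''+..+.-..+.-..-'', ''..+...-+..-+.'', ''.--..+..+-.+'', ''+.+-..+..-.'', ''.+.......-'',
    ''.+-.-.-+.'', ''+.....--'', ''..--+..'', ''.+..+.'', ''....+'', ''....'', ''++.'', ''.+'',
    ''.'', ''''],
    [1, 1, 1, 1, 1, 1, 1, 1, 1, 1, 1, 1, 1, 1, 1, 1, 1, 1, 1, 1, 1, 1]),
   ([
    ''++...........+--.-.-.+'', ''-....-.-..+....-++...'', ''...+.-...-+....-..+.'',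
    ''.....++--..+...-+.-'', ''+...--+...-.-...++'', ''...--.+..+...-+-.'', ''.-+.-.++....-.-.'',
    ''+.-+-.+-+......'', ''..+.-..-..+.+.'', ''++.........-.'', ''.+...+..-...'',
    ''....-.....-'', ''.-...+....'', ''-+.+..-.-'', ''.-.-.+..'', ''...+-..'', ''+..+..'',
    ''++.--'', ''.-.+'', ''...'', ''..'', ''+'', ''''],
    [1, 1, 1, 1, 1, 1, 1, 1, 1, 1, 1, 1, 1, 1, 1, 1, 1, 1, 1, 1, 1, 1, 1]),
   ([
    ''++.....-.......-..++--.'', ''-....+.......+-.-+..-.'', ''.-..++.....-...+...-.'',
    ''.-.+.+--.-...+.+....'', ''--.+..+.....+..+-..'', ''.-.+...+...+.-..+.'',
    ''.-.+.++....--...+'', ''-...-..+..-.....'', ''...+.......-+..'', ''.--.-..-...+.+'',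
    ''-.+.+-....+.-'', ''.-+......+.+'', ''-..+-..+...'', ''+........-'', ''.+.+--...'',
    ''.-+..---'', ''.+..-+.'', ''..-.+.'', ''....-'', ''-.+.'', ''..+'', ''..'', ''.'', ''''],
    [1, 1, 1, 1, 1, 1, 1, 1, 1, 1, 1, 1, 1, 1, 1, 1, 1, 1, 1, 1, 1, 1, 1, 1])]"

lemma seeds_8: "nut_seeds 8 [9, 10, 11, 12, 13, 14, 15, 16, 17, 18, 19, 20, 21, 22, 23, 24] seeds_8"
  by code_simp

definition seeds_9 :: "(string list \<times> int list) list" where
  "seeds_9 = [
   ([
    ''++--+-.-+-.'', ''--+.++.+--'', ''+--.++-.-'', ''.++-+.-+'', ''--.++++'', ''.---++'',
    ''---++'', ''-++-'', ''-+.'', ''.-'', ''+'', ''''],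
    [2, 2, 2, 2, 1, 1, 1, 1, 1, 1, 1, 1]),
   ([
    ''-+-++-.+-.+..'', ''+....-+++--+'', ''.-...---+-+'', ''.--+-++.++'', ''-++..-+--'',
    ''+--+..++'', ''+..+-+-'', ''+-..--'', ''.--+.'', ''+-.-'', ''-.-'', ''+.'', ''.'', ''''],
    [2, 2, 1, 2, 2, 1, 1, 1, 1, 1, 1, 1, 1, 1]),
   ([
    ''++..--.+--...-+'', ''-...-++..--+-.'', ''.-..--++++...'', ''++++-.--.-.-'',
    ''+.-..+-.-+-'', ''--.+..+-.-'', ''+.+-.+.+.'', ''--.....+'', ''-++..-.'', ''.+-+..'',
    ''+..-+'', ''++..'', ''-+-'', ''++'', ''+'', ''''],
    [2, 2, 1, 2, 2, 1, 1, 1, 1, 1, 1, 1, 1, 1, 1, 1]),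
   ([
    ''-+-.+.+.+.--..+..'', ''+.+..--.+.++-...'', ''.-....-.-+--..+'', ''-.-.+.+..++.-+'',
    ''-.-+....+.++.'', ''...---++-..+'', ''.-+.++-+.+-'', ''--++..+.-.'', ''.....+-+-'',
    ''-...-++.'', ''+-..-.-'', ''+...-+'', ''..-.-'', ''.---'', ''-..'', ''+.'', ''.'', ''''],
    [2, 1, 1, 2, 1, 1, 1, 1, 1, 1, 1, 1, 1, 1, 1, 1, 1, 1]),
   ([
    ''++-.-.--+.-.+......'', ''-+....-.-.+..+--..'', ''-....+-+...+.+..-'', ''-.+..-+.....+.+.'',
    ''-+..++-+...+.-.'', ''+-...-+.+.+.+.'', ''...-----..+..'', ''-+..+-++...+'',
    ''..+-.+..+.+'', ''-..+.-..+.'', ''.-..-...+'', ''.+.+..++'', ''-.....-'', ''-.-+..'',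
    ''-.--.'', ''-+.-'', ''--.'', ''-+'', ''-'', ''''],
    [2, 2, 2, 2, 1, 1, 1, 1, 1, 1, 1, 1, 1, 1, 1, 1, 1, 1, 1, 1]),
   ([
    ''+-..-..-+.....+.+-+..'', ''+.+.-....-...--.+-..'', ''..+....--...++.-.-.'',
    ''-+++-...-......-+-'', ''.+...---.-+.....+'', ''+-+....-..-..-..'', ''-......-.+-..-.'',
    ''....+++-..-.+.'', ''..+.-.-.+.+.+'', ''--.++.--.-+.'', ''++++...+..-'', ''.......+++'',
    ''-.++.+..-'', ''..+.+..-'', ''+.-+.-.'', ''....-.'', ''..+.-'', ''-+-+'', ''...'', ''..'',
    ''.'', ''''],
    [2, 2, 1, 2, 2, 2, 2, 2, 2, 1, 1, 1, 1, 1, 1, 1, 1, 1, 1, 1, 1, 1]),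
   ([
    ''-+.........-+...+.--+.+'', ''++.....-..+...-..-.++.'', ''.+..-..-....-.+.--...'',
    ''-....-.-.-+...+++...'', ''..+-.....-.-+.++...'', ''-.+.++.+.-.-..-..-'',
    ''++..+.-..-.-..-+.'', ''-....+.+..-..--.'', ''+..-...+....-.-'', ''.+..-...+.+.+-'',
    ''-...++.--..-+'', ''...-....-+-.'', ''.++...+-.-+'', ''.-+-...-..'', ''.+-+..+.-'',
    ''.-...+..'', ''.....-+'', ''-.+...'', ''+..+.'', ''...+'', ''...'', ''..'', ''.'', ''''],
    [2, 2, 1, 2, 2, 2, 2, 2, 2, 2, 2, 1, 1, 1, 1, 1, 1, 1, 1, 1, 1, 1, 1, 1]),
   ([
    ''+-..+..+.......--...--..+'', ''+-.....--.--......+....+'', ''.--.+..+.....-......++.'',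
    ''.-.++-..+........++.-.'', ''+.--......+.+++.....-'', ''-.......+..+....+..-'',
    ''...+.++.-+...+...--'', ''.+.+.-.-....--....'', ''...-+....-+..-..-'', ''-...+++-...+....'',
    ''-+.....-.-+....'', ''.--..--..+.+.+'', ''.-...+...-.-.'', ''....+-...+.+'',
    ''.+..--..-+.'', ''+..-+..-+.'', ''-+.-.....'', ''...+-.+.'', ''.-.-...'', ''.-.-++'',
    ''.+...'', ''.-..'', ''+..'', ''-.'', ''.'', ''''],
    [2, 2, 2, 2, 2, 2, 2, 2, 1, 1, 1, 1, 1, 1, 1, 1, 1, 1, 1, 1, 1, 1, 1, 1, 1, 1]),
   ([
    ''+-....-.+..+--...+.-.......'', ''+............--..-...---.+'',
    ''+..-...+....-...+..-..+..'', ''+.-+.-......-+...-....-.'', ''-.-+-+-....+.....-.....'',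
    ''+.-+.-+.+.-..........+'', ''......++-.-.+.......+'', ''+..-...+...+..+....+'',
    ''.-.-....+.-.-.+....'', ''...+-.....-.+..-..'', ''.+-..--..+......-'', ''..+.....++.+.+-.'',
    ''.-...--..--....'', ''.+++-+........'', ''......+.++...'', ''....-+...++.'',
    ''...+.+...+.'', ''-..-..+.-.'', ''..-++-..-'', ''.+..-...'', ''+..+.+.'', ''......'',
    ''+...-'', ''.--.'', ''++-'', ''+-'', ''.'', ''''],
    [4, 2, 1, 2, 2, 1, 1, 1, 1, 1, 1, 1, 1, 1, 1, 1, 1, 1, 1, 1, 1, 1, 1, 1, 1, 1, 1, 1])]"

lemma seeds_9: "nut_seeds 9 [12, 14, 16, 18, 20, 22, 24, 26, 28] seeds_9"
  by code_simp

definition seeds_10 :: "(string list \<times> int list) list" where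
  "seeds_10 = [
   ([
    ''-+-.-++--++'', ''++++.-+---'', ''.-----+++'', ''+++----+'', ''--++--+'', ''--.+++'',
    ''+++--'', ''+.+-'', ''+--'', ''+-'', ''.'', ''''],
    [1, 1, 1, 1, 1, 1, 1, 1, 1, 1, 1, 1]),
   ([
    ''-+.+-.-+++--'', ''+--+-++.++.'', ''-+-+---..-'', ''-.++++-++'', ''-+..--++'', ''.++++-+'',
    ''--+---'', ''-.+-+'', ''--.-'', ''---'', ''+.'', ''+'', ''''],
    [2, 2, 2, 2, 2, 2, 2, 1, 1, 1, 1, 1, 1]),
   ([
    ''+-.++--++.-.-'', ''++.-+.+----.'', ''-+.-+-.++.-'', ''.+-+-.++--'', ''++---.+--'',
    ''-..+---+'', ''.-++..+'', ''+-+--+'', ''.-++.'', ''--++'', ''.+-'', ''+.'', ''+'', ''''],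
    [1, 1, 1, 1, 1, 1, 1, 1, 1, 1, 1, 1, 1, 1]),
   ([
    ''+-.+.+-.++-.--'', ''+-.-..-.-+-+-'', ''--+-+-+..+..'', ''++-++-.+..+'', ''.--..++--+'',
    ''.-+--++-.'', ''++-+-+..'', ''-.-..++'', ''+.+-.+'', ''-.--+'', ''.++-'', ''---'', ''+.'',
    ''+'', ''''],
    [2, 2, 2, 1, 1, 1, 1, 1, 1, 1, 1, 1, 1, 1, 1]),
   ([
    ''-+...--++.+--.+'', ''+.--+.+.++.-.-'', ''-.+-..--.+-+.'', ''-+.+-.-++-+.'',
    ''..-+.+-++-+'', ''.+-+.--.+-'', ''-+-.++.+-'', ''-++.+..-'', ''..-.+-.'', ''-.-+-+'',
    ''+-+-.'', ''-..-'', ''...'', ''-+'', ''+'', ''''],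
    [1, 1, 1, 1, 1, 1, 1, 1, 1, 1, 1, 1, 1, 1, 1, 1]),
   ([
    ''-++--....+.-.+-+'', ''+-+.+-.+..++-..'', ''.---.-.+-..-.+'', ''.+--.+-..-.++'',
    ''.++--.-.+.+.'', ''.-.+++.-.+-'', ''+--....+-+'', ''+-+.+..+.'', ''.++++.--'', ''.+---..'',
    ''--.-.-'', ''.-++-'', ''++--'', ''+.-'', ''-.'', ''.'', ''''],
    [2, 2, 1, 2, 1, 1, 1, 1, 1, 1, 1, 1, 1, 1, 1, 1, 1]),
   ([
    ''--+..+-....+-.-++'', ''-+++...+.+..--.-'', ''.+.++..-+..+--.'', ''.--..-.-.+-+.+'',
    ''-+--.-..+..-+'', ''..+++-+-..-.'', ''+.+-.-.-.-.'', ''.-+-.-..++'', ''---+-+++.'',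
    ''.++.-..-'', ''..+.++-'', ''.+.-.+'', ''-+---'', ''.+..'', ''++-'', ''..'', ''.'', ''''],
    [1, 1, 1, 1, 1, 1, 1, 1, 1, 1, 1, 1, 1, 1, 1, 1, 1, 1]),
   ([
    ''+---+.+-....-+...+'', ''+-..-..+.-..---+.'', ''.+-.+++..-.-.+..'', ''++..+-+...+.+-.'',
    ''..-.+.+.+-.-+.'', ''-..-+....----'', ''-.+..+-.++++'', ''+.---+.-...'', ''.-+-+..-+.'',
    ''-.-+....-'', ''++--...-'', ''+.-+.--'', ''.++.-.'', ''.-++.'', ''+..-'', ''+.+'', ''.+'',
    ''-'', ''''],
    [4, 2, 1, 2, 2, 2, 1, 1, 1, 1, 1, 1, 1, 1, 1, 1, 1, 1, 1]),
   ([
    ''+-.....+..-+-+.-+-.'', ''+-.-..--...+...++-'', ''-..-..--..+++...+'', ''-..+-.+..+-..+.+'',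
    ''++-.-.+.+.+--..'', ''-.++....++---.'', ''.-++.-..++..-'', ''++.+--+-.-..'',
    ''..-+.-....+'', ''.+-...-.+.'', ''-.---+++.'', ''.+-.+..-'', ''-..+-++'', ''....-.'',
    ''+..-.'', ''-.--'', ''+..'', ''.-'', ''+'', ''''],
    [1, 1, 1, 1, 1, 1, 1, 1, 1, 1, 1, 1, 1, 1, 1, 1, 1, 1, 1, 1]),
   ([
    ''+-....-..+-+..--.+.+'', ''+...-...-.--+.+.-+.'', ''.+..++--..+..-.-..'',
    ''++..-+-...--.-.-+'', ''-..+-....-.-+.+-'', ''..-.++.-..++.--'', ''++.+.-+..+---.'',
    ''..-.--++...+-'', ''....+-+.--..'', ''-+..++.--+.'', ''.....+...-'', ''+-+.--.+-'',
    ''+.--++..'', ''.-.+...'', ''+...-+'', ''..+.+'', ''+...'', ''...'', ''++'', ''.'', ''''],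
    [2, 1, 1, 2, 2, 2, 2, 1, 1, 1, 1, 1, 1, 1, 1, 1, 1, 1, 1, 1, 1]),
   ([
    ''-+....++-+.-.-+....-.'', ''++-+.....-+...+.-..-'', ''+.+...+.-....--..--'',
    ''..---.+......-.-++'', ''.+.-.-+.+--.++...'', ''+.+.-.+--..-.-..'', ''-...+++.--..-..'',
    ''.+...--+-+.+..'', ''+...-+...--+.'', ''..-++-..-.-.'', ''.-.+.+-.+-.'', ''+..++.-.--'',
    ''......-+-'', ''-.-.+..+'', ''....++.'', ''++-..-'', ''-+...'', ''+..+'', ''..+'', ''++'',
    ''.'', ''''],
    [1, 1, 1, 1, 1, 1, 1, 1, 1, 1, 1, 1, 1, 1, 1, 1, 1, 1, 1, 1, 1, 1]),
   ([
    ''+-..+-.++.-+....+....-'', ''+.--.....-..-+--....-'', ''.+.+.+-..-.+--......'',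
    ''..-..-..++-++-..-+.'', ''..+-+...---..-..+.'', ''++-..+.+.-.--....'', ''.---+......-..+.'',
    ''-+-.+-.+....--.'', ''.-..-.....-.+.'', ''..-+...+.+...'', ''.+-+++.+...-'',
    ''..-.++.-+.+'', ''....+.-+-.'', ''.+..+.-..'', ''.+..--.+'', ''.....+-'', ''..++-+'',
    ''-.-.+'', ''++-+'', ''+-+'', ''..'', ''.'', ''''],
    [2, 2, 4, 1, 1, 1, 1, 1, 1, 1, 1, 1, 1, 1, 1, 1, 1, 1, 1, 1, 1, 1, 1]),
   ([
    ''++--+...+..-.-......-.+'', ''---.+....-+.+...+..+..'', ''++...+..-....-.--...-'',
    ''+.+..-.+....+.-.-...'', ''-..-..+......++-...'', ''..--...-..+++.+.-.'',
    ''..++..-...--.---.'', ''+.-.+.-+--..+.-+'', ''...---+...+.+..'', ''-.+++-.......-'',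
    ''+-..-++.-+...'', ''...-.+..+--.'', ''.+..-.-.+..'', ''-+..-++..+'', ''.-....++.'',
    ''+--.+...'', ''.+...--'', ''.+..+-'', ''....+'', ''.-+-'', ''-..'', ''+.'', ''+'', ''''],
    [2, 2, 2, 2, 2, 1, 1, 1, 1, 1, 1, 1, 1, 1, 1, 1, 1, 1, 1, 1, 1, 1, 1, 1]),
   ([
    ''+--..+-..-..+..+-+......'', ''++-..-...-.-...-.+.-...'', ''.+.-...++....-.-+.-...'',
    ''..+..++..-+.-..-....-'', ''.-+..-.+..-+.....+-.'', ''.-+-+..++.-...+..--'',
    ''....+-..-+.+...-..'', ''..-...+..+...+.++'', ''+.-...-.+--+.-.+'', ''..--..-+..++.-.'',
    ''........-.++.-'', ''-....+-+-..+.'', ''..+++.--.+..'', ''-+.-+....+.'', ''---+..+..-'',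
    ''.++...-+.'', ''.....+..'', ''.......'', ''...-.-'', ''--..+'', ''+--+'', ''+-.'', ''..'',
    ''+'', ''''],
    [2, 2, 2, 1, 1, 1, 1, 1, 1, 1, 1, 1, 1, 1, 1, 1, 1, 1, 1, 1, 1, 1, 1, 1, 1]),
   ([
    ''-+....+-.-.+....+..-.-+..'', ''+-.+...+..-...+.+-....+.'', ''.-..++..-.....-.-+.-...'',
    ''.++-.-+.-......++-....'', ''++.-+.......-.-.-++..'', ''..--..+---.........-'',
    ''.--.-..+-.+-.....-.'', ''+.-...+--..+....-.'', ''....+......+...++'', ''.+.+.+.......-.-'',
    ''-..-++.+-..+...'', ''...++.-.-+..+.'', ''.-...++.+.--.'', ''--...+.+.--+'',
    ''..++..+-...'', ''+...-....+'', ''.-.+-..--'', ''-.-.++.-'', ''-..+...'', ''.....+'',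
    ''+.-..'', ''-+..'', ''-+.'', ''.-'', ''+'', ''''],
    [2, 1, 1, 2, 2, 1, 1, 1, 1, 1, 1, 1, 1, 1, 1, 1, 1, 1, 1, 1, 1, 1, 1, 1, 1, 1]),
   ([
    ''+-...-..-.+....+-.+...+.-.'', ''+.-.-....-..+..-.+-.....-'', ''.-....+....+.-...+..-.-+'',
    ''..+-+.+...-+-+-....-...'', ''+..-...-..+..+.+.++...'', ''++..-........---.-+.+'',
    ''..+..-........-+..++'', ''.--......--..+++.+.'', ''+..+...+.--.-+-...'',
    ''.+..-.-.......-+.'', ''++-.-..-+...+...'', ''-..--+.-.+.....'', ''-....-.++..+..'',
    ''++.-...+--+.+'', ''....--...-+-'', ''..+--.+..-.'', ''++...-.+..'', ''..++....+'',
    ''.+..+...'', ''..-..+.'', ''...-..'', ''..-.-'', ''..--'', ''...'', ''+-'', ''.'', ''''],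
    [2, 2, 2, 1, 1, 1, 1, 1, 1, 1, 1, 1, 1, 1, 1, 1, 1, 1, 1, 1, 1, 1, 1, 1, 1, 1, 1]),
   ([
    ''+-.-.+..-+.......++..-..-..'', ''+-...+...-......+-...+-.-.'',
    ''....-.-..-.+...+.+..+-...'', ''+--.............+..-++-+'', ''+.-.+-+........-.+....-'',
    ''+.......+.-....-+--..+'', ''-.+.-.-+.+.....-.....'', ''.-.....+.+...+.+...-'',
    ''..++--++...--..-.+.'', ''-..+.+.-.+........'', ''-+....+.--.+..+..'', ''-+..-.....+..+..'',
    ''+.+.-.......-+-'', ''.-.--+....+...'', ''..+.---...+.-'', ''.+-..-.-.-..'',
    ''+-+..-..-+.'', ''-.-.......'', ''...-.+..-'', ''....--.+'', ''+++....'', ''.-+.++'',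
    ''...-.'', ''..-+'', ''.+.'', ''+.'', ''.'', ''''],
    [2, 2, 1, 2, 2, 1, 1, 1, 1, 1, 1, 1, 1, 1, 1, 1, 1, 1, 1, 1, 1, 1, 1, 1, 1, 1, 1, 1]),
   ([
    ''+-.....-..-.....+..++..-.+.+'', ''+...--.+....-.+-....-.+....'',
    ''-...+..+....-.-+-.......+.'', ''.-...+-+.+.+.--...+......'', ''++.+.---.+.-....+.....-.'',
    ''.....-+.-..+...+-....+-'', ''....+..+..-.-.--.+.-..'', ''+.+....+..-....--..--'',
    ''.+...-...-+-....--..'', ''..-+.-....-..-.+.+-'', ''+-...-....-....+..'',
    ''..--......++.....'', ''.+...+.+-.++....'', ''.+-..--..--.-.+'', ''..-..+..+.....'',
    ''-..+-....+...'', ''+..+.+....++'', ''..+....+...'', ''..+.+.++-.'', ''-...+.+-+'',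
    ''........'', ''+.-...-'', ''.--+..'', ''.--+.'', ''...+'', ''--+'', ''..'', ''.'', ''''],
    [2, 1, 1, 2, 2, 2, 2, 2, 2, 2, 2, 2, 2, 1, 1, 1, 1, 1, 1, 1, 1, 1, 1, 1, 1, 1, 1, 1, 1]),
   ([
    ''++.+......-..+...-.-.--...-..'', ''-..+.-......-+.....+..--...-'',
    ''....+.......-.+.-.-+...-..+'', ''....-.++-.--...+.+..-.+...'',
    ''-.+..-.+.+..-+-.........-'', ''..-........+..-.-+.+-+..'', ''++...+...-+-...--+.-...'',
    ''......-...-.++.-.....-'', ''..-.+..+..+-.....+.+.'', ''-...+.+++..-..-.+--.'',
    ''-..+.....+-.-.+...+'', ''.-.+.+..-.++......'', ''.-.-.-.+.+..-.+..'', ''..--+..-..++..-+'',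
    ''...........+.-.'', ''.-..+..+.+.-.-'', ''.+-.-....+.+.'', ''...-...-....'',
    ''....-+.....'', ''.+.+-..+-.'', ''.+.....+.'', ''........'', ''+..-..+'', ''......'',
    ''+.+.+'', ''.--.'', ''-..'', ''+.'', ''+'', ''''],
    [2, 2, 1, 2, 2, 2, 1, 1, 1, 1, 1, 1, 1, 1, 1, 1, 1, 1, 1, 1, 1, 1, 1, 1, 1, 1, 1, 1, 1, 1]),
   ([
    ''++.....++....-.-....-.-...--..'', ''-..+.+.........----...+...+..'',
    ''...-......-.+......++...+-.-'', ''.-.+-....+-.-+...+.....-+..'',
    ''.+..+.....-..---.-.+..+..+'', ''.-..+...+....-.-.-..++...'', ''..+-...++-.+......-....-'',
    ''+..+-.........-..-..-.-'', ''.-..+.-..-.-+....+....'', ''.---..........-...+--'',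
    ''.-+.....+++..-.-....'', ''-..-+.......-+.+.-+'', ''.....+.+.+.++.-...'',
    ''.........++.-..--'', ''..+.-.+.-.+...+.'', ''++.....--....+.'', ''+.+..+...+..-.'',
    ''-+..-..-.-...'', ''.+..+.....++'', ''++......+..'', ''.+.-.+....'', ''...-.--..'',
    ''-..-...+'', ''..+.+..'', ''....-.'', ''-..++'', ''.-..'', ''.+.'', ''..'', ''.'', ''''],
    [2, 2, 2, 2, 2, 1, 1, 1, 1, 1, 1, 1, 1, 1, 1, 1, 1, 1, 1, 1, 1, 1, 1, 1, 1, 1, 1, 1, 1, 1, 1])]"

lemma seeds_10: "nut_seeds 10 [12, 13, 14, 15, 16, 17, 18, 19, 20, 21, 22, 23, 24, 25, 26, 27, 28, 29, 30, 31] seeds_10"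
  by code_simp

definition seeds_11 :: "(string list \<times> int list) list" where
  "seeds_11 = [
   ([
    ''-+..-+-+-+++-'', ''+.-.-+-+-+++'', ''+-.---.-+++'', ''-+++--+---'', ''++-.+++-+'',
    ''+-+---+-'', ''--+.--.'', ''+++..+'', ''.+++-'', ''---+'', ''--.'', ''.-'', ''-'', ''''],
    [2, 2, 2, 2, 2, 2, 2, 2, 2, 2, 1, 1, 1, 1]),
   ([
    ''+--+..-+.+-.+-+'', ''+-.---.+..+-+-'', ''-.+-..++--.++'', ''.+++.+-+++..'',
    ''+++-.-+----'', ''-.+--.+.--'', ''++--..+.+'', ''-..+-++-'', ''++----.'', ''--.---'',
    ''+-..+'', ''-++.'', ''.++'', ''--'', ''.'', ''''],
    [2, 2, 2, 2, 1, 1, 1, 1, 1, 1, 1, 1, 1, 1, 1, 1]),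
   ([
    ''+-++-.--+-...++..'', ''+..+-..-+-+---..'', ''+-.-..--+.+.++.'', ''-.+-++..--.--.'',
    ''-++..--+...++'', ''.+.-..+-+-++'', ''+.+.+---..-'', ''+..-..--+-'', ''.-+-+-+--'',
    ''++-.-.-.'', ''+++.-.-'', ''-...--'', ''.+..+'', ''++-+'', ''.++'', ''++'', ''.'', ''''],
    [2, 2, 2, 2, 2, 2, 2, 2, 2, 2, 2, 2, 2, 2, 1, 1, 1, 1]),
   ([
    ''-+..-.-.+...+.+--++'', ''+.+.-.-+-.+-..-..+'', ''--+-+-....+.--...'', ''-+.++.+--..-+.+.'',
    ''.+-..-+-+..++..'', ''.+.-.-.--..+-+'', ''.+.++.-+.+.--'', ''+-...+---...'',
    ''.+-+..+.--.'', ''.+--.-++.-'', ''+-+.+.-.-'', ''..-+.-+.'', ''.+-+++.'', ''-...-.'',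
    ''++++-'', ''...+'', ''..-'', ''--'', ''-'', ''''],
    [2, 2, 2, 2, 2, 2, 1, 1, 1, 1, 1, 1, 1, 1, 1, 1, 1, 1, 1, 1]),
   ([
    ''++-......--.+-+..++.-'', ''-.+..--...+.+.-+..--'', ''..-++.--..-..+-..+.'',
    ''--++++..+...--..+.'', ''+.-+-++.+-.....-.'', ''......+.++.+---+'', ''-..+-...-+-+-.-'',
    ''-....++-..-..+'', ''+-.+.-.-..-.+'', ''++-+.-.-.-..'', ''...+.-+.-+.'', ''-.-.++-++.'',
    ''-.-..-.-+'', ''.----+..'', ''+..+..-'', ''.++-..'', ''++..+'', ''....'', ''.-.'', ''++'',
    ''-'', ''''],
    [2, 1, 1, 2, 1, 1, 1, 1, 1, 1, 1, 1, 1, 1, 1, 1, 1, 1, 1, 1, 1, 1]),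
   ([
    ''-+...-....+.+-+-+.-.-..'', ''+..-++-..-...++....+-.'', ''+....+--..-.-.-....+-'',
    ''...-+.+-+-..-.-+-...'', ''-+.++.---.++....+-.'', ''...-++++-...--...+'',
    ''.--..+++-.-..-...'', ''..--+...--+++..+'', ''...-+.-.+-..-..'', ''.+..+.+-+-...+'',
    ''+..---.+.+..-'', ''-.........++'', ''.....-+-..-'', ''...+.-.--.'', ''+.-.++.+-'',
    ''++..-...'', ''...+-+.'', ''+..+..'', ''+..+-'', ''-+..'', ''++.'', ''-+'', ''-'', ''''],
    [2, 2, 2, 2, 2, 2, 2, 2, 2, 2, 2, 2, 2, 2, 1, 1, 1, 1, 1, 1, 1, 1, 1, 1]),
   ([
    ''-+-.++.-+..-...+.....-.-.'', ''+.+--.+++...........+.--'', ''+-+--...-..-...-......+'',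
    ''-...+....+..--.-.+..++'', ''.+-...+.-.++....-..+.'', ''+-..-..-.-..+...+-..'',
    ''..+..-.--.......+-.'', ''..+-+.+...+.++.+..'', ''..+++-..-.-...--.'', ''....+---..--.-.-'',
    ''..-.-..-.+-.++-'', ''-+.+.+....--.+'', ''.-....+-.+.++'', ''.+-.+-..+...'',
    ''.-++++.....'', ''....+.-+.+'', ''++..+-.-.'', ''-+-+..+.'', ''..-.-.-'', ''-+++.-'',
    ''--.+.'', ''.-..'', ''..-'', ''..'', ''.'', ''''],
    [2, 2, 2, 2, 2, 2, 2, 2, 1, 1, 1, 1, 1, 1, 1, 1, 1, 1, 1, 1, 1, 1, 1, 1, 1, 1]),
   ([
    ''-+....+...-+--..-.+.+..+...'', ''+.....-.++..+--.......++-.'',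
    ''-.+--....+..+....-....--.'', ''..-.++-+....++.-....-..+'', ''.+--...+..-.+..---..++.'',
    ''--.+...++.-.--.+....+.'', ''..++.-+.+.......+.-..'', ''++-+..+-.....+......'',
    ''....-.....-.++-++..'', ''.-..-..-..-.---...'', ''--...-..++.+.-...'', ''+-.........+.-.-'',
    ''....-.+.--....-'', ''-++.-.+......-'', ''+.+-......-.-'', ''+.-....+-...'',
    ''.-...+.+.+-'', ''+..--+-...'', ''.+.+..+++'', ''+..-+.-+'', ''-++..-.'', ''.-.+.-'',
    ''...-+'', ''--..'', ''...'', ''-.'', ''+'', ''''],
    [2, 2, 1, 2, 2, 2, 2, 1, 1, 1, 1, 1, 1, 1, 1, 1, 1, 1, 1, 1, 1, 1, 1, 1, 1, 1, 1, 1]),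
   ([
    ''-+...--++......-..+...+.+..-.'', ''+..+..-..+...-.-......++.-.+'',
    ''..-.-+--..-.++.+...........'', ''-.+...+--.-.+.....+-...+.-'',
    ''...-+..-..+-...+++..-..+.'', ''-.+....-........+.+.---+'', ''.+.-...+.-.+.-+.......+'',
    ''...+++++.-.-...+.....-'', ''........+..--....-..-'', ''-.....-....+..--++-.'',
    ''..+.....-.-...+.+++'', ''..-..+-+..-.--+...'', ''-+.+.......-++.+-'', ''+-.....-..+.+..-'',
    ''...-.+.....-.--'', ''.-.-...-..+-+.'', ''.++.....+...+'', ''.+++--....+.'',
    ''.+--+...--.'', ''..-+...-+.'', ''--.+-+...'', ''..+..-..'', ''-.-.+..'', ''-.-+..'',
    ''--...'', ''....'', ''...'', ''..'', ''.'', ''''],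
    [2, 2, 1, 2, 2, 2, 2, 2, 2, 2, 2, 1, 1, 1, 1, 1, 1, 1, 1, 1, 1, 1, 1, 1, 1, 1, 1, 1, 1, 1]),
   ([
    ''+-...-....-.-+-..+..+........++'', ''+..-...+.-.---......+.+.....-.'',
    ''....-..++..+..-..-....+.-+...'', ''-...-+.++....-+.+....+-....-'',
    ''++.......-+.+-.-...--+.....'', ''+.--..........--....-.+.++'',
    ''....--.....++...-....--+.'', ''+...+-+.+.-.+-..+.....-.'', ''...-+..+...+-......+-.+'',
    ''..+...-+.+...--....-.-'', ''.++-...+.+---..-...-.'', ''.+.+.+..+......-...-'',
    ''....-.-.......+.--.'', ''.+......+....+.+.-'', ''.-..-....-.++....'', ''-....++..+-..-..'',
    ''+.....+--...+-.'', ''-..+.+....-...'', ''.---...+.....'', ''++--+-..-...'',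
    ''.-.........'', ''...+...+..'', ''+-.+-....'', ''...+-+.+'', ''...-++.'', ''.-+.--'',
    ''+-.+.'', ''.+.-'', ''..+'', ''..'', ''.'', ''''],
    [2, 2, 2, 2, 2, 2, 2, 2, 1, 1, 1, 1, 1, 1, 1, 1, 1, 1, 1, 1, 1, 1, 1, 1, 1, 1, 1, 1, 1, 1, 1, 1]),
   ([
    ''++..-++...-..-....-...-......+..-'', ''--..+....--..+......-...+..-...+'',
    ''-.+-...+..-...+...-....+......+'', ''.+-+.....-....+..+..+....-..+.'',
    ''.+-..+.+....-..--.....+-..-+.'', ''-....+....-...+....+...+..--'',
    ''.+-..-.......+-............'', ''..+-......--...-.-+......+'',
    ''+----............-++..+-.'', ''....+-..++.-.....-+.-+..'', ''....-+.-...-...-.+-....'',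
    ''....+.+.-..++..+......'', ''...+..+..++....-.-.+.'', ''-+.+....-+...++...+.'',
    ''..+-+....++...--+..'', ''+-..-.+.......--.+'', ''...-..+.-.-..+-..'', ''.-.+..--...++...'',
    ''.-.......+.-.-+'', ''.+..-..-.+.+..'', ''+.+.....+.-..'', ''+.+-........'',
    ''...-...++-+'', ''.+--.....-'', ''--..-+.-.'', ''.-++....'', ''.-+.+..'', ''-...+.'',
    ''....-'', ''....'', ''.-.'', ''.-'', ''.'', ''''],
    [2, 2, 1, 2, 2, 2, 2, 1, 1, 1, 1, 1, 1, 1, 1, 1, 1, 1, 1, 1, 1, 1, 1, 1, 1, 1, 1, 1, 1, 1, 1, 1, 1, 1])]"

lemma seeds_11: "nut_seeds 11 [14, 16, 18, 20, 22, 24, 26, 28, 30, 32, 34] seeds_11"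
  by code_simp

lemma orders_3: "12 \<le> n \<Longrightarrow> even n \<Longrightarrow> int n \<in> unbalanced_nut_orders 3"
  by (rule seeds_generate[OF seeds_3, where P = even and start = 12]) (simp_all, presburger+)

lemma orders_4: "7 \<le> n \<Longrightarrow> int n \<in> unbalanced_nut_orders 4"
  by (rule seeds_generate[OF seeds_4, where P = "\<lambda>_. True" and start = 7]) (simp_all, presburger+)

lemma orders_5: "10 \<le> n \<Longrightarrow> even n \<Longrightarrow> int n \<in> unbalanced_nut_orders 5"
  by (rule seeds_generate[OF seeds_5, where P = even and start = 10]) (simp_all, presburger+)

lemma orders_6: "8 \<le> n \<Longrightarrow> int n \<in> unbalanced_nut_orders 6"
  by (rule seeds_generate[OF seeds_6, where P = "\<lambda>_. True" and start = 8]) (simp_all, presburger+)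

lemma orders_7: "10 \<le> n \<Longrightarrow> even n \<Longrightarrow> int n \<in> unbalanced_nut_orders 7"
  by (rule seeds_generate[OF seeds_7, where P = even and start = 10]) (simp_all, presburger+)

lemma orders_8: "9 \<le> n \<Longrightarrow> int n \<in> unbalanced_nut_orders 8"
  by (rule seeds_generate[OF seeds_8, where P = "\<lambda>_. True" and start = 9]) (simp_all, presburger+)

lemma orders_9: "12 \<le> n \<Longrightarrow> even n \<Longrightarrow> int n \<in> unbalanced_nut_orders 9"
  by (rule seeds_generate[OF seeds_9, where P = even and start = 12]) (simp_all, presburger+)

lemma orders_10: "12 \<le> n \<Longrightarrow> int n \<in> unbalanced_nut_orders 10"
  by (rule seeds_generate[OF seeds_10, where P = "\<lambda>_. True" and start = 12]) (simp_all, presburger+)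

lemma orders_11: "14 \<le> n \<Longrightarrow> even n \<Longrightarrow> int n \<in> unbalanced_nut_orders 11"
  by (rule seeds_generate[OF seeds_11, where P = even and start = 14]) (simp_all, presburger+)

lemma order_4_5: "5 \<in> unbalanced_nut_orders 4"
  using nut_seeds_orders[OF seeds_4, of 5] by simp

section \<open>Parity of kernel vectors\<close>

lemma even_sum_symmetric:
  fixes h :: "'a \<Rightarrow> 'a \<Rightarrow> int"
  assumes "finite S" "\<And>u v. h u v = h v u" "\<And>v. h v v = 0"
  shows "even (\<Sum>u\<in>S. \<Sum>v\<in>S. h u v)"
  using assms(1)
proof induction
  case (insert w S)
  have eq: "(\<Sum>u\<in>insert w S. \<Sum>v\<in>insert w S. h u v) = 2 * (\<Sum>v\<in>S. h w v) + (\<Sum>u\<in>S. \<Sum>v\<in>S. h u v)"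
  proof -
    have "(\<Sum>u\<in>S. h u w) = (\<Sum>v\<in>S. h w v)" by (intro sum.cong refl assms(2))
    then show ?thesis using insert assms(3)[of w] by (simp add: sum.distrib)
  qed
  show ?case unfolding eq using insert.IH by simp
qed simp

context nut_matrix
begin

abbreviation N :: "'a \<Rightarrow> 'a set" where "N \<equiv> nbrs V a"

definition Od :: "'a set" where "Od = {v \<in> V. odd (x v)}"

lemma finite_N [simp]: "finite (N u)" using fin by (simp add: nbrs_def)
lemma finite_Od [simp]: "finite Od" using fin by (simp add: Od_def)
lemma Od_subset: "Od \<subseteq> V" by (auto simp: Od_def)
lemma N_subset: "N u \<subseteq> V" by (auto simp: nbrs_def)
lemma not_self_nbr [simp]: "u \<notin> N u" using loopfree by (auto simp: nbrs_def)
lemma nbr_sym: "u \<in> V \<Longrightarrow> v \<in> N u \<Longrightarrow> u \<in> N v" using sym[of u v] by (auto simp: nbrs_def)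
lemma nbr_commute: "u \<in> V \<Longrightarrow> v \<in> V \<Longrightarrow> v \<in> N u \<longleftrightarrow> u \<in> N v" using nbr_sym by blast
lemma sign: "v \<in> N u \<Longrightarrow> a u v = 1 \<or> a u v = - 1" using entry[of u v] by (auto simp: nbrs_def)

lemma sum_nbrs: "A \<subseteq> V \<Longrightarrow> (\<Sum>v\<in>A. a u v * y v) = (\<Sum>v\<in>N u \<inter> A. a u v * y v)"
  using finite_subset[OF _ fin] by (intro sum.mono_neutral_right) (auto simp: nbrs_def)

lemma row: "u \<in> V \<Longrightarrow> (\<Sum>v\<in>N u. a u v * x v) = 0"
  using ker[of u] sum_nbrs[of V u x] N_subset[of u] by (simp add: Int_absorb2)

lemma no_kernel_vector_on:
  assumes S: "S \<subseteq> V" "s \<in> S" "y s \<noteq> 0" and w: "w \<in> V" "w \<notin> S"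
    and kernel: "\<And>u. u \<in> V \<Longrightarrow> (\<Sum>v\<in>N u \<inter> S. a u v * y v) = 0"
  shows False
proof -
  define y' where "y' v = (if v \<in> S then y v else 0)" for v
  have "(\<Sum>v\<in>V. a u v * y' v) = 0" if "u \<in> V" for u
  proof -
    have "(\<Sum>v\<in>V. a u v * y' v) = (\<Sum>v\<in>S. a u v * y v)"
      using S(1) fin by (intro sum.mono_neutral_cong_right) (auto simp: y'_def)
    then show ?thesis using kernel[OF that] sum_nbrs[OF S(1)] by simp
  qed
  then have "y' s = 0" using uniq[of y' w s] S w by (auto simp: y'_def)
  then show False using S by (simp add: y'_def)
qed

lemma sum_parity_card:
  assumes "finite A" "\<And>v. v \<in> A \<Longrightarrow> odd (k v :: int)"
  shows "even (\<Sum>v\<in>A. k v) \<longleftrightarrow> even (card A)"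
  using assms by (induction A) auto

text \<open>The row of \<open>u\<close> modulo 2.\<close>

lemma even_odd_nbrs:
  assumes u: "u \<in> V"
  shows "even (card (N u \<inter> Od))"
proof -
  have "0 = (\<Sum>v\<in>N u \<inter> Od. a u v * x v) + (\<Sum>v\<in>N u - Od. a u v * x v)"
    using row[OF u] sum.Int_Diff[OF finite_N, of "\<lambda>v. a u v * x v" u Od] by simp
  moreover have "even (\<Sum>v\<in>N u - Od. a u v * x v)"
    using N_subset by (intro dvd_sum) (auto simp: Od_def)
  ultimately have "even (\<Sum>v\<in>N u \<inter> Od. a u v * x v)" by presburger
  moreover have "odd (a u v * x v)" if "v \<in> N u \<inter> Od" for v
    using sign[of v u] that by (auto simp: Od_def)
  ultimately show ?thesis using sum_parity_card[of "N u \<inter> Od" "\<lambda>v. a u v * x v"] by simp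
qed

lemma double_count:
  assumes "A \<subseteq> V" "B \<subseteq> V"
  shows "(\<Sum>u\<in>A. card (N u \<inter> B)) = (\<Sum>u\<in>B. card (N u \<inter> A))"
proof -
  have fin': "finite A" "finite B" using assms fin finite_subset by auto
  have c: "card (N u \<inter> B) = (\<Sum>v\<in>B. if a u v \<noteq> 0 then 1 else 0)" if "u \<in> V" "B \<subseteq> V" "finite B" for u B
  proof -
    have "N u \<inter> B = {v \<in> B. a u v \<noteq> 0}" using that by (auto simp: nbrs_def)
    then show ?thesis using sum.inter_filter[OF that(3), of "\<lambda>_. 1 :: nat" "\<lambda>v. a u v \<noteq> 0"] by simp
  qed
  have "(\<Sum>u\<in>A. card (N u \<inter> B)) = (\<Sum>u\<in>A. \<Sum>v\<in>B. if a u v \<noteq> 0 then 1 else 0)"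
    using assms fin' by (intro sum.cong) (auto intro!: c)
  also have "\<dots> = (\<Sum>v\<in>B. \<Sum>u\<in>A. if a v u \<noteq> 0 then 1 else 0)"
    by (subst sum.swap) (simp add: sym)
  also have "\<dots> = (\<Sum>u\<in>B. card (N u \<inter> A))"
    using assms fin' by (intro sum.cong) (auto intro!: c[symmetric])
  finally show ?thesis .
qed

lemma even_sum_degrees: "even (\<Sum>u\<in>V. card (N u))"
proof -
  have "int (card (N u)) = (\<Sum>v\<in>V. \<bar>a u v\<bar>)" for u
  proof -
    have "(\<Sum>v\<in>V. \<bar>a u v\<bar>) = (\<Sum>v\<in>N u. \<bar>a u v\<bar>)"
      using fin by (intro sum.mono_neutral_right) (auto simp: nbrs_def)
    also have "\<dots> = (\<Sum>v\<in>N u. 1)" by (intro sum.cong) (auto dest: sign)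
    finally show ?thesis by simp
  qed
  then have "int (\<Sum>u\<in>V. card (N u)) = (\<Sum>u\<in>V. \<Sum>v\<in>V. \<bar>a u v\<bar>)" by simp
  also have "even \<dots>" using sym loopfree by (intro even_sum_symmetric fin) auto
  finally show ?thesis by (simp only: even_of_nat)
qed

text \<open>The quadratic form of the matrix vanishes at \<open>x\<close>. Terms with an even and an odd entry
  come in symmetric pairs and contribute a multiple of 4, as do terms with two even entries, so the edges
  inside the odd set contribute a multiple of 4 as well. Each of these edges contributes an odd number twice,
  which is 2 modulo 4.\<close>

lemma odd_induced_edges: "4 dvd (\<Sum>u\<in>Od. card (N u \<inter> Od))"
proof -
  define E where "E = V - Od"
  have E: "finite E" "V = Od \<union> E" "Od \<inter> E = {}" "E \<subseteq> V" using fin Od_subset by (auto simp: E_def)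
  define q where "q A B = (\<Sum>u\<in>A. \<Sum>v\<in>B. x u * (a u v * x v))" for A B
  have "q V V = 0"
    unfolding q_def by (rule sum.neutral, rule ballI) (simp only: sum_distrib_left[symmetric] ker mult_zero_right)
  moreover have "q V V = q Od Od + q Od E + (q E Od + q E E)"
  proof -
    have "q V V = (\<Sum>u\<in>Od \<union> E. \<Sum>v\<in>Od \<union> E. x u * (a u v * x v))" using E(2) by (simp add: q_def)
    also have "\<dots> = q Od Od + q Od E + (q E Od + q E E)"
      using E(1,3) by (simp add: sum.union_disjoint sum.distrib q_def)
    finally show ?thesis .
  qed
  moreover have "q E Od = q Od E"
    unfolding q_def by (subst sum.swap) (simp add: sym mult_ac)
  moreover have "even (q Od E)"
    unfolding q_def by (intro dvd_sum) (auto simp: E_def Od_def)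
  moreover have "4 dvd q E E"
    unfolding q_def
  proof (intro dvd_sum)
    fix u v assume "u \<in> E" "v \<in> E"
    then have "2 * 2 dvd x u * (a u v * x v)" by (intro mult_dvd_mono) (auto simp: E_def Od_def)
    then show "4 dvd x u * (a u v * x v)" by simp
  qed
  ultimately have q4: "4 dvd q Od Od" by presburger
  \<comment> \<open>modulo 4, a symmetric sum only sees how many of its terms are odd\<close>
  define h where "h u v = (x u * (a u v * x v) - (if a u v \<noteq> 0 then 1 else 0)) div 2" for u v
  have h: "x u * (a u v * x v) = (if a u v \<noteq> 0 then 1 else 0) + 2 * h u v" if "u \<in> Od" "v \<in> Od" for u v
    using that entry[of u v] by (auto simp: h_def Od_def elim!: oddE)
  have h_even: "even (\<Sum>u\<in>Od. \<Sum>v\<in>Od. h u v)"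
    by (intro even_sum_symmetric) (auto simp: h_def sym loopfree mult_ac)
  have "q Od Od = (\<Sum>u\<in>Od. \<Sum>v\<in>Od. if a u v \<noteq> 0 then 1 else 0) + 2 * (\<Sum>u\<in>Od. \<Sum>v\<in>Od. h u v)"
    unfolding q_def sum_distrib_left sum.distrib[symmetric] by (intro sum.cong refl) (simp add: h)
  also have "(\<Sum>u\<in>Od. \<Sum>v\<in>Od. if a u v \<noteq> 0 then 1 else (0::int)) = int (\<Sum>u\<in>Od. card (N u \<inter> Od))"
  proof -
    have "(\<Sum>v\<in>Od. if a u v \<noteq> 0 then 1 else (0::int)) = int (card (N u \<inter> Od))" if "u \<in> Od" for u
    proof -
      have "N u \<inter> Od = {v \<in> Od. a u v \<noteq> 0}" using Od_subset by (auto simp: nbrs_def)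
      then show ?thesis using sum.inter_filter[OF finite_Od, of "\<lambda>_. 1 :: int" "\<lambda>v. a u v \<noteq> 0"] by simp
    qed
    then show ?thesis by simp
  qed
  finally have "4 dvd int (\<Sum>u\<in>Od. card (N u \<inter> Od))" using q4 h_even by presburger
  then show ?thesis by presburger
qed

end

locale normal_nut_matrix = nut_matrix +
  assumes odd_entry: "\<exists>v\<in>V. odd (x v)"
    and odd_mod_4: "\<And>v. v \<in> V \<Longrightarrow> odd (x v) \<Longrightarrow> x v mod 4 = 1"

text \<open>Dividing by the greatest common divisor makes some entry odd. An odd entry is 1 or 3 modulo 4, and
  switching at the vertices of the second kind changes the sign of their entries.\<close>

lemma normalise:
  assumes "nut_matrix V a x"
  shows "\<exists>a' x'. normal_nut_matrix V a' x' \<and> nbrs V a' = nbrs V a"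
proof -
  interpret nut_matrix V a x by fact
  define g where "g = Gcd (x ` V)"
  have g0: "g \<noteq> 0" using nonempty full by (auto simp: g_def Gcd_0_iff)
  have gdvd: "g dvd x v" if "v \<in> V" for v using that by (auto simp: g_def intro: Gcd_dvd)
  define d where "d v = (if (x v div g) mod 4 = 3 then - 1 else 1 :: int)" for v
  have dd: "d v * d v = 1" "d v \<noteq> 0" for v by (auto simp: d_def)
  define z where "z v = d v * (x v div g)" for v
  have xz: "x v = g * d v * z v" if "v \<in> V" for v
  proof -
    have "g * d v * z v = g * (d v * d v) * (x v div g)" by (simp only: z_def mult.assoc)
    then show ?thesis using gdvd[OF that] dd by simp
  qed
  define b where "b u v = d u * d v * a u v" for u v
  have b_ker: "(\<Sum>v\<in>V. b u v * y v) = d u * (\<Sum>v\<in>V. a u v * (d v * y v))" for u y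
    unfolding sum_distrib_left b_def by (intro sum.cong refl) (simp only: mult_ac)
  have "normal_nut_matrix V b z"
  proof
    show "finite V" "V \<noteq> {}" by (fact fin nonempty)+
    show "b u v = b v u" "b v v = 0" "b u v \<in> {- 1, 0, 1}" for u v
      using sym[of u v] loopfree entry[of u v] by (auto simp: b_def d_def)
    show "(\<Sum>v\<in>V. b u v * z v) = 0" if "u \<in> V" for u
    proof -
      have "g * (\<Sum>v\<in>V. a u v * (d v * z v)) = (\<Sum>v\<in>V. a u v * x v)"
        unfolding sum_distrib_left by (intro sum.cong refl) (simp add: xz)
      then show ?thesis using g0 ker[OF that] by (simp add: b_ker)
    qed
    show "z v \<noteq> 0" if "v \<in> V" for v using xz[OF that] full[OF that] by auto
    show "y v = 0" if y: "\<And>u. u \<in> V \<Longrightarrow> (\<Sum>v\<in>V. b u v * y v) = 0" "w \<in> V" "y w = 0" "v \<in> V" for y w v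
    proof -
      have "d v * y v = 0"
        using uniq[of "\<lambda>v. d v * y v" w v] y b_ker dd by simp
      then show ?thesis using dd by simp
    qed
    show "\<exists>v\<in>V. odd (z v)"
    proof (rule ccontr)
      assume "\<not> (\<exists>v\<in>V. odd (z v))"
      then have "g * 2 dvd x v" if "v \<in> V" for v
        using xz[OF that] that by (auto simp: mult.assoc intro!: mult_dvd_mono)
      then have "g * 2 dvd g" unfolding g_def by (intro Gcd_greatest) auto
      then show False using g0 by simp
    qed
    show "z v mod 4 = 1" if "odd (z v)" for v
    proof -
      define m where "m = x v div g"
      have "odd m" using that by (auto simp: z_def m_def)
      then have "m mod 4 = 1 \<or> m mod 4 = 3" by presburger
      moreover have "(- m) mod 4 = 1" if "m mod 4 = 3" using that by presburger
      ultimately show ?thesis by (auto simp: z_def d_def m_def)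
    qed
  qed
  moreover have "nbrs V b = nbrs V a" using dd by (auto simp: nbrs_def b_def)
  ultimately show ?thesis by blast
qed

section \<open>Degrees one and two, complete graphs\<close>

context nut_matrix begin

lemma order_gt_degree: "u \<in> V \<Longrightarrow> card (N u) < card V"
  using N_subset not_self_nbr fin by (metis psubsetI psubset_card_mono)

lemma not_1_regular: "\<not> (\<forall>u\<in>V. card (N u) = 1)"
proof
  assume deg: "\<forall>u\<in>V. card (N u) = 1"
  obtain u where u: "u \<in> V" using nonempty by auto
  then obtain v where v: "N u = {v}" using deg by (auto simp: card_1_singleton_iff)
  then show False using row[OF u] sign[of v u] full[of v] N_subset[of u] by auto
qed

text \<open>Each vertex has one edge along which \<open>x u * a u v * x v\<close> is positive and one along
  which it is negative. The two involutions \<open>p\<close> and \<open>q\<close> following these edges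
  generate a dihedral action on a cycle; every second vertex of the cycle, the orbit of the rotation
  \<open>r\<close>, carries a kernel vector of its own.\<close>

lemma not_2_regular: "\<not> (\<forall>u\<in>V. card (N u) = 2)"
proof
  assume deg: "\<forall>u\<in>V. card (N u) = 2"
  \<comment> \<open>the two terms of a row cancel, so every vertex has one positive and one negative edge,
    where an edge is weighted by the kernel vector\<close>
  define wt where "wt u v = x u * a u v * x v" for u v
  have wt_sym: "wt u v = wt v u" for u v using sym[of u v] by (simp add: wt_def)
  have "\<exists>p q. N u = {p, q} \<and> p \<noteq> q \<and> 0 < wt u p \<and> wt u q < 0" if u: "u \<in> V" for u
  proof -
    obtain p q where pq: "N u = {p, q}" "p \<noteq> q" using deg u by (auto simp: card_2_iff)
    have "wt u p + wt u q = x u * (a u p * x p + a u q * x q)" by (simp add: wt_def algebra_simps)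
    also have "\<dots> = 0" using row[OF u] pq by simp
    finally have s: "wt u p + wt u q = 0" .
    have "wt u p \<noteq> 0" using full N_subset[of u] sign[of p u] pq u by (auto simp: wt_def)
    then have "0 < wt u p \<and> wt u q < 0 \<or> 0 < wt u q \<and> wt u p < 0" using s by linarith
    then show ?thesis
    proof
      assume "0 < wt u p \<and> wt u q < 0"
      then show ?thesis using pq by blast
    next
      assume "0 < wt u q \<and> wt u p < 0"
      moreover have "N u = {q, p}" using pq(1) by auto
      ultimately show ?thesis using pq(2) by blast
    qed
  qed
  then obtain p q where pq: "\<And>u. u \<in> V \<Longrightarrow> N u = {p u, q u}" "\<And>u. u \<in> V \<Longrightarrow> p u \<noteq> q u"
    "\<And>u. u \<in> V \<Longrightarrow> 0 < wt u (p u)" "\<And>u. u \<in> V \<Longrightarrow> wt u (q u) < 0" by metis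
  have pV: "p u \<in> V" "q u \<in> V" if "u \<in> V" for u using pq(1)[OF that] N_subset[of u] by auto
  have pp: "p (p u) = u" if u: "u \<in> V" for u
  proof -
    have "u \<in> N (p u)" using nbr_sym[OF u] pq(1)[OF u] by auto
    moreover have "u \<noteq> q (p u)" using pq(4)[OF pV(1)[OF u]] pq(3)[OF u] wt_sym[of u "p u"] by auto
    ultimately show ?thesis using pq(1)[OF pV(1)[OF u]] by auto
  qed
  have qq: "q (q u) = u" if u: "u \<in> V" for u
  proof -
    have "u \<in> N (q u)" using nbr_sym[OF u] pq(1)[OF u] by auto
    moreover have "u \<noteq> p (q u)" using pq(3)[OF pV(2)[OF u]] pq(4)[OF u] wt_sym[of u "q u"] by auto
    ultimately show ?thesis using pq(1)[OF pV(2)[OF u]] by auto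
  qed
  have fixfree: "p u \<noteq> u" "q u \<noteq> u" if "u \<in> V" for u
  proof -
    have "u \<notin> {p u, q u}" using not_self_nbr[of u] unfolding pq(1)[OF that] .
    then show "p u \<noteq> u" "q u \<noteq> u" by (metis insertCI)+
  qed
  define r where "r u = p (q u)" for u
  have rV: "(r ^^ k) u \<in> V" if "u \<in> V" for k u using that by (induction k) (auto simp: r_def pV)
  \<comment> \<open>\<open>p\<close> and \<open>q\<close> invert \<open>r\<close>, so \<open>p u = r^k u\<close> would give one of them a fixed point\<close>
  have no_power: "p u \<noteq> (r ^^ k) u" if "u \<in> V" for u k
    using that
  proof (induction k arbitrary: u rule: less_induct)
    case (less k)
    show ?case
    proof
      assume eq: "p u = (r ^^ k) u"
      consider "k = 0" | "k = 1" | m where "k = Suc (Suc m)" by (metis One_nat_def not0_implies_Suc)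
      then show False
      proof cases
        case 1
        then show False using eq fixfree less.prems by simp
      next
        case 2
        then have "p u = p (q u)" using eq by (simp add: r_def)
        then have "p (p u) = p (p (q u))" by simp
        then show False using pp[OF less.prems] pp[OF pV(2)[OF less.prems]] fixfree[OF less.prems] by simp
      next
        case 3
        define w where "w = r u"
        have w: "w \<in> V" using less.prems pV by (simp add: w_def r_def)
        have "(r ^^ k) u = r ((r ^^ m) w)" using 3 by (simp add: w_def funpow_swap1)
        then have "p u = p (q ((r ^^ m) w))" using eq by (simp add: r_def)
        then have "p (p u) = p (p (q ((r ^^ m) w)))" by simp
        then have "u = q ((r ^^ m) w)"
          using pp[OF less.prems] pp[OF pV(2)[OF rV[OF w, of m]]] by simp
        then have "q u = (r ^^ m) w" using qq[OF rV[OF w, of m]] by simp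
        moreover have "p w = q u" using pp[OF pV(2)[OF less.prems]] by (simp add: w_def r_def)
        ultimately show False using less.IH[of m w] 3 w by simp
      qed
    qed
  qed
  obtain u0 where u0: "u0 \<in> V" using nonempty by auto
  define S where "S = range (\<lambda>k. (r ^^ k) u0)"
  have SV: "S \<subseteq> V" using rV[OF u0] by (auto simp: S_def)
  have r_S: "r u \<in> S" if uS: "u \<in> S" for u
  proof -
    obtain k where "u = (r ^^ k) u0" using uS unfolding S_def by blast
    then have "r u = (r ^^ Suc k) u0" by simp
    then show ?thesis unfolding S_def by (rule range_eqI)
  qed
  have "inj_on r S"
  proof (rule inj_onI)
    fix u w assume "u \<in> S" "w \<in> S" and eq: "r u = r w"
    then have u: "u \<in> V" and w: "w \<in> V" using SV by auto
    have "p (r u) = p (r w)" using eq by simp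
    then have "q (q u) = q (q w)" using pp[OF pV(2)[OF u]] pp[OF pV(2)[OF w]] by (simp add: r_def)
    then show "u = w" using qq u w by simp
  qed
  then have "r ` S = S"
    using r_S finite_subset[OF SV fin] by (intro endo_inj_surj) auto
  have S_iff: "r u \<in> S \<longleftrightarrow> u \<in> S" if u: "u \<in> V" for u
  proof
    assume "r u \<in> S"
    then obtain w where w: "w \<in> S" "r u = r w" using \<open>r ` S = S\<close> by blast
    have "p (r u) = p (r w)" using w by simp
    then have "q (q u) = q (q w)" using pp[OF pV(2)[OF u]] pp[OF pV(2)[of w]] w(1) SV by (auto simp: r_def)
    then have "u = w" using qq u w(1) SV by auto
    then show "u \<in> S" using w by simp
  qed (rule r_S)
  have "p u0 \<notin> S" using no_power[OF u0] by (auto simp: S_def)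
  then show False
  proof (rule no_kernel_vector_on[where S = S and y = x and w = "p u0" and s = u0, rotated 4])
    show "u0 \<in> S" unfolding S_def by (rule range_eqI[of _ _ 0]) simp
    fix u assume u: "u \<in> V"
    have "p u \<in> S \<longleftrightarrow> q u \<in> S" using S_iff[OF pV(2)[OF u]] qq[OF u] by (simp add: r_def)
    then have "N u \<inter> S = N u \<or> N u \<inter> S = {}" using pq(1)[OF u] by auto
    then show "(\<Sum>v\<in>N u \<inter> S. a u v * x v) = 0" using row[OF u] by auto
  qed (use SV full u0 pV in auto)
qed

end

text \<open>In a complete graph, all vertices have the same number of odd neighbours up to one, and parity
  makes all entries odd. Then all \<open>\<rho> * (\<rho> + 1) div 2\<close> edges lie in the odd set, and
  \<open>\<rho>\<close> is even.\<close>

lemma complete_degree: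
  assumes nut: "nut_matrix V a x" and reg: "\<forall>u\<in>V. card (nbrs V a u) = \<rho>" and n: "card V = Suc \<rho>"
  shows "4 dvd \<rho>"
proof -
  obtain a' x' where nut': "normal_nut_matrix V a' x'" and nbrs: "nbrs V a' = nbrs V a"
    using normalise[OF nut] by blast
  interpret normal_nut_matrix V a' x' by fact
  have N_eq: "N u = V - {u}" if "u \<in> V" for u
    using that reg n N_subset[of u] fin nbrs not_self_nbr[of u] by (intro card_subset_eq) auto
  obtain w where w: "w \<in> Od" using odd_entry by (auto simp: Od_def)
  have "N u \<inter> Od = Od - {u}" if "u \<in> V" for u using N_eq[OF that] Od_subset by auto
  then have odd_nbrs: "even (card (Od - {u}))" if "u \<in> V" for u using even_odd_nbrs[OF that] that by simp
  have "odd (card Od)"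
    using odd_nbrs[of w] w Od_subset by (auto simp: card_Diff_singleton_if card_gt_0_iff)
  then have "u \<in> Od" if "u \<in> V" for u using odd_nbrs[OF that] by (cases "u \<in> Od") auto
  then have OV: "Od = V" using Od_subset by auto
  have "(\<Sum>u\<in>Od. card (N u \<inter> Od)) = (\<Sum>u\<in>V. \<rho>)"
    unfolding OV using reg nbrs N_subset by (intro sum.cong) (auto simp: Int_absorb2)
  then have "4 dvd Suc \<rho> * \<rho>" using odd_induced_edges n by simp
  moreover have "even \<rho>" using \<open>odd (card Od)\<close> OV n by simp
  then have "coprime 4 (Suc \<rho>)" 
    by (metis coprime_commute coprime_mult_left_iff even_Suc coprime_right_2_iff_odd mult_2 numeral_Bit0)
  ultimately show ?thesis using coprime_dvd_mult_right_iff by blast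
qed

section \<open>The octahedron\<close>

context nut_matrix begin

lemma no_kernel_vector:
  assumes "s \<in> V" "y s \<noteq> 0" "w \<in> V" "y w = 0" "\<And>u. u \<in> V \<Longrightarrow> (\<Sum>v\<in>N u. a u v * y v) = 0"
  shows False
proof -
  have "(\<Sum>v\<in>V. a u v * y v) = 0" if "u \<in> V" for u
    using assms(5)[OF that] sum_nbrs[of V u y] N_subset[of u] by (simp add: Int_absorb2)
  then show False using uniq[of y w s] assms by blast
qed

text \<open>Two vertices with the same neighbourhood and proportional rows are themselves the support of a
  kernel vector.\<close>

lemma no_proportional_twins:
  assumes u: "u \<in> V" "u' \<in> V" "u \<noteq> u'" and N: "N u' = N u" "w \<in> N u"
    and ratio: "\<And>v. v \<in> N u \<Longrightarrow> a u' v = r * a u v" and r: "r = 1 \<or> r = - 1"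
  shows False
proof (rule no_kernel_vector[of u "\<lambda>v. if v = u then 1 else if v = u' then - r else 0" w])
  show "w \<in> V" using N(2) N_subset by auto
  have "w \<noteq> u" "w \<noteq> u'" using N not_self_nbr[of u] not_self_nbr[of u'] by auto
  then show "(if w = u then 1 else if w = u' then - r else 0) = 0" by simp
  fix z assume z: "z \<in> V"
  have "(\<Sum>v\<in>N z. a z v * (if v = u then 1 else if v = u' then - r else 0))
    = (\<Sum>v\<in>N z. (if v = u then a z u else 0) + (if v = u' then - r * a z u' else 0))"
    using u(3) by (intro sum.cong) auto
  also have "\<dots> = (if u \<in> N z then a z u else 0) + (if u' \<in> N z then - r * a z u' else 0)"
    by (simp add: sum.distrib)
  also have "\<dots> = 0"
  proof (cases "z \<in> N u")
    case True
    then have "u \<in> N z" "u' \<in> N z" using nbr_sym u(1,2) N(1) by auto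
    moreover have "a z u' = r * a z u" using ratio[OF True] sym by simp
    ultimately show ?thesis using r by auto
  next
    case False
    then have "u \<notin> N z" "u' \<notin> N z" using nbr_commute[of u z] nbr_commute[of u' z] u N(1) z by auto
    then show ?thesis by simp
  qed
  finally show "(\<Sum>v\<in>N z. a z v * (if v = u then 1 else if v = u' then - r else 0)) = 0" .
qed (use u in auto)

end

context normal_nut_matrix begin

text \<open>The reason for normalising: modulo 4, an odd entry is 1, and the sign in front of an even entry
  does not matter. A row thus constrains the signs towards odd neighbours by the even entries alone.\<close>

lemma row_mod_4:
  assumes "u \<in> V"
  shows "4 dvd (\<Sum>v\<in>N u. if odd (x v) then a u v else x v)"
proof -
  have "4 dvd (if odd (x v) then a u v else x v) - a u v * x v" if v: "v \<in> N u" for v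
  proof (cases "odd (x v)")
    case True
    then have "x v mod 4 = 1" using odd_mod_4 v N_subset by auto
    then show ?thesis using True sign[OF v] by (auto; presburger)
  next
    case False
    then show ?thesis using sign[OF v] by (auto elim!: evenE)
  qed
  then have "4 dvd (\<Sum>v\<in>N u. (if odd (x v) then a u v else x v) - a u v * x v)" by (intro dvd_sum) auto
  then show ?thesis using row[OF assms] by (simp add: sum_subtractf)
qed

text \<open>The pairs \<open>a1\<close>, \<open>a2\<close> and \<open>b1\<close>, \<open>b2\<close> and
  \<open>c1\<close>, \<open>c2\<close> are the antipodal ones.\<close>

definition octahedron :: "'a \<Rightarrow> 'a \<Rightarrow> 'a \<Rightarrow> 'a \<Rightarrow> 'a \<Rightarrow> 'a \<Rightarrow> bool" where
  "octahedron a1 a2 b1 b2 c1 c2 \<longleftrightarrow> distinct [a1, a2, b1, b2, c1, c2] \<and> (\<forall>v. v \<in> V \<longleftrightarrow> v \<in> {a1, a2, b1, b2, c1, c2}) \<and>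
     N a1 = {b1, b2, c1, c2} \<and> N a2 = {b1, b2, c1, c2} \<and> N b1 = {a1, a2, c1, c2} \<and>
     N b2 = {a1, a2, c1, c2} \<and> N c1 = {a1, a2, b1, b2} \<and> N c2 = {a1, a2, b1, b2}"

lemma octahedron_rotate: "octahedron a1 a2 b1 b2 c1 c2 \<Longrightarrow> octahedron b1 b2 c1 c2 a1 a2"
  unfolding octahedron_def by auto

lemma octahedron_swap: "octahedron a1 a2 b1 b2 c1 c2 \<Longrightarrow> octahedron a2 a1 b1 b2 c1 c2"
  unfolding octahedron_def by auto

lemma octahedron_swap_b: "octahedron a1 a2 b1 b2 c1 c2 \<Longrightarrow> octahedron a1 a2 b2 b1 c1 c2"
  unfolding octahedron_def by auto

lemma octahedron_swap_c: "octahedron a1 a2 b1 b2 c1 c2 \<Longrightarrow> octahedron a1 a2 b1 b2 c2 c1"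
  unfolding octahedron_def by auto

lemma octahedron_exists:
  assumes card: "card V = 6" and deg: "\<forall>u\<in>V. card (N u) = 4"
  obtains a1 a2 b1 b2 c1 c2 where "octahedron a1 a2 b1 b2 c1 c2"
proof -
  have "\<exists>m. V - insert u (N u) = {m}" if "u \<in> V" for u
  proof -
    have "card (V - insert u (N u)) = 1"
      using that card deg N_subset[of u] fin by (subst card_Diff_subset) auto
    then show ?thesis by (auto simp: card_1_singleton_iff)
  qed
  then obtain m where m: "\<And>u. u \<in> V \<Longrightarrow> V - insert u (N u) = {m u}" by metis
  have mV: "m u \<in> V" "m u \<noteq> u" "m u \<notin> N u" if "u \<in> V" for u using m[OF that] by auto
  have N_eq: "N u = V - {u, m u}" if "u \<in> V" for u using m[OF that] N_subset[of u] not_self_nbr[of u] by auto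
  have mm: "m (m u) = u" if u: "u \<in> V" for u
  proof -
    have "u \<notin> N (m u)" using nbr_commute[OF u mV(1)[OF u]] mV(3)[OF u] by blast
    then have "u \<in> V - insert (m u) (N (m u))" using u mV(2)[OF u] by auto
    then show ?thesis using m[OF mV(1)[OF u]] by auto
  qed
  obtain a1 where a1: "a1 \<in> V" using nonempty by auto
  define a2 where "a2 = m a1"
  have a: "a2 \<in> V" "a2 \<noteq> a1" "m a2 = a1" using mV[OF a1] mm[OF a1] by (auto simp: a2_def)
  have "card (V - {a1, a2}) = 4" using a1 a card by (subst card_Diff_subset) auto
  then have "V - {a1, a2} \<noteq> {}" by force
  then obtain b1 where b1: "b1 \<in> V" "b1 \<noteq> a1" "b1 \<noteq> a2" by blast
  define b2 where "b2 = m b1"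
  have b: "b2 \<in> V" "b2 \<noteq> b1" "m b2 = b1" using mV[OF b1(1)] mm[OF b1(1)] by (auto simp: b2_def)
  have b': "b2 \<noteq> a1" "b2 \<noteq> a2" using b(3) a(3) b1(2,3) by (auto simp: a2_def)
  have "card (V - {a1, a2, b1, b2}) = 2" using a1 a b1 b b' card by (subst card_Diff_subset) auto
  then have "V - {a1, a2, b1, b2} \<noteq> {}" by force
  then obtain c1 where c1: "c1 \<in> V" "c1 \<noteq> a1" "c1 \<noteq> a2" "c1 \<noteq> b1" "c1 \<noteq> b2" by blast
  define c2 where "c2 = m c1"
  have c: "c2 \<in> V" "c2 \<noteq> c1" "m c2 = c1" using mV[OF c1(1)] mm[OF c1(1)] by (auto simp: c2_def)
  have c': "c2 \<noteq> a1" "c2 \<noteq> a2" "c2 \<noteq> b1" "c2 \<noteq> b2"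
    using c(3) b(3) a(3) c1 by (auto simp: a2_def b2_def)
  have V: "{a1, a2, b1, b2, c1, c2} = V"
    using fin a1 a b1 b b' c1 c c' card by (intro card_subset_eq) auto
  have V_iff: "v \<in> V \<longleftrightarrow> v \<in> {a1, a2, b1, b2, c1, c2}" for v using V by simp
  have N: "N a1 = V - {a1, a2}" "N a2 = V - {a2, a1}" "N b1 = V - {b1, b2}" "N b2 = V - {b2, b1}"
    "N c1 = V - {c1, c2}" "N c2 = V - {c2, c1}"
    using N_eq a1 a b1 b c1 c by (simp_all add: a2_def b2_def c2_def)
  have "octahedron a1 a2 b1 b2 c1 c2"
    unfolding octahedron_def N
    using a b1 b b' c1 c c' by (intro conjI allI set_eqI) (auto simp: V_iff)
  then show ?thesis by (rule that)
qed

text \<open>By the rows modulo 2, if one antipodal pair has mixed parity then all three have. The odd vertices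
  would form a triangle, which has an odd number of edges.\<close>

lemma octahedron_parity:
  assumes oct: "octahedron a1 a2 b1 b2 c1 c2"
  shows "odd (x a1) \<longleftrightarrow> odd (x a2)"
proof (rule ccontr)
  assume *: "\<not> ?thesis"
  note d = oct[unfolded octahedron_def]
  have s: "even (\<Sum>v\<in>N u. x v)" if "u \<in> V" for u
  proof -
    have "even (\<Sum>v\<in>N u. a u v * x v - x v)"
      using sign by (intro dvd_sum) (auto dest!: sign)
    then show ?thesis using row[OF that] by (simp add: sum_subtractf)
  qed
  have "even (x b1 + x b2 + x c1 + x c2)" "even (x a1 + x a2 + x c1 + x c2)" "even (x a1 + x a2 + x b1 + x b2)"
    using s[of a1] s[of b1] s[of c1] d by (simp_all add: add.assoc)
  then have p: "odd (x a1) \<noteq> odd (x a2)" "odd (x b1) \<noteq> odd (x b2)" "odd (x c1) \<noteq> odd (x c2)"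
    using * by presburger+
  have no: False if "octahedron a1 a2 b1 b2 c1 c2" "odd (x a1)" "even (x a2)" "odd (x b1)" "even (x b2)" "odd (x c1)" "even (x c2)"
    for a1 a2 b1 b2 c1 c2
  proof -
    note d = that(1)[unfolded octahedron_def]
    have "Od = {a1, b1, c1}" using d that by (auto simp: Od_def)
    then have "(\<Sum>u\<in>Od. card (N u \<inter> Od)) = 6" using d by simp
    then show False using odd_induced_edges by simp
  qed
  obtain a a' where a: "octahedron a a' b1 b2 c1 c2" "odd (x a)" "even (x a')"
    using p(1) oct octahedron_swap[OF oct] by blast
  obtain b b' where b: "octahedron a a' b b' c1 c2" "odd (x b)" "even (x b')"
    using p(2) a(1) octahedron_swap_b[OF a(1)] by blast
  obtain c c' where c: "octahedron a a' b b' c c'" "odd (x c)" "even (x c')"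
    using p(3) b(1) octahedron_swap_c[OF b(1)] by blast
  show False using no[OF c(1)] a b c by blast
qed

end

context normal_nut_matrix begin

text \<open>Modulo 4, the row of an even vertex tells whether its signs towards the two odd vertices agree,
  and the row of \<open>a1\<close> makes the answers coincide. So the rows of the odd vertices are
  proportional.\<close>

lemma octahedron_one_odd_pair:
  assumes oct: "octahedron a1 a2 b1 b2 c1 c2"
    and par: "odd (x a1)" "odd (x a2)" "even (x b1)" "even (x b2)" "even (x c1)" "even (x c2)"
  shows False
proof -
  note d = oct[unfolded octahedron_def]
  have inV: "a1 \<in> V" "a2 \<in> V" "b1 \<in> V" "b2 \<in> V" "c1 \<in> V" "c2 \<in> V" using d by auto
  have s: "a a1 w = 1 \<or> a a1 w = - 1" "a a2 w = 1 \<or> a a2 w = - 1" if "w \<in> {b1, b2, c1, c2}" for w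
    using that d by (auto intro!: sign)
  have r: "4 dvd a a1 b1 + a a2 b1 + x c1 + x c2" "4 dvd a a1 b2 + a a2 b2 + x c1 + x c2"
    "4 dvd a a1 c1 + a a2 c1 + x b1 + x b2" "4 dvd a a1 c2 + a a2 c2 + x b1 + x b2"
    "4 dvd x b1 + x b2 + x c1 + x c2"
    using row_mod_4[OF inV(3)] row_mod_4[OF inV(4)] row_mod_4[OF inV(5)] row_mod_4[OF inV(6)]
      row_mod_4[OF inV(1)] d par
    by (simp_all add: sym[of b1] sym[of b2] sym[of c1] sym[of c2] add.assoc)
  have same: "a a2 w = a a1 w \<longleftrightarrow> a a2 b1 = a a1 b1" if w: "w \<in> {b1, b2, c1, c2}" for w
  proof -
    note sb1 = s[of b1, simplified] and sw = s[OF w]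
    consider "w = b1" | "w = b2" | "w = c1" | "w = c2" using w by auto
    then show ?thesis
    proof cases
      case 2
      have "4 dvd (a a1 w + a a2 w) - (a a1 b1 + a a2 b1)" using dvd_diff[OF r(2) r(1)] 2 by simp
      then show ?thesis using sb1 sw by auto
    next
      case 3
      have "4 dvd (a a1 w + a a2 w) + (a a1 b1 + a a2 b1)"
        using dvd_diff[OF dvd_add[OF r(3) r(1)] r(5)] 3 by (simp add: algebra_simps)
      then show ?thesis using sb1 sw by auto
    next
      case 4
      have "4 dvd (a a1 w + a a2 w) + (a a1 b1 + a a2 b1)"
        using dvd_diff[OF dvd_add[OF r(4) r(1)] r(5)] 4 by (simp add: algebra_simps)
      then show ?thesis using sb1 sw by auto
    qed simp
  qed
  define r where "r = (if a a2 b1 = a a1 b1 then 1 else - 1 :: int)"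
  have ratio: "a a2 w = r * a a1 w" if w: "w \<in> {b1, b2, c1, c2}" for w
    using same[OF w] s(1)[OF w] s(2)[OF w] unfolding r_def by presburger
  show False
    by (rule no_proportional_twins[of a1 a2 b1 r]) (use d ratio in \<open>auto simp: r_def\<close>)
qed

text \<open>The rows of the odd vertices modulo 4 determine the signs of the four-cycle that they form. Such a
  cycle is singular, and a signed indicator vector of its vertices is a kernel vector unless the two even
  vertices require different signs. In that exceptional case the exact rows give relations between the odd
  entries that contradict their being 1 modulo 4.\<close>

lemma octahedron_two_odd_pairs:
  assumes oct: "octahedron a1 a2 b1 b2 c1 c2"
    and par: "odd (x a1)" "odd (x a2)" "odd (x b1)" "odd (x b2)" "even (x c1)" "even (x c2)"
  shows False
proof -
  note d = oct[unfolded octahedron_def]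
  have inV: "a1 \<in> V" "a2 \<in> V" "b1 \<in> V" "b2 \<in> V" "c1 \<in> V" "c2 \<in> V" using d by auto
  have m: "x a1 mod 4 = 1" "x a2 mod 4 = 1" "x b1 mod 4 = 1" "x b2 mod 4 = 1"
    using odd_mod_4 par inV by auto
  have s: "a a1 b1 = 1 \<or> a a1 b1 = - 1" "a a1 b2 = 1 \<or> a a1 b2 = - 1"
    "a a2 b1 = 1 \<or> a a2 b1 = - 1" "a a2 b2 = 1 \<or> a a2 b2 = - 1"
    using d by (auto intro!: sign)
  have sc: "a c w = 1 \<or> a c w = - 1" if "c \<in> {c1, c2}" "w \<in> {a1, a2, b1, b2}" for c w
    using that d by (auto intro!: sign)
  define X where "X = x c1 + x c2"
  have r: "4 dvd a a1 b1 + a a1 b2 + X" "4 dvd a a2 b1 + a a2 b2 + X"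
    "4 dvd a a1 b1 + a a2 b1 + X" "4 dvd a a1 b2 + a a2 b2 + X"
    using row_mod_4[OF inV(1)] row_mod_4[OF inV(2)] row_mod_4[OF inV(3)] row_mod_4[OF inV(4)] d par
    by (simp_all add: sym[of b1] sym[of b2] X_def add.assoc)
  have rc: "4 dvd a c a1 + a c a2 + a c b1 + a c b2" if "c \<in> {c1, c2}" for c
    using that row_mod_4[OF inV(5)] row_mod_4[OF inV(6)] d par by (auto simp: add.assoc)
  have rowc: "a c a1 * x a1 + a c a2 * x a2 + a c b1 * x b1 + a c b2 * x b2 = 0" if "c \<in> {c1, c2}" for c
    using that row[OF inV(5)] row[OF inV(6)] d by (auto simp: add.assoc)
  have Ns: "N a1 = {b1, b2, c1, c2}" "N a2 = {b1, b2, c1, c2}" "N b1 = {a1, a2, c1, c2}"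
    "N b2 = {a1, a2, c1, c2}" "N c1 = {a1, a2, b1, b2}" "N c2 = {a1, a2, b1, b2}"
    and ne: "a1 \<noteq> a2" "a1 \<noteq> b1" "a1 \<noteq> b2" "a1 \<noteq> c1" "a1 \<noteq> c2" "a2 \<noteq> b1" "a2 \<noteq> b2" "a2 \<noteq> c1" "a2 \<noteq> c2"
    "b1 \<noteq> b2" "b1 \<noteq> c1" "b1 \<noteq> c2" "b2 \<noteq> c1" "b2 \<noteq> c2" "c1 \<noteq> c2"
    using d by auto
  have evenX: "even X" using par by (simp add: X_def)
  \<comment> \<open>a signed indicator vector of the four odd vertices, with one sign \<open>e\<close> still to be chosen\<close>
  have kernel: False
    if t: "t = 1 \<or> t = - 1" and e: "e = 1 \<or> e = - 1"
      and rows: "a a1 b1 + t * a a1 b2 = 0" "a a2 b1 + t * a a2 b2 = 0"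
        "a a1 b1 + t * a a2 b1 = 0" "a a1 b2 + t * a a2 b2 = 0"
        "\<And>c. c \<in> {c1, c2} \<Longrightarrow> a c a1 + t * a c a2 + e * (a c b1 + t * a c b2) = 0" for t e
  proof (rule no_kernel_vector[of a1 "\<lambda>v. if v = a1 then 1 else if v = a2 then t else if v = b1 then e
      else if v = b2 then e * t else 0" c1])
    fix u assume "u \<in> V"
    then consider "u = a1" | "u = a2" | "u = b1" | "u = b2" | "u \<in> {c1, c2}" using d by auto
    then show "(\<Sum>v\<in>N u. a u v * (if v = a1 then 1 else if v = a2 then t else if v = b1 then e
      else if v = b2 then e * t else 0)) = 0" (is "?sum = 0")
    proof cases
      case 1
      then have "?sum = e * (a a1 b1 + t * a a1 b2)" using Ns ne by (simp add: algebra_simps)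
      then show ?thesis using rows(1) by simp
    next
      case 2
      then have "?sum = e * (a a2 b1 + t * a a2 b2)" using Ns ne by (simp add: algebra_simps)
      then show ?thesis using rows(2) by simp
    next
      case 3
      then have "?sum = a b1 a1 + t * a b1 a2" using Ns ne by (simp add: algebra_simps)
      then show ?thesis using rows(3) sym[of b1 a1] sym[of b1 a2] by simp
    next
      case 4
      then have "?sum = a b2 a1 + t * a b2 a2" using Ns ne by (simp add: algebra_simps)
      then show ?thesis using rows(4) sym[of b2 a1] sym[of b2 a2] by simp
    next
      case 5
      then have "?sum = a u a1 + t * a u a2 + e * (a u b1 + t * a u b2)"
        using Ns ne by (auto simp: algebra_simps)
      then show ?thesis using rows(5)[OF 5] by simp
    qed
  qed (use inV ne in auto)
  \<comment> \<open>both even vertices admit a common choice of \<open>e\<close> unless two independent relations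
    between the odd entries follow\<close>
  have choice: "(\<exists>e. (e = 1 \<or> e = - 1) \<and> (\<forall>c\<in>{c1, c2}. a c a1 + t * a c a2 + e * (a c b1 + t * a c b2) = 0))
     \<or> (x a1 + t * x a2 = 0 \<and> x b1 + t * x b2 = 0 \<and> (\<forall>c\<in>{c1, c2}. a c a2 = t * a c a1))"
    if t: "t = 1 \<or> t = - 1" for t
  proof -
    have split: "a c a1 + t * a c a2 = 0 \<and> a c b1 + t * a c b2 = 0 \<or> a c a2 = t * a c a1 \<and> a c b2 = t * a c b1"
      if "c \<in> {c1, c2}" for c
      using rc[OF that] sc[OF that, of a1] sc[OF that, of a2] sc[OF that, of b1] sc[OF that, of b2] t by force
    have rel: "a c a1 * (x a1 + t * x a2) + a c b1 * (x b1 + t * x b2) = 0"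
      if "c \<in> {c1, c2}" "a c a2 = t * a c a1" "a c b2 = t * a c b1" for c
      using rowc[OF that(1)] that(2,3) by (simp add: algebra_simps)
    define solves where "solves c e \<longleftrightarrow> a c a1 + t * a c a2 + e * (a c b1 + t * a c b2) = 0" for c e
    define e where "e c = - (a c a1 * a c b1)" for c
    define zero where "zero c \<longleftrightarrow> a c a1 + t * a c a2 = 0 \<and> a c b1 + t * a c b2 = 0" for c
    have e: "e c = 1 \<or> e c = - 1" if "c \<in> {c1, c2}" for c
      using sc[OF that, of a1] sc[OF that, of b1] by (auto simp: e_def)
    have solves_zero: "solves c k" if "zero c" for c k using that by (simp add: solves_def zero_def)
    have solves_e: "solves c (e c)" if "c \<in> {c1, c2}" for c
    proof (cases "zero c")
      case False
      then have "a c a2 = t * a c a1" "a c b2 = t * a c b1" using split[OF that] by (auto simp: zero_def)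
      then show ?thesis using t sc[OF that, of a1] sc[OF that, of b1] by (auto simp: solves_def e_def)
    qed (rule solves_zero)
    have "e c1 = e c2 \<or> e c1 = - e c2" using e[of c1] e[of c2] by auto
    then consider "zero c1" | "zero c2" | "\<not> zero c1" "\<not> zero c2" "e c1 = e c2" | "\<not> zero c1" "\<not> zero c2" "e c1 = - e c2"
      by blast
    then have "(\<exists>e. (e = 1 \<or> e = - 1) \<and> (\<forall>c\<in>{c1, c2}. solves c e))
      \<or> (x a1 + t * x a2 = 0 \<and> x b1 + t * x b2 = 0 \<and> (\<forall>c\<in>{c1, c2}. a c a2 = t * a c a1))"
    proof cases
      case 1
      then show ?thesis using solves_zero[of c1 "e c2"] solves_e[of c2] e[of c2] by blast
    next
      case 2
      then show ?thesis using solves_zero[of c2 "e c1"] solves_e[of c1] e[of c1] by blast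
    next
      case 3
      then show ?thesis using solves_e[of c2] solves_e[of c1] e[of c1] by auto
    next
      case 4
      then have nz: "a c1 a2 = t * a c1 a1" "a c1 b2 = t * a c1 b1" "a c2 a2 = t * a c2 a1" "a c2 b2 = t * a c2 b1"
        using split[of c1] split[of c2] by (auto simp: zero_def)
      define p q where "p = x a1 + t * x a2" and "q = x b1 + t * x b2"
      have "a c1 a1 * p + a c1 b1 * q = 0" "a c2 a1 * p + a c2 b1 * q = 0"
        using rel[of c1] rel[of c2] nz by (simp_all add: p_def q_def)
      moreover have "a c1 a1 * a c1 b1 = - (a c2 a1 * a c2 b1)" using 4 by (simp add: e_def)
      ultimately have "p = 0 \<and> q = 0"
        using sc[of c1 a1] sc[of c1 b1] sc[of c2 a1] sc[of c2 b1] by auto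
      then show ?thesis using nz by (simp add: p_def q_def)
    qed
    then show ?thesis by (simp only: solves_def)
  qed
  have "X mod 4 = 0 \<or> X mod 4 = 2" using evenX by presburger
  then consider "X mod 4 = 0" | "X mod 4 = 2" by blast
  then show False
  proof cases
    case 1
    have "a a1 b2 = - a a1 b1" "a a2 b1 = - a a1 b1" "a a2 b2 = a a1 b1"
      using s r 1 by presburger+
    moreover have "x a1 + x a2 \<noteq> 0" using m by presburger
    ultimately show False using choice[of 1] kernel[of 1] by force
  next
    case 2
    have eq: "a a1 b2 = a a1 b1" "a a2 b1 = a a1 b1" "a a2 b2 = a a1 b1"
      using s r 2 by presburger+
    show False
    proof (cases "x b1 + - 1 * x b2 = 0 \<and> (\<forall>c\<in>{c1, c2}. a c a2 = - 1 * a c a1)")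
      case True
      have "a a1 b1 * x b1 + a a1 b2 * x b2 + a c1 a1 * x c1 + a c2 a1 * x c2 = 0"
        "a a2 b1 * x b1 + a a2 b2 * x b2 + a c1 a2 * x c1 + a c2 a2 * x c2 = 0"
        using row[OF inV(1)] row[OF inV(2)] d by (simp_all add: sym[of c1] sym[of c2] add.assoc)
      then have "a a1 b1 * (x b1 + x b2) = 0" using eq True by (simp add: algebra_simps)
      then have "x b1 + x b2 = 0" using s(1) by auto
      then show False using m by presburger
    next
      case False
      then show False using choice[of "- 1"] kernel[of "- 1"] eq by force
    qed
  qed
qed

text \<open>The sum and the difference of the rows of \<open>a1\<close> and \<open>a2\<close> split the four
  terms of these rows into two parts that vanish separately. As the rows are not proportional, both parts are
  non-empty, and a single term cannot vanish, so the parts are pairs: the antipodal ones or one of the two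
  crossing ones. In a crossing pair the entries agree up to sign, hence agree, because both are 1 modulo
  4.\<close>

lemma octahedron_pair_relations:
  assumes oct: "octahedron a1 a2 b1 b2 c1 c2"
    and odd: "odd (x b1)" "odd (x b2)" "odd (x c1)" "odd (x c2)"
  shows "(\<forall>u\<in>{a1, a2}. a u b1 * x b1 + a u b2 * x b2 = 0) \<or>
    (x b1 = x c1 \<and> x b2 = x c2 \<and> (\<forall>u\<in>{a1, a2}. a u b1 = - a u c1 \<and> a u b2 = - a u c2)) \<or>
    (x b1 = x c2 \<and> x b2 = x c1 \<and> (\<forall>u\<in>{a1, a2}. a u b1 = - a u c2 \<and> a u b2 = - a u c1))"
proof -
  note d = oct[unfolded octahedron_def]
  have inV: "a1 \<in> V" "a2 \<in> V" "b1 \<in> V" "b2 \<in> V" "c1 \<in> V" "c2 \<in> V" using d by auto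
  have s: "a u w = 1 \<or> a u w = - 1" if "u \<in> {a1, a2}" "w \<in> {b1, b2, c1, c2}" for u w
    using that d by (auto intro!: sign)
  have r: "a u b1 * x b1 + a u b2 * x b2 + (a u c1 * x c1 + a u c2 * x c2) = 0" if "u \<in> {a1, a2}" for u
    using that row[OF inV(1)] row[OF inV(2)] d by (auto simp: add.assoc)
  have m: "x b1 mod 4 = 1" "x b2 mod 4 = 1" "x c1 mod 4 = 1" "x c2 mod 4 = 1"
    using odd_mod_4 odd inV by auto
  have opposite: "p = q \<and> \<alpha> = - \<beta>"
    if "\<alpha> * p + \<beta> * q = 0" "\<alpha> = 1 \<or> \<alpha> = - 1" "\<beta> = 1 \<or> \<beta> = - 1" "p mod 4 = 1" "q mod 4 = 1" for \<alpha> \<beta> p q :: int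
    using that by auto presburger+
  have twins: "\<exists>w\<in>{b1, b2, c1, c2}. a a2 w \<noteq> r * a a1 w" if "r = 1 \<or> r = - 1" for r
  proof (rule ccontr)
    assume "\<not> ?thesis"
    then show False using no_proportional_twins[of a1 a2 b1 r] d inV that by auto
  qed
  define same where "same w \<longleftrightarrow> a a2 w = a a1 w" for w
  have sw: "a a2 w = (if same w then a a1 w else - a a1 w)" if "w \<in> {b1, b2, c1, c2}" for w
    using s[of a1 w] s[of a2 w] that by (auto simp: same_def)
  \<comment> \<open>adding and subtracting the two rows separates the vertices on which they agree from the others\<close>
  define f where "f w = a a1 w * x w" for w
  have agree: "(if same b1 then f b1 else 0) + (if same b2 then f b2 else 0)
      + (if same c1 then f c1 else 0) + (if same c2 then f c2 else 0) = 0"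
    and differ: "(if same b1 then 0 else f b1) + (if same b2 then 0 else f b2)
      + (if same c1 then 0 else f c1) + (if same c2 then 0 else f c2) = 0"
  proof -
    have "f b1 + f b2 + (f c1 + f c2) = 0" using r[of a1] by (simp add: f_def)
    moreover have "a a2 w * x w = (if same w then f w else - f w)" if "w \<in> {b1, b2, c1, c2}" for w
      using sw[OF that] by (simp add: f_def)
    then have "(if same b1 then f b1 else - f b1) + (if same b2 then f b2 else - f b2)
      + ((if same c1 then f c1 else - f c1) + (if same c2 then f c2 else - f c2)) = 0"
      using r[of a2] by simp
    ultimately show "(if same b1 then f b1 else 0) + (if same b2 then f b2 else 0)
      + (if same c1 then f c1 else 0) + (if same c2 then f c2 else 0) = 0"
      "(if same b1 then 0 else f b1) + (if same b2 then 0 else f b2)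
      + (if same c1 then 0 else f c1) + (if same c2 then 0 else f c2) = 0"
      by (auto split: if_splits)
  qed
  have f0: "f b1 \<noteq> 0" "f b2 \<noteq> 0" "f c1 \<noteq> 0" "f c2 \<noteq> 0"
    using full inV s[of a1 b1] s[of a1 b2] s[of a1 c1] s[of a1 c2] by (auto simp: f_def)
  have "\<not> (same b1 \<and> same b2 \<and> same c1 \<and> same c2)"
    using twins[of 1] by (auto simp: same_def)
  moreover have "same b1 \<or> same b2 \<or> same c1 \<or> same c2"
  proof (rule ccontr)
    assume "\<not> ?thesis"
    then have "a a2 w = - 1 * a a1 w" if "w \<in> {b1, b2, c1, c2}" for w using sw[OF that] that by auto
    then show False using twins[of "- 1"] by blast
  qed
  moreover note not_const = calculation
  have "(same b1 = same b2 \<and> same c1 = same c2 \<and> same b1 \<noteq> same c1) \<or>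
    (same b1 = same c1 \<and> same b2 = same c2 \<and> same b1 \<noteq> same b2) \<or>
    (same b1 = same c2 \<and> same b2 = same c1 \<and> same b1 \<noteq> same b2)"
    using not_const agree differ f0 by (auto split: if_splits)
  then show ?thesis
  proof (elim disjE)
    assume c: "same b1 = same b2 \<and> same c1 = same c2 \<and> same b1 \<noteq> same c1"
    then have "f b1 + f b2 = 0" using agree differ by (auto split: if_splits)
    then have "\<forall>u\<in>{a1, a2}. a u b1 * x b1 + a u b2 * x b2 = 0"
      using sw[of b1] sw[of b2] c by (auto simp: f_def)
    then show ?thesis by blast
  next
    assume c: "same b1 = same c1 \<and> same b2 = same c2 \<and> same b1 \<noteq> same b2"
    then have "f b1 + f c1 = 0" "f b2 + f c2 = 0" using agree differ by (auto split: if_splits)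
    then have "x b1 = x c1 \<and> a a1 b1 = - a a1 c1" "x b2 = x c2 \<and> a a1 b2 = - a a1 c2"
      using opposite[of "a a1 b1" "x b1" "a a1 c1" "x c1"] opposite[of "a a1 b2" "x b2" "a a1 c2" "x c2"] s m
      by (auto simp: f_def)
    then show ?thesis using sw c by auto
  next
    assume c: "same b1 = same c2 \<and> same b2 = same c1 \<and> same b1 \<noteq> same b2"
    then have "f b1 + f c2 = 0" "f b2 + f c1 = 0" using agree differ by (auto split: if_splits)
    then have "x b1 = x c2 \<and> a a1 b1 = - a a1 c2" "x b2 = x c1 \<and> a a1 b2 = - a a1 c1"
      using opposite[of "a a1 b1" "x b1" "a a1 c2" "x c2"] opposite[of "a a1 b2" "x b2" "a a1 c1" "x c1"] s m
      by (auto simp: f_def)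
    then show ?thesis using sw c by auto
  qed
qed

text \<open>If both \<open>a\<close> and \<open>b\<close> see crossing pairs, the signs reduce to those
  between \<open>a\<close> and \<open>b\<close>, and the rows of \<open>c1\<close> and \<open>c2\<close> make
  \<open>a1\<close> and \<open>a2\<close> proportional.\<close>

lemma octahedron_crossing:
  assumes oct: "octahedron a1 a2 b1 b2 c1 c2"
    and odd: "odd (x c1)" "odd (x c2)"
    and xa: "x a1 = x c1" "x a2 = x c2" and xb: "x b1 = x c1" "x b2 = x c2"
    and sa: "\<And>u. u \<in> {a1, a2} \<Longrightarrow> a u b1 = - a u c1 \<and> a u b2 = - a u c2"
    and sb: "\<And>u. u \<in> {b1, b2} \<Longrightarrow> a u a1 = - a u c1 \<and> a u a2 = - a u c2"
  shows False
proof -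
  note d = oct[unfolded octahedron_def]
  have inV: "a1 \<in> V" "a2 \<in> V" "b1 \<in> V" "b2 \<in> V" "c1 \<in> V" "c2 \<in> V" using d by auto
  have m: "x c1 mod 4 = 1" "x c2 mod 4 = 1" using odd_mod_4 odd inV by auto
  have s: "a a1 b1 = 1 \<or> a a1 b1 = - 1" "a a1 b2 = 1 \<or> a a1 b2 = - 1"
    "a a2 b1 = 1 \<or> a a2 b1 = - 1" "a a2 b2 = 1 \<or> a a2 b2 = - 1"
    using d by (auto intro!: sign)
  have e: "a c1 a1 = - a a1 b1" "a c1 a2 = - a a2 b1" "a c2 a1 = - a a1 b2" "a c2 a2 = - a a2 b2"
    "a c1 b1 = - a a1 b1" "a c1 b2 = - a a1 b2" "a c2 b1 = - a a2 b1" "a c2 b2 = - a a2 b2"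
    using sa[of a1] sa[of a2] sb[of b1] sb[of b2] 
      sym[of c1 a1] sym[of c1 a2] sym[of c2 a1] sym[of c2 a2] sym[of c1 b1] sym[of c1 b2] sym[of c2 b1] sym[of c2 b2]
      sym[of b1 a1] sym[of b1 a2] sym[of b2 a1] sym[of b2 a2] by simp_all
  have "2 * (a a1 b1 * x c1) + (a a2 b1 + a a1 b2) * x c2 = 0" "(a a1 b2 + a a2 b1) * x c1 + 2 * (a a2 b2 * x c2) = 0"
    using row[OF inV(5)] row[OF inV(6)] d by (simp_all add: e xa xb algebra_simps)
  then have "a a2 b1 = - a a1 b1 \<and> a a1 b2 = - a a1 b1 \<and> a a2 b2 = a a1 b1"
    using s m full[OF inV(5)] full[OF inV(6)] by (elim disjE) (simp_all, presburger+)
  then have "a a2 w = - 1 * a a1 w" if "w \<in> N a1" for w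
    using that d e sym[of a1 c1] sym[of a1 c2] sym[of a2 c1] sym[of a2 c2] by auto
  then show False using no_proportional_twins[of a1 a2 b1 "- 1"] d inV by auto
qed

text \<open>Let \<open>P u u' w w'\<close> say that \<open>u\<close> and \<open>u'\<close> see the pair
  \<open>w\<close>, \<open>w'\<close> as vanishing. If both other pairs see a given pair this way, the pair
  carries a kernel vector (\<open>aligned\<close>). Two pairs cannot both fail to see each other
  (\<open>crossing\<close>). Finally a pair sees one of the others as vanishing if and only if it sees both
  (\<open>rel\<close>), so a pair that fails to see one of the others is seen by both.\<close>

lemma octahedron_all_odd:
  assumes oct: "octahedron a1 a2 b1 b2 c1 c2" and odd: "\<And>v. v \<in> V \<Longrightarrow> odd (x v)"
  shows False
proof -
  define P where "P u u' w w' \<longleftrightarrow> (\<forall>v\<in>{u, u'}. a v w * x w + a v w' * x w' = 0)" for u u' w w'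
  have aligned: False
    if oct: "octahedron a1 a2 b1 b2 c1 c2" and "P a1 a2 b1 b2"
      "P c1 c2 b1 b2" for a1 a2 b1 b2 c1 c2
  proof -
    note d = oct[unfolded octahedron_def]
    show False
    proof (rule no_kernel_vector[of b1 "\<lambda>v. if v = b1 then x b1 else if v = b2 then x b2 else 0" c1])
      fix u assume "u \<in> V"
      then consider "u \<in> {a1, a2}" | "u = b1" | "u = b2" | "u \<in> {c1, c2}" using d by auto
      then show "(\<Sum>v\<in>N u. a u v * (if v = b1 then x b1 else if v = b2 then x b2 else 0)) = 0"
        using d that(2,3) unfolding P_def by cases auto
    qed (use d full in auto)
  qed
  have crossing: False
    if oct: "octahedron a1 a2 b1 b2 c1 c2"
      and a: "\<not> P a1 a2 b1 b2"
      and b: "\<not> P b1 b2 a1 a2" for a1 a2 b1 b2 c1 c2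
  proof -
    note d = oct[unfolded octahedron_def]
    have o: "odd (x v)" if "v \<in> {a1, a2, b1, b2, c1, c2}" for v using that odd d by auto
    have oct': "octahedron b1 b2 a1 a2 c1 c2" using oct unfolding octahedron_def by auto
    obtain p1 p2 where p: "(p1, p2) = (b1, b2) \<or> (p1, p2) = (b2, b1)" "x p1 = x c1" "x p2 = x c2"
      "\<forall>u\<in>{a1, a2}. a u p1 = - a u c1 \<and> a u p2 = - a u c2"
      using octahedron_pair_relations[OF oct] a o unfolding P_def by (metis insert_iff)
    obtain q1 q2 where q: "(q1, q2) = (a1, a2) \<or> (q1, q2) = (a2, a1)" "x q1 = x c1" "x q2 = x c2"
      "\<forall>u\<in>{b1, b2}. a u q1 = - a u c1 \<and> a u q2 = - a u c2"
      using octahedron_pair_relations[OF oct'] b o unfolding P_def by (metis insert_iff)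
    have "octahedron q1 q2 p1 p2 c1 c2"
      using oct p(1) q(1) octahedron_swap octahedron_swap_b by (metis Pair_inject)
    then show False
      using octahedron_crossing[of q1 q2 p1 p2 c1 c2] p q o by auto
  qed
  note octs = oct octahedron_rotate[OF oct] octahedron_rotate[OF octahedron_rotate[OF oct]]
  have rel: "P a1 a2 b1 b2 \<longleftrightarrow> P a1 a2 c1 c2"
    if "octahedron a1 a2 b1 b2 c1 c2" for a1 a2 b1 b2 c1 c2
  proof -
    note d = that[unfolded octahedron_def]
    have "a u b1 * x b1 + a u b2 * x b2 + (a u c1 * x c1 + a u c2 * x c2) = 0" if "u \<in> {a1, a2}" for u
      using that row[of a1] row[of a2] d by (auto simp: add.assoc)
    then show ?thesis unfolding P_def by (metis add.left_neutral add.right_neutral)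
  qed
  show False
    using aligned[OF octs(1)] aligned[OF octs(2)] aligned[OF octs(3)]
      crossing[OF octs(1)] crossing[OF octs(2)] crossing[OF octs(3)]
      rel[OF octs(1)] rel[OF octs(2)] rel[OF octs(3)] by blast
qed

lemma not_4_regular_order_6:
  assumes card: "card V = 6" and deg: "\<forall>u\<in>V. card (N u) = 4"
  shows False
proof -
  obtain a1 a2 b1 b2 c1 c2 where oct: "octahedron a1 a2 b1 b2 c1 c2"
    using octahedron_exists[OF assms] .
  note d = oct[unfolded octahedron_def]
  note octs = oct octahedron_rotate[OF oct] octahedron_rotate[OF octahedron_rotate[OF oct]]
  have par: "odd (x a1) \<longleftrightarrow> odd (x a2)" "odd (x b1) \<longleftrightarrow> odd (x b2)" "odd (x c1) \<longleftrightarrow> odd (x c2)"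
    using octs by (auto dest!: octahedron_parity)
  have ex: "odd (x a1) \<or> odd (x b1) \<or> odd (x c1)" using odd_entry d par by auto
  consider "odd (x a1)" "odd (x b1)" "odd (x c1)"
    | "odd (x a1)" "odd (x b1)" "even (x c1)" | "odd (x b1)" "odd (x c1)" "even (x a1)" | "odd (x c1)" "odd (x a1)" "even (x b1)"
    | "odd (x a1)" "even (x b1)" "even (x c1)" | "odd (x b1)" "even (x a1)" "even (x c1)" | "odd (x c1)" "even (x a1)" "even (x b1)"
    using ex by blast
  then show False
  proof cases
    case 1 then show False using octahedron_all_odd[OF oct] d par by auto
  next
    case 2 then show False using octahedron_two_odd_pairs[OF octs(1)] par by blast
  next
    case 3 then show False using octahedron_two_odd_pairs[OF octs(2)] par by blast
  next
    case 4 then show False using octahedron_two_odd_pairs[OF octs(3)] par by blast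
  next
    case 5 then show False using octahedron_one_odd_pair[OF octs(1)] par by blast
  next
    case 6 then show False using octahedron_one_odd_pair[OF octs(2)] par by blast
  next
    case 7 then show False using octahedron_one_odd_pair[OF octs(3)] par by blast
  qed
qed

end

section \<open>Short cycles\<close>

text \<open>A disjoint union of cycles, given by neighbourhoods.\<close>

locale two_regular =
  fixes S :: "'a set" and M :: "'a \<Rightarrow> 'a set"
  assumes finite_S: "finite S" and M_subset: "v \<in> S \<Longrightarrow> M v \<subseteq> S" and M_irrefl: "v \<in> S \<Longrightarrow> v \<notin> M v"
    and M_card: "v \<in> S \<Longrightarrow> card (M v) = 2" and M_sym: "u \<in> S \<Longrightarrow> v \<in> M u \<Longrightarrow> u \<in> M v"
begin

lemma other_neighbour:
  assumes "v \<in> S" "u \<in> M v"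
  obtains w where "M v = {u, w}" "w \<noteq> u" "w \<in> S" "w \<noteq> v" "v \<in> M w"
proof -
  have "card (M v - {u}) = 1" using M_card[OF assms(1)] assms(2) by simp
  then obtain w where "M v - {u} = {w}" by (auto simp: card_1_singleton_iff)
  then have "M v = {u, w}" "w \<noteq> u" using assms(2) by auto
  then show ?thesis using that[of w] M_subset[OF assms(1)] M_irrefl[OF assms(1)] M_sym[OF assms(1), of w] by auto
qed

lemma neighbours_eq:
  assumes "v \<in> S" "p \<in> M v" "q \<in> M v" "p \<noteq> q"
  shows "M v = {p, q}"
  using other_neighbour[OF assms(1,2)] assms(3,4) by (metis insertE singletonD insert_commute)

lemma path_of_three:
  assumes "S \<noteq> {}"
  obtains u v w where "u \<in> S" "v \<in> S" "w \<in> S" "distinct [u, v, w]" "M v = {u, w}" "v \<in> M u" "v \<in> M w"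
proof -
  obtain v where v: "v \<in> S" using assms by auto
  then obtain u w where uw: "M v = {u, w}" "u \<noteq> w" using M_card[OF v] by (auto simp: card_2_iff)
  then show ?thesis using that[of u v w] M_subset[OF v] M_irrefl[OF v] M_sym[OF v] v by auto
qed

lemma card_ge_3: "S \<noteq> {} \<Longrightarrow> 3 \<le> card S"
proof -
  assume "S \<noteq> {}"
  from path_of_three[OF this] obtain u v w where "u \<in> S" "v \<in> S" "w \<in> S" "distinct [u, v, w]" by metis
  then have "card {u, v, w} = 3" "{u, v, w} \<subseteq> S" by auto
  then show ?thesis using card_mono[OF finite_S, of "{u, v, w}"] by simp
qed

lemma remove_triangle:
  assumes "M u = {v, w}" "M v = {u, w}" "M w = {u, v}" "u \<in> S" "v \<in> S" "w \<in> S"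
  shows "two_regular (S - {u, v, w}) M"
proof
  fix p assume p: "p \<in> S - {u, v, w}"
  have "u \<notin> M p" "v \<notin> M p" "w \<notin> M p"
    using M_sym[of p u] M_sym[of p v] M_sym[of p w] p assms(1-3) by auto
  then show "M p \<subseteq> S - {u, v, w}" using M_subset p by auto
qed (use finite_S M_irrefl M_card M_sym in auto)

lemma pentagon:
  assumes "card S = 5"
  obtains c0 c1 c2 c3 c4 where "distinct [c0, c1, c2, c3, c4]" "S = {c0, c1, c2, c3, c4}"
    "M c0 = {c1, c4}" "M c1 = {c0, c2}" "M c2 = {c1, c3}" "M c3 = {c2, c4}" "M c4 = {c0, c3}"
proof -
  have "S \<noteq> {}" using assms by auto
  from path_of_three[OF this] obtain c4 c0 c1 where p: "c4 \<in> S" "c0 \<in> S" "c1 \<in> S" "distinct [c4, c0, c1]"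
    "M c0 = {c4, c1}" "c0 \<in> M c4" "c0 \<in> M c1" by metis
  from other_neighbour[OF p(3,7)] obtain c2 where c2: "M c1 = {c0, c2}" "c2 \<noteq> c0" "c2 \<in> S" "c2 \<noteq> c1" "c1 \<in> M c2" by metis
  from other_neighbour[OF p(1,6)] obtain c3 where c3: "M c4 = {c0, c3}" "c3 \<noteq> c0" "c3 \<in> S" "c3 \<noteq> c4" "c4 \<in> M c3" by metis
  have n24: "c2 \<noteq> c4"
  proof
    assume eq: "c2 = c4"
    then have "c1 \<in> {c0, c3}" using c2(5) c3(1) by auto
    then have "M c4 = {c0, c1}" "M c1 = {c0, c4}" using p(4) c3(1) c2(1) eq by auto
    then have "two_regular (S - {c0, c4, c1}) M" using p by (intro remove_triangle) auto
    moreover have "card (S - {c0, c4, c1}) = 2" using p assms finite_S by (subst card_Diff_subset) auto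
    ultimately show False using two_regular.card_ge_3 by force
  qed
  moreover have "c3 \<noteq> c1"
    using n24 c2 c3(5) p(4) by auto
  moreover have "c2 \<noteq> c3"
  proof
    assume eq: "c2 = c3"
    have sub: "{c0, c1, c2, c4} \<subseteq> S" using p(1-3) c2(3) by simp
    have "c0 \<notin> {c1, c2, c4}" "c1 \<notin> {c2, c4}" "c2 \<notin> {c4}" using p(4) c2(2,4) n24 by auto
    then have "card {c0, c1, c2, c4} = 4" by simp
    then have "card (S - {c0, c1, c2, c4}) = 1" using assms finite_S sub by (subst card_Diff_subset) auto
    then obtain q where q: "S - {c0, c1, c2, c4} = {q}" by (auto simp: card_1_singleton_iff)
    have "M c2 = {c1, c4}" using neighbours_eq[OF c2(3,5), of c4] c3(5) eq p(4) by auto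
    have qS: "q \<in> S" "q \<noteq> c0" "q \<noteq> c1" "q \<noteq> c2" "q \<noteq> c4" using q by auto
    have "c0 \<notin> M q" "c1 \<notin> M q" "c2 \<notin> M q" "c4 \<notin> M q"
      using M_sym[OF qS(1), of c0] M_sym[OF qS(1), of c1] M_sym[OF qS(1), of c2] M_sym[OF qS(1), of c4]
        qS p(5) c2(1) c3(1) eq \<open>M c2 = {c1, c4}\<close> by auto
    then have "M q = {}" using M_subset[OF qS(1)] M_irrefl[OF qS(1)] q by auto
    then show False using M_card[OF qS(1)] by simp
  qed
  ultimately have dist: "distinct [c0, c1, c2, c3, c4]" using p(4) c2 c3 by auto
  have S: "{c0, c1, c2, c3, c4} = S"
    using dist p c2(3) c3(3) assms finite_S by (intro card_subset_eq) auto
  from other_neighbour[OF c2(3,5)] obtain w where w: "M c2 = {c1, w}" "w \<noteq> c1" "w \<in> S" "w \<noteq> c2" "c2 \<in> M w" by metis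
  have "w = c3" using w S p(5) c2(1) c3(1) dist by auto
  then have "M c2 = {c1, c3}" "M c3 = {c2, c4}"
    using w neighbours_eq[OF c3(3), of c2 c4] c3(5) dist by auto
  then show ?thesis using that[of c0 c1 c2 c3 c4] dist S p(5) c2(1) c3(1) by (metis insert_commute)
qed

end

section \<open>Degree five on eight vertices\<close>

context normal_nut_matrix begin

text \<open>A pentagon \<open>c0\<close>, \<dots>, \<open>c4\<close> whose vertices are all joined to three
  independent hubs \<open>b\<close>, \<open>c\<close>, \<open>d\<close>, with two odd hubs: the only pattern
  that parity leaves for degree five on eight vertices.\<close>

definition wheel :: "'a \<Rightarrow> 'a \<Rightarrow> 'a \<Rightarrow> 'a \<Rightarrow> 'a \<Rightarrow> 'a \<Rightarrow> 'a \<Rightarrow> 'a \<Rightarrow> bool" where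
  "wheel b c d c0 c1 c2 c3 c4 \<longleftrightarrow> distinct [b, c, d, c0, c1, c2, c3, c4] \<and>
     {b, c, d, c0, c1, c2, c3, c4} \<subseteq> V \<and>
     N b = {c0, c1, c2, c3, c4} \<and> N c = {c0, c1, c2, c3, c4} \<and> N d = {c0, c1, c2, c3, c4} \<and>
     N c0 = {b, c, d, c1, c4} \<and> N c1 = {b, c, d, c0, c2} \<and> N c2 = {b, c, d, c1, c3} \<and>
     N c3 = {b, c, d, c2, c4} \<and> N c4 = {b, c, d, c0, c3} \<and>
     odd (x b) \<and> odd (x c) \<and> even (x d) \<and> even (x c0) \<and> even (x c1) \<and> even (x c2) \<and> even (x c3) \<and> even (x c4)"

lemma wheel_rotate: "wheel b c d c0 c1 c2 c3 c4 \<Longrightarrow> wheel b c d c1 c2 c3 c4 c0"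
  unfolding wheel_def by auto

text \<open>Weight the row of each rim vertex by half of its entry and add. The contributions of the hubs
  cancel by the rows of the hubs, which leaves the quadratic form of the rim.\<close>

lemma wheel_rim:
  assumes w: "wheel b c d c0 c1 c2 c3 c4"
    and y: "x c0 = 2 * y0" "x c1 = 2 * y1" "x c2 = 2 * y2" "x c3 = 2 * y3" "x c4 = 2 * y4"
  shows "a c0 c1 * y0 * y1 + a c1 c2 * y1 * y2 + a c2 c3 * y2 * y3 + a c3 c4 * y3 * y4 + a c4 c0 * y4 * y0 = 0"
proof -
  note d = w[unfolded wheel_def]
  have inV: "b \<in> V" "c \<in> V" "d \<in> V" "c0 \<in> V" "c1 \<in> V" "c2 \<in> V" "c3 \<in> V" "c4 \<in> V" using d by auto
  have Ns: "N b = {c0, c1, c2, c3, c4}" "N c = {c0, c1, c2, c3, c4}" "N d = {c0, c1, c2, c3, c4}"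
    "N c0 = {b, c, d, c1, c4}" "N c1 = {b, c, d, c0, c2}" "N c2 = {b, c, d, c1, c3}"
    "N c3 = {b, c, d, c2, c4}" "N c4 = {b, c, d, c0, c3}"
    and ne: "c0 \<noteq> c1" "c0 \<noteq> c2" "c0 \<noteq> c3" "c0 \<noteq> c4" "c1 \<noteq> c2" "c1 \<noteq> c3" "c1 \<noteq> c4" "c2 \<noteq> c3" "c2 \<noteq> c4" "c3 \<noteq> c4"
    "b \<noteq> c" "b \<noteq> d" "c \<noteq> d"
    using d by simp_all
  have rows: "a u c0 * y0 + a u c1 * y1 + a u c2 * y2 + (a u c3 * y3 + a u c4 * y4) = 0" if u: "u \<in> {b, c, d}" for u
  proof -
    have "u \<in> V" "N u = {c0, c1, c2, c3, c4}" using u inV Ns by auto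
    then have "(\<Sum>v\<in>{c0, c1, c2, c3, c4}. a u v * x v) = 0" using row[of u] by simp
    then have "2 * (a u c0 * y0 + a u c1 * y1 + a u c2 * y2 + (a u c3 * y3 + a u c4 * y4)) = 0"
      using ne by (simp add: y algebra_simps)
    then show ?thesis by simp
  qed
  define R where "R v = a v b * x b + a v c * x c + a v d * x d" for v
  have r': "R c0 + 2 * (a c0 c1 * y1 + a c4 c0 * y4) = 0" "R c1 + 2 * (a c0 c1 * y0 + a c1 c2 * y2) = 0"
    "R c2 + 2 * (a c1 c2 * y1 + a c2 c3 * y3) = 0" "R c3 + 2 * (a c2 c3 * y2 + a c3 c4 * y4) = 0"
    "R c4 + 2 * (a c4 c0 * y0 + a c3 c4 * y3) = 0"
    using row[OF inV(4)] row[OF inV(5)] row[OF inV(6)] row[OF inV(7)] row[OF inV(8)] d y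
    by (simp_all add: R_def sym[of c0 c4] sym[of c1 c0] sym[of c2 c1] sym[of c3 c2] sym[of c4 c3] algebra_simps)
  have "R c0 * y0 + R c1 * y1 + R c2 * y2 + R c3 * y3 + R c4 * y4
    = x b * (a b c0 * y0 + a b c1 * y1 + a b c2 * y2 + (a b c3 * y3 + a b c4 * y4))
    + x c * (a c c0 * y0 + a c c1 * y1 + a c c2 * y2 + (a c c3 * y3 + a c c4 * y4))
    + x d * (a d c0 * y0 + a d c1 * y1 + a d c2 * y2 + (a d c3 * y3 + a d c4 * y4))"
    by (simp add: R_def sym[of _ b] sym[of _ c] sym[of _ d] algebra_simps)
  then have "R c0 * y0 + R c1 * y1 + R c2 * y2 + R c3 * y3 + R c4 * y4 = 0" using rows by simp
  moreover have "4 * (a c0 c1 * y0 * y1 + a c1 c2 * y1 * y2 + a c2 c3 * y2 * y3 + a c3 c4 * y3 * y4 + a c4 c0 * y4 * y0)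
    = (R c0 + 2 * (a c0 c1 * y1 + a c4 c0 * y4)) * y0 + (R c1 + 2 * (a c0 c1 * y0 + a c1 c2 * y2)) * y1
    + (R c2 + 2 * (a c1 c2 * y1 + a c2 c3 * y3)) * y2 + (R c3 + 2 * (a c2 c3 * y2 + a c3 c4 * y4)) * y3
    + (R c4 + 2 * (a c4 c0 * y0 + a c3 c4 * y3)) * y4
    - (R c0 * y0 + R c1 * y1 + R c2 * y2 + R c3 * y3 + R c4 * y4)"
    by (simp add: algebra_simps)
  ultimately show ?thesis
    unfolding r' by simp
qed

text \<open>Modulo 4, the rows of the rim show that the rows of \<open>b\<close> and \<open>c\<close> agree,
  up to a common sign, on \<open>c0\<close>, \<open>c1\<close>, \<open>c2\<close> and are opposite on
  \<open>c3\<close>, \<open>c4\<close>. So the halves, switched to make the row of \<open>b\<close> constant,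
  satisfy \<open>Y0 + Y1 + Y2 = 0\<close> and \<open>Y3 + Y4 = 0\<close>. The third hub is not proportional to
  the others, which gives \<open>Y1 = \<kappa> * Y3\<close> with a sign \<open>\<kappa>\<close>. Comparing the
  rows of \<open>c0\<close> and \<open>c2\<close> and inserting everything into the form of the rim yields
  \<open>P * \<kappa> + E c3 c4 = 0\<close>, where \<open>P\<close> is a sum of two signs and hence even: a
  contradiction modulo 2.\<close>

lemma wheel_odd_halves:
  assumes w: "wheel b c d c0 c1 c2 c3 c4"
    and y: "x c0 = 2 * y0" "x c1 = 2 * y1" "x c2 = 2 * y2" "x c3 = 2 * y3" "x c4 = 2 * y4"
    and par: "odd y0" "even y1" "odd y2" "even y3" "even y4"
  shows False
proof -
  note d = w[unfolded wheel_def]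
  have inV: "b \<in> V" "c \<in> V" "d \<in> V" "c0 \<in> V" "c1 \<in> V" "c2 \<in> V" "c3 \<in> V" "c4 \<in> V" using d by auto
  have s: "a u v = 1 \<or> a u v = - 1" if "u \<in> {b, c, d}" "v \<in> {c0, c1, c2, c3, c4}" for u v
    using that d by (auto intro!: sign)
  have Ns: "N b = {c0, c1, c2, c3, c4}" "N c = {c0, c1, c2, c3, c4}" "N d = {c0, c1, c2, c3, c4}"
    "N c0 = {b, c, d, c1, c4}" "N c1 = {b, c, d, c0, c2}" "N c2 = {b, c, d, c1, c3}"
    "N c3 = {b, c, d, c2, c4}" "N c4 = {b, c, d, c0, c3}"
    and ne: "c0 \<noteq> c1" "c0 \<noteq> c2" "c0 \<noteq> c3" "c0 \<noteq> c4" "c1 \<noteq> c2" "c1 \<noteq> c3" "c1 \<noteq> c4" "c2 \<noteq> c3" "c2 \<noteq> c4" "c3 \<noteq> c4"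
    "b \<noteq> c" "b \<noteq> d" "c \<noteq> d"
    using d by simp_all
  have rows: "a u c0 * y0 + a u c1 * y1 + a u c2 * y2 + (a u c3 * y3 + a u c4 * y4) = 0" if u: "u \<in> {b, c, d}" for u
  proof -
    have "u \<in> V" "N u = {c0, c1, c2, c3, c4}" using u inV Ns by auto
    then have "(\<Sum>v\<in>{c0, c1, c2, c3, c4}. a u v * x v) = 0" using row[of u] by simp
    then have "2 * (a u c0 * y0 + a u c1 * y1 + a u c2 * y2 + (a u c3 * y3 + a u c4 * y4)) = 0"
      using ne by (simp add: y algebra_simps)
    then show ?thesis by simp
  qed
  have mods: "4 dvd a b c0 + a c c0 + x d + 2 * (y1 + y4)" "4 dvd a b c1 + a c c1 + x d + 2 * (y0 + y2)"
    "4 dvd a b c2 + a c c2 + x d + 2 * (y1 + y3)" "4 dvd a b c3 + a c c3 + x d + 2 * (y2 + y4)"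
    "4 dvd a b c4 + a c c4 + x d + 2 * (y0 + y3)"
    using row_mod_4[OF inV(4)] row_mod_4[OF inV(5)] row_mod_4[OF inV(6)] row_mod_4[OF inV(7)] row_mod_4[OF inV(8)] d y
    by (simp_all add: sym[of c0] sym[of c1] sym[of c2] sym[of c3] sym[of c4] algebra_simps)
  define h where "h v = a b v + a c v" for v
  have h: "4 dvd h c0 + x d" "4 dvd h c1 + x d" "4 dvd h c2 + x d" "4 dvd h c3 + x d + 2" "4 dvd h c4 + x d + 2"
    using mods(1)[folded h_def] mods(2)[folded h_def] mods(3)[folded h_def] mods(4)[folded h_def]
      mods(5)[folded h_def] par by presburger+
  define r where "r = (if a c c0 = a b c0 then 1 else - 1 :: int)"
  have r: "r = 1 \<or> r = - 1" by (simp add: r_def)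
  have near: "a c v = r * a b v" if "4 dvd h v - h c0" "v \<in> {c0, c1, c2, c3, c4}" for v
    using that(1) s[of b v] s[of c v] s[of b c0] s[of c c0] that(2) by (auto simp: h_def r_def)
  have far: "a c v = - r * a b v" if "4 dvd h v - h c0 + 2" "v \<in> {c0, c1, c2, c3, c4}" for v
    using that(1) s[of b v] s[of c v] s[of b c0] s[of c c0] that(2) by (auto simp: h_def r_def)
  have rc: "a c c0 = r * a b c0" "a c c1 = r * a b c1" "a c c2 = r * a b c2"
    "a c c3 = - r * a b c3" "a c c4 = - r * a b c4"
    using near[of c0] near[of c1] near[of c2] far[of c3] far[of c4]
      dvd_diff[OF h(2) h(1)] dvd_diff[OF h(3) h(1)] dvd_diff[OF h(4) h(1)] dvd_diff[OF h(5) h(1)]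
    by (simp_all add: algebra_simps)
  \<comment> \<open>switching at the rim makes the row of \<open>b\<close> constant\<close>
  define Y0 Y1 Y2 Y3 Y4 where "Y0 = a b c0 * y0" and "Y1 = a b c1 * y1" and "Y2 = a b c2 * y2"
    and "Y3 = a b c3 * y3" and "Y4 = a b c4 * y4"
  note Y_defs = Y0_def Y1_def Y2_def Y3_def Y4_def
  have "Y0 + Y1 + Y2 + (Y3 + Y4) = 0" "r * (Y0 + Y1 + Y2) - r * (Y3 + Y4) = 0"
    using rows[of b] rows[of c] by (simp_all add: rc Y_defs algebra_simps)
  then have Y012: "Y0 + Y1 + Y2 = 0" and Y34: "Y4 = - Y3" using r by auto
  define t where "t v = a d v * a b v" for v
  have td: "a d v = t v * a b v" and t1: "t v = 1 \<or> t v = - 1" if "v \<in> {c0, c1, c2, c3, c4}" for v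
    using that s[of b v] s[of d v] by (auto simp: t_def)
  have "t c0 * Y0 + t c1 * Y1 + t c2 * Y2 + (t c3 * Y3 + t c4 * Y4) = 0"
    using rows[of d] td by (simp add: Y_defs algebra_simps)
  then have "t c0 * Y0 + t c1 * Y1 + t c2 * Y2 + (t c3 - t c4) * Y3 = 0"
    unfolding Y34 by (simp add: algebra_simps)
  moreover have no_twin: "\<not> (t c0 = t c1 \<and> t c2 = t c1 \<and> t c3 = t c4)"
  proof
    assume eq: "t c0 = t c1 \<and> t c2 = t c1 \<and> t c3 = t c4"
    show False
    proof (cases "t c3 = t c0")
      case True
      have "a d v = t c0 * a b v" if "v \<in> N b" for v
      proof -
        have v: "v \<in> {c0, c1, c2, c3, c4}" using that Ns(1) by simp
        then have "t v = t c0" using eq True by auto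
        then show ?thesis using td[OF v] by simp
      qed
      then show False
        using t1[of c0] by (intro no_proportional_twins[of b d c0 "t c0"]) (simp_all add: inV Ns ne)
    next
      case False
      then have far: "t c3 = - t c0" using t1[of c0] t1[of c3] by auto
      have "a d v = r * t c0 * a c v" if "v \<in> N c" for v
      proof -
        have "v \<in> {c0, c1, c2, c3, c4}" using that Ns(2) by simp
        then have "(t v = t c0 \<and> a c v = r * a b v) \<or> (t v = - t c0 \<and> a c v = - r * a b v)"
          using eq far rc by auto
        moreover have "a d v = t v * a b v" using td \<open>v \<in> {c0, c1, c2, c3, c4}\<close> by blast
        ultimately show ?thesis using r by auto
      qed
      moreover have "r * t c0 = 1 \<or> r * t c0 = - 1" using t1[of c0, simplified] r by (elim disjE) simp_all
      ultimately show False
        by (intro no_proportional_twins[of c d c0 "r * t c0"]) (simp_all add: inV Ns ne)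
    qed
  qed
  moreover have "Y1 \<noteq> 0" "Y3 \<noteq> 0" using full[of c1] full[of c3] inV y s[of b c1] s[of b c3] by (auto simp: Y_defs)
  moreover have "odd Y0" "odd Y2" "even Y1" "even Y3" using par s[of b c0] s[of b c2] by (auto simp: Y_defs)
  ultimately have k: "t c2 = t c0 \<and> t c1 = - t c0 \<and> t c4 = - t c3 \<and> Y1 = t c0 * t c3 * Y3"
    using t1[of c0, simplified] t1[of c1, simplified] t1[of c2, simplified] t1[of c3, simplified]
      t1[of c4, simplified] Y012
    by (elim disjE; simp; presburger)
  define \<kappa> where "\<kappa> = t c0 * t c3"
  have \<kappa>: "\<kappa> = 1 \<or> \<kappa> = - 1" "Y1 = \<kappa> * Y3" using k t1[of c0] t1[of c3] by (auto simp: \<kappa>_def)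
  define E where "E u v = a b u * a b v * a u v" for u v
  have bb: "a b v * a b v = 1" if "v \<in> {c0, c1, c2, c3, c4}" for v using s[of b v] that by auto
  have E1: "E u v = 1 \<or> E u v = - 1" if "v \<in> N u" "u \<in> {c0, c1, c2, c3, c4}" "v \<in> {c0, c1, c2, c3, c4}" for u v
    using sign[OF that(1)] s[of b u] s[of b v] that(2,3) by (auto simp: E_def)
  \<comment> \<open>the rows of \<open>c0\<close> and \<open>c2\<close> have proportional restrictions to the hubs\<close>
  have row0: "a b c0 * x b + a c c0 * x c + a d c0 * x d + 2 * (a c0 c1 * y1 + a c4 c0 * y4) = 0"
    and row2: "a b c2 * x b + a c c2 * x c + a d c2 * x d + 2 * (a c1 c2 * y1 + a c2 c3 * y3) = 0"
    using row[OF inV(4)] row[OF inV(6)] d y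
    by (simp_all add: sym[of c0 b] sym[of c0 c] sym[of c0 d] sym[of c0 c4] sym[of c2 b] sym[of c2 c] sym[of c2 d] sym[of c2 c1] algebra_simps)
  have Ya: "y0 = a b c0 * Y0" "y1 = a b c1 * Y1" "y2 = a b c2 * Y2" "y3 = a b c3 * Y3" "y4 = a b c4 * Y4"
    using bb by (simp_all add: Y_defs flip: mult.assoc)
  have hub0: "x b + r * x c + t c0 * x d + 2 * (E c0 c1 * Y1 + E c4 c0 * Y4) = 0"
  proof -
    have "a b c0 * (a b c0 * x b + a c c0 * x c + a d c0 * x d + 2 * (a c0 c1 * y1 + a c4 c0 * y4))
      = (a b c0 * a b c0) * (x b + r * x c + t c0 * x d) + 2 * (E c0 c1 * Y1 + E c4 c0 * Y4)"
      using td[of c0] by (simp add: rc Ya E_def algebra_simps)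
    then show ?thesis using row0 bb[of c0] by simp
  qed
  have hub2: "x b + r * x c + t c0 * x d + 2 * (E c1 c2 * Y1 + E c2 c3 * Y3) = 0"
  proof -
    have "a b c2 * (a b c2 * x b + a c c2 * x c + a d c2 * x d + 2 * (a c1 c2 * y1 + a c2 c3 * y3))
      = (a b c2 * a b c2) * (x b + r * x c + t c0 * x d) + 2 * (E c1 c2 * Y1 + E c2 c3 * Y3)"
      using td[of c2] k by (simp add: rc Ya E_def algebra_simps)
    then show ?thesis using row2 bb[of c2] by simp
  qed
  define P Q where "P = \<kappa> * E c0 c1 - E c4 c0" and "Q = \<kappa> * E c1 c2 + E c2 c3"
  have "Y3 * P = Y3 * Q"
    using hub0 hub2 \<kappa>(2) Y34 by (simp add: P_def Q_def algebra_simps)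
  then have m: "Q = P" using \<open>Y3 \<noteq> 0\<close> by simp
  have rim: "E c0 c1 * Y0 * Y1 + E c1 c2 * Y1 * Y2 + E c2 c3 * Y2 * Y3 + E c3 c4 * Y3 * Y4 + E c4 c0 * Y4 * Y0 = 0"
    using wheel_rim[OF w y] by (simp add: Ya E_def algebra_simps)
  have "Y3 * (P * Y0 + Q * Y2 - E c3 c4 * Y3) = 0"
    using rim \<kappa>(2) Y34 by (simp add: P_def Q_def algebra_simps)
  then have "P * Y0 + Q * Y2 - E c3 c4 * Y3 = 0" using \<open>Y3 \<noteq> 0\<close> by simp
  then have "P * (Y0 + Y2) - E c3 c4 * Y3 = 0" by (simp add: m distrib_left)
  moreover have "Y0 + Y2 = - (\<kappa> * Y3)" using Y012 \<kappa>(2) by linarith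
  ultimately have "Y3 * (P * \<kappa> + E c3 c4) = 0" by (simp add: algebra_simps)
  then have "P * \<kappa> + E c3 c4 = 0" using \<open>Y3 \<noteq> 0\<close> by simp
  moreover have "E c0 c1 = 1 \<or> E c0 c1 = - 1" "E c4 c0 = 1 \<or> E c4 c0 = - 1" "E c3 c4 = 1 \<or> E c3 c4 = - 1"
    by (rule E1; simp add: Ns)+
  ultimately show False using \<kappa>(1) unfolding P_def by (elim disjE) simp_all
qed

text \<open>Halve the entries of the rim. The row of \<open>b\<close> modulo 4 makes the number of odd halves
  even. If there are none, the rows of \<open>b\<close> and \<open>c\<close> are proportional. Two of them
  that are not adjacent are excluded by \<open>wheel_odd_halves\<close>. In the other cases the number of rim
  edges between odd halves is odd, so the form of the rim is odd.\<close>

lemma wheel_impossible: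
  assumes w: "wheel b c d c0 c1 c2 c3 c4"
  shows False
proof -
  note d = w[unfolded wheel_def]
  have inV: "b \<in> V" "c \<in> V" "d \<in> V" "c0 \<in> V" "c1 \<in> V" "c2 \<in> V" "c3 \<in> V" "c4 \<in> V" using d by auto
  have Ns: "N b = {c0, c1, c2, c3, c4}" "N c = {c0, c1, c2, c3, c4}"
    "N c0 = {b, c, d, c1, c4}" "N c1 = {b, c, d, c0, c2}" "N c2 = {b, c, d, c1, c3}"
    "N c3 = {b, c, d, c2, c4}" "N c4 = {b, c, d, c0, c3}"
    and ne: "c0 \<noteq> c1" "c0 \<noteq> c2" "c0 \<noteq> c3" "c0 \<noteq> c4" "c1 \<noteq> c2" "c1 \<noteq> c3" "c1 \<noteq> c4" "c2 \<noteq> c3" "c2 \<noteq> c4" "c3 \<noteq> c4"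
    "b \<noteq> c" "b \<noteq> d" "c \<noteq> d" "b \<notin> {c0, c1, c2, c3, c4}" "c \<notin> {c0, c1, c2, c3, c4}" "d \<notin> {c0, c1, c2, c3, c4}"
    and par: "odd (x b)" "odd (x c)" "even (x d)" "even (x c0)" "even (x c1)" "even (x c2)" "even (x c3)" "even (x c4)"
    using d by simp_all
  define y0 y1 y2 y3 y4 where "y0 = x c0 div 2" and "y1 = x c1 div 2" and "y2 = x c2 div 2"
    and "y3 = x c3 div 2" and "y4 = x c4 div 2"
  then have y: "x c0 = 2 * y0" "x c1 = 2 * y1" "x c2 = 2 * y2" "x c3 = 2 * y3" "x c4 = 2 * y4"
    using par(4-8) by simp_all
  have "4 dvd x c0 + x c1 + x c2 + x c3 + x c4"
    using row_mod_4[OF inV(1)] by (simp add: Ns ne par add.assoc)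
  then have sum_even: "even (y0 + y1 + y2 + y3 + y4)" unfolding y by presburger
  have mods: "4 dvd a b c0 + a c c0 + x d + 2 * (y1 + y4)" "4 dvd a b c1 + a c c1 + x d + 2 * (y0 + y2)"
    "4 dvd a b c2 + a c c2 + x d + 2 * (y1 + y3)" "4 dvd a b c3 + a c c3 + x d + 2 * (y2 + y4)"
    "4 dvd a b c4 + a c c4 + x d + 2 * (y0 + y3)"
    using row_mod_4[OF inV(4)] row_mod_4[OF inV(5)] row_mod_4[OF inV(6)] row_mod_4[OF inV(7)] row_mod_4[OF inV(8)] d y
    by (simp_all add: sym[of c0] sym[of c1] sym[of c2] sym[of c3] sym[of c4] algebra_simps)
  have s: "a u v = 1 \<or> a u v = - 1" if "u \<in> {b, c}" "v \<in> {c0, c1, c2, c3, c4}" for u v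
    using that Ns by (intro sign) auto
  consider "even y0" "even y1" "even y2" "even y3" "even y4"
    | "odd y0" "even y1" "odd y2" "even y3" "even y4" | "odd y1" "even y2" "odd y3" "even y4" "even y0"
    | "odd y2" "even y3" "odd y4" "even y0" "even y1" | "odd y3" "even y4" "odd y0" "even y1" "even y2"
    | "odd y4" "even y0" "odd y1" "even y2" "even y3"
    | "odd y0 \<and> odd y1 \<or> odd y1 \<and> odd y2 \<or> odd y2 \<and> odd y3 \<or> odd y3 \<and> odd y4 \<or> odd y4 \<and> odd y0"
    using sum_even by auto
  then show False
  proof cases
    case 1
    define h where "h v = a b v + a c v" for v
    have h: "4 dvd h c0 + x d" "4 dvd h c1 + x d" "4 dvd h c2 + x d" "4 dvd h c3 + x d" "4 dvd h c4 + x d"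
      using mods(1)[folded h_def] mods(2)[folded h_def] mods(3)[folded h_def] mods(4)[folded h_def]
        mods(5)[folded h_def] 1 by presburger+
    define r where "r = (if a c c0 = a b c0 then 1 else - 1 :: int)"
    have near: "a c v = r * a b v" if "4 dvd h v - h c0" "v \<in> {c0, c1, c2, c3, c4}" for v
      using that(1) s[of b v] s[of c v] s[of b c0] s[of c c0] that(2) by (auto simp: h_def r_def)
    have "a c c0 = r * a b c0" "a c c1 = r * a b c1" "a c c2 = r * a b c2" "a c c3 = r * a b c3" "a c c4 = r * a b c4"
      using near[of c0] near[of c1] near[of c2] near[of c3] near[of c4]
        dvd_diff[OF h(2) h(1)] dvd_diff[OF h(3) h(1)] dvd_diff[OF h(4) h(1)] dvd_diff[OF h(5) h(1)]
      by (simp_all add: algebra_simps)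
    then have "a c v = r * a b v" if "v \<in> N b" for v using that unfolding Ns by blast
    moreover have "r = 1 \<or> r = - 1" by (simp add: r_def)
    ultimately show False
      by (intro no_proportional_twins[of b c c0 r]) (simp_all add: inV Ns ne)
  next
    case 2 then show False using wheel_odd_halves[OF w y] by blast
  next
    case 3 then show False using wheel_odd_halves[OF wheel_rotate[OF w] y(2,3,4,5,1)] by blast
  next
    case 4
    then show False using wheel_odd_halves[OF wheel_rotate[OF wheel_rotate[OF w]] y(3,4,5,1,2)] by blast
  next
    case 5
    then show False
      using wheel_odd_halves[OF wheel_rotate[OF wheel_rotate[OF wheel_rotate[OF w]]] y(4,5,1,2,3)] by blast
  next
    case 6
    then show False
      using wheel_odd_halves[OF wheel_rotate[OF wheel_rotate[OF wheel_rotate[OF wheel_rotate[OF w]]]] y(5,1,2,3,4)] by blast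
  next
    case 7
    have e: "a c0 c1 = 1 \<or> a c0 c1 = - 1" "a c1 c2 = 1 \<or> a c1 c2 = - 1" "a c2 c3 = 1 \<or> a c2 c3 = - 1"
      "a c3 c4 = 1 \<or> a c3 c4 = - 1" "a c4 c0 = 1 \<or> a c4 c0 = - 1"
      by (rule sign; simp add: Ns)+
    have "even (a c0 c1 * y0 * y1 + a c1 c2 * y1 * y2 + a c2 c3 * y2 * y3 + a c3 c4 * y3 * y4 + a c4 c0 * y4 * y0)"
      using wheel_rim[OF w y] by simp
    moreover have "odd (a c0 c1)" "odd (a c1 c2)" "odd (a c2 c3)" "odd (a c3 c4)" "odd (a c4 c0)" using e by auto
    ultimately show False using sum_even 7 by auto
  qed
qed

text \<open>In the complement, which is regular of degree two, an odd vertex has exactly one odd neighbour and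
  an even vertex has none or two. Counting leaves two odd vertices that form a triangle of the complement with
  one even vertex, and five even vertices on a pentagon.\<close>

lemma not_5_regular_order_8:
  assumes card: "card V = 8" and deg: "\<forall>u\<in>V. card (N u) = 5"
  shows False
proof -
  \<comment> \<open>the complement is regular of degree two\<close>
  define H where "H u = V - insert u (N u)" for u
  have H_subset: "H u \<subseteq> V" "u \<notin> H u" for u by (auto simp: H_def)
  have finite_H: "finite (H u)" for u using fin by (simp add: H_def)
  have H_card: "card (H u) = 2" if "u \<in> V" for u
    using that card deg N_subset[of u] not_self_nbr[of u] unfolding H_def by (subst card_Diff_subset) auto
  have H_sym: "v \<in> H u \<Longrightarrow> u \<in> H v" if "u \<in> V" for u v using that nbr_commute[of u v] by (auto simp: H_def)
  have N_eq: "N u = V - insert u (H u)" for u using N_subset[of u] not_self_nbr[of u] by (auto simp: H_def)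
  have "5 * card Od = (\<Sum>u\<in>Od. card (N u \<inter> V))"
    using deg Od_subset N_subset by (simp add: Int_absorb2 subset_iff)
  also have "\<dots> = (\<Sum>u\<in>V. card (N u \<inter> Od))"
    using Od_subset by (intro double_count) auto
  also have "even \<dots>" using even_odd_nbrs by (auto intro!: dvd_sum)
  finally have even_Od: "even (card Od)" by simp
  have small: "even k \<Longrightarrow> k = 0 \<or> k = 2" "odd k \<Longrightarrow> k = 1" if "k \<le> 2" for k :: nat
    using that by presburger+
  have H_parity: "even (card (H u \<inter> Od)) \<longleftrightarrow> u \<notin> Od" if u: "u \<in> V" for u
  proof -
    have "Od = (N u \<inter> Od) \<union> (H u \<inter> Od) \<union> (Od \<inter> {u})" using Od_subset by (auto simp: H_def)
    also have "card \<dots> = card ((N u \<inter> Od) \<union> (H u \<inter> Od)) + card (Od \<inter> {u})"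
      using not_self_nbr[of u] finite_H by (intro card_Un_disjoint) (auto simp: H_def)
    also have "card ((N u \<inter> Od) \<union> (H u \<inter> Od)) = card (N u \<inter> Od) + card (H u \<inter> Od)"
      using finite_H by (intro card_Un_disjoint) (auto simp: H_def)
    finally have "even (card (N u \<inter> Od) + card (H u \<inter> Od) + card (Od \<inter> {u}))" using even_Od by simp
    then show ?thesis using even_odd_nbrs[OF u] by (cases "u \<in> Od") auto
  qed
  have H_le: "card (H u \<inter> Od) \<le> 2" if "u \<in> V" for u
    using card_mono[OF finite_H, of "H u \<inter> Od" u] H_card[OF that] by simp
  define E2 where "E2 = {u \<in> V - Od. card (H u \<inter> Od) = 2}"
  define E0 where "E0 = {u \<in> V - Od. card (H u \<inter> Od) = 0}"
  have fins: "finite E2" "finite E0" using fin by (auto simp: E2_def E0_def)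
  have outside: "u \<in> E2 \<or> u \<in> E0" if "u \<in> V" "u \<notin> Od" for u
  proof -
    have "even (card (H u \<inter> Od))" "card (H u \<inter> Od) \<le> 2" using that H_parity H_le by auto
    then have "card (H u \<inter> Od) = 0 \<or> card (H u \<inter> Od) = 2" using small(1) by blast
    then show ?thesis using that by (auto simp: E2_def E0_def)
  qed
  have one: "card (H u \<inter> Od) = 1" if "u \<in> Od" for u
  proof -
    have "odd (card (H u \<inter> Od))" "card (H u \<inter> Od) \<le> 2" using that H_parity H_le Od_subset by auto
    then show ?thesis using small(2) by blast
  qed
  have V_eq: "V = Od \<union> (E2 \<union> E0)" using outside Od_subset by (auto simp: E2_def E0_def)
  have "card V = card Od + (card E2 + card E0)"
    using fins by (subst V_eq, subst card_Un_disjoint; (subst card_Un_disjoint)?) (auto simp: E2_def E0_def)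
  then have total: "card Od + card E2 + card E0 = 8" using card by simp
  have "card Od = 2 * card E2"
  proof -
    have "(\<Sum>u\<in>Od. card {v \<in> V - Od. v \<in> H u}) = (\<Sum>v\<in>V - Od. card {u \<in> Od. v \<in> H u})"
      using fin by (intro sum_multicount_gen ballI) auto
    moreover have "card {v \<in> V - Od. v \<in> H u} = 1" if u: "u \<in> Od" for u
    proof -
      have "{v \<in> V - Od. v \<in> H u} = H u - H u \<inter> Od" using H_subset(1)[of u] by auto
      then show ?thesis using one[OF u] H_card[of u] u Od_subset finite_H by (simp add: card_Diff_subset subset_iff)
    qed
    moreover have "card {u \<in> Od. v \<in> H u} = (if v \<in> E2 then 2 else 0)" if v: "v \<in> V - Od" for v
    proof -
      have "{u \<in> Od. v \<in> H u} = H v \<inter> Od" using H_sym v Od_subset by blast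
      then show ?thesis using outside[of v] v by (auto simp: E2_def E0_def)
    qed
    ultimately have "card Od = (\<Sum>v\<in>V - Od. if v \<in> E2 then 2 else 0)" by simp
    also have "\<dots> = (\<Sum>v\<in>E2. 2)"
      using fin by (intro sum.mono_neutral_cong_right) (auto simp: E2_def)
    finally show ?thesis by simp
  qed
  moreover have "Od \<noteq> {}" using odd_entry by (auto simp: Od_def)
  then have "card Od \<noteq> 0" by simp
  moreover have H_E0: "H u \<subseteq> E0" if u: "u \<in> E0" for u
  proof
    fix v assume v: "v \<in> H u"
    have "u \<in> V" "u \<notin> Od" "H u \<inter> Od = {}" using u finite_H[of u] by (auto simp: E0_def)
    then have "v \<in> V" "v \<notin> Od" "u \<in> H v" using v H_subset(1) H_sym by auto
    moreover from this have "H v \<inter> Od \<noteq> H v" using \<open>u \<notin> Od\<close> by auto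
    then have "card (H v \<inter> Od) < card (H v)" by (intro psubset_card_mono[OF finite_H]) auto
    ultimately show "v \<in> E0" using outside[of v] H_card[of v] by (auto simp: E2_def)
  qed
  have "two_regular E0 H"
    using fins H_E0 H_subset(2) H_card H_sym by unfold_locales (auto simp: E0_def)
  then have "card E0 = 0 \<or> 3 \<le> card E0" using two_regular.card_ge_3 fins by fastforce
  ultimately have cards: "card Od = 2" "card E2 = 1" "card E0 = 5" using total by presburger+
  obtain b c where bc: "Od = {b, c}" "b \<noteq> c" using cards(1) by (auto simp: card_2_iff)
  obtain d where d: "E2 = {d}" using cards(2) by (auto simp: card_1_singleton_iff)
  have dV: "d \<in> V" "d \<notin> Od" "card (H d \<inter> Od) = 2" using d by (auto simp: E2_def)
  have bV: "b \<in> V" "c \<in> V" using bc Od_subset by auto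
  have Hd: "H d = {b, c}"
  proof -
    have "H d \<inter> Od = Od" using dV(3) cards(1) by (intro card_subset_eq) auto
    then show ?thesis using H_card[OF dV(1)] bc finite_H[of d] by (metis Int_lower1 card_2_iff card_subset_eq)
  qed
  have two: "H u = {v, d}" if u: "u \<in> V" "Od = {u, v}" "u \<in> H d" for u v
  proof -
    have "d \<in> H u" using H_sym[OF dV(1) u(3)] .
    moreover have "H u \<inter> Od \<noteq> {}" using one[of u] u(2) by force
    then have "v \<in> H u" using u(2) H_subset(2)[of u] by auto
    moreover have "v \<noteq> d" using u(2) dV(2) by auto
    ultimately have "{v, d} \<subseteq> H u" "card {v, d} = card (H u)" using H_card[OF u(1)] by auto
    then show ?thesis using card_subset_eq[OF finite_H] by metis
  qed
  have Hb: "H b = {c, d}" "H c = {b, d}" using two[of b c] two[of c b] bc bV Hd by auto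
  have E0_eq: "E0 = V - {b, c, d}" 
  proof -
    have "E0 = V - Od - E2" using outside by (auto simp: E0_def E2_def)
    then show ?thesis unfolding bc d by auto
  qed
  have Nbcd: "N b = E0" "N c = E0" "N d = E0" unfolding N_eq Hb Hd E0_eq by auto
  define M where "M u = E0 - insert u (H u)" for u
  have "two_regular E0 M"
  proof
    fix v assume v: "v \<in> E0"
    have "card (insert v (H v)) = 3" using v H_subset(2)[of v] finite_H[of v] H_card[of v] by (simp add: E0_def)
    then show "card (M v) = 2"
      unfolding M_def using H_E0[OF v] v finite_H cards(3) by (subst card_Diff_subset) auto
  qed (use fins H_sym in \<open>auto simp: M_def E0_def\<close>)
  from two_regular.pentagon[OF this cards(3)]
  obtain c0 c1 c2 c3 c4 where pent: "distinct [c0, c1, c2, c3, c4]" "E0 = {c0, c1, c2, c3, c4}"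
    "M c0 = {c1, c4}" "M c1 = {c0, c2}" "M c2 = {c1, c3}" "M c3 = {c2, c4}" "M c4 = {c0, c3}" .
  have N_E0: "N v = {b, c, d} \<union> M v" if "v \<in> E0" for v
    using that H_E0[OF that] bV dV(1) unfolding N_eq M_def E0_eq by auto
  have Ns: "N c0 = {b, c, d} \<union> {c1, c4}" "N c1 = {b, c, d} \<union> {c0, c2}" "N c2 = {b, c, d} \<union> {c1, c3}"
    "N c3 = {b, c, d} \<union> {c2, c4}" "N c4 = {b, c, d} \<union> {c0, c3}"
    using N_E0 pent by auto
  have "b \<notin> E0" "c \<notin> E0" "d \<notin> E0" "b \<noteq> d" "c \<noteq> d" using E0_eq bc dV by auto
  moreover have "odd (x b)" "odd (x c)" "even (x d)" using bc dV by (auto simp: Od_def)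
  moreover have "even (x v)" if "v \<in> E0" for v using that by (auto simp: E0_def Od_def)
  moreover have "E0 \<subseteq> V" by (auto simp: E0_def)
  ultimately have "wheel b c d c0 c1 c2 c3 c4"
    unfolding wheel_def Nbcd Ns using pent(1,2) bc(2) bV dV(1) by auto
  then show False by (rule wheel_impossible)
qed

end

section \<open>Refuting all signatures of a graph\<close>

text \<open>Signs of a signature that is positive on a spanning tree; the list \<open>E\<close> contains the
  remaining edges.\<close>

fun edge_sign :: "(nat \<times> nat) list \<Rightarrow> int list \<Rightarrow> nat \<Rightarrow> nat \<Rightarrow> int" where
  "edge_sign ((p, q) # E) (s # S) i j = (if i = p \<and> j = q \<or> i = q \<and> j = p then s else edge_sign E S i j)"
| "edge_sign _ _ i j = 1"

fun sign_lists :: "nat \<Rightarrow> int list list" where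
  "sign_lists 0 = [[]]"
| "sign_lists (Suc n) = map ((#) 1) (sign_lists n) @ map ((#) (- 1)) (sign_lists n)"

definition row_value :: "(nat \<times> nat) list \<Rightarrow> nat list list \<Rightarrow> int list \<Rightarrow> int list \<Rightarrow> nat \<Rightarrow> int" where
  "row_value E nb S y i = sum_list (map (\<lambda>j. edge_sign E S i j * y ! j) (nb ! i))"

text \<open>A vector refutes the nut property if its image under the matrix is supported on a single vertex,
  because the image is orthogonal to the kernel, which would then vanish at this vertex, or if it is a
  non-zero kernel vector with a zero entry.\<close>

definition refutes :: "(nat \<times> nat) list \<Rightarrow> nat list list \<Rightarrow> int list \<Rightarrow> int list \<Rightarrow> bool" where
  "refutes E nb S y \<longleftrightarrow> length y = length nb \<and>
     (let k = length (filter (\<lambda>r. r \<noteq> 0) (map (row_value E nb S y) [0..<length nb]))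
      in k = 1 \<or> k = 0 \<and> 0 \<in> set y \<and> \<not> list_all (\<lambda>r. r = 0) y)"

text \<open>The first neighbour in each list is the parent in a spanning tree, rooted at vertex 0. The vectors
  \<open>ys\<close> correspond to the signatures of the edges outside the tree, in the order of
  \<open>sign_lists\<close>.\<close>

definition refuted :: "nat list list \<Rightarrow> (nat \<times> nat) list \<Rightarrow> int list list \<Rightarrow> bool" where
  "refuted nb E ys \<longleftrightarrow>
     list_all (\<lambda>i. i = 0 \<or> nb ! i \<noteq> [] \<and> hd (nb ! i) < i) [0..<length nb] \<and>
     list_all (\<lambda>i. distinct (nb ! i) \<and> list_all (\<lambda>j. j < length nb \<and>
        ((i, j) \<in> set E \<or> (j, i) \<in> set E \<or>
         0 < i \<and> j = hd (nb ! i) \<or> 0 < j \<and> i = hd (nb ! j))) (nb ! i)) [0..<length nb] \<and>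
     list_all (\<lambda>(i, j). i < length nb \<and> j \<in> set (nb ! i)) E \<and>
     list_all2 (refutes E nb) (sign_lists (length E)) ys"

lemma sign_lists_complete:
  "(\<And>s. s \<in> set S \<Longrightarrow> s = 1 \<or> s = - 1) \<Longrightarrow> S \<in> set (sign_lists (length S))"
proof (induction S)
  case (Cons s S)
  then have "S \<in> set (sign_lists (length S))" "s = 1 \<or> s = - 1" by auto
  then show ?case by auto
qed simp

lemma edge_sign_map:
  assumes "\<And>p q. f p q = f q p"
  shows "edge_sign E (map (\<lambda>(p, q). f p q) E) i j = (if (i, j) \<in> set E \<or> (j, i) \<in> set E then f i j else 1)"
proof (induction E)
  case (Cons e E)
  obtain p q where "e = (p, q)" by (cases e)
  moreover have "f q p = f p q" by (rule assms)
  ultimately show ?case using Cons.IH by auto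
qed simp

text \<open>Switching along the tree, from the root upwards, makes all tree edges positive, so the table
  covers every signature.\<close>

lemma (in nut_matrix) not_refuted:
  assumes ref: "refuted nb E ys"
    and vs: "distinct vs" "set vs = V" "length vs = length nb"
    and nbrs: "\<And>i. i < length nb \<Longrightarrow> N (vs ! i) = (!) vs ` set (nb ! i)"
  shows False
proof -
  define n where "n = length nb"
  have parent: "nb ! i \<noteq> []" "hd (nb ! i) < i" if "0 < i" "i < n" for i
  proof -
    have "\<forall>i\<in>{0..<n}. i = 0 \<or> nb ! i \<noteq> [] \<and> hd (nb ! i) < i"
      using ref by (simp add: refuted_def list_all_iff n_def)
    then have "i = 0 \<or> nb ! i \<noteq> [] \<and> hd (nb ! i) < i" by (rule bspec) (use that in simp)
    then show "nb ! i \<noteq> []" "hd (nb ! i) < i" using that by auto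
  qed
  have nb: "distinct (nb ! i)" "\<And>j. j \<in> set (nb ! i) \<Longrightarrow> j < n"
    "\<And>j. j \<in> set (nb ! i) \<Longrightarrow> (i, j) \<in> set E \<or> (j, i) \<in> set E \<or>
      0 < i \<and> j = hd (nb ! i) \<or> 0 < j \<and> i = hd (nb ! j)" if "i < n" for i
    using ref that by (auto simp: refuted_def list_all_iff n_def)
  have cotree: "i < n" "j \<in> set (nb ! i)" if "(i, j) \<in> set E" for i j
    using ref that by (auto simp: refuted_def list_all_iff n_def)
  have bij: "bij_betw ((!) vs) {..<n} V" using bij_betw_nth[of vs "{..<n}" V] vs by (simp add: n_def)
  have vs_V: "vs ! i \<in> V" if "i < n" for i using that bij by (auto simp: bij_betw_def)
  have inj: "vs ! i = vs ! j \<longleftrightarrow> i = j" if "i < n" "j < n" for i j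
    using that vs by (simp add: nth_eq_iff_index_eq n_def)
  define b where "b i j = a (vs ! i) (vs ! j)" for i j
  have b_sym: "b i j = b j i" for i j by (simp add: b_def sym)
  have b_zero: "b i j \<noteq> 0 \<longleftrightarrow> j \<in> set (nb ! i)" if "i < n" "j < n" for i j
  proof -
    have "b i j \<noteq> 0 \<longleftrightarrow> vs ! j \<in> N (vs ! i)" using vs_V that by (simp add: b_def nbrs_def)
    then show ?thesis using nbrs[of i] that nb(2) inj by (auto simp: n_def)
  qed
  have b_one: "b i j = 1 \<or> b i j = - 1" if "i < n" "j \<in> set (nb ! i)" for i j
    using b_zero[of i j] nb(2) that entry[of "vs ! i" "vs ! j"] by (auto simp: b_def)
  \<comment> \<open>switch so that the spanning tree becomes positive\<close>
  have "\<exists>d. (\<forall>i. d i = 1 \<or> d i = - 1) \<and> (\<forall>i<m. 0 < i \<longrightarrow> d i * d (hd (nb ! i)) * b i (hd (nb ! i)) = (1::int))" if "m \<le> n" for m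
    using that
  proof (induction m)
    case (Suc m)
    then obtain d where d: "\<And>i. d i = 1 \<or> d i = - 1"
      "\<And>i. i < m \<Longrightarrow> 0 < i \<Longrightarrow> d i * d (hd (nb ! i)) * b i (hd (nb ! i)) = (1::int)" by auto
    define h where "h = hd (nb ! m)"
    define d' where "d' = (if m = 0 then d else d(m := d h * b m h))"
    show ?case
    proof (cases "m = 0")
      case False
      have h: "h < m" "h \<in> set (nb ! m)" using parent[of m] False Suc.prems by (auto simp: h_def)
      have bh: "b m h = 1 \<or> b m h = - 1" using b_one h Suc.prems by auto
      have "d' i * d' (hd (nb ! i)) * b i (hd (nb ! i)) = 1" if "i < Suc m" "0 < i" for i
      proof (cases "i = m")
        case True
        then show ?thesis using h(1) bh d(1)[of h] False by (auto simp: d'_def h_def)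
      next
        case False
        then have "hd (nb ! i) < m" using parent[of i] that Suc.prems by auto
        then show ?thesis using False that d(2)[of i] by (auto simp: d'_def)
      qed
      moreover have "d' i = 1 \<or> d' i = - 1" for i using d(1)[of i] d(1)[of h] bh by (auto simp: d'_def)
      ultimately show ?thesis by blast
    qed (use d in auto)
  qed (auto intro: exI[of _ "\<lambda>_. 1"])
  from this[of n] obtain d where d: "\<And>i. d i = 1 \<or> d i = - 1"
    "\<And>i. i < n \<Longrightarrow> 0 < i \<Longrightarrow> d i * d (hd (nb ! i)) * b i (hd (nb ! i)) = (1::int)" by auto
  define f where "f i j = d i * d j * b i j" for i j
  have f_sym: "f i j = f j i" for i j by (simp add: f_def b_sym)
  define S where "S = map (\<lambda>(p, q). f p q) E"
  have "s = 1 \<or> s = - 1" if s: "s \<in> set S" for s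
  proof -
    obtain i j where "(i, j) \<in> set E" "s = f i j" using s by (auto simp: S_def)
    then show ?thesis using cotree[of i j] b_one[of i j] d(1)[of i] d(1)[of j] by (auto simp: f_def)
  qed
  then have "S \<in> set (sign_lists (length E))" using sign_lists_complete[of S] by (simp add: S_def)
  moreover have "list_all2 (refutes E nb) (sign_lists (length E)) ys" using ref by (simp add: refuted_def)
  ultimately obtain y where y: "refutes E nb S y" by (auto simp: list_all2_conv_all_nth in_set_conv_nth)
  have es: "edge_sign E S i j = f i j" if i: "i < n" and j: "j \<in> set (nb ! i)" for i j
  proof (cases "(i, j) \<in> set E \<or> (j, i) \<in> set E")
    case True
    then show ?thesis using edge_sign_map[of f E i j] f_sym by (simp add: S_def)
  next
    case False
    have jn: "j < n" using nb(2)[OF i j] .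
    have "(0 < i \<and> j = hd (nb ! i)) \<or> (0 < j \<and> i = hd (nb ! j))"
      using nb(3)[OF i j] False by blast
    then have "f i j = 1"
    proof (elim disjE conjE)
      assume "0 < i" "j = hd (nb ! i)"
      then show ?thesis using d(2)[OF i] by (simp add: f_def)
    next
      assume "0 < j" "i = hd (nb ! j)"
      then show ?thesis using d(2)[OF jn] f_sym[of i j] by (simp add: f_def)
    qed
    then show ?thesis using edge_sign_map[of f E i j] f_sym False by (simp add: S_def)
  qed
  define idx where "idx = the_inv_into {..<n} ((!) vs)"
  have idx: "idx (vs ! i) = i" if "i < n" for i
    using that bij by (simp add: idx_def the_inv_into_f_f bij_betw_def)
  define Y where "Y v = d (idx v) * y ! idx v" for v
  have rowY: "(\<Sum>v\<in>V. a (vs ! i) v * Y v) = d i * row_value E nb S y i" if i: "i < n" for i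
  proof -
    have "(\<Sum>v\<in>V. a (vs ! i) v * Y v) = (\<Sum>j<n. b i j * (d j * y ! j))"
      using sum.reindex_bij_betw[OF bij, of "\<lambda>v. a (vs ! i) v * Y v"] idx by (simp add: b_def Y_def)
    also have "\<dots> = (\<Sum>j\<in>set (nb ! i). b i j * (d j * y ! j))"
      using nb(2)[OF i] b_zero[OF i] by (intro sum.mono_neutral_right) auto
    also have "\<dots> = (\<Sum>j\<in>set (nb ! i). d i * (edge_sign E S i j * y ! j))"
    proof (rule sum.cong)
      fix j assume "j \<in> set (nb ! i)"
      then have "edge_sign E S i j = d i * d j * b i j" using es[OF i] by (simp add: f_def)
      then show "b i j * (d j * y ! j) = d i * (edge_sign E S i j * y ! j)" using d(1)[of i] by auto
    qed simp
    also have "\<dots> = d i * row_value E nb S y i"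
      using nb(1)[OF i] by (simp add: row_value_def sum_list_distinct_conv_sum_set sum_distrib_left)
    finally show ?thesis .
  qed
  define r where "r i = row_value E nb S y i" for i
  have "length (filter (\<lambda>r. r \<noteq> 0) (map (row_value E nb S y) [0..<n])) = card {i. i < n \<and> r i \<noteq> 0}"
    unfolding length_filter_conv_card by (rule arg_cong[of _ _ card]) (auto simp: r_def)
  then have cases: "length y = n" "card {i. i < n \<and> r i \<noteq> 0} = 1 \<or>
      card {i. i < n \<and> r i \<noteq> 0} = 0 \<and> 0 \<in> set y \<and> (\<exists>k\<in>set y. k \<noteq> 0)"
    using y by (auto simp: refutes_def Let_def n_def list_all_iff)
  show False
  proof (cases "card {i. i < n \<and> r i \<noteq> 0} = 1")
    case True
    then obtain k where k: "{i. i < n \<and> r i \<noteq> 0} = {k}" by (auto simp: card_1_singleton_iff)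
    have "0 = (\<Sum>v\<in>V. (\<Sum>u\<in>V. a v u * x u) * Y v)" using ker by simp
    also have "\<dots> = (\<Sum>u\<in>V. x u * (\<Sum>v\<in>V. a u v * Y v))"
      unfolding sum_distrib_left sum_distrib_right
      by (subst sum.swap) (intro sum.cong refl, simp add: sym mult_ac)
    also have "\<dots> = (\<Sum>i<n. x (vs ! i) * (d i * r i))"
      using sum.reindex_bij_betw[OF bij, of "\<lambda>u. x u * (\<Sum>v\<in>V. a u v * Y v)"] rowY by (simp add: r_def)
    also have "\<dots> = (\<Sum>i\<in>{k}. x (vs ! i) * (d i * r i))"
      using k by (intro sum.mono_neutral_right) auto
    finally have "x (vs ! k) * (d k * r k) = 0" by simp
    moreover have "k < n" "r k \<noteq> 0" using k by auto
    ultimately show False using full[OF vs_V[of k]] d(1)[of k] by auto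
  next
    case False
    then have zero: "r i = 0" if "i < n" for i using cases(2) that by auto
    obtain j k where jk: "j < n" "y ! j = 0" "k < n" "y ! k \<noteq> 0"
      using False cases by (auto simp: in_set_conv_nth)
    have "(\<Sum>v\<in>V. a u v * Y v) = 0" if u: "u \<in> V" for u
    proof -
      obtain i where "i < n" "u = vs ! i" using u bij by (auto simp: bij_betw_def)
      then show ?thesis using rowY[of i] zero[of i] by (simp add: r_def)
    qed
    then have "Y (vs ! k) = 0" using uniq[of Y "vs ! j" "vs ! k"] vs_V jk idx by (simp add: Y_def)
    then show False using jk idx d(1)[of k] by (auto simp: Y_def)
  qed
qed

text \<open>Eight cubic graphs of order ten, the last one being the Petersen graph. Each has six edges outside
  a spanning tree and therefore 64 signatures up to switching.\<close>

lemma refuted_cubic_graph_A: "refuted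
  [[1, 2, 3], [0, 2, 3], [0, 1, 4], [0, 1, 5], [2, 5, 6], [3, 4, 7], [4, 8, 9], [5, 8, 9], [6, 7, 9], [6, 7, 8]]
  [(1, 2), (1, 3), (4, 5), (7, 8), (7, 9), (8, 9)]
  [[0, 0, 1, -1, 0, 0, -1, 1, 0, 0], [0, 0, 1, -1, 0, 0, -1, 1, 0, 0],
   [0, 0, -1, 1, 0, 0, 1, -1, 0, 0], [0, 0, -1, 1, 0, 0, 1, -1, 0, 0],
   [0, 0, -1, 1, 0, 0, 1, -1, 0, 0], [0, 0, -1, 1, 0, 0, 1, -1, 0, 0],
   [0, 0, -1, 1, 0, 0, 1, 1, 0, 0], [0, 0, -1, 1, 0, 0, 1, 1, 0, 0],
   [0, 0, 1, -1, 0, 0, -1, 1, 0, 0], [0, 0, 1, -1, 0, 0, -1, 1, 0, 0],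
   [0, 0, -1, 1, 0, 0, 1, -1, 0, 0], [0, 0, -1, 1, 0, 0, 1, -1, 0, 0],
   [0, 0, -1, 1, 0, 0, 1, -1, 0, 0], [0, 0, -1, 1, 0, 0, 1, -1, 0, 0],
   [0, 0, -1, 1, 0, 0, 1, 1, 0, 0], [0, 0, -1, 1, 0, 0, 1, 1, 0, 0],
   [0, 0, 1, -1, 0, 0, -1, 1, 0, 0], [0, 0, 1, -1, 0, 0, -1, 1, 0, 0],
   [1, -1, 0, 1, 0, -2, 2, -1, 1, -1], [-1, -1, 1, 0, 2, 0, -1, 0, -1, -1],
   [1, -1, 0, 1, 0, -2, 2, -1, -1, 1], [-1, -1, 1, 0, 2, 0, -1, 0, -1, -1],
   [0, 0, 1, 1, 0, 0, -1, -1, 0, 0], [0, 0, 1, 1, 0, 0, -1, -1, 0, 0],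
   [0, 0, 1, -1, 0, 0, -1, 1, 0, 0], [0, 0, 1, -1, 0, 0, -1, 1, 0, 0],
   [-1, 1, 0, -1, 0, 2, 2, 1, -1, 1], [1, -1, 0, 1, 0, -2, 0, -1, 1, -1],
   [-1, 1, 0, -1, 0, 2, 2, 1, 1, -1], [1, -1, 0, 1, 0, -2, 0, -1, -1, 1],
   [0, 0, 1, 1, 0, 0, -1, -1, 0, 0], [0, 0, 1, 1, 0, 0, -1, -1, 0, 0],
   [0, 0, -1, 1, 0, 0, 1, -1, 0, 0], [0, 0, -1, 1, 0, 0, 1, -1, 0, 0],
   [-1, -1, 0, 1, 0, 2, 0, -1, -1, 1], [-1, 1, -1, 0, 2, 0, 1, -2, -1, -1],
   [-1, -1, 0, 1, 0, 2, 0, -1, 1, -1], [-1, 1, -1, 0, 2, 0, 1, -2, -1, -1],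
   [0, 0, 1, 1, 0, 0, -1, -1, 0, 0], [0, 0, 1, 1, 0, 0, -1, -1, 0, 0],
   [0, 0, -1, 1, 0, 0, 1, -1, 0, 0], [0, 0, -1, 1, 0, 0, 1, -1, 0, 0],
   [1, -1, 1, 0, -2, 0, -1, 0, 1, 1], [-1, -1, 0, 1, 0, 2, 2, -1, -1, 1],
   [1, -1, 1, 0, -2, 0, -1, 0, 1, 1], [-1, -1, 0, 1, 0, 2, 2, -1, 1, -1],
   [0, 0, 1, 1, 0, 0, -1, -1, 0, 0], [0, 0, 1, 1, 0, 0, -1, -1, 0, 0],
   [0, 0, 1, -1, 0, 0, -1, 1, 0, 0], [0, 0, 1, -1, 0, 0, -1, 1, 0, 0],
   [0, 0, -1, 1, 0, 0, 1, -1, 0, 0], [0, 0, -1, 1, 0, 0, 1, -1, 0, 0],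
   [0, 0, -1, 1, 0, 0, 1, -1, 0, 0], [0, 0, -1, 1, 0, 0, 1, -1, 0, 0],
   [0, 0, -1, 1, 0, 0, 1, 1, 0, 0], [0, 0, -1, 1, 0, 0, 1, 1, 0, 0],
   [0, 0, 1, -1, 0, 0, -1, 1, 0, 0], [0, 0, 1, -1, 0, 0, -1, 1, 0, 0],
   [0, 0, -1, 1, 0, 0, 1, -1, 0, 0], [0, 0, -1, 1, 0, 0, 1, -1, 0, 0],
   [0, 0, -1, 1, 0, 0, 1, -1, 0, 0], [0, 0, -1, 1, 0, 0, 1, -1, 0, 0],
   [0, 0, -1, 1, 0, 0, 1, 1, 0, 0], [0, 0, -1, 1, 0, 0, 1, 1, 0, 0]]"
  by code_simp

lemma (in nut_matrix) no_cubic_graph_A: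
  assumes "card V = 10" "set [v0, v1, v2, v3, v4, v5, v6, v7, v8, v9] = V"
    "N v0 = {v1, v2, v3}" "N v1 = {v0, v2, v3}" "N v2 = {v0, v1, v4}" "N v3 = {v0, v1, v5}" "N v4 = {v2, v5, v6}"
    "N v5 = {v3, v4, v7}" "N v6 = {v4, v8, v9}" "N v7 = {v5, v8, v9}" "N v8 = {v6, v7, v9}" "N v9 = {v6, v7, v8}"
  shows False
proof (rule not_refuted[OF refuted_cubic_graph_A _ assms(2)])
  show "distinct [v0, v1, v2, v3, v4, v5, v6, v7, v8, v9]" by (rule card_distinct) (simp only: assms(1,2), simp)
next
  fix i :: nat assume "i < length [[1, 2, 3], [0, 2, 3], [0, 1, 4], [0, 1, 5], [2, 5, 6], [3, 4, 7], [4, 8, 9], [5, 8, 9], [6, 7, 9], [6, 7, 8]]"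
  then have "i = 0 \<or> i = 1 \<or> i = 2 \<or> i = 3 \<or> i = 4 \<or> i = 5 \<or> i = 6 \<or> i = 7 \<or> i = 8 \<or> i = 9" by auto
  then show "N ([v0, v1, v2, v3, v4, v5, v6, v7, v8, v9] ! i) = (!) [v0, v1, v2, v3, v4, v5, v6, v7, v8, v9] ` set ([[1, 2, 3], [0, 2, 3], [0, 1, 4], [0, 1, 5], [2, 5, 6], [3, 4, 7], [4, 8, 9], [5, 8, 9], [6, 7, 9], [6, 7, 8]] ! i)"
    using assms(3-12) by (elim disjE) simp_all
qed simp

lemma refuted_cubic_graph_B: "refuted
  [[1, 2, 3], [0, 2, 3], [0, 1, 4], [0, 1, 5], [2, 6, 7], [3, 8, 9], [4, 7, 8], [4, 6, 9], [5, 6, 9], [5, 7, 8]]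
  [(1, 2), (1, 3), (6, 7), (6, 8), (7, 9), (8, 9)]
  [[0, 0, 0, 0, 0, 0, 1, -1, 1, -1], [0, 0, -1, 1, 0, 0, 0, 1, -1, 0],
   [0, 0, -1, 1, 0, 0, 1, 0, 0, -1], [0, 0, -1, 1, 0, 0, 1, 0, 0, 1],
   [0, 0, -1, 1, 0, 0, 0, 1, -1, 0], [0, 0, -1, 1, 0, 0, 0, 1, 1, 0],
   [0, 0, -1, 1, 0, 0, 0, 1, 1, 0], [0, 0, -1, 1, 0, 0, 0, 1, -1, 0],
   [0, 0, 1, -1, 0, 0, -1, 0, 0, 1], [0, 0, -1, 1, 0, 0, 0, 1, 1, 0],
   [0, 0, -1, 1, 0, 0, 0, 1, 1, 0], [0, 0, -1, 1, 0, 0, 1, 0, 0, -1],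
   [0, 0, -1, 1, 0, 0, 1, 0, 0, 1], [0, 0, -1, 1, 0, 0, 0, 1, -1, 0],
   [0, 0, 1, -1, 0, 0, -1, 0, 0, 1], [0, 0, 0, 0, 0, 0, 1, -1, 1, -1],
   [0, 0, 0, 0, 0, 0, -1, 1, -1, 1], [-2, -1, 4, 2, 3, 1, -2, -2, -1, -1],
   [1, -1, 0, 1, 0, -2, 1, -1, 1, 1], [0, 0, 0, 0, 0, 0, 1, -1, 1, 1],
   [1, -1, 0, 1, 0, -2, -1, 1, 1, 1], [0, 0, 0, 0, 0, 0, -1, 1, 1, 1],
   [0, 0, 0, 0, 0, 0, 1, -1, -1, 1], [-1, -2, 4, -2, 3, -1, -2, -2, 1, 1],
   [-2, 3, 6, 4, -1, 5, -3, -3, -2, -2], [0, 0, 0, 0, 0, 0, 1, -1, -1, 1],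
   [0, 0, 0, 0, 0, 0, -1, 1, 1, 1], [-1, -1, 1, 0, 2, 0, 1, 1, -1, 1],
   [0, 0, 0, 0, 0, 0, 1, -1, 1, 1], [-1, -1, 1, 0, 2, 0, 1, 1, 1, -1],
   [2, 3, 4, 6, -5, 1, -2, -2, -3, -3], [0, 0, 0, 0, 0, 0, -1, 1, -1, 1],
   [0, 0, -1, 1, 0, 0, 0, 1, -1, 0], [-2, 3, 4, 6, 5, -1, -2, -2, -3, -3],
   [1, -1, 1, 0, -2, 0, 1, 1, 1, -1], [0, 0, -1, 1, 0, 0, 0, 1, -1, 0],
   [1, -1, 1, 0, -2, 0, 1, 1, -1, 1], [0, 0, -1, 1, 0, 0, 1, 0, 0, -1],
   [0, 0, 0, 0, 0, 0, 1, -1, -1, 1], [2, 3, 6, 4, 1, -5, -3, -3, -2, -2],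
   [-2, -1, 2, 4, 1, 3, -1, -1, -2, -2], [0, 0, 0, 0, 0, 0, 1, -1, -1, 1],
   [0, 0, -1, 1, 0, 0, 1, 0, 0, -1], [-1, -1, 0, 1, 0, 2, -1, 1, 1, 1],
   [0, 0, -1, 1, 0, 0, 0, 1, -1, 0], [-1, -1, 0, 1, 0, 2, 1, -1, 1, 1],
   [-1, -2, -2, 4, -1, 3, 1, 1, -2, -2], [0, 0, -1, 1, 0, 0, 0, 1, -1, 0],
   [0, 0, 0, 0, 0, 0, 1, -1, 1, -1], [0, 0, -1, 1, 0, 0, 0, 1, -1, 0],
   [0, 0, -1, 1, 0, 0, 1, 0, 0, -1], [0, 0, -1, 1, 0, 0, 1, 0, 0, 1],
   [0, 0, -1, 1, 0, 0, 0, 1, -1, 0], [0, 0, -1, 1, 0, 0, 0, 1, 1, 0],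
   [0, 0, -1, 1, 0, 0, 0, 1, 1, 0], [0, 0, -1, 1, 0, 0, 0, 1, -1, 0],
   [0, 0, 1, -1, 0, 0, -1, 0, 0, 1], [0, 0, -1, 1, 0, 0, 0, 1, 1, 0],
   [0, 0, -1, 1, 0, 0, 0, 1, 1, 0], [0, 0, -1, 1, 0, 0, 1, 0, 0, -1],
   [0, 0, -1, 1, 0, 0, 1, 0, 0, 1], [0, 0, -1, 1, 0, 0, 0, 1, -1, 0],
   [0, 0, 1, -1, 0, 0, -1, 0, 0, 1], [0, 0, 0, 0, 0, 0, 1, -1, 1, -1]]"
  by code_simp

lemma (in nut_matrix) no_cubic_graph_B:
  assumes "card V = 10" "set [v0, v1, v2, v3, v4, v5, v6, v7, v8, v9] = V"
    "N v0 = {v1, v2, v3}" "N v1 = {v0, v2, v3}" "N v2 = {v0, v1, v4}" "N v3 = {v0, v1, v5}" "N v4 = {v2, v6, v7}"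
    "N v5 = {v3, v8, v9}" "N v6 = {v4, v7, v8}" "N v7 = {v4, v6, v9}" "N v8 = {v5, v6, v9}" "N v9 = {v5, v7, v8}"
  shows False
proof (rule not_refuted[OF refuted_cubic_graph_B _ assms(2)])
  show "distinct [v0, v1, v2, v3, v4, v5, v6, v7, v8, v9]" by (rule card_distinct) (simp only: assms(1,2), simp)
next
  fix i :: nat assume "i < length [[1, 2, 3], [0, 2, 3], [0, 1, 4], [0, 1, 5], [2, 6, 7], [3, 8, 9], [4, 7, 8], [4, 6, 9], [5, 6, 9], [5, 7, 8]]"
  then have "i = 0 \<or> i = 1 \<or> i = 2 \<or> i = 3 \<or> i = 4 \<or> i = 5 \<or> i = 6 \<or> i = 7 \<or> i = 8 \<or> i = 9" by auto
  then show "N ([v0, v1, v2, v3, v4, v5, v6, v7, v8, v9] ! i) = (!) [v0, v1, v2, v3, v4, v5, v6, v7, v8, v9] ` set ([[1, 2, 3], [0, 2, 3], [0, 1, 4], [0, 1, 5], [2, 6, 7], [3, 8, 9], [4, 7, 8], [4, 6, 9], [5, 6, 9], [5, 7, 8]] ! i)"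
    using assms(3-12) by (elim disjE) simp_all
qed simp

lemma refuted_cubic_graph_C: "refuted
  [[1, 2, 3], [0, 2, 4], [0, 1, 5], [0, 4, 6], [1, 3, 7], [2, 6, 8], [3, 5, 9], [4, 8, 9], [5, 7, 9], [6, 7, 8]]
  [(1, 2), (3, 4), (5, 6), (7, 8), (7, 9), (8, 9)]
  [[1, 0, 0, 0, -1, -1, 0, 0, 0, 1], [-1, 0, 0, 0, 1, 1, 0, 0, 0, -1],
   [-1, 0, 0, 0, 1, 1, 0, 0, 0, -1], [-1, 0, 0, 0, 1, 1, 0, 0, 0, 1],
   [0, 0, 0, 0, 1, 0, -1, 0, 1, 0], [-1, 0, 0, 0, 1, 1, 0, 0, 0, -1],
   [0, 0, 0, 0, 1, 0, -1, 0, 1, 0], [-1, 0, 0, 0, 1, 1, 0, 0, 0, 1],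
   [0, -1, 0, 1, 0, 1, 0, 0, 0, 0], [0, -1, 0, 1, 0, 1, 0, 0, 0, 0],
   [0, -1, 0, 1, 0, 1, 0, 0, 0, 0], [0, -1, 0, 1, 0, 1, 0, 0, 0, 0],
   [0, -1, 0, 1, 0, 1, 0, 0, 0, 0], [0, -1, 0, 1, 0, 1, 0, 0, 0, 0],
   [0, -1, 0, 1, 0, 1, 0, 0, 0, 0], [0, -1, 0, 1, 0, 1, 0, 0, 0, 0],
   [0, 0, 0, 0, 1, 0, 1, 0, -1, 0], [-1, 0, 1, -1, 0, 1, 1, -1, 0, 0],
   [0, 0, 0, 0, 1, 0, 1, 0, -1, 0], [0, 0, -1, 1, 1, 0, 1, 1, 0, 1],
   [1, 0, 0, 0, -1, -1, 0, 0, 0, 1], [0, 0, -1, 1, 1, 0, 1, 1, 0, -1],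
   [1, 0, 0, 0, 1, -1, 0, 0, 0, 1], [0, 0, -1, 1, 1, 0, 1, 1, 0, -1],
   [0, 0, 1, -1, -1, 0, 1, -1, 0, 1], [1, 0, 0, 0, 1, -1, 0, 0, 0, -1],
   [-2, -3, 1, 2, 1, 5, 3, 5, 2, 3], [1, 0, 0, 0, -1, -1, 0, 0, 0, -1],
   [1, 0, -1, 1, 0, 1, -1, 1, 0, 0], [0, 0, 0, 0, 1, 0, 1, 0, 1, 0],
   [-1, 0, 1, 1, 0, 1, 1, 1, 0, 0], [0, 0, 0, 0, 1, 0, 1, 0, 1, 0],
   [0, 1, 0, -1, 0, 1, 0, 0, 0, 0], [0, 1, 0, -1, 0, 1, 0, 0, 0, 0],
   [0, 1, 0, -1, 0, 1, 0, 0, 0, 0], [0, 1, 0, -1, 0, 1, 0, 0, 0, 0],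
   [0, 0, 0, 0, 1, 0, -1, 0, 1, 0], [0, 1, 0, -1, 0, 1, 0, 0, 0, 0],
   [0, 0, 0, 0, 1, 0, -1, 0, 1, 0], [0, 1, 0, -1, 0, 1, 0, 0, 0, 0],
   [1, 0, 0, 0, -1, -1, 0, 0, 0, 1], [0, 0, 0, 0, 1, 0, -1, 0, -1, 0],
   [-1, 0, 0, 0, 1, 1, 0, 0, 0, 1], [0, 0, 0, 0, 1, 0, -1, 0, -1, 0],
   [1, 0, 0, 0, -1, -1, 0, 0, 0, 1], [-1, 0, 0, 0, 1, 1, 0, 0, 0, 1],
   [-1, 0, 0, 0, 1, 1, 0, 0, 0, 1], [-1, 0, 0, 0, 1, 1, 0, 0, 0, 1],
   [0, 0, 0, 0, 1, 0, 1, 0, -1, 0], [1, 0, 1, 1, 0, -1, -1, 1, 0, 0],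
   [0, 0, 0, 0, 1, 0, 1, 0, -1, 0], [1, 0, 1, -1, 0, 1, -1, -1, 0, 0],
   [1, 0, 0, 0, -1, -1, 0, 0, 0, 1], [-2, 3, -1, -2, 1, 5, 3, -5, -2, -3],
   [1, 0, 0, 0, 1, -1, 0, 0, 0, 1], [-1, 0, -1, 1, 0, 1, 1, 1, 0, 0],
   [0, 0, 1, -1, 1, 0, 1, -1, 0, 1], [1, 0, 0, 0, 1, -1, 0, 0, 0, -1],
   [0, 0, 1, -1, 1, 0, 1, -1, 0, 1], [1, 0, 0, 0, -1, -1, 0, 0, 0, -1],
   [0, 0, -1, 1, -1, 0, -1, 1, 0, 1], [0, 0, 0, 0, 1, 0, 1, 0, 1, 0],
   [0, 0, 1, -1, 1, 0, 1, 1, 0, 1], [0, 0, 0, 0, 1, 0, 1, 0, 1, 0]]"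
  by code_simp

lemma (in nut_matrix) no_cubic_graph_C:
  assumes "card V = 10" "set [v0, v1, v2, v3, v4, v5, v6, v7, v8, v9] = V"
    "N v0 = {v1, v2, v3}" "N v1 = {v0, v2, v4}" "N v2 = {v0, v1, v5}" "N v3 = {v0, v4, v6}" "N v4 = {v1, v3, v7}"
    "N v5 = {v2, v6, v8}" "N v6 = {v3, v5, v9}" "N v7 = {v4, v8, v9}" "N v8 = {v5, v7, v9}" "N v9 = {v6, v7, v8}"
  shows False
proof (rule not_refuted[OF refuted_cubic_graph_C _ assms(2)])
  show "distinct [v0, v1, v2, v3, v4, v5, v6, v7, v8, v9]" by (rule card_distinct) (simp only: assms(1,2), simp)
next
  fix i :: nat assume "i < length [[1, 2, 3], [0, 2, 4], [0, 1, 5], [0, 4, 6], [1, 3, 7], [2, 6, 8], [3, 5, 9], [4, 8, 9], [5, 7, 9], [6, 7, 8]]"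
  then have "i = 0 \<or> i = 1 \<or> i = 2 \<or> i = 3 \<or> i = 4 \<or> i = 5 \<or> i = 6 \<or> i = 7 \<or> i = 8 \<or> i = 9" by auto
  then show "N ([v0, v1, v2, v3, v4, v5, v6, v7, v8, v9] ! i) = (!) [v0, v1, v2, v3, v4, v5, v6, v7, v8, v9] ` set ([[1, 2, 3], [0, 2, 4], [0, 1, 5], [0, 4, 6], [1, 3, 7], [2, 6, 8], [3, 5, 9], [4, 8, 9], [5, 7, 9], [6, 7, 8]] ! i)"
    using assms(3-12) by (elim disjE) simp_all
qed simp

lemma refuted_cubic_graph_D: "refuted
  [[1, 2, 3], [0, 2, 4], [0, 1, 5], [0, 6, 7], [1, 6, 8], [2, 6, 9], [3, 4, 5], [3, 8, 9], [4, 7, 9], [5, 7, 8]]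
  [(1, 2), (4, 6), (5, 6), (7, 8), (7, 9), (8, 9)]
  [[-1, -1, -1, 2, 2, 2, 2, -1, -1, -1], [0, 1, 0, 1, 0, -1, 0, 0, -1, 0],
   [1, 0, 0, 0, 1, -1, 0, -1, 0, 0], [0, 0, -1, 1, 1, 0, 0, 0, 0, 1],
   [1, 0, 0, 0, -1, 1, 0, -1, 0, 0], [0, -1, 0, 1, 0, 1, 0, 0, 1, 0],
   [-1, 0, 0, 0, 1, 1, 0, 1, 0, 0], [-1, 0, 0, 0, 1, 1, 0, 1, 0, 0],
   [0, 0, 0, 0, 0, 0, -1, 1, 1, -1], [0, -1, 0, 1, 0, 1, 0, 0, 1, 0],
   [-1, 0, 0, 0, 1, 1, 0, 1, 0, 0], [-1, 0, 0, 0, 1, 1, 0, 1, 0, 0],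
   [-1, 0, 0, 0, 1, 1, 0, 1, 0, 0], [-1, 0, 0, 0, 1, 1, 0, 1, 0, 0],
   [-1, 0, 0, 0, 1, 1, 0, 1, 0, 0], [-1, 0, 0, 0, 1, 1, 0, 1, 0, 0],
   [0, 0, 0, 0, 0, 0, -1, 1, -1, 1], [0, 0, -1, 1, 1, 0, 0, 0, 0, 1],
   [-1, 0, 0, 0, 1, 1, 0, 1, 0, 0], [-1, 0, 0, 0, 1, 1, 0, 1, 0, 0],
   [-1, 0, 0, 0, 1, 1, 0, 1, 0, 0], [-1, 0, 0, 0, 1, 1, 0, 1, 0, 0],
   [-1, 0, 0, 0, 1, 1, 0, 1, 0, 0], [-1, 0, 0, 0, 1, 1, 0, 1, 0, 0],
   [-1, 1, 1, 0, 0, 0, 1, 0, 0, 0], [-1, 1, 1, 0, 0, 0, 1, 0, 0, 0],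
   [-1, 1, 1, 0, 0, 0, 1, 0, 0, 0], [-1, 1, 1, 0, 0, 0, 1, 0, 0, 0],
   [-1, 1, 1, 0, 0, 0, 1, 0, 0, 0], [-1, 1, 1, 0, 0, 0, 1, 0, 0, 0],
   [-1, 1, 1, 0, 0, 0, 1, 0, 0, 0], [-1, 1, 1, 0, 0, 0, 1, 0, 0, 0],
   [0, -1, 0, 1, 0, -1, 0, 0, 1, 0], [0, 0, 0, 0, 0, 0, -1, 1, 1, 1],
   [0, -1, 0, 1, 0, -1, 0, 0, 1, 0], [0, 0, 0, 0, 0, 0, 1, -1, -1, -1],
   [0, -1, 0, 1, 0, -1, 0, 0, 1, 0], [0, 0, 0, 0, 0, 0, 1, -1, -1, -1],
   [-1, 0, 0, 0, 1, 1, 0, 1, 0, 0], [-1, 0, 0, 0, 1, 1, 0, 1, 0, 0],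
   [0, 0, -1, 1, -1, 0, 0, 0, 0, 1], [0, 0, 0, 0, 0, 0, -1, 1, 1, -1],
   [-1, 0, 0, 0, 1, 1, 0, 1, 0, 0], [-1, 0, 0, 0, 1, 1, 0, 1, 0, 0],
   [-1, 0, 0, 0, 1, 1, 0, 1, 0, 0], [-1, 0, 0, 0, 1, 1, 0, 1, 0, 0],
   [-1, 0, 0, 0, 1, 1, 0, 1, 0, 0], [-1, 0, 0, 0, 1, 1, 0, 1, 0, 0],
   [0, -1, 0, 1, 0, -1, 0, 0, 1, 0], [0, 0, 0, 0, 0, 0, -1, 1, -1, 1],
   [-1, 0, 0, 0, 1, 1, 0, 1, 0, 0], [-1, 0, 0, 0, 1, 1, 0, 1, 0, 0],
   [-1, 0, 0, 0, 1, 1, 0, 1, 0, 0], [-1, 0, 0, 0, 1, 1, 0, 1, 0, 0],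
   [-1, 0, 0, 0, 1, 1, 0, 1, 0, 0], [-1, 0, 0, 0, 1, 1, 0, 1, 0, 0],
   [0, 1, 0, 1, 0, 1, 0, 0, -1, 0], [-2, -1, -1, 2, 1, 1, 1, 1, 2, 2],
   [0, 0, -1, 1, -1, 0, 0, 0, 0, 1], [1, 0, 0, 0, 1, -1, 0, -1, 0, 0],
   [0, -1, 0, 1, 0, -1, 0, 0, 1, 0], [1, 0, 0, 0, -1, 1, 0, -1, 0, 0],
   [1, 0, 0, 0, -1, -1, 0, -1, 0, 0], [0, -1, 0, 1, 0, 1, 0, 0, 1, 0]]"
  by code_simp

lemma (in nut_matrix) no_cubic_graph_D:
  assumes "card V = 10" "set [v0, v1, v2, v3, v4, v5, v6, v7, v8, v9] = V"
    "N v0 = {v1, v2, v3}" "N v1 = {v0, v2, v4}" "N v2 = {v0, v1, v5}" "N v3 = {v0, v6, v7}" "N v4 = {v1, v6, v8}"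
    "N v5 = {v2, v6, v9}" "N v6 = {v3, v4, v5}" "N v7 = {v3, v8, v9}" "N v8 = {v4, v7, v9}" "N v9 = {v5, v7, v8}"
  shows False
proof (rule not_refuted[OF refuted_cubic_graph_D _ assms(2)])
  show "distinct [v0, v1, v2, v3, v4, v5, v6, v7, v8, v9]" by (rule card_distinct) (simp only: assms(1,2), simp)
next
  fix i :: nat assume "i < length [[1, 2, 3], [0, 2, 4], [0, 1, 5], [0, 6, 7], [1, 6, 8], [2, 6, 9], [3, 4, 5], [3, 8, 9], [4, 7, 9], [5, 7, 8]]"
  then have "i = 0 \<or> i = 1 \<or> i = 2 \<or> i = 3 \<or> i = 4 \<or> i = 5 \<or> i = 6 \<or> i = 7 \<or> i = 8 \<or> i = 9" by auto
  then show "N ([v0, v1, v2, v3, v4, v5, v6, v7, v8, v9] ! i) = (!) [v0, v1, v2, v3, v4, v5, v6, v7, v8, v9] ` set ([[1, 2, 3], [0, 2, 4], [0, 1, 5], [0, 6, 7], [1, 6, 8], [2, 6, 9], [3, 4, 5], [3, 8, 9], [4, 7, 9], [5, 7, 8]] ! i)"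
    using assms(3-12) by (elim disjE) simp_all
qed simp

lemma refuted_cubic_graph_E: "refuted
  [[1, 2, 3], [0, 2, 4], [0, 1, 5], [0, 6, 7], [1, 6, 8], [2, 7, 9], [3, 4, 8], [3, 5, 9], [4, 6, 9], [5, 7, 8]]
  [(1, 2), (4, 6), (5, 7), (6, 8), (7, 9), (8, 9)]
  [[-2, 1, 1, 1, 1, 1, 1, 1, -2, -2], [0, 1, 0, 1, 0, -1, 0, 0, -1, 0],
   [0, 0, 1, -1, 1, 0, 0, 0, 0, -1], [0, 0, -1, 1, 1, 0, 0, 0, 0, 1],
   [0, 1, 0, -1, 0, 1, 0, 0, -1, 0], [0, -1, 0, 1, 0, 1, 0, 0, 1, 0],
   [0, 0, 1, -1, 1, 0, 0, 0, 0, -1], [0, -1, 0, 1, 0, 1, 0, 0, 1, 0],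
   [0, 1, 0, -1, 0, -1, 0, 0, 1, 0], [0, -1, 0, 1, 0, 1, 0, 0, 1, 0],
   [0, 0, 1, -1, 1, 0, 0, 0, 0, -1], [0, -1, 0, 1, 0, 1, 0, 0, 1, 0],
   [0, -1, 0, 1, 0, 1, 0, 0, 1, 0], [0, -1, 0, 1, 0, 1, 0, 0, 1, 0],
   [0, -1, 0, 1, 0, 1, 0, 0, 1, 0], [0, -1, 0, 1, 0, 1, 0, 0, 1, 0],
   [0, 0, 1, -1, -1, 0, 0, 0, 0, 1], [0, 0, -1, 1, 1, 0, 0, 0, 0, 1],
   [0, 0, -1, 1, 1, 0, 0, 0, 0, 1], [0, 0, -1, 1, 1, 0, 0, 0, 0, 1],
   [0, 0, 1, -1, -1, 0, 0, 0, 0, 1], [0, -1, 0, 1, 0, 1, 0, 0, 1, 0],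
   [0, 0, -1, 1, 1, 0, 0, 0, 0, 1], [0, -1, 0, 1, 0, 1, 0, 0, 1, 0],
   [0, 0, 1, -1, -1, 0, 0, 0, 0, 1], [0, -1, 0, 1, 0, 1, 0, 0, 1, 0],
   [0, 0, -1, 1, 1, 0, 0, 0, 0, 1], [0, -1, 0, 1, 0, 1, 0, 0, 1, 0],
   [0, -1, 0, 1, 0, 1, 0, 0, 1, 0], [0, -1, 0, 1, 0, 1, 0, 0, 1, 0],
   [0, -1, 0, 1, 0, 1, 0, 0, 1, 0], [0, -1, 0, 1, 0, 1, 0, 0, 1, 0],
   [0, -1, 0, 1, 0, -1, 0, 0, 1, 0], [0, 0, 1, -1, 1, 0, 0, 0, 0, 1],
   [0, -1, 0, 1, 0, -1, 0, 0, 1, 0], [0, 0, 1, -1, 1, 0, 0, 0, 0, -1],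
   [0, -1, 0, 1, 0, -1, 0, 0, 1, 0], [0, 0, 1, -1, 1, 0, 0, 0, 0, 1],
   [0, -1, 0, 1, 0, -1, 0, 0, 1, 0], [0, 0, 1, -1, 1, 0, 0, 0, 0, -1],
   [0, 0, -1, 1, -1, 0, 0, 0, 0, 1], [0, 0, 1, -1, 1, 0, 0, 0, 0, 1],
   [0, 0, -1, 1, -1, 0, 0, 0, 0, 1], [0, 0, 1, -1, 1, 0, 0, 0, 0, -1],
   [0, -1, 0, 1, 0, -1, 0, 0, 1, 0], [0, -1, 0, 1, 0, 1, 0, 0, 1, 0],
   [0, -1, 0, 1, 0, -1, 0, 0, 1, 0], [0, -1, 0, 1, 0, 1, 0, 0, 1, 0],
   [0, -1, 0, 1, 0, -1, 0, 0, 1, 0], [0, 1, 0, -1, 0, 1, 0, 0, 1, 0],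
   [0, -1, 0, 1, 0, -1, 0, 0, 1, 0], [0, 0, -1, 1, 1, 0, 0, 0, 0, 1],
   [0, -1, 0, 1, 0, -1, 0, 0, 1, 0], [0, 1, 0, -1, 0, 1, 0, 0, -1, 0],
   [0, -1, 0, 1, 0, -1, 0, 0, 1, 0], [0, 0, -1, 1, 1, 0, 0, 0, 0, 1],
   [0, 1, 0, 1, 0, 1, 0, 0, -1, 0], [-1, -2, 1, 1, 2, -1, -1, 2, 1, 1],
   [0, 0, -1, 1, -1, 0, 0, 0, 0, 1], [0, 0, -1, 1, 1, 0, 0, 0, 0, 1],
   [0, -1, 0, 1, 0, -1, 0, 0, 1, 0], [0, -1, 0, 1, 0, 1, 0, 0, 1, 0],
   [0, -1, 0, 1, 0, -1, 0, 0, 1, 0], [0, -1, 0, 1, 0, 1, 0, 0, 1, 0]]"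
  by code_simp

lemma (in nut_matrix) no_cubic_graph_E:
  assumes "card V = 10" "set [v0, v1, v2, v3, v4, v5, v6, v7, v8, v9] = V"
    "N v0 = {v1, v2, v3}" "N v1 = {v0, v2, v4}" "N v2 = {v0, v1, v5}" "N v3 = {v0, v6, v7}" "N v4 = {v1, v6, v8}"
    "N v5 = {v2, v7, v9}" "N v6 = {v3, v4, v8}" "N v7 = {v3, v5, v9}" "N v8 = {v4, v6, v9}" "N v9 = {v5, v7, v8}"
  shows False
proof (rule not_refuted[OF refuted_cubic_graph_E _ assms(2)])
  show "distinct [v0, v1, v2, v3, v4, v5, v6, v7, v8, v9]" by (rule card_distinct) (simp only: assms(1,2), simp)
next
  fix i :: nat assume "i < length [[1, 2, 3], [0, 2, 4], [0, 1, 5], [0, 6, 7], [1, 6, 8], [2, 7, 9], [3, 4, 8], [3, 5, 9], [4, 6, 9], [5, 7, 8]]"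
  then have "i = 0 \<or> i = 1 \<or> i = 2 \<or> i = 3 \<or> i = 4 \<or> i = 5 \<or> i = 6 \<or> i = 7 \<or> i = 8 \<or> i = 9" by auto
  then show "N ([v0, v1, v2, v3, v4, v5, v6, v7, v8, v9] ! i) = (!) [v0, v1, v2, v3, v4, v5, v6, v7, v8, v9] ` set ([[1, 2, 3], [0, 2, 4], [0, 1, 5], [0, 6, 7], [1, 6, 8], [2, 7, 9], [3, 4, 8], [3, 5, 9], [4, 6, 9], [5, 7, 8]] ! i)"
    using assms(3-12) by (elim disjE) simp_all
qed simp

lemma refuted_cubic_graph_F: "refuted
  [[1, 2, 3], [0, 2, 4], [0, 1, 5], [0, 6, 7], [1, 6, 8], [2, 7, 9], [3, 4, 9], [3, 5, 8], [4, 7, 9], [5, 6, 8]]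
  [(1, 2), (4, 6), (5, 7), (6, 9), (7, 8), (8, 9)]
  [[-2, 1, 1, 1, 1, 1, 1, 1, -2, -2], [0, 1, 1, 2, -1, -1, 0, 0, -1, -1],
   [0, 0, -1, 1, 1, 0, -1, 1, 1, 0], [0, 1, 0, 0, 0, -1, 0, 0, -1, 0],
   [0, -1, 0, 1, 0, 1, 1, -1, 0, 1], [0, 0, 1, 0, -1, 0, 0, 0, 0, -1],
   [0, -1, 2, -1, 0, 1, 1, -1, 0, -1], [0, 1, 0, 0, 0, -1, 0, 0, -1, 0],
   [0, 0, -1, 1, 1, 0, 1, -1, -1, 0], [0, 1, 0, 0, 0, -1, 0, 0, -1, 0],
   [0, -1, 0, 1, 0, 1, 1, -1, 0, -1], [0, -1, -1, 2, 1, 1, 0, 0, 1, 1],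
   [0, -1, 0, 1, 0, 1, 1, -1, 0, 1], [0, 1, 0, 0, 0, -1, 0, 0, -1, 0],
   [0, -1, 0, 1, 0, 1, 1, -1, 0, -1], [0, 0, 1, 0, -1, 0, 0, 0, 0, -1],
   [0, -1, 0, 1, 0, 1, -1, 1, 0, -1], [0, 0, 1, 0, -1, 0, 0, 0, 0, -1],
   [0, 0, -1, 1, 1, 0, -1, 1, 1, 0], [0, 1, 0, 0, 0, -1, 0, 0, -1, 0],
   [0, 0, -1, 1, 1, 0, -1, 1, -1, 0], [0, -1, -1, 2, 1, 1, 0, 0, 1, 1],
   [0, 0, -1, 1, 1, 0, -1, 1, -1, 0], [0, 1, 0, 0, 0, -1, 0, 0, -1, 0],
   [0, 0, 1, -1, -1, 0, -1, 1, 1, 0], [0, 1, 0, 0, 0, -1, 0, 0, -1, 0],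
   [0, -1, 0, 1, 0, 1, -1, 1, 0, 1], [0, 0, 1, 0, -1, 0, 0, 0, 0, -1],
   [0, 0, -1, 1, 1, 0, 1, -1, 1, 0], [0, 1, 0, 0, 0, -1, 0, 0, -1, 0],
   [0, -1, 0, 1, 0, 1, -1, 1, 0, 1], [0, -1, -1, 2, 1, 1, 0, 0, 1, 1],
   [0, 1, 0, 0, 0, 1, 0, 0, -1, 0], [0, 0, 1, -1, 1, 0, 1, -1, 1, 0],
   [0, 0, 1, 0, 1, 0, 0, 0, 0, -1], [0, -1, 0, 1, 0, -1, 1, -1, 0, 1],
   [0, 1, 0, 0, 0, 1, 0, 0, -1, 0], [0, 0, -1, 1, -1, 0, -1, 1, 1, 0],
   [0, -1, -1, 2, -1, -1, 0, 0, 1, 1], [0, 0, 1, -1, 1, 0, 1, -1, -1, 0],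
   [0, 0, 1, 0, 1, 0, 0, 0, 0, -1], [0, -1, 0, 1, 0, -1, 1, -1, 0, -1],
   [0, 1, 0, 0, 0, 1, 0, 0, -1, 0], [0, 0, -1, 1, -1, 0, 1, -1, 1, 0],
   [0, -1, -1, 2, -1, -1, 0, 0, 1, 1], [0, 0, 1, -1, 1, 0, -1, 1, 1, 0],
   [0, 1, 0, 0, 0, 1, 0, 0, -1, 0], [0, 0, -1, 1, -1, 0, 1, -1, -1, 0],
   [0, 1, 0, 0, 0, 1, 0, 0, -1, 0], [0, 0, -1, 1, -1, 0, -1, 1, -1, 0],
   [0, -1, -1, 2, -1, -1, 0, 0, 1, 1], [0, 1, 0, -1, 0, 1, 1, -1, 0, 1],
   [0, 1, 0, 0, 0, 1, 0, 0, -1, 0], [0, -1, 0, 1, 0, -1, -1, 1, 0, 1],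
   [0, 0, 1, 0, 1, 0, 0, 0, 0, -1], [0, -1, 0, 1, 0, -1, -1, 1, 0, -1],
   [0, 1, 1, 2, 1, 1, 0, 0, -1, -1], [2, 1, 1, 1, -1, -1, -1, -1, -2, -2],
   [0, 1, 0, 0, 0, 1, 0, 0, -1, 0], [0, 0, -1, 1, -1, 0, 1, -1, 1, 0],
   [0, 0, 1, 0, 1, 0, 0, 0, 0, -1], [0, -1, 0, 1, 0, -1, -1, 1, 0, 1],
   [0, 1, 0, 0, 0, 1, 0, 0, -1, 0], [0, -2, 1, 1, 1, 0, -1, 1, 1, 0]]"
  by code_simp

lemma (in nut_matrix) no_cubic_graph_F:
  assumes "card V = 10" "set [v0, v1, v2, v3, v4, v5, v6, v7, v8, v9] = V"
    "N v0 = {v1, v2, v3}" "N v1 = {v0, v2, v4}" "N v2 = {v0, v1, v5}" "N v3 = {v0, v6, v7}" "N v4 = {v1, v6, v8}"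
    "N v5 = {v2, v7, v9}" "N v6 = {v3, v4, v9}" "N v7 = {v3, v5, v8}" "N v8 = {v4, v7, v9}" "N v9 = {v5, v6, v8}"
  shows False
proof (rule not_refuted[OF refuted_cubic_graph_F _ assms(2)])
  show "distinct [v0, v1, v2, v3, v4, v5, v6, v7, v8, v9]" by (rule card_distinct) (simp only: assms(1,2), simp)
next
  fix i :: nat assume "i < length [[1, 2, 3], [0, 2, 4], [0, 1, 5], [0, 6, 7], [1, 6, 8], [2, 7, 9], [3, 4, 9], [3, 5, 8], [4, 7, 9], [5, 6, 8]]"
  then have "i = 0 \<or> i = 1 \<or> i = 2 \<or> i = 3 \<or> i = 4 \<or> i = 5 \<or> i = 6 \<or> i = 7 \<or> i = 8 \<or> i = 9" by auto
  then show "N ([v0, v1, v2, v3, v4, v5, v6, v7, v8, v9] ! i) = (!) [v0, v1, v2, v3, v4, v5, v6, v7, v8, v9] ` set ([[1, 2, 3], [0, 2, 4], [0, 1, 5], [0, 6, 7], [1, 6, 8], [2, 7, 9], [3, 4, 9], [3, 5, 8], [4, 7, 9], [5, 6, 8]] ! i)"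
    using assms(3-12) by (elim disjE) simp_all
qed simp

lemma refuted_cubic_graph_G: "refuted
  [[1, 2, 3], [0, 4, 5], [0, 4, 6], [0, 7, 8], [1, 2, 7], [1, 8, 9], [2, 8, 9], [3, 4, 9], [3, 5, 6], [5, 6, 7]]
  [(2, 4), (4, 7), (5, 8), (6, 8), (6, 9), (7, 9)]
  [[1, 0, 0, 0, -1, 0, 0, 0, -1, 1], [-1, 0, 0, 0, 1, 0, 0, 0, 1, -1],
   [0, -1, 1, 0, 0, 0, 0, 0, 0, 1], [0, 1, -1, 0, 0, 0, 0, 0, 0, -1],
   [0, -1, 1, 0, 0, 0, 0, 0, 1, 0], [0, -1, 1, 0, 0, 0, 0, 0, 1, 0],
   [0, 0, 0, 0, 1, -1, -1, 0, 0, 0], [0, 0, 0, 0, 1, -1, -1, 0, 0, 0],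
   [0, 1, -1, 0, 0, 0, 0, 0, 1, 0], [0, 1, -1, 0, 0, 0, 0, 0, 1, 0],
   [0, 0, 0, 0, 1, -1, -1, 0, 0, 0], [0, 0, 0, 0, 1, -1, -1, 0, 0, 0],
   [-1, 0, 0, 0, 1, 0, 0, 0, 1, 1], [-1, 0, 0, 0, 1, 0, 0, 0, 1, 1],
   [0, -1, 1, 0, 0, 0, 0, 0, 0, 1], [0, 1, -1, 0, 0, 0, 0, 0, 0, -1],
   [1, 0, 0, 0, -1, 0, 0, 0, -1, 1], [1, 0, 0, 0, -1, 0, 0, 0, -1, 1],
   [0, -1, 1, 0, 0, 0, 0, 0, 0, 1], [0, 1, -1, 0, 0, 0, 0, 0, 0, -1],
   [0, -1, 1, 0, 0, 0, 0, 0, 1, 0], [0, -1, 1, 0, 0, 0, 0, 0, 1, 0],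
   [0, 0, 0, 0, -1, 1, 1, 0, 0, 0], [0, 0, 0, 0, -1, 1, 1, 0, 0, 0],
   [0, 1, -1, 0, 0, 0, 0, 0, 1, 0], [0, 1, -1, 0, 0, 0, 0, 0, 1, 0],
   [0, 0, 0, 0, -1, 1, 1, 0, 0, 0], [0, 0, 0, 0, -1, 1, 1, 0, 0, 0],
   [-1, 0, 0, 0, 1, 0, 0, 0, 1, 1], [1, 0, 0, 0, -1, 0, 0, 0, -1, -1],
   [0, -1, 1, 0, 0, 0, 0, 0, 0, 1], [0, 1, -1, 0, 0, 0, 0, 0, 0, -1],
   [0, 0, 0, 0, 1, -1, 1, 0, 0, 0], [0, 0, 0, 0, 1, -1, 1, 0, 0, 0],
   [1, 1, 1, -2, 2, 1, 1, 0, -1, 0], [-1, 1, 1, -2, 0, 1, 1, 0, 1, -2],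
   [0, -1, -1, 2, 1, -1, 1, 0, 0, 1], [-1, -1, 1, 0, 0, 1, 1, 2, 1, 0],
   [1, 0, 0, 0, 0, -1, -1, 0, 0, 0], [1, 0, 0, 0, 0, -1, -1, 0, 0, 0],
   [-1, -1, 1, 0, 0, 1, 1, 2, -1, 0], [0, -1, -1, 2, -1, 1, -1, 0, 0, 1],
   [1, 0, 0, 0, 0, -1, -1, 0, 0, 0], [1, 0, 0, 0, 0, -1, -1, 0, 0, 0],
   [0, 0, 0, 0, 1, -1, 1, 0, 0, 0], [0, 0, 0, 0, 1, -1, 1, 0, 0, 0],
   [0, -1, 1, 0, 1, -1, 1, 2, -2, -1], [1, -1, -1, 2, -2, 1, 1, 0, -1, 0],
   [0, 0, 0, 0, -1, 1, -1, 0, 0, 0], [0, 0, 0, 0, -1, 1, -1, 0, 0, 0],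
   [-1, 1, 1, -2, 0, 1, 1, 0, 1, 2], [1, 1, 1, -2, -2, 1, 1, 0, -1, 0],
   [-1, 1, -1, 0, 0, 1, 1, 2, -1, 0], [0, -1, -1, 2, 1, -1, 1, 0, 0, 1],
   [1, 0, 0, 0, 0, -1, -1, 0, 0, 0], [1, 0, 0, 0, 0, -1, -1, 0, 0, 0],
   [0, -1, -1, 2, -1, 1, -1, 0, 0, 1], [-1, 1, -1, 0, 0, 1, 1, 2, 1, 0],
   [1, 0, 0, 0, 0, -1, -1, 0, 0, 0], [1, 0, 0, 0, 0, -1, -1, 0, 0, 0],
   [0, 0, 0, 0, -1, 1, -1, 0, 0, 0], [0, 0, 0, 0, -1, 1, -1, 0, 0, 0],
   [1, -1, -1, 2, 2, 1, 1, 0, -1, 0], [0, 1, -1, 0, -1, 1, -1, 2, -2, 1]]"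
  by code_simp

lemma (in nut_matrix) no_cubic_graph_G:
  assumes "card V = 10" "set [v0, v1, v2, v3, v4, v5, v6, v7, v8, v9] = V"
    "N v0 = {v1, v2, v3}" "N v1 = {v0, v4, v5}" "N v2 = {v0, v4, v6}" "N v3 = {v0, v7, v8}" "N v4 = {v1, v2, v7}"
    "N v5 = {v1, v8, v9}" "N v6 = {v2, v8, v9}" "N v7 = {v3, v4, v9}" "N v8 = {v3, v5, v6}" "N v9 = {v5, v6, v7}"
  shows False
proof (rule not_refuted[OF refuted_cubic_graph_G _ assms(2)])
  show "distinct [v0, v1, v2, v3, v4, v5, v6, v7, v8, v9]" by (rule card_distinct) (simp only: assms(1,2), simp)
next
  fix i :: nat assume "i < length [[1, 2, 3], [0, 4, 5], [0, 4, 6], [0, 7, 8], [1, 2, 7], [1, 8, 9], [2, 8, 9], [3, 4, 9], [3, 5, 6], [5, 6, 7]]"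
  then have "i = 0 \<or> i = 1 \<or> i = 2 \<or> i = 3 \<or> i = 4 \<or> i = 5 \<or> i = 6 \<or> i = 7 \<or> i = 8 \<or> i = 9" by auto
  then show "N ([v0, v1, v2, v3, v4, v5, v6, v7, v8, v9] ! i) = (!) [v0, v1, v2, v3, v4, v5, v6, v7, v8, v9] ` set ([[1, 2, 3], [0, 4, 5], [0, 4, 6], [0, 7, 8], [1, 2, 7], [1, 8, 9], [2, 8, 9], [3, 4, 9], [3, 5, 6], [5, 6, 7]] ! i)"
    using assms(3-12) by (elim disjE) simp_all
qed simp

lemma refuted_petersen: "refuted
  [[1, 2, 3], [0, 4, 5], [0, 6, 7], [0, 8, 9], [1, 6, 8], [1, 7, 9], [2, 4, 9], [2, 5, 8], [3, 4, 7], [3, 5, 6]]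
  [(4, 6), (4, 8), (5, 7), (5, 9), (6, 9), (7, 8)]
  [[-1, -1, -1, 2, -1, 2, 2, -1, -1, 2], [0, 1, -1, 0, 0, 0, 0, 0, -1, 1],
   [0, 1, -1, 0, 0, 0, 0, 0, 1, -1], [-1, 0, 0, 0, 0, 1, 1, 0, 1, 0],
   [0, -1, 1, 0, 0, 0, 0, 0, 1, -1], [0, -1, 1, 0, 0, 0, 0, 0, 1, -1],
   [-1, 0, 0, 0, 1, 0, 0, 1, 0, 1], [-1, 0, 0, 0, 1, 0, 0, 1, 0, 1],
   [0, -1, 0, 1, 0, 0, 1, -1, 0, 0], [-1, 0, 0, 0, 1, 0, 0, 1, 0, 1],
   [-1, 0, 0, 0, 0, 1, 1, 0, 1, 0], [-1, 0, 0, 0, 1, 0, 0, 1, 0, 1],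
   [-1, 0, 0, 0, 0, 1, 1, 0, 1, 0], [0, 0, 1, 1, -1, 1, 0, 0, 0, 0],
   [0, 0, 1, 1, -1, 1, 0, 0, 0, 0], [0, -1, 0, 1, 0, 0, 1, -1, 0, 0],
   [0, -1, 1, 0, 0, 0, 0, 0, -1, 1], [-1, 0, 0, 0, 0, 1, 1, 0, 1, 0],
   [0, 0, 1, -1, -1, 1, 0, 0, 0, 0], [-1, 0, 0, 0, 0, 1, 1, 0, 1, 0],
   [-1, 0, 0, 0, 0, 1, 1, 0, 1, 0], [-1, 0, 0, 0, 0, 1, 1, 0, 1, 0],
   [-1, 0, 0, 0, 1, 0, 0, 1, 0, 1], [0, -1, 0, 1, 0, 0, 1, 1, 0, 0],
   [-1, 0, 0, 0, 1, 0, 0, 1, 0, 1], [0, 0, 1, -1, -1, 1, 0, 0, 0, 0],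
   [-1, 0, 0, 0, 0, 1, 1, 0, 1, 0], [0, -1, 0, 1, 0, 0, 1, -1, 0, 0],
   [-1, 0, 0, 0, 0, 1, 1, 0, 1, 0], [0, 0, -1, 1, 1, -1, 0, 0, 0, 0],
   [0, 0, -1, 1, 1, -1, 0, 0, 0, 0], [0, -1, 0, 1, 0, 0, 1, -1, 0, 0],
   [0, -1, 0, 1, 0, 0, -1, 1, 0, 0], [0, -1, 0, 1, 0, 0, -1, 1, 0, 0],
   [-1, 0, 0, 0, 0, 1, 1, 0, 1, 0], [-1, 0, 0, 0, 0, 1, 1, 0, 1, 0],
   [0, -1, 0, 1, 0, 0, -1, 1, 0, 0], [-1, 0, 0, 0, 0, 1, 1, 0, 1, 0],
   [0, 0, -1, 1, -1, 1, 0, 0, 0, 0], [0, -1, 0, 1, 0, 0, -1, 1, 0, 0],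
   [-1, 0, 0, 0, 0, 1, 1, 0, 1, 0], [-1, 0, 0, 0, 1, 0, 0, 1, 0, 1],
   [-1, 0, 0, 0, 0, 1, 1, 0, 1, 0], [0, -1, 1, 0, 0, 0, 0, 0, 1, 1],
   [-1, 0, 0, 0, 0, 1, 1, 0, 1, 0], [0, -1, 1, 0, 0, 0, 0, 0, 1, -1],
   [0, 0, 1, -1, 1, -1, 0, 0, 0, 0], [0, -1, 1, 0, 0, 0, 0, 0, 1, -1],
   [-1, 0, 0, 0, 1, 0, 0, 1, 0, 1], [0, -1, 0, 1, 0, 0, -1, 1, 0, 0],
   [0, -1, 1, 0, 0, 0, 0, 0, -1, 1], [0, -1, 0, 1, 0, 0, -1, 1, 0, 0],
   [-1, 0, 0, 0, 1, 0, 0, 1, 0, 1], [0, -1, 0, 1, 0, 0, -1, 1, 0, 0],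
   [0, 0, -1, 1, -1, 1, 0, 0, 0, 0], [0, -1, 0, 1, 0, 0, -1, 1, 0, 0],
   [-1, 0, 0, 0, 1, 0, 0, 1, 0, 1], [0, 0, 1, -1, -1, 1, 0, 0, 0, 0],
   [0, 0, 1, -1, -1, 1, 0, 0, 0, 0], [0, -1, 1, 0, 0, 0, 0, 0, -1, 1],
   [0, 1, -1, 0, 0, 0, 0, 0, 1, 1], [0, 1, -1, 0, 0, 0, 0, 0, -1, 1],
   [0, 1, -1, 0, 0, 0, 0, 0, 1, -1], [-2, 2, 2, 2, 1, 1, 1, 1, 1, 1]]"
  by code_simp

lemma (in nut_matrix) no_petersen:
  assumes "card V = 10" "set [v0, v1, v2, v3, v4, v5, v6, v7, v8, v9] = V"
    "N v0 = {v1, v2, v3}" "N v1 = {v0, v4, v5}" "N v2 = {v0, v6, v7}" "N v3 = {v0, v8, v9}" "N v4 = {v1, v6, v8}"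
    "N v5 = {v1, v7, v9}" "N v6 = {v2, v4, v9}" "N v7 = {v2, v5, v8}" "N v8 = {v3, v4, v7}" "N v9 = {v3, v5, v6}"
  shows False
proof (rule not_refuted[OF refuted_petersen _ assms(2)])
  show "distinct [v0, v1, v2, v3, v4, v5, v6, v7, v8, v9]" by (rule card_distinct) (simp only: assms(1,2), simp)
next
  fix i :: nat assume "i < length [[1, 2, 3], [0, 4, 5], [0, 6, 7], [0, 8, 9], [1, 6, 8], [1, 7, 9], [2, 4, 9], [2, 5, 8], [3, 4, 7], [3, 5, 6]]"
  then have "i = 0 \<or> i = 1 \<or> i = 2 \<or> i = 3 \<or> i = 4 \<or> i = 5 \<or> i = 6 \<or> i = 7 \<or> i = 8 \<or> i = 9" by auto
  then show "N ([v0, v1, v2, v3, v4, v5, v6, v7, v8, v9] ! i) = (!) [v0, v1, v2, v3, v4, v5, v6, v7, v8, v9] ` set ([[1, 2, 3], [0, 4, 5], [0, 6, 7], [0, 8, 9], [1, 6, 8], [1, 7, 9], [2, 4, 9], [2, 5, 8], [3, 4, 7], [3, 5, 6]] ! i)"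
    using assms(3-12) by (elim disjE) simp_all
qed simp

section \<open>Two-regular graphs on six vertices, and perfect matchings\<close>

context two_regular begin

lemma remove_closed:
  assumes "A \<subseteq> S" "\<And>v. v \<in> A \<Longrightarrow> M v \<subseteq> A"
  shows "two_regular (S - A) M"
proof
  fix p assume p: "p \<in> S - A"
  have "v \<notin> A" if "v \<in> M p" for v using M_sym[of p v] that p assms(2)[of v] by auto
  then show "M p \<subseteq> S - A" using M_subset[of p] p by auto
qed (use finite_S M_irrefl M_card M_sym in auto)

text \<open>What remains after the removal of a closed set is again two-regular and thus has at least three
  elements.\<close>

lemma closed_card:
  assumes "A \<subseteq> S" "\<And>v. v \<in> A \<Longrightarrow> M v \<subseteq> A" "A \<noteq> S"
  shows "card A + 3 \<le> card S"
proof -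
  interpret R: two_regular "S - A" M by (rule remove_closed[OF assms(1,2)])
  have "S - A \<noteq> {}" using assms(1,3) by auto
  from R.card_ge_3[OF this] show ?thesis
    using assms(1) finite_S finite_subset[OF assms(1) finite_S] card_mono[OF finite_S assms(1)] by (simp add: card_Diff_subset)
qed

lemma triangle:
  assumes "card S = 3"
  obtains u v w where "S = {u, v, w}" "distinct [u, v, w]" "M u = {v, w}" "M v = {u, w}" "M w = {u, v}"
proof -
  have "S \<noteq> {}" using assms by auto
  from path_of_three[OF this] obtain u v w where p: "u \<in> S" "v \<in> S" "w \<in> S" "distinct [u, v, w]"
    "M v = {u, w}" "v \<in> M u" "v \<in> M w" by metis
  have S: "{u, v, w} = S" using p assms finite_S by (intro card_subset_eq) auto
  from other_neighbour[OF p(1,6)] obtain t where t: "M u = {v, t}" "t \<noteq> v" "t \<in> S" "t \<noteq> u" by metis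
  from other_neighbour[OF p(3,7)] obtain s where s: "M w = {v, s}" "s \<noteq> v" "s \<in> S" "s \<noteq> w" by metis
  have "t = w" "s = u" using t s S by auto
  then show ?thesis using that[of u v w] S p t s by (simp add: insert_commute)
qed

lemma hexagon_or_triangles:
  assumes card: "card S = 6"
  obtains (hexagon) c1 c2 c3 c4 c5 c6 where "distinct [c1, c2, c3, c4, c5, c6]" "S = {c1, c2, c3, c4, c5, c6}"
      "M c1 = {c2, c6}" "M c2 = {c1, c3}" "M c3 = {c2, c4}" "M c4 = {c3, c5}" "M c5 = {c4, c6}" "M c6 = {c1, c5}"
  | (triangles) c1 c2 c3 c4 c5 c6 where "distinct [c1, c2, c3, c4, c5, c6]" "S = {c1, c2, c3, c4, c5, c6}"
      "M c1 = {c2, c3}" "M c2 = {c1, c3}" "M c3 = {c1, c2}" "M c4 = {c5, c6}" "M c5 = {c4, c6}" "M c6 = {c4, c5}"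
proof -
  have "S \<noteq> {}" using assms by auto
  from path_of_three[OF this] obtain c1 c2 c3 where p: "c1 \<in> S" "c2 \<in> S" "c3 \<in> S" "distinct [c1, c2, c3]"
    "M c2 = {c1, c3}" "c2 \<in> M c1" "c2 \<in> M c3" by metis
  from other_neighbour[OF p(1,6)] obtain c6 where c6: "M c1 = {c2, c6}" "c6 \<noteq> c2" "c6 \<in> S" "c6 \<noteq> c1" "c1 \<in> M c6" by metis
  from other_neighbour[OF p(3,7)] obtain c4 where c4: "M c3 = {c2, c4}" "c4 \<noteq> c2" "c4 \<in> S" "c4 \<noteq> c3" "c3 \<in> M c4" by metis
  have no_closed: False if "A \<subseteq> S" "\<And>v. v \<in> A \<Longrightarrow> M v \<subseteq> A" "card A = 4 \<or> card A = 5" for A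
    using closed_card[OF that(1,2)] that(3) card by (cases "A = S") auto
  show ?thesis
  proof (cases "c6 = c3")
    case True
    have c41: "c4 = c1" using True c6(5) c4(1) p(4) by auto
    have M3: "M c1 = {c2, c3}" "M c3 = {c2, c1}" using True c6(1) c4(1) c41 by auto
    interpret R: two_regular "S - {c1, c2, c3}" M
      by (rule remove_closed) (use p M3 in auto)
    have "card (S - {c1, c2, c3}) = 3" using p card finite_S by (subst card_Diff_subset) auto
    from R.triangle[OF this] obtain u v w where r: "S - {c1, c2, c3} = {u, v, w}" "distinct [u, v, w]"
      "M u = {v, w}" "M v = {u, w}" "M w = {u, v}" .
    have "{u, v, w} \<inter> {c1, c2, c3} = {}" using r(1) by blast
    then have "distinct [c1, c2, c3, u, v, w]" using p(4) r(2) by auto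
    moreover have "S = {c1, c2, c3, u, v, w}" using r(1) p(1-3) by blast
    ultimately show ?thesis using triangles[of c1 c2 c3 u v w] M3 p(5) r(3-5) by (simp add: insert_commute)
  next
    case False
    have n41: "c4 \<noteq> c1" using False c4(5) c6(1) p(4) by auto
    have n46: "c4 \<noteq> c6"
    proof
      assume eq: "c4 = c6"
      then have "M c4 = {c3, c1}" using neighbours_eq[of c4 c3 c1] c4 c6 p(4) by auto
      then show False using no_closed[of "{c1, c2, c3, c4}"] p c4 c6 eq n41 by auto
    qed
    from other_neighbour[OF c4(3,5)] obtain c5 where c5: "M c4 = {c3, c5}" "c5 \<noteq> c3" "c5 \<in> S" "c5 \<noteq> c4" "c4 \<in> M c5" by metis
    from other_neighbour[OF c6(3,5)] obtain t where t: "M c6 = {c1, t}" "t \<noteq> c1" "t \<in> S" "t \<noteq> c6" "c6 \<in> M t" by metis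
    have n5: "c5 \<noteq> c1" "c5 \<noteq> c2"
    proof -
      have "c4 \<notin> M c1" "c4 \<notin> M c2" using c6(1) p(5) c4(2,4) n41 n46 by simp_all
      then show "c5 \<noteq> c1" "c5 \<noteq> c2" using c5(5) by auto
    qed
    have n56: "c5 \<noteq> c6"
    proof
      assume eq: "c5 = c6"
      then have "M c6 = {c4, c1}" using neighbours_eq[of c6 c4 c1] c5 c6 n41 by auto
      then have "M v \<subseteq> {c1, c2, c3, c4, c6}" if "v \<in> {c1, c2, c3, c4, c6}" for v
        using that p(5) c4(1) c6(1) c5(1) eq by (elim insertE emptyE) simp_all
      moreover have "{c1, c2, c3, c4, c6} \<subseteq> S" using p(1-3) c4(3) c6(3) by simp
      moreover have "card {c1, c2, c3, c4, c6} = 5"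
        using p(4) c4(2,4) c6(2,4) n41 n46 False by (auto simp: card_insert_if)
      ultimately show False using no_closed[of "{c1, c2, c3, c4, c6}"] by blast
    qed
    have dist: "distinct [c1, c2, c3, c4, c5, c6]" using p(4) c4(2,4) c5(2,4) c6(2,4) n41 n46 n5 n56 False by auto
    have S: "{c1, c2, c3, c4, c5, c6} = S"
      using p c4(3) c5(3) c6(3) dist card finite_S by (intro card_subset_eq) auto
    have "t = c5"
    proof -
      have "c2 \<noteq> t" "c3 \<noteq> t" "c4 \<noteq> t" using t(5) p(5) c4(1) c5(1) dist by auto
      then show ?thesis using t(2-4) S by auto
    qed
    moreover have "M c5 = {c4, c6}" using neighbours_eq[of c5 c4 c6] c5(3,5) t(5) calculation n46 by auto
    ultimately show ?thesis using hexagon[of c1 c2 c3 c4 c5 c6] dist S p(5) c4(1) c5(1) c6(1) t(1)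
      by (simp add: insert_commute)
  qed
qed

end

text \<open>The fifteen perfect matchings of six points, listed by the partner of the first point.\<close>

lemma matching_of_six:
  assumes "distinct [s1, s2, s3, s4, s5, s6]"
    and "\<forall>s\<in>{s1, s2, s3, s4, s5, s6}. m s \<in> {s1, s2, s3, s4, s5, s6} \<and> m s \<noteq> s \<and> m (m s) = s"
  shows "(m s1 = s2 \<and> m s3 = s4 \<and> m s5 = s6) \<or>
    (m s1 = s2 \<and> m s3 = s5 \<and> m s4 = s6) \<or>
    (m s1 = s2 \<and> m s3 = s6 \<and> m s4 = s5) \<or>
    (m s1 = s3 \<and> m s2 = s4 \<and> m s5 = s6) \<or>
    (m s1 = s3 \<and> m s2 = s5 \<and> m s4 = s6) \<or>
    (m s1 = s3 \<and> m s2 = s6 \<and> m s4 = s5) \<or>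
    (m s1 = s4 \<and> m s2 = s3 \<and> m s5 = s6) \<or>
    (m s1 = s4 \<and> m s2 = s5 \<and> m s3 = s6) \<or>
    (m s1 = s4 \<and> m s2 = s6 \<and> m s3 = s5) \<or>
    (m s1 = s5 \<and> m s2 = s3 \<and> m s4 = s6) \<or>
    (m s1 = s5 \<and> m s2 = s4 \<and> m s3 = s6) \<or>
    (m s1 = s5 \<and> m s2 = s6 \<and> m s3 = s4) \<or>
    (m s1 = s6 \<and> m s2 = s3 \<and> m s4 = s5) \<or>
    (m s1 = s6 \<and> m s2 = s4 \<and> m s3 = s5) \<or>
    (m s1 = s6 \<and> m s2 = s5 \<and> m s3 = s4)"
proof -
  let ?S = "{s1, s2, s3, s4, s5, s6}"
  have m: "m s \<in> ?S" "m s \<noteq> s" "m (m s) = s" if "s \<in> ?S" for s using bspec[OF assms(2) that] by blast+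
  have swap: "m q = p" if "m p = q" "p \<in> ?S" for p q using m(3)[OF that(2)] that(1) by simp
  \<comment> \<open>once two pairs are known, the last two elements have nowhere else to go\<close>
  have last: "m p = q" if "?S = {t1, t1', t2, t2', p, q}" "m t1 = t1'" "m t2 = t2'" "p \<notin> {t1, t1', t2, t2'}" for t1 t1' t2 t2' p q
  proof -
    have in_S: "t1 \<in> ?S" "t2 \<in> ?S" "p \<in> ?S" unfolding that(1) by simp_all
    have "m p \<in> {t1, t1', t2, t2', p, q}" using m(1)[OF in_S(3)] unfolding that(1) .
    moreover have "m t1' = t1" "m t2' = t2" using swap that(2,3) in_S by blast+
    then have "m p \<noteq> t1" "m p \<noteq> t1'" "m p \<noteq> t2" "m p \<noteq> t2'"
      using swap[of p] in_S(3) that(2-4) by auto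
    ultimately show ?thesis using m(2)[OF in_S(3)] by blast
  qed
  have d: "s1 \<noteq> s2" "s1 \<noteq> s3" "s1 \<noteq> s4" "s1 \<noteq> s5" "s1 \<noteq> s6" "s2 \<noteq> s3" "s2 \<noteq> s4" "s2 \<noteq> s5" "s2 \<noteq> s6"
    "s3 \<noteq> s4" "s3 \<noteq> s5" "s3 \<noteq> s6" "s4 \<noteq> s5" "s4 \<noteq> s6" "s5 \<noteq> s6" using assms(1) by auto
  have pair: "m t1 = t1' \<Longrightarrow> (m t = u1 \<and> m v1 = w1) \<or> (m t = u2 \<and> m v2 = w2) \<or> (m t = u3 \<and> m v3 = w3)"
    if "distinct [t1, t1', t, u1, u2, u3]" "?S = {t1, t1', t, u1, u2, u3}"
      "v1 = u2 \<and> w1 = u3" "v2 = u1 \<and> w2 = u3" "v3 = u1 \<and> w3 = u2" for t1 t1' t u1 u2 u3 v1 w1 v2 w2 v3 w3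
  proof -
    assume t1: "m t1 = t1'"
    have in_S: "t1 \<in> ?S" "t \<in> ?S" unfolding that(2) by simp_all
    have t1': "m t1' = t1" using swap[OF t1 in_S(1)] .
    have "m t \<in> {t1, t1', t, u1, u2, u3}" using m(1)[OF in_S(2)] unfolding that(2) .
    moreover have "m t \<noteq> t1" "m t \<noteq> t1'" "m t \<noteq> t" using swap[of t] in_S(2) t1 t1' m(2)[OF in_S(2)] that(1) by auto
    ultimately consider "m t = u1" | "m t = u2" | "m t = u3" by blast
    then show ?thesis
    proof cases
      case 1
      then have "m u2 = u3" using last[of t1 t1' t u1 u2 u3] t1 that(1,2) by auto
      then show ?thesis using 1 that(3) by blast
    next
      case 2
      then have "m u1 = u3" using last[of t1 t1' t u2 u1 u3] t1 that(1,2) by (auto simp: insert_commute)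
      then show ?thesis using 2 that(4) by blast
    next
      case 3
      then have "m u1 = u2" using last[of t1 t1' t u3 u1 u2] t1 that(1,2) by (auto simp: insert_commute)
      then show ?thesis using 3 that(5) by blast
    qed
  qed
  have "m s1 \<in> ?S" "m s1 \<noteq> s1" using m by blast+
  then consider "m s1 = s2" | "m s1 = s3" | "m s1 = s4" | "m s1 = s5" | "m s1 = s6" by blast
  then show ?thesis
  proof cases
    case 1 then show ?thesis using pair[of s1 s2 s3 s4 s5 s6] d by (auto simp: insert_commute)
  next
    case 2 then show ?thesis using pair[of s1 s3 s2 s4 s5 s6] d by (auto simp: insert_commute)
  next
    case 3 then show ?thesis using pair[of s1 s4 s2 s3 s5 s6] d by (auto simp: insert_commute)
  next
    case 4 then show ?thesis using pair[of s1 s5 s2 s3 s4 s6] d by (auto simp: insert_commute)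
  next
    case 5 then show ?thesis using pair[of s1 s6 s2 s3 s4 s5] d by (auto simp: insert_commute)
  qed
qed

section \<open>Cubic graphs\<close>

text \<open>The terms of the two rows agree up to sign. If three non-zero numbers have sum zero, then the only
  other choice of signs with sum zero is the opposite one, so the rows are proportional.\<close>

lemma (in nut_matrix) cubic_twins:
  assumes "p \<in> V" "q \<in> V" "p \<noteq> q" "N p = N q" "card (N p) = 3"
  shows False
proof -
  obtain u v w where N: "N p = {u, v, w}" "u \<noteq> v" "u \<noteq> w" "v \<noteq> w" using assms(5) by (auto simp: card_3_iff)
  have s: "a p t = 1 \<or> a p t = - 1" "a q t = 1 \<or> a q t = - 1" if "t \<in> {u, v, w}" for t
    using that N(1) assms(4) sign by auto
  have uvw: "u \<in> V" "v \<in> V" "w \<in> V" using N N_subset[of p] by auto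
  define g where "g t = a p t * x t" for t
  define same where "same t \<longleftrightarrow> a q t = a p t" for t
  have st: "a q t = (if same t then a p t else - a p t)" if "t \<in> {u, v, w}" for t
    using s[OF that] by (auto simp: same_def)
  have "g u + (g v + g w) = 0" using row[OF assms(1)] N by (simp add: g_def)
  moreover have "a q t * x t = (if same t then g t else - g t)" if "t \<in> {u, v, w}" for t
    using st[OF that] by (simp add: g_def)
  then have "(if same u then g u else - g u) + ((if same v then g v else - g v) + (if same w then g w else - g w)) = 0"
    using row[OF assms(2)] N assms(4) by simp
  moreover have "g u \<noteq> 0" "g v \<noteq> 0" "g w \<noteq> 0"
    using full uvw s[of u] s[of v] s[of w] by (auto simp: g_def)
  ultimately have "same u = same v \<and> same u = same w" by (auto split: if_splits)
  then have r: "a q t = (if same u then 1 else - 1) * a p t" if "t \<in> N p" for t using that st N(1) by auto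
  show False
    by (rule no_proportional_twins[of p q u "if same u then 1 else - 1"]) (use assms N(1) r in auto)
qed

text \<open>The odd vertices split into those without odd neighbours (\<open>Iso\<close>) and those with two,
  which form cycles (\<open>Cyc\<close>); the even vertices likewise have two odd neighbours
  (\<open>Ev2\<close>) or none (\<open>Ev0\<close>).\<close>

locale cubic_nut_matrix = normal_nut_matrix +
  assumes cubic: "u \<in> V \<Longrightarrow> card (N u) = 3"
begin

definition Iso :: "'a set" where "Iso = {u \<in> Od. N u \<inter> Od = {}}"
definition Cyc :: "'a set" where "Cyc = {u \<in> Od. card (N u \<inter> Od) = 2}"
definition Ev2 :: "'a set" where "Ev2 = {u \<in> V - Od. card (N u \<inter> Od) = 2}"
definition Ev0 :: "'a set" where "Ev0 = {u \<in> V - Od. N u \<inter> Od = {}}"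

lemma odd_nbrs_cases: "u \<in> V \<Longrightarrow> N u \<inter> Od = {} \<or> card (N u \<inter> Od) = 2"
proof -
  assume u: "u \<in> V"
  have small: "even k \<Longrightarrow> k = 0 \<or> k = 2" if "k \<le> 3" for k :: nat using that by presburger
  have "card (N u \<inter> Od) \<le> 3" using cubic[OF u] card_mono[OF finite_N, of "N u \<inter> Od" u] by simp
  then have "card (N u \<inter> Od) = 0 \<or> card (N u \<inter> Od) = 2" using small even_odd_nbrs[OF u] by blast
  then show ?thesis by auto
qed

lemma finites [simp]: "finite Iso" "finite Cyc" "finite Ev2" "finite Ev0"
  using fin by (auto simp: Iso_def Cyc_def Ev2_def Ev0_def)

lemma V_split: "V - Od = Ev2 \<union> Ev0" "Od = Iso \<union> Cyc" "Ev2 \<inter> Ev0 = {}" "Iso \<inter> Cyc = {}"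
  using odd_nbrs_cases Od_subset by (auto simp: Iso_def Cyc_def Ev2_def Ev0_def)

lemma even_nbrs: "u \<in> V \<Longrightarrow> card (N u - Od) = 3 - card (N u \<inter> Od)"
  using cubic[of u] card_Diff_subset_Int[of "N u" Od] by simp

lemma odd_nbr_in_Ev2: "u \<in> Od \<Longrightarrow> v \<in> N u \<Longrightarrow> v \<notin> Od \<Longrightarrow> v \<in> Ev2"
  using odd_nbrs_cases[of v] nbr_sym[of u v] N_subset[of u] Od_subset by (auto simp: Ev2_def)

lemma order_split: "card V = card Iso + card Cyc + card Ev2 + card Ev0"
proof -
  have "card V = card Od + card (V - Od)"
    using Od_subset fin card_mono[OF fin Od_subset] by (simp add: card_Diff_subset)
  also have "card Od = card Iso + card Cyc" using V_split by (simp add: card_Un_disjoint)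
  also have "card (V - Od) = card Ev2 + card Ev0" using V_split by (simp add: card_Un_disjoint)
  finally show ?thesis by simp
qed

text \<open>Count the edges between odd and even vertices from both sides.\<close>

lemma edge_count: "3 * card Iso + card Cyc = 2 * card Ev2"
proof -
  have "(\<Sum>u\<in>Od. card (N u \<inter> (V - Od))) = (\<Sum>u\<in>V - Od. card (N u \<inter> Od))"
    using Od_subset by (intro double_count) auto
  moreover have "(\<Sum>u\<in>Od. card (N u \<inter> (V - Od))) = (\<Sum>u\<in>Iso. 3) + (\<Sum>u\<in>Cyc. 1)"
  proof -
    have e: "N u \<inter> (V - Od) = N u - Od" for u using N_subset by auto
    have "(\<Sum>u\<in>Od. card (N u \<inter> (V - Od))) = (\<Sum>u\<in>Iso. card (N u - Od)) + (\<Sum>u\<in>Cyc. card (N u - Od))"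
      unfolding e using V_split by (subst V_split(2)) (simp add: sum.union_disjoint)
    also have "\<dots> = (\<Sum>u\<in>Iso. 3) + (\<Sum>u\<in>Cyc. 1)"
      using even_nbrs Od_subset by (intro arg_cong2[where f = "(+)"] sum.cong) (auto simp: Iso_def Cyc_def subset_iff)
    finally show ?thesis .
  qed
  moreover have "(\<Sum>u\<in>V - Od. card (N u \<inter> Od)) = (\<Sum>u\<in>Ev2. 2)"
  proof -
    have "(\<Sum>u\<in>V - Od. card (N u \<inter> Od)) = (\<Sum>u\<in>Ev2. card (N u \<inter> Od)) + (\<Sum>u\<in>Ev0. card (N u \<inter> Od))"
      unfolding V_split(1) by (rule sum.union_disjoint) (simp_all add: V_split)
    also have "(\<Sum>u\<in>Ev2. card (N u \<inter> Od)) = (\<Sum>u\<in>Ev2. 2)" by (intro sum.cong) (simp_all add: Ev2_def)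
    also have "(\<Sum>u\<in>Ev0. card (N u \<inter> Od)) = 0" by (intro sum.neutral) (simp add: Ev0_def)
    finally show ?thesis by simp
  qed
  ultimately show ?thesis by simp
qed

text \<open>The cycles have as many edges as vertices.\<close>

lemma even_card_Cyc: "even (card Cyc)"
proof -
  have "(\<Sum>u\<in>Od. card (N u \<inter> Od)) = (\<Sum>u\<in>Cyc. 2)"
  proof -
    have "(\<Sum>u\<in>Od. card (N u \<inter> Od)) = (\<Sum>u\<in>Iso. card (N u \<inter> Od)) + (\<Sum>u\<in>Cyc. card (N u \<inter> Od))"
      by (subst V_split(2)) (rule sum.union_disjoint, simp_all add: V_split)
    also have "(\<Sum>u\<in>Iso. card (N u \<inter> Od)) = 0" by (intro sum.neutral) (simp add: Iso_def)
    also have "(\<Sum>u\<in>Cyc. card (N u \<inter> Od)) = (\<Sum>u\<in>Cyc. 2)" by (intro sum.cong) (simp_all add: Cyc_def)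
    finally show ?thesis by simp
  qed
  then have "4 dvd 2 * card Cyc" using odd_induced_edges by simp
  moreover have "even k" if "4 dvd 2 * k" for k :: nat using that by presburger
  ultimately show ?thesis by blast
qed

lemma two_regular_Cyc: "two_regular Cyc (\<lambda>v. N v \<inter> Od)"
proof
  fix v assume v: "v \<in> Cyc"
  show "N v \<inter> Od \<subseteq> Cyc"
  proof
    fix u assume u: "u \<in> N v \<inter> Od"
    have "v \<in> N u \<inter> Od" using nbr_sym[of v u] u v Od_subset by (auto simp: Cyc_def)
    then show "u \<in> Cyc" using odd_nbrs_cases[of u] u Od_subset by (auto simp: Cyc_def)
  qed
next
  fix u v assume "u \<in> Cyc" "v \<in> N u \<inter> Od"
  then show "u \<in> N v \<inter> Od" using nbr_sym[of u v] Od_subset by (auto simp: Cyc_def)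
qed (auto simp: Cyc_def)

lemma small_order_cases:
  assumes "card V \<le> 10"
  shows "(card Iso = 2 \<and> card Cyc = 0 \<and> card Ev2 = 3) \<or> (card Iso = 4 \<and> card Cyc = 0 \<and> card Ev2 = 6 \<and> card Ev0 = 0)
    \<or> (card Iso = 0 \<and> card Cyc = 4 \<and> card Ev2 = 2 \<and> card Ev0 \<le> 4)
    \<or> (card Iso = 0 \<and> card Cyc = 6 \<and> card Ev2 = 3 \<and> card Ev0 = 1)"
proof -
  have "card Cyc = 0 \<or> 3 \<le> card Cyc" using two_regular.card_ge_3[OF two_regular_Cyc] by fastforce
  moreover have "even (card V)"
  proof -
    have "even (3 * card V)" using even_sum_degrees cubic by simp
    then show ?thesis by simp
  qed
  moreover have "Od \<noteq> {}" using odd_entry by (auto simp: Od_def)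
  then have "card Iso + card Cyc \<noteq> 0" using V_split(2) by auto
  moreover have arith: "(i = 2 \<and> c = 0 \<and> e = 3) \<or> (i = 4 \<and> c = 0 \<and> e = 6 \<and> f = 0)
    \<or> (i = 0 \<and> c = 4 \<and> e = 2 \<and> f \<le> 4) \<or> (i = 0 \<and> c = 6 \<and> e = 3 \<and> f = 1)"
    if "3 * i + c = 2 * e" "even c" "i + c + e + f \<le> 10" "even (i + c + e + f)" "c = 0 \<or> 3 \<le> c" "i + c \<noteq> 0"
    for i c e f :: nat
  proof -
    have "i \<le> 4" "c \<le> 6" using that by linarith+
    moreover have "even i" using that(1,2) by presburger
    ultimately have "i = 0 \<or> i = 2 \<or> i = 4" "c = 0 \<or> c = 4 \<or> c = 6" using that(2,5) by presburger+
    then show ?thesis using that(1,3,4,6) by (elim disjE; simp; presburger)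
  qed
  ultimately show ?thesis
    using arith[OF edge_count even_card_Cyc, of "card Ev0"] assms order_split by simp
qed

text \<open>Both isolated odd vertices are adjacent to all three vertices of \<open>Ev2\<close>, so they are
  twins.\<close>

lemma not_two_isolated: "\<not> (card Iso = 2 \<and> card Cyc = 0 \<and> card Ev2 = 3)"
proof
  assume c: "card Iso = 2 \<and> card Cyc = 0 \<and> card Ev2 = 3"
  obtain p q where pq: "Iso = {p, q}" "p \<noteq> q" using c by (auto simp: card_2_iff)
  have "N u = Ev2" if "u \<in> Iso" for u
  proof -
    have "u \<in> V" "u \<in> Od" "N u \<inter> Od = {}" using that Od_subset by (auto simp: Iso_def)
    then have "N u \<subseteq> Ev2" "card (N u) = 3" using odd_nbr_in_Ev2 cubic by auto
    then show ?thesis using c by (intro card_subset_eq) auto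
  qed
  moreover have "p \<in> V" "q \<in> V" using pq(1) Od_subset by (auto simp: Iso_def)
  ultimately show False using cubic_twins[of p q] pq c by auto
qed

text \<open>If \<open>x u\<close> and \<open>x v\<close> were congruent modulo 4, the rows modulo 4 would determine the signs of the cycle \<open>p q r s\<close> up to one sign, and together with
  the exact rows they would relate the signs towards \<open>u\<close> and \<open>v\<close> so that a signed indicator vector of the cycle lies in the kernel.\<close>

lemma four_cycle_halves:
  assumes N: "N p = {q, s, u}" "N q = {p, r, u}" "N r = {q, s, v}" "N s = {p, r, v}" "N u = {p, q, u'}" "N v = {r, s, v'}"
    and d: "distinct [p, q, r, s, u, v]" "u' \<notin> {p, q, r, s}" "v' \<notin> {p, q, r, s}"
    and V: "p \<in> V" "q \<in> V" "r \<in> V" "s \<in> V" "u \<in> V" "v \<in> V"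
    and par: "odd (x p)" "odd (x q)" "odd (x r)" "odd (x s)" "even (x u)" "even (x v)"
  shows "(x u + x v) mod 4 = 2"
proof (rule ccontr)
  assume *: "(x u + x v) mod 4 \<noteq> 2"
  define g :: int where "g = (if x u mod 4 = 0 then 1 else - 1)"
  have g: "g = 1 \<or> g = - 1" by (simp add: g_def)
  have sg: "a p q = 1 \<or> a p q = - 1" "a p s = 1 \<or> a p s = - 1" "a q r = 1 \<or> a q r = - 1" "a r s = 1 \<or> a r s = - 1"
    "a u p = 1 \<or> a u p = - 1" "a u q = 1 \<or> a u q = - 1" "a v r = 1 \<or> a v r = - 1" "a v s = 1 \<or> a v s = - 1"
    using N by (auto intro!: sign)
  have ne: "p \<noteq> q" "p \<noteq> r" "p \<noteq> s" "p \<noteq> u" "p \<noteq> v" "q \<noteq> r" "q \<noteq> s" "q \<noteq> u" "q \<noteq> v" "r \<noteq> s" "r \<noteq> u" "r \<noteq> v"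
    "s \<noteq> u" "s \<noteq> v" "u \<noteq> v" using d(1) by simp_all
  have nu: "u' \<noteq> p" "u' \<noteq> q" "u' \<noteq> r" "u' \<noteq> s" "v' \<noteq> p" "v' \<noteq> q" "v' \<noteq> r" "v' \<noteq> s" using d(2,3) by auto
  note sy = sym[of q p] sym[of s p] sym[of r q] sym[of s r] sym[of p u] sym[of q u] sym[of r v] sym[of s v]
  have m: "4 dvd a p q + a p s + x u" "4 dvd a p q + a q r + x u" "4 dvd a q r + a r s + x v" "4 dvd a p s + a r s + x v"
    using row_mod_4[OF V(1)] row_mod_4[OF V(2)] row_mod_4[OF V(3)] row_mod_4[OF V(4)] ne par sy
    by (simp_all add: N add.assoc)
  have rel: "a p s = - g * a p q" "a q r = - g * a p q" "a r s = a p q"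
  proof -
    have e: "\<beta> = - (if U mod 4 = 0 then 1 else - 1) * \<alpha>" if "4 dvd \<alpha> + \<beta> + U" "even U" "\<alpha> = 1 \<or> \<alpha> = - 1" "\<beta> = 1 \<or> \<beta> = - 1"
      for \<alpha> \<beta> U :: int using that by (elim disjE; simp; presburger)
    show 1: "a p s = - g * a p q" unfolding g_def by (rule e[OF m(1) par(5) sg(1,2)])
    show 2: "a q r = - g * a p q" unfolding g_def by (rule e[OF m(2) par(5) sg(1,3)])
    have "x v mod 4 = 0 \<longleftrightarrow> x u mod 4 = 0"
    proof -
      have "Y mod 4 = 0 \<longleftrightarrow> X mod 4 = 0" if "even X" "even Y" "(X + Y) mod 4 \<noteq> 2" for X Y :: int using that by presburger
      from this[OF par(5,6) *] show ?thesis .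
    qed
    then have "a r s = - g * a q r" unfolding g_def using e[OF m(3) par(6) sg(3,4)] by simp
    then show "a r s = a p q" using 2 g by auto
  qed
  have rows: "a p q * x q + a p s * x s + a u p * x u = 0" "a p q * x p + a q r * x r + a u q * x u = 0"
    "a q r * x q + a r s * x s + a v r * x v = 0" "a p s * x p + a r s * x r + a v s * x v = 0"
    using row[OF V(1)] row[OF V(2)] row[OF V(3)] row[OF V(4)] ne sy by (simp_all add: N add.assoc)
  define \<alpha> where "\<alpha> = x q - g * x s"
  define \<beta> where "\<beta> = x p - g * x r"
  have r4: "a p q * \<alpha> + a u p * x u = 0" "a p q * \<beta> + a u q * x u = 0"
    "- g * (a p q * \<alpha>) + a v r * x v = 0" "- g * (a p q * \<beta>) + a v s * x v = 0"
    using rows g unfolding rel \<alpha>_def \<beta>_def by (auto simp: algebra_simps)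
  have "a v r * x v = - g * a u p * x u" "a v s * x v = - g * a u q * x u"
  proof -
    have "a v r * x v = g * (a p q * \<alpha>)" "a v s * x v = g * (a p q * \<beta>)" using r4(3,4) by simp_all
    moreover have "a p q * \<alpha> = - (a u p * x u)" "a p q * \<beta> = - (a u q * x u)" using r4(1,2) by simp_all
    ultimately show "a v r * x v = - g * a u p * x u" "a v s * x v = - g * a u q * x u" by simp_all
  qed
  then have eq: "a v s = (a u p * a u q) * a v r"
    using g sg(5-8) full[OF V(5)] full[OF V(6)] by (elim disjE) simp_all
  \<comment> \<open>so the cycle carries a kernel vector\<close>
  define b where "b = - (a u p * a u q)"
  show False
  proof (rule no_kernel_vector[of p "\<lambda>t. if t = p then 1 else if t = q then b else if t = r then g else if t = s then g * b else 0" u])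
    fix t assume t: "t \<in> V"
    let ?y = "\<lambda>t. if t = p then 1 else if t = q then b else if t = r then g else if t = s then g * b else (0::int)"
    have gg: "g * g = 1" and bb: "b = 1 \<or> b = - 1" using g sg(5,6) by (auto simp: b_def)
    consider "t = p" | "t = q" | "t = r" | "t = s" | "t = u" | "t = v" | "t \<notin> {p, q, r, s, u, v}" by blast
    then show "(\<Sum>w\<in>N t. a t w * ?y w) = 0"
    proof cases
      case 1 then show ?thesis using ne rel gg by (simp add: N algebra_simps)
    next
      case 2 then show ?thesis using ne rel gg sy by (simp add: N algebra_simps)
    next
      case 3 then show ?thesis using ne rel gg sy by (simp add: N algebra_simps)
    next
      case 4 then show ?thesis using ne rel gg sy by (simp add: N algebra_simps)
    next
      case 5
      then have "(\<Sum>w\<in>N t. a t w * ?y w) = a u p + a u q * b" using ne nu by (simp add: N)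
      also have "\<dots> = 0" using sg(5,6) by (auto simp: b_def)
      finally show ?thesis .
    next
      case 6
      then have "(\<Sum>w\<in>N t. a t w * ?y w) = g * (a v r + a v s * b)" using ne nu by (simp add: N algebra_simps)
      also have "\<dots> = 0" using sg(5-8) eq by (auto simp: b_def)
      finally show ?thesis .
    next
      case 7
      have "w \<notin> {p, q, r, s}" if "w \<in> N t" for w
        using nbr_sym[OF t that] 7 N by auto
      then show ?thesis by (intro sum.neutral) auto
    qed
  qed (use V ne in auto)
qed

text \<open>The six vertices form a prism. The rows modulo 4 determine all signs up to three, and eliminating \<open>x u\<close>
  and \<open>x v\<close> from the exact rows of the four odd vertices leaves \<open>x q + x r = 0\<close>, although both entries are 1 modulo 4.\<close>

lemma four_cycle_closed:
  assumes N: "N p = {q, s, u}" "N q = {p, r, u}" "N r = {q, s, v}" "N s = {p, r, v}" "N u = {p, q, v}" "N v = {r, s, u}"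
    and d: "distinct [p, q, r, s, u, v]"
    and V: "p \<in> V" "q \<in> V" "r \<in> V" "s \<in> V" "u \<in> V" "v \<in> V"
    and par: "odd (x p)" "odd (x q)" "odd (x r)" "odd (x s)"
    and half: "x u mod 4 = 2" "x v mod 4 = 0"
  shows False
proof -
  have sg: "a p q = 1 \<or> a p q = - 1" "a p s = 1 \<or> a p s = - 1" "a q r = 1 \<or> a q r = - 1" "a r s = 1 \<or> a r s = - 1"
    "a u p = 1 \<or> a u p = - 1" "a u q = 1 \<or> a u q = - 1" "a v r = 1 \<or> a v r = - 1" "a v s = 1 \<or> a v s = - 1"
    using N by (auto intro!: sign)
  have ne: "p \<noteq> q" "p \<noteq> r" "p \<noteq> s" "p \<noteq> u" "p \<noteq> v" "q \<noteq> r" "q \<noteq> s" "q \<noteq> u" "q \<noteq> v" "r \<noteq> s" "r \<noteq> u" "r \<noteq> v"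
    "s \<noteq> u" "s \<noteq> v" "u \<noteq> v" using d by simp_all
  have ev: "even (x u)" "even (x v)" using half by presburger+
  note sy = sym[of q p] sym[of s p] sym[of r q] sym[of s r] sym[of p u] sym[of q u] sym[of r v] sym[of s v]
  have m: "4 dvd a p q + a p s + x u" "4 dvd a p q + a q r + x u" "4 dvd a q r + a r s + x v"
    "4 dvd a u p + a u q + x v" "4 dvd a v r + a v s + x u"
    using row_mod_4[OF V(1)] row_mod_4[OF V(2)] row_mod_4[OF V(3)] row_mod_4[OF V(5)] row_mod_4[OF V(6)] ne par ev sy
    by (simp_all add: N add.assoc)
  have opp: "\<beta> = - \<alpha>" if "4 dvd \<alpha> + \<beta> + U" "U mod 4 = 0" "\<alpha> = 1 \<or> \<alpha> = - 1" "\<beta> = 1 \<or> \<beta> = - 1" for \<alpha> \<beta> U :: int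
    using that by (elim disjE; simp; presburger)
  have equ: "\<beta> = \<alpha>" if "4 dvd \<alpha> + \<beta> + U" "U mod 4 = 2" "\<alpha> = 1 \<or> \<alpha> = - 1" "\<beta> = 1 \<or> \<beta> = - 1" for \<alpha> \<beta> U :: int
    using that by (elim disjE; simp; presburger)
  have rel: "a p s = a p q" "a q r = a p q" "a r s = - a p q" "a u q = - a u p" "a v s = a v r"
    using equ[OF m(1) half(1) sg(1,2)] equ[OF m(2) half(1) sg(1,3)] opp[OF m(3) half(2) sg(3,4)]
      opp[OF m(4) half(2) sg(5,6)] equ[OF m(5) half(1) sg(7,8)] by simp_all
  have rows: "a p q * x q + a p s * x s + a u p * x u = 0" "a p q * x p + a q r * x r + a u q * x u = 0"
    "a q r * x q + a r s * x s + a v r * x v = 0" "a p s * x p + a r s * x r + a v s * x v = 0"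
    using row[OF V(1)] row[OF V(2)] row[OF V(3)] row[OF V(4)] ne sy by (simp_all add: N add.assoc)
  have "a p q * (2 * (x q + x r)) = 0" using rows unfolding rel by (simp add: algebra_simps)
  then have "x q + x r = 0" using sg(1) by auto
  moreover have "x q mod 4 = 1" "x r mod 4 = 1" using odd_mod_4 V par by auto
  ultimately show False by presburger
qed

text \<open>The four odd vertices form a cycle. Let \<open>u\<close> and \<open>v\<close> be their even
  neighbours. If these are attached to opposite vertices of the cycle, there are twins. Otherwise exactly one
  of the entries of \<open>u\<close> and \<open>v\<close> is divisible by 4
  (\<open>four_cycle_halves\<close>). Either \<open>u\<close> and \<open>v\<close> are adjacent
  (\<open>four_cycle_closed\<close>), or the rows of their third neighbours \<open>u'\<close> and
  \<open>v'\<close>, which share all remaining neighbours, contradict this modulo 4.\<close>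

lemma not_four_cycle: "\<not> (card Iso = 0 \<and> card Cyc = 4 \<and> card Ev2 = 2 \<and> card Ev0 \<le> 4)"
proof
  assume c: "card Iso = 0 \<and> card Cyc = 4 \<and> card Ev2 = 2 \<and> card Ev0 \<le> 4"
  then have Od_eq: "Od = Cyc" "card Od = 4" using V_split(2) by auto
  interpret C: two_regular Od "\<lambda>v. N v \<inter> Od" using two_regular_Cyc Od_eq by simp
  have OV: "w \<in> V" "odd (x w)" if "w \<in> Od" for w using that by (auto simp: Od_def)
  have EV: "w \<in> V" "even (x w)" "w \<notin> Od" if "w \<in> Ev2 \<union> Ev0" for w
    using that by (auto simp: Ev2_def Ev0_def Od_def)
  obtain u v where uv: "Ev2 = {u, v}" "u \<noteq> v" using c by (auto simp: card_2_iff)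
  have uV: "u \<in> V" "v \<in> V" "u \<notin> Od" "v \<notin> Od" "card (N u \<inter> Od) = 2" "card (N v \<inter> Od) = 2"
    using uv by (auto simp: Ev2_def)
  have outer: "\<exists>t. N w = insert t (N w \<inter> Od) \<and> t \<notin> Od \<and> t \<in> V" if "w \<in> V" "card (N w \<inter> Od) = 2" for w
  proof -
    have "card (N w - Od) = 1" using even_nbrs[OF that(1)] that(2) by simp
    then obtain t where t: "N w - Od = {t}" by (auto simp: card_1_singleton_iff)
    then have "N w = insert t (N w \<inter> Od)" "t \<notin> Od" "t \<in> N w" by blast+
    then show ?thesis using N_subset[of w] by blast
  qed
  have odd_N: "\<exists>t\<in>{u, v}. N w = insert t (N w \<inter> Od)" if w: "w \<in> Od" for w
  proof -
    obtain t where t: "N w = insert t (N w \<inter> Od)" "t \<notin> Od" using outer[of w] OV(1)[OF w] C.M_card[OF w] by blast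
    then have "t \<in> N w" by blast
    then have "t \<in> Ev2" using odd_nbr_in_Ev2[OF w] t(2) by blast
    then show ?thesis using t(1) uv(1) by blast
  qed
  obtain p q where pq: "N u \<inter> Od = {p, q}" "p \<noteq> q" using uV(5) by (auto simp: card_2_iff)
  have pO: "p \<in> Od" "q \<in> Od" "u \<in> N p" "u \<in> N q" using pq(1) nbr_sym[OF uV(1)] by blast+
  have with_u: "N w = insert u (N w \<inter> Od)" if w: "w \<in> Od" "u \<in> N w" for w
  proof -
    obtain t where t: "N w = insert t (N w \<inter> Od)" using odd_N[OF w(1)] by blast
    have "u \<in> insert t (N w \<inter> Od)" using w(2) t by (rule subst[rotated])
    then have "u = t" using uV(3) by blast
    then show ?thesis using t by blast
  qed
  note Np = with_u[OF pO(1,3)] with_u[OF pO(2,4)]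
  show False
  proof (cases "q \<in> N p")
    case False
    have p_nq: "p \<notin> N q" using False nbr_sym[OF OV(1)[OF pO(2)], of p] by blast
    have "card (Od - {p, q}) = 2" using pO pq(2) Od_eq(2) by (subst card_Diff_subset) auto
    then have "N p \<inter> Od = Od - {p, q}" "N q \<inter> Od = Od - {p, q}"
      using C.M_card[OF pO(1)] C.M_card[OF pO(2)] False p_nq not_self_nbr[of p] not_self_nbr[of q]
      by (intro card_subset_eq; auto)+
    then have "N p = N q" using Np by simp
    then show False using cubic_twins[of p q] pq(2) OV(1) pO cubic by blast
  next
    case True
    have pq': "q \<in> N p \<inter> Od" "p \<in> N q \<inter> Od" using True pO nbr_sym[OF OV(1)[OF pO(1)], of q] by auto
    from C.other_neighbour[OF pO(1) pq'(1)] obtain s where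
      s: "N p \<inter> Od = {q, s}" "s \<noteq> q" "s \<in> Od" "s \<noteq> p" "p \<in> N s \<inter> Od" by metis
    from C.other_neighbour[OF pO(2) pq'(2)] obtain r where
      r: "N q \<inter> Od = {p, r}" "r \<noteq> p" "r \<in> Od" "r \<noteq> q" "q \<in> N r \<inter> Od" by metis
    have rs: "r \<noteq> s"
    proof
      assume eq: "r = s"
      then have "N s \<inter> Od = {p, q}" using C.neighbours_eq[OF s(3,5), of q] r(5) pq(2) by auto
      then have "N w \<inter> Od \<subseteq> {p, q, s}" if "w \<in> {p, q, s}" for w
        using that s(1) r(1) eq by (elim insertE emptyE) simp_all
      moreover have "{p, q, s} \<subseteq> Od" using pO s(3) by simp
      moreover have c3: "card {p, q, s} = 3" using s(2,4) pq(2) by simp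
      then have "{p, q, s} \<noteq> Od" using Od_eq(2) by auto
      ultimately have "card {p, q, s} + 3 \<le> card Od" using C.closed_card[of "{p, q, s}"] by blast
      then show False using Od_eq(2) c3 by simp
    qed
    have Od4: "{p, q, r, s} = Od"
      using pO r(2-4) s(2-4) rs pq(2) Od_eq(2) by (intro card_subset_eq) auto
    have "p \<notin> N r" using nbr_sym[OF OV(1)[OF r(3)], of p] s(1) r(2-4) rs by auto
    have "q \<notin> N s" using nbr_sym[OF OV(1)[OF s(3)], of q] r(1) s(2-4) rs by auto
    have Nr: "N r \<inter> Od = {q, s}"
    proof -
      from C.other_neighbour[OF r(3,5)] obtain t where t: "N r \<inter> Od = {q, t}" "t \<noteq> q" "t \<in> Od" "t \<noteq> r" by metis
      then show ?thesis using \<open>p \<notin> N r\<close> Od4 by auto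
    qed
    have Ns: "N s \<inter> Od = {p, r}"
    proof -
      from C.other_neighbour[OF s(3,5)] obtain t where t: "N s \<inter> Od = {p, t}" "t \<noteq> p" "t \<in> Od" "t \<noteq> s" by metis
      then show ?thesis using \<open>q \<notin> N s\<close> Od4 by auto
    qed
    have not_u: "u \<notin> N r" "u \<notin> N s"
      using nbr_sym[OF OV(1)[OF r(3)], of u] nbr_sym[OF OV(1)[OF s(3)], of u] pq(1) r(2-4) s(2-4) by auto
    have Nrs: "N r = {q, s, v}" "N s = {p, r, v}"
      using odd_N[OF r(3)] odd_N[OF s(3)] not_u Nr Ns by auto
    have Npq: "N p = {q, s, u}" "N q = {p, r, u}" using Np s(1) r(1) by auto
    have Nv: "N v \<inter> Od = {r, s}"
    proof -
      have "r \<in> N v" "s \<in> N v" using nbr_sym[OF OV(1)] r(3) s(3) Nrs by blast+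
      then have "{r, s} \<subseteq> N v \<inter> Od" "card {r, s} = 2" using r(3) s(3) rs by auto
      then show ?thesis using uV(6) card_subset_eq[of "N v \<inter> Od" "{r, s}"] by auto
    qed
    obtain u' where u': "N u = {p, q, u'}" "u' \<notin> Od" "u' \<in> V" using outer[OF uV(1,5)] pq(1) by auto
    obtain v' where v': "N v = {r, s, v'}" "v' \<notin> Od" "v' \<in> V" using outer[OF uV(2,6)] Nv by auto
    have dist: "distinct [p, q, r, s, u, v]" using pq(2) r(2-4) s(2-4) rs pO uV(3,4) uv(2) by auto
    have V6: "p \<in> V" "q \<in> V" "r \<in> V" "s \<in> V" "u \<in> V" "v \<in> V" using OV pO r(3) s(3) uV by auto
    have par: "odd (x p)" "odd (x q)" "odd (x r)" "odd (x s)" "even (x u)" "even (x v)"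
      using OV pO r(3) s(3) EV uv by auto
    have half: "(x u + x v) mod 4 = 2"
      using u'(2) v'(2) Od4 by (intro four_cycle_halves[OF Npq Nrs u'(1) v'(1) dist _ _ V6 par]) auto
    show False
    proof (cases "u' = v")
      case True
      then have "u \<in> N v" using nbr_sym[OF uV(1), of v] u'(1) by auto
      then have vu: "v' = u" using v'(1) uV(3) r(3) s(3) by auto
      have "(x u mod 4 = 2 \<and> x v mod 4 = 0) \<or> (x u mod 4 = 0 \<and> x v mod 4 = 2)"
      proof -
        have "(X mod 4 = 2 \<and> Y mod 4 = 0) \<or> (X mod 4 = 0 \<and> Y mod 4 = 2)" if "even X" "even Y" "(X + Y) mod 4 = 2" for X Y :: int
          using that by presburger
        then show ?thesis using par(5,6) half by blast
      qed
      then show False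
      proof (elim disjE conjE)
        assume "x u mod 4 = 2" "x v mod 4 = 0"
        then show False
          using four_cycle_closed[OF Npq Nrs _ _ dist V6 par(1-4)] u'(1) v'(1) True vu by simp
      next
        assume h: "x u mod 4 = 0" "x v mod 4 = 2"
        show False
          by (rule four_cycle_closed[of s r p v q u])
            (use Npq Nrs u'(1) v'(1) True vu dist V6 par h in auto)
      qed
    next
      case False
      have vu: "v' \<noteq> u"
      proof
        assume "v' = u"
        then have "v \<in> N u" using nbr_sym[OF uV(2), of u] v'(1) by auto
        then show False using u'(1) uV(4) pO False by auto
      qed
      have "u' \<noteq> u" "v' \<noteq> v" using u'(1) v'(1) not_self_nbr[of u] not_self_nbr[of v] by auto
      then have E0: "u' \<in> Ev0" "v' \<in> Ev0" using u' v' False vu uv(1) V_split(1) by auto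
      have N0: "N w \<subseteq> {u, v} \<union> (Ev0 - {w})" if "w \<in> Ev0" for w
      proof -
        have "N w \<inter> Od = {}" using that by (simp add: Ev0_def)
        then show ?thesis using N_subset[of w] V_split(1) uv(1) not_self_nbr[of w] by auto
      qed
      have only: "u \<in> N w \<longleftrightarrow> w = u'" "v \<in> N w \<longleftrightarrow> w = v'" if "w \<in> Ev0" for w
      proof -
        have w: "w \<in> V" "w \<notin> Od" using EV that by auto
        show "u \<in> N w \<longleftrightarrow> w = u'" using nbr_commute[OF w(1) uV(1)] u'(1) w(2) pO by auto
        show "v \<in> N w \<longleftrightarrow> w = v'" using nbr_commute[OF w(1) uV(2)] v'(1) w(2) r(3) s(3) by auto
      qed
      have c3: "card (N w) = 3" "w \<in> V" if "w \<in> Ev0" for w using that EV cubic by auto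
      \<comment> \<open>a vertex of the even part without a neighbour in \<open>u, v\<close> sees the whole even part\<close>
      have full0: "N w = Ev0 - {w} \<and> card Ev0 = 4" if w: "w \<in> Ev0" "w \<noteq> u'" "w \<noteq> v'" for w
      proof -
        have sub: "N w \<subseteq> Ev0 - {w}" using N0[OF w(1)] only[OF w(1)] w(2,3) by auto
        have "3 \<le> card (Ev0 - {w})" using card_mono[OF _ sub] c3(1)[OF w(1)] by simp
        then have "card Ev0 = 4" "card (Ev0 - {w}) = 3" using c w(1) by auto
        then show ?thesis using sub c3(1)[OF w(1)] card_subset_eq[of "Ev0 - {w}" "N w"] by simp
      qed
      have nuv: "u' \<noteq> v'"
      proof
        assume eq: "u' = v'"
        have "N u' \<noteq> {u, v}" using c3(1)[OF E0(1)] uv(2) by auto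
        moreover have "{u, v} \<subseteq> N u'" using only[OF E0(1)] eq by auto
        ultimately obtain w where w: "w \<in> N u'" "w \<notin> {u, v}" by blast
        then have w0: "w \<in> Ev0" "w \<noteq> u'" using N0[OF E0(1)] by auto
        then have "card Ev0 = 4" using full0[of w] eq by blast
        have "t \<in> N u'" if "t \<in> Ev0 - {u'}" for t
        proof -
          have "u' \<in> N t" using full0[of t] that eq E0(1) by auto
          then show ?thesis using nbr_sym[of t u'] c3(2)[of t] that by blast
        qed
        then have "{u, v} \<union> (Ev0 - {u'}) \<subseteq> N u'" using \<open>{u, v} \<subseteq> N u'\<close> by blast
        then have "card ({u, v} \<union> (Ev0 - {u'})) \<le> 3" using card_mono[OF finite_N, of _ u'] c3(1)[OF E0(1)] by metis
        moreover have "card ({u, v} \<union> (Ev0 - {u'})) = card {u, v} + card (Ev0 - {u'})"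
          using uv(1) V_split(3) by (intro card_Un_disjoint) auto
        ultimately show False using \<open>card Ev0 = 4\<close> E0(1) uv(2) by simp
      qed
      have "card (N u' - {u}) = 2" using c3(1)[OF E0(1)] only(1)[OF E0(1)] by simp
      moreover have "N u' - {u} \<subseteq> Ev0 - {u'}" using N0[OF E0(1)] only(2)[OF E0(1)] nuv by auto
      ultimately have "2 \<le> card (Ev0 - {u'})" by (metis card_mono finite_Diff finites(4))
      then have "Ev0 - {u'} \<noteq> {v'}" by force
      then obtain t where t: "t \<in> Ev0" "t \<noteq> u'" "t \<noteq> v'" using E0(2) nuv by blast
      have c4: "card Ev0 = 4" using full0[OF t] by simp
      have "card (Ev0 - {u', v', t}) = 1" using c4 E0 t nuv by (subst card_Diff_subset) auto
      then obtain t' where t': "Ev0 - {u', v', t} = {t'}" by (auto simp: card_1_singleton_iff)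
      then have t'0: "t' \<in> Ev0" "t' \<noteq> u'" "t' \<noteq> v'" "t' \<noteq> t" by auto
      have nb: "t \<in> N w" "t' \<in> N w" if "w \<in> {u', v'}" for w
      proof -
        have "w \<in> N t" "w \<in> N t'" using full0[OF t] full0[OF t'0(1-3)] that E0 t t'0 by auto
        then show "t \<in> N w" "t' \<in> N w" using nbr_sym c3(2) t(1) t'0(1) by blast+
      qed
      have not2: "t \<notin> {u, v}" "t' \<notin> {u, v}" using t(1) t'0(1) uv(1) V_split(3) by auto
      have Nu': "N u' = {u, t, t'}" "N v' = {v, t, t'}"
      proof -
        have "{u, t, t'} \<subseteq> N u'" "card {u, t, t'} = 3" using nb[of u'] only(1)[OF E0(1)] not2 t'0(4) by auto
        then show "N u' = {u, t, t'}" using c3(1)[OF E0(1)] card_subset_eq[OF finite_N, of "{u, t, t'}" u'] by simp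
        have "{v, t, t'} \<subseteq> N v'" "card {v, t, t'} = 3" using nb[of v'] only(2)[OF E0(2)] not2 t'0(4) by auto
        then show "N v' = {v, t, t'}" using c3(1)[OF E0(2)] card_subset_eq[OF finite_N, of "{v, t, t'}" v'] by simp
      qed
      have ne_t: "u \<noteq> t" "u \<noteq> t'" "v \<noteq> t" "v \<noteq> t'" "t \<noteq> t'" using not2 t'0(4) by auto
      have "even (x t)" "even (x t')" using EV t(1) t'0(1) by auto
      then have "4 dvd x u + (x t + x t')" "4 dvd x v + (x t + x t')"
        using row_mod_4[OF c3(2)[OF E0(1)]] row_mod_4[OF c3(2)[OF E0(2)]] ne_t par(5,6)
        by (simp_all add: Nu')
      then have "4 dvd (x u + (x t + x t')) - (x v + (x t + x t'))" by (rule dvd_diff)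
      then have "4 dvd x u - x v" by simp
      moreover have False if "4 dvd X - Y" "even X" "(X + Y) mod 4 = 2" for X Y :: int using that by presburger
      ultimately show False using half par(5) by blast
    qed
  qed
qed

end

section \<open>Cubic graphs of order ten\<close>

text \<open>The four lemmas below enumerate the cubic graphs of order ten that parity leaves. In the first
  two, the six odd vertices \<open>c1\<close>, \<dots>, \<open>c6\<close> form a hexagon or two triangles,
  \<open>e\<close> sends each of them to its even neighbour, the partner \<open>m c\<close> has the same even
  neighbour, and all even neighbours are joined to \<open>z\<close>. In the last two, four odd vertices
  \<open>b1\<close>, \<dots>, \<open>b4\<close> are joined through six even vertices that subdivide the edges
  of a cubic multigraph and are matched by \<open>m\<close>. The fifteen matchings in each case produce only
  eight graphs up to isomorphism, and the instantiations are these isomorphisms.\<close>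

lemma (in nut_matrix) hexagon_with_spokes:
  assumes card: "card V = 10" and V: "V = {c1, c2, c3, c4, c5, c6, e c1, e c2, e c3, e c4, e c5, e c6, z}"
    and d: "distinct [c1, c2, c3, c4, c5, c6]"
    and Nc: "N c1 = {e c1, c2, c6}" "N c2 = {e c2, c1, c3}" "N c3 = {e c3, c2, c4}"
      "N c4 = {e c4, c3, c5}" "N c5 = {e c5, c4, c6}" "N c6 = {e c6, c1, c5}"
    and Ne: "N (e c1) = {c1, m c1, z}" "N (e c2) = {c2, m c2, z}" "N (e c3) = {c3, m c3, z}"
      "N (e c4) = {c4, m c4, z}" "N (e c5) = {c5, m c5, z}" "N (e c6) = {c6, m c6, z}"
    and Nz: "N z = {e c1, e c2, e c3, e c4, e c5, e c6}"
    and em: "e (m c1) = e c1" "e (m c2) = e c2" "e (m c3) = e c3" "e (m c4) = e c4" "e (m c5) = e c5" "e (m c6) = e c6"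
    and m: "\<forall>s\<in>{c1, c2, c3, c4, c5, c6}. m s \<in> {c1, c2, c3, c4, c5, c6} \<and> m s \<noteq> s \<and> m (m s) = s"
  shows False
proof -
  show ?thesis using matching_of_six[OF d m]
  proof (elim disjE conjE)
    assume m: "m c1 = c2" "m c3 = c4" "m c5 = c6"
    note e = em(1)[unfolded m] em(3)[unfolded m] em(5)[unfolded m]
    show False
      by (rule no_cubic_graph_E[OF card, of "e c1" c1 c2 z c6 c3 "e c5" "e c3" c5 c4],
        simp add: V e insert_commute, simp_all add: Nc Ne Nz e m insert_commute)
  next
    assume m: "m c1 = c2" "m c3 = c5" "m c4 = c6"
    note e = em(1)[unfolded m] em(3)[unfolded m] em(4)[unfolded m]
    show False
      by (rule no_cubic_graph_F[OF card, of "e c1" c1 c2 z c6 c3 "e c4" "e c3" c5 c4],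
        simp add: V e insert_commute, simp_all add: Nc Ne Nz e m insert_commute)
  next
    assume m: "m c1 = c2" "m c3 = c6" "m c4 = c5"
    note e = em(1)[unfolded m] em(3)[unfolded m] em(4)[unfolded m]
    show False
      by (rule no_cubic_graph_D[OF card, of c1 c2 "e c1" c6 c3 z "e c3" c5 c4 "e c4"],
        simp add: V e insert_commute, simp_all add: Nc Ne Nz e m insert_commute)
  next
    assume m: "m c1 = c3" "m c2 = c4" "m c5 = c6"
    note e = em(1)[unfolded m] em(2)[unfolded m] em(5)[unfolded m]
    show False
      by (rule no_cubic_graph_F[OF card, of "e c5" c5 c6 z c4 c1 "e c2" "e c1" c3 c2],
        simp add: V e insert_commute, simp_all add: Nc Ne Nz e m insert_commute)
  next
    assume m: "m c1 = c3" "m c2 = c5" "m c4 = c6"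
    note e = em(1)[unfolded m] em(2)[unfolded m] em(4)[unfolded m]
    show False
      by (rule no_cubic_graph_G[OF card, of c2 c1 c3 "e c2" "e c1" c6 c4 z c5 "e c4"],
        simp add: V e insert_commute, simp_all add: Nc Ne Nz e m insert_commute)
  next
    assume m: "m c1 = c3" "m c2 = c6" "m c4 = c5"
    note e = em(1)[unfolded m] em(2)[unfolded m] em(4)[unfolded m]
    show False
      by (rule no_cubic_graph_F[OF card, of "e c4" c4 c5 z c3 c6 "e c1" "e c2" c2 c1],
        simp add: V e insert_commute, simp_all add: Nc Ne Nz e m insert_commute)
  next
    assume m: "m c1 = c4" "m c2 = c3" "m c5 = c6"
    note e = em(1)[unfolded m] em(2)[unfolded m] em(5)[unfolded m]
    show False
      by (rule no_cubic_graph_D[OF card, of c2 c3 "e c2" c1 c4 z "e c1" c6 c5 "e c5"],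
        simp add: V e insert_commute, simp_all add: Nc Ne Nz e m insert_commute)
  next
    assume m: "m c1 = c4" "m c2 = c5" "m c3 = c6"
    note e = em(1)[unfolded m] em(2)[unfolded m] em(3)[unfolded m]
    show False
      by (rule no_petersen[OF card, of c1 c2 c6 "e c1" c3 "e c2" "e c3" c5 c4 z],
        simp add: V e insert_commute, simp_all add: Nc Ne Nz e m insert_commute)
  next
    assume m: "m c1 = c4" "m c2 = c6" "m c3 = c5"
    note e = em(1)[unfolded m] em(2)[unfolded m] em(3)[unfolded m]
    show False
      by (rule no_cubic_graph_G[OF card, of c1 c2 c6 "e c1" "e c2" c3 c5 z c4 "e c3"],
        simp add: V e insert_commute, simp_all add: Nc Ne Nz e m insert_commute)
  next
    assume m: "m c1 = c5" "m c2 = c3" "m c4 = c6"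
    note e = em(1)[unfolded m] em(2)[unfolded m] em(4)[unfolded m]
    show False
      by (rule no_cubic_graph_F[OF card, of "e c2" c2 c3 z c1 c4 "e c1" "e c4" c6 c5],
        simp add: V e insert_commute, simp_all add: Nc Ne Nz e m insert_commute)
  next
    assume m: "m c1 = c5" "m c2 = c4" "m c3 = c6"
    note e = em(1)[unfolded m] em(2)[unfolded m] em(3)[unfolded m]
    show False
      by (rule no_cubic_graph_G[OF card, of c3 c2 c4 "e c3" "e c2" c1 c5 z c6 "e c1"],
        simp add: V e insert_commute, simp_all add: Nc Ne Nz e m insert_commute)
  next
    assume m: "m c1 = c5" "m c2 = c6" "m c3 = c4"
    note e = em(1)[unfolded m] em(2)[unfolded m] em(3)[unfolded m]
    show False
      by (rule no_cubic_graph_F[OF card, of "e c3" c3 c4 z c2 c5 "e c2" "e c1" c1 c6],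
        simp add: V e insert_commute, simp_all add: Nc Ne Nz e m insert_commute)
  next
    assume m: "m c1 = c6" "m c2 = c3" "m c4 = c5"
    note e = em(1)[unfolded m] em(2)[unfolded m] em(4)[unfolded m]
    show False
      by (rule no_cubic_graph_E[OF card, of "e c1" c1 c6 z c2 c5 "e c2" "e c4" c3 c4],
        simp add: V e insert_commute, simp_all add: Nc Ne Nz e m insert_commute)
  next
    assume m: "m c1 = c6" "m c2 = c4" "m c3 = c5"
    note e = em(1)[unfolded m] em(2)[unfolded m] em(3)[unfolded m]
    show False
      by (rule no_cubic_graph_F[OF card, of "e c1" c1 c6 z c2 c5 "e c2" "e c3" c3 c4],
        simp add: V e insert_commute, simp_all add: Nc Ne Nz e m insert_commute)
  next
    assume m: "m c1 = c6" "m c2 = c5" "m c3 = c4"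
    note e = em(1)[unfolded m] em(2)[unfolded m] em(3)[unfolded m]
    show False
      by (rule no_cubic_graph_D[OF card, of c1 c6 "e c1" c2 c5 z "e c2" c3 c4 "e c3"],
        simp add: V e insert_commute, simp_all add: Nc Ne Nz e m insert_commute)
  qed
qed

lemma (in nut_matrix) triangles_with_spokes:
  assumes card: "card V = 10" and V: "V = {c1, c2, c3, c4, c5, c6, e c1, e c2, e c3, e c4, e c5, e c6, z}"
    and d: "distinct [c1, c2, c3, c4, c5, c6]"
    and Nc: "N c1 = {e c1, c2, c3}" "N c2 = {e c2, c1, c3}" "N c3 = {e c3, c1, c2}"
      "N c4 = {e c4, c5, c6}" "N c5 = {e c5, c4, c6}" "N c6 = {e c6, c4, c5}"
    and Ne: "N (e c1) = {c1, m c1, z}" "N (e c2) = {c2, m c2, z}" "N (e c3) = {c3, m c3, z}"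
      "N (e c4) = {c4, m c4, z}" "N (e c5) = {c5, m c5, z}" "N (e c6) = {c6, m c6, z}"
    and Nz: "N z = {e c1, e c2, e c3, e c4, e c5, e c6}"
    and em: "e (m c1) = e c1" "e (m c2) = e c2" "e (m c3) = e c3" "e (m c4) = e c4" "e (m c5) = e c5" "e (m c6) = e c6"
    and m: "\<forall>s\<in>{c1, c2, c3, c4, c5, c6}. m s \<in> {c1, c2, c3, c4, c5, c6} \<and> m s \<noteq> s \<and> m (m s) = s"
  shows False
proof -
  show ?thesis using matching_of_six[OF d m]
  proof (elim disjE conjE)
    assume m: "m c1 = c2" "m c3 = c4" "m c5 = c6"
    note e = em(1)[unfolded m] em(3)[unfolded m] em(5)[unfolded m]
    show False
      by (rule no_cubic_graph_A[OF card, of c1 c2 c3 "e c1" "e c3" z c4 "e c5" c5 c6],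
        simp add: V e insert_commute, simp_all add: Nc Ne Nz e m insert_commute)
  next
    assume m: "m c1 = c2" "m c3 = c5" "m c4 = c6"
    note e = em(1)[unfolded m] em(3)[unfolded m] em(4)[unfolded m]
    show False
      by (rule no_cubic_graph_A[OF card, of c1 c2 c3 "e c1" "e c3" z c5 "e c4" c4 c6],
        simp add: V e insert_commute, simp_all add: Nc Ne Nz e m insert_commute)
  next
    assume m: "m c1 = c2" "m c3 = c6" "m c4 = c5"
    note e = em(1)[unfolded m] em(3)[unfolded m] em(4)[unfolded m]
    show False
      by (rule no_cubic_graph_A[OF card, of c1 c2 c3 "e c1" "e c3" z c6 "e c4" c4 c5],
        simp add: V e insert_commute, simp_all add: Nc Ne Nz e m insert_commute)
  next
    assume m: "m c1 = c3" "m c2 = c4" "m c5 = c6"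
    note e = em(1)[unfolded m] em(2)[unfolded m] em(5)[unfolded m]
    show False
      by (rule no_cubic_graph_A[OF card, of c1 c3 c2 "e c1" "e c2" z c4 "e c5" c5 c6],
        simp add: V e insert_commute, simp_all add: Nc Ne Nz e m insert_commute)
  next
    assume m: "m c1 = c3" "m c2 = c5" "m c4 = c6"
    note e = em(1)[unfolded m] em(2)[unfolded m] em(4)[unfolded m]
    show False
      by (rule no_cubic_graph_A[OF card, of c1 c3 c2 "e c1" "e c2" z c5 "e c4" c4 c6],
        simp add: V e insert_commute, simp_all add: Nc Ne Nz e m insert_commute)
  next
    assume m: "m c1 = c3" "m c2 = c6" "m c4 = c5"
    note e = em(1)[unfolded m] em(2)[unfolded m] em(4)[unfolded m]
    show False
      by (rule no_cubic_graph_A[OF card, of c1 c3 c2 "e c1" "e c2" z c6 "e c4" c4 c5],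
        simp add: V e insert_commute, simp_all add: Nc Ne Nz e m insert_commute)
  next
    assume m: "m c1 = c4" "m c2 = c3" "m c5 = c6"
    note e = em(1)[unfolded m] em(2)[unfolded m] em(5)[unfolded m]
    show False
      by (rule no_cubic_graph_A[OF card, of c2 c3 c1 "e c2" "e c1" z c4 "e c5" c5 c6],
        simp add: V e insert_commute, simp_all add: Nc Ne Nz e m insert_commute)
  next
    assume m: "m c1 = c4" "m c2 = c5" "m c3 = c6"
    note e = em(1)[unfolded m] em(2)[unfolded m] em(3)[unfolded m]
    show False
      by (rule no_cubic_graph_D[OF card, of c1 c2 c3 "e c1" "e c2" "e c3" z c4 c5 c6],
        simp add: V e insert_commute, simp_all add: Nc Ne Nz e m insert_commute)
  next
    assume m: "m c1 = c4" "m c2 = c6" "m c3 = c5"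
    note e = em(1)[unfolded m] em(2)[unfolded m] em(3)[unfolded m]
    show False
      by (rule no_cubic_graph_D[OF card, of c1 c2 c3 "e c1" "e c2" "e c3" z c4 c6 c5],
        simp add: V e insert_commute, simp_all add: Nc Ne Nz e m insert_commute)
  next
    assume m: "m c1 = c5" "m c2 = c3" "m c4 = c6"
    note e = em(1)[unfolded m] em(2)[unfolded m] em(4)[unfolded m]
    show False
      by (rule no_cubic_graph_A[OF card, of c2 c3 c1 "e c2" "e c1" z c5 "e c4" c4 c6],
        simp add: V e insert_commute, simp_all add: Nc Ne Nz e m insert_commute)
  next
    assume m: "m c1 = c5" "m c2 = c4" "m c3 = c6"
    note e = em(1)[unfolded m] em(2)[unfolded m] em(3)[unfolded m]
    show False
      by (rule no_cubic_graph_D[OF card, of c1 c2 c3 "e c1" "e c2" "e c3" z c5 c4 c6],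
        simp add: V e insert_commute, simp_all add: Nc Ne Nz e m insert_commute)
  next
    assume m: "m c1 = c5" "m c2 = c6" "m c3 = c4"
    note e = em(1)[unfolded m] em(2)[unfolded m] em(3)[unfolded m]
    show False
      by (rule no_cubic_graph_D[OF card, of c1 c2 c3 "e c1" "e c2" "e c3" z c5 c6 c4],
        simp add: V e insert_commute, simp_all add: Nc Ne Nz e m insert_commute)
  next
    assume m: "m c1 = c6" "m c2 = c3" "m c4 = c5"
    note e = em(1)[unfolded m] em(2)[unfolded m] em(4)[unfolded m]
    show False
      by (rule no_cubic_graph_A[OF card, of c2 c3 c1 "e c2" "e c1" z c6 "e c4" c4 c5],
        simp add: V e insert_commute, simp_all add: Nc Ne Nz e m insert_commute)
  next
    assume m: "m c1 = c6" "m c2 = c4" "m c3 = c5"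
    note e = em(1)[unfolded m] em(2)[unfolded m] em(3)[unfolded m]
    show False
      by (rule no_cubic_graph_D[OF card, of c1 c2 c3 "e c1" "e c2" "e c3" z c6 c4 c5],
        simp add: V e insert_commute, simp_all add: Nc Ne Nz e m insert_commute)
  next
    assume m: "m c1 = c6" "m c2 = c5" "m c3 = c4"
    note e = em(1)[unfolded m] em(2)[unfolded m] em(3)[unfolded m]
    show False
      by (rule no_cubic_graph_D[OF card, of c1 c2 c3 "e c1" "e c2" "e c3" z c6 c5 c4],
        simp add: V e insert_commute, simp_all add: Nc Ne Nz e m insert_commute)
  qed
qed

lemma (in nut_matrix) subdivided_K4_with_mates:
  assumes card: "card V = 10" and V: "V = {b1, b2, b3, b4, e1, e2, e3, e4, e5, e6}"
    and d: "distinct [e1, e2, e3, e4, e5, e6]"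
    and Nb: "N b1 = {e1, e2, e3}" "N b2 = {e1, e4, e5}" "N b3 = {e2, e4, e6}" "N b4 = {e3, e5, e6}"
    and Ne: "N e1 = {m e1, b1, b2}" "N e2 = {m e2, b1, b3}" "N e3 = {m e3, b1, b4}"
      "N e4 = {m e4, b2, b3}" "N e5 = {m e5, b2, b4}" "N e6 = {m e6, b3, b4}"
    and m: "\<forall>s\<in>{e1, e2, e3, e4, e5, e6}. m s \<in> {e1, e2, e3, e4, e5, e6} \<and> m s \<noteq> s \<and> m (m s) = s"
  shows False
proof -
  have mm: "m (m e1) = e1" "m (m e2) = e2" "m (m e3) = e3" "m (m e4) = e4" "m (m e5) = e5" "m (m e6) = e6"
    using m by simp_all
  show ?thesis using matching_of_six[OF d m]
  proof (elim disjE conjE)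
    assume m: "m e1 = e2" "m e3 = e4" "m e5 = e6"
    note m' = mm(1)[unfolded m] mm(3)[unfolded m] mm(5)[unfolded m]
    show False
      by (rule no_cubic_graph_D[OF card, of b1 e1 e2 e3 b2 b3 e4 b4 e5 e6],
        simp add: V insert_commute, simp_all add: Nb Ne m m' insert_commute)
  next
    assume m: "m e1 = e2" "m e3 = e5" "m e4 = e6"
    note m' = mm(1)[unfolded m] mm(3)[unfolded m] mm(4)[unfolded m]
    show False
      by (rule no_cubic_graph_E[OF card, of e1 b1 e2 b2 e3 b3 e5 e4 b4 e6],
        simp add: V insert_commute, simp_all add: Nb Ne m m' insert_commute)
  next
    assume m: "m e1 = e2" "m e3 = e6" "m e4 = e5"
    note m' = mm(1)[unfolded m] mm(3)[unfolded m] mm(4)[unfolded m]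
    show False
      by (rule no_cubic_graph_E[OF card, of e2 b1 e1 b3 e3 b2 e6 e4 b4 e5],
        simp add: V insert_commute, simp_all add: Nb Ne m m' insert_commute)
  next
    assume m: "m e1 = e3" "m e2 = e4" "m e5 = e6"
    note m' = mm(1)[unfolded m] mm(2)[unfolded m] mm(5)[unfolded m]
    show False
      by (rule no_cubic_graph_E[OF card, of e1 b1 e3 b2 e2 b4 e4 e5 b3 e6],
        simp add: V insert_commute, simp_all add: Nb Ne m m' insert_commute)
  next
    assume m: "m e1 = e3" "m e2 = e5" "m e4 = e6"
    note m' = mm(1)[unfolded m] mm(2)[unfolded m] mm(4)[unfolded m]
    show False
      by (rule no_cubic_graph_D[OF card, of b1 e1 e3 e2 b2 b4 e5 b3 e4 e6],
        simp add: V insert_commute, simp_all add: Nb Ne m m' insert_commute)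
  next
    assume m: "m e1 = e3" "m e2 = e6" "m e4 = e5"
    note m' = mm(1)[unfolded m] mm(2)[unfolded m] mm(4)[unfolded m]
    show False
      by (rule no_cubic_graph_E[OF card, of e3 b1 e1 b4 e2 b2 e6 e5 b3 e4],
        simp add: V insert_commute, simp_all add: Nb Ne m m' insert_commute)
  next
    assume m: "m e1 = e4" "m e2 = e3" "m e5 = e6"
    note m' = mm(1)[unfolded m] mm(2)[unfolded m] mm(5)[unfolded m]
    show False
      by (rule no_cubic_graph_E[OF card, of e2 b1 e3 b3 e1 b4 e4 e6 b2 e5],
        simp add: V insert_commute, simp_all add: Nb Ne m m' insert_commute)
  next
    assume m: "m e1 = e4" "m e2 = e5" "m e3 = e6"
    note m' = mm(1)[unfolded m] mm(2)[unfolded m] mm(3)[unfolded m]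
    show False
      by (rule no_cubic_graph_D[OF card, of b2 e1 e4 e5 b1 b3 e2 b4 e3 e6],
        simp add: V insert_commute, simp_all add: Nb Ne m m' insert_commute)
  next
    assume m: "m e1 = e4" "m e2 = e6" "m e3 = e5"
    note m' = mm(1)[unfolded m] mm(2)[unfolded m] mm(3)[unfolded m]
    show False
      by (rule no_cubic_graph_E[OF card, of e1 b2 e4 b1 e5 b3 e3 e2 b4 e6],
        simp add: V insert_commute, simp_all add: Nb Ne m m' insert_commute)
  next
    assume m: "m e1 = e5" "m e2 = e3" "m e4 = e6"
    note m' = mm(1)[unfolded m] mm(2)[unfolded m] mm(4)[unfolded m]
    show False
      by (rule no_cubic_graph_E[OF card, of e3 b1 e2 b4 e1 b3 e5 e6 b2 e4],
        simp add: V insert_commute, simp_all add: Nb Ne m m' insert_commute)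
  next
    assume m: "m e1 = e5" "m e2 = e4" "m e3 = e6"
    note m' = mm(1)[unfolded m] mm(2)[unfolded m] mm(3)[unfolded m]
    show False
      by (rule no_cubic_graph_E[OF card, of e1 b2 e5 b1 e4 b4 e2 e3 b3 e6],
        simp add: V insert_commute, simp_all add: Nb Ne m m' insert_commute)
  next
    assume m: "m e1 = e5" "m e2 = e6" "m e3 = e4"
    note m' = mm(1)[unfolded m] mm(2)[unfolded m] mm(3)[unfolded m]
    show False
      by (rule no_cubic_graph_D[OF card, of b2 e1 e5 e4 b1 b4 e3 b3 e2 e6],
        simp add: V insert_commute, simp_all add: Nb Ne m m' insert_commute)
  next
    assume m: "m e1 = e6" "m e2 = e3" "m e4 = e5"
    note m' = mm(1)[unfolded m] mm(2)[unfolded m] mm(4)[unfolded m]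
    show False
      by (rule no_cubic_graph_D[OF card, of b1 e2 e3 e1 b3 b4 e6 b2 e4 e5],
        simp add: V insert_commute, simp_all add: Nb Ne m m' insert_commute)
  next
    assume m: "m e1 = e6" "m e2 = e4" "m e3 = e5"
    note m' = mm(1)[unfolded m] mm(2)[unfolded m] mm(3)[unfolded m]
    show False
      by (rule no_cubic_graph_D[OF card, of b3 e2 e4 e6 b1 b2 e1 b4 e3 e5],
        simp add: V insert_commute, simp_all add: Nb Ne m m' insert_commute)
  next
    assume m: "m e1 = e6" "m e2 = e5" "m e3 = e4"
    note m' = mm(1)[unfolded m] mm(2)[unfolded m] mm(3)[unfolded m]
    show False
      by (rule no_petersen[OF card, of b1 e1 e2 e3 b2 e6 e5 b3 e4 b4],
        simp add: V insert_commute, simp_all add: Nb Ne m m' insert_commute)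
  qed
qed

lemma (in nut_matrix) subdivided_necklace_with_mates:
  assumes card: "card V = 10" and V: "V = {b1, b2, b3, b4, e1, e2, e3, e4, e5, e6}"
    and d: "distinct [e1, e2, e3, e4, e5, e6]"
    and Nb: "N b1 = {e1, e2, e5}" "N b2 = {e1, e2, e6}" "N b3 = {e3, e4, e5}" "N b4 = {e3, e4, e6}"
    and Ne: "N e1 = {m e1, b1, b2}" "N e2 = {m e2, b1, b2}" "N e3 = {m e3, b3, b4}"
      "N e4 = {m e4, b3, b4}" "N e5 = {m e5, b1, b3}" "N e6 = {m e6, b2, b4}"
    and m: "\<forall>s\<in>{e1, e2, e3, e4, e5, e6}. m s \<in> {e1, e2, e3, e4, e5, e6} \<and> m s \<noteq> s \<and> m (m s) = s"
  shows False
proof -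
  have mm: "m (m e1) = e1" "m (m e2) = e2" "m (m e3) = e3" "m (m e4) = e4" "m (m e5) = e5" "m (m e6) = e6"
    using m by simp_all
  show ?thesis using matching_of_six[OF d m]
  proof (elim disjE conjE)
    assume m: "m e1 = e2" "m e3 = e4" "m e5 = e6"
    note m' = mm(1)[unfolded m] mm(3)[unfolded m] mm(5)[unfolded m]
    show False
      by (rule no_cubic_graph_A[OF card, of e1 e2 b1 b2 e5 e6 b3 b4 e3 e4],
        simp add: V insert_commute, simp_all add: Nb Ne m m' insert_commute)
  next
    assume m: "m e1 = e2" "m e3 = e5" "m e4 = e6"
    note m' = mm(1)[unfolded m] mm(3)[unfolded m] mm(4)[unfolded m]
    show False
      by (rule no_cubic_graph_B[OF card, of e1 e2 b1 b2 e5 e6 b3 e3 e4 b4],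
        simp add: V insert_commute, simp_all add: Nb Ne m m' insert_commute)
  next
    assume m: "m e1 = e2" "m e3 = e6" "m e4 = e5"
    note m' = mm(1)[unfolded m] mm(3)[unfolded m] mm(4)[unfolded m]
    show False
      by (rule no_cubic_graph_B[OF card, of e1 e2 b1 b2 e5 e6 b3 e4 e3 b4],
        simp add: V insert_commute, simp_all add: Nb Ne m m' insert_commute)
  next
    assume m: "m e1 = e3" "m e2 = e4" "m e5 = e6"
    note m' = mm(1)[unfolded m] mm(2)[unfolded m] mm(5)[unfolded m]
    show False
      by (rule no_cubic_graph_G[OF card, of b1 e1 e2 e5 b2 e3 e4 e6 b3 b4],
        simp add: V insert_commute, simp_all add: Nb Ne m m' insert_commute)
  next
    assume m: "m e1 = e3" "m e2 = e5" "m e4 = e6"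
    note m' = mm(1)[unfolded m] mm(2)[unfolded m] mm(4)[unfolded m]
    show False
      by (rule no_cubic_graph_C[OF card, of b1 e2 e5 e1 b2 b3 e3 e6 e4 b4],
        simp add: V insert_commute, simp_all add: Nb Ne m m' insert_commute)
  next
    assume m: "m e1 = e3" "m e2 = e6" "m e4 = e5"
    note m' = mm(1)[unfolded m] mm(2)[unfolded m] mm(4)[unfolded m]
    show False
      by (rule no_cubic_graph_C[OF card, of b2 e2 e6 e1 b1 b4 e3 e5 e4 b3],
        simp add: V insert_commute, simp_all add: Nb Ne m m' insert_commute)
  next
    assume m: "m e1 = e4" "m e2 = e3" "m e5 = e6"
    note m' = mm(1)[unfolded m] mm(2)[unfolded m] mm(5)[unfolded m]
    show False
      by (rule no_cubic_graph_G[OF card, of b1 e1 e2 e5 b2 e4 e3 e6 b3 b4],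
        simp add: V insert_commute, simp_all add: Nb Ne m m' insert_commute)
  next
    assume m: "m e1 = e4" "m e2 = e5" "m e3 = e6"
    note m' = mm(1)[unfolded m] mm(2)[unfolded m] mm(3)[unfolded m]
    show False
      by (rule no_cubic_graph_C[OF card, of b1 e2 e5 e1 b2 b3 e4 e6 e3 b4],
        simp add: V insert_commute, simp_all add: Nb Ne m m' insert_commute)
  next
    assume m: "m e1 = e4" "m e2 = e6" "m e3 = e5"
    note m' = mm(1)[unfolded m] mm(2)[unfolded m] mm(3)[unfolded m]
    show False
      by (rule no_cubic_graph_C[OF card, of b2 e2 e6 e1 b1 b4 e4 e5 e3 b3],
        simp add: V insert_commute, simp_all add: Nb Ne m m' insert_commute)
  next
    assume m: "m e1 = e5" "m e2 = e3" "m e4 = e6"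
    note m' = mm(1)[unfolded m] mm(2)[unfolded m] mm(4)[unfolded m]
    show False
      by (rule no_cubic_graph_C[OF card, of b1 e1 e5 e2 b2 b3 e3 e6 e4 b4],
        simp add: V insert_commute, simp_all add: Nb Ne m m' insert_commute)
  next
    assume m: "m e1 = e5" "m e2 = e4" "m e3 = e6"
    note m' = mm(1)[unfolded m] mm(2)[unfolded m] mm(3)[unfolded m]
    show False
      by (rule no_cubic_graph_C[OF card, of b1 e1 e5 e2 b2 b3 e4 e6 e3 b4],
        simp add: V insert_commute, simp_all add: Nb Ne m m' insert_commute)
  next
    assume m: "m e1 = e5" "m e2 = e6" "m e3 = e4"
    note m' = mm(1)[unfolded m] mm(2)[unfolded m] mm(3)[unfolded m]
    show False
      by (rule no_cubic_graph_B[OF card, of e3 e4 b3 b4 e5 e6 b1 e1 e2 b2],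
        simp add: V insert_commute, simp_all add: Nb Ne m m' insert_commute)
  next
    assume m: "m e1 = e6" "m e2 = e3" "m e4 = e5"
    note m' = mm(1)[unfolded m] mm(2)[unfolded m] mm(4)[unfolded m]
    show False
      by (rule no_cubic_graph_C[OF card, of b2 e1 e6 e2 b1 b4 e3 e5 e4 b3],
        simp add: V insert_commute, simp_all add: Nb Ne m m' insert_commute)
  next
    assume m: "m e1 = e6" "m e2 = e4" "m e3 = e5"
    note m' = mm(1)[unfolded m] mm(2)[unfolded m] mm(3)[unfolded m]
    show False
      by (rule no_cubic_graph_C[OF card, of b2 e1 e6 e2 b1 b4 e4 e5 e3 b3],
        simp add: V insert_commute, simp_all add: Nb Ne m m' insert_commute)
  next
    assume m: "m e1 = e6" "m e2 = e5" "m e3 = e4"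
    note m' = mm(1)[unfolded m] mm(2)[unfolded m] mm(3)[unfolded m]
    show False
      by (rule no_cubic_graph_B[OF card, of e3 e4 b3 b4 e5 e6 b1 e2 e1 b2],
        simp add: V insert_commute, simp_all add: Nb Ne m m' insert_commute)
  qed
qed

context cubic_nut_matrix begin

text \<open>The vertex \<open>z\<close> of \<open>Ev0\<close> is adjacent to all of \<open>Ev2\<close>, and
  each vertex of \<open>Ev2\<close> joins two odd vertices.\<close>

lemma not_six_cycle: "\<not> (card Iso = 0 \<and> card Cyc = 6 \<and> card Ev2 = 3 \<and> card Ev0 = 1)"
proof
  assume c: "card Iso = 0 \<and> card Cyc = 6 \<and> card Ev2 = 3 \<and> card Ev0 = 1"
  then have Od_eq: "Od = Cyc" "card Od = 6" using V_split(2) by auto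
  interpret C: two_regular Od "\<lambda>v. N v \<inter> Od" using two_regular_Cyc Od_eq by simp
  have card10: "card V = 10" using order_split c by simp
  have OV: "w \<in> V" if "w \<in> Od" for w using that Od_subset by blast
  obtain z where z: "Ev0 = {z}" using c by (auto simp: card_1_singleton_iff)
  have zV: "z \<in> V" "z \<notin> Od" "N z \<inter> Od = {}" using z by (auto simp: Ev0_def)
  have Nz: "N z = Ev2"
  proof -
    have "N z \<subseteq> V - Od" using zV(3) N_subset[of z] by blast
    then have "N z \<subseteq> Ev2 \<union> {z}" unfolding V_split(1) z .
    moreover have "z \<notin> N z" by (simp add: not_self_nbr)
    ultimately have "N z \<subseteq> Ev2" by blast
    then show ?thesis using cubic[OF zV(1)] c by (intro card_subset_eq) auto
  qed
  have E: "w \<in> V" "w \<notin> Od" "card (N w \<inter> Od) = 2" "N w = insert z (N w \<inter> Od)" if w: "w \<in> Ev2" for w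
  proof -
    show 1: "w \<in> V" "w \<notin> Od" "card (N w \<inter> Od) = 2" using w by (auto simp: Ev2_def)
    have "card (N w - Od) = 1" using even_nbrs[OF 1(1)] 1(3) by simp
    then obtain t where t: "N w - Od = {t}" by (auto simp: card_1_singleton_iff)
    have "z \<in> N w" using nbr_sym[OF zV(1), of w] Nz w by blast
    then have "z \<in> N w - Od" using zV(2) by blast
    then have "t = z" unfolding t by simp
    then show "N w = insert z (N w \<inter> Od)" using t by blast
  qed
  have "\<exists>t. t \<in> Ev2 \<and> N w = insert t (N w \<inter> Od)" if w: "w \<in> Od" for w
  proof -
    have "card (N w - Od) = 1" using even_nbrs[OF OV[OF w]] C.M_card[OF w] by simp
    then obtain t where t: "N w - Od = {t}" by (auto simp: card_1_singleton_iff)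
    then have "t \<in> N w" "t \<notin> Od" by blast+
    then show ?thesis using odd_nbr_in_Ev2[OF w] t by blast
  qed
  then obtain e where e: "\<And>w. w \<in> Od \<Longrightarrow> e w \<in> Ev2 \<and> N w = insert (e w) (N w \<inter> Od)"
    using bchoice[of Od "\<lambda>w t. t \<in> Ev2 \<and> N w = insert t (N w \<inter> Od)"] by blast
  have e_mem: "e w \<in> N w" if "w \<in> Od" for w using e[OF that] by blast
  have e_unique: "t = e w" if "w \<in> Od" "t \<in> N w" "t \<notin> Od" for w t
  proof -
    have "N w \<subseteq> insert (e w) Od" using e[OF that(1)] by blast
    then show ?thesis using that(2,3) by blast
  qed
  have "\<exists>t. t \<noteq> w \<and> N (e w) \<inter> Od = {w, t}" if w: "w \<in> Od" for w
  proof -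
    have "w \<in> N (e w) \<inter> Od" using nbr_sym[OF OV[OF w] e_mem[OF w]] w by blast
    moreover obtain s t where "N (e w) \<inter> Od = {s, t}" "s \<noteq> t" using E(3)[of "e w"] e[OF w] by (auto simp: card_2_iff)
    ultimately show ?thesis by auto
  qed
  then have "\<forall>w\<in>Od. \<exists>t. t \<noteq> w \<and> N (e w) \<inter> Od = {w, t}" by (rule ballI)
  from bchoice[OF this] obtain m where m': "\<forall>w\<in>Od. m w \<noteq> w \<and> N (e w) \<inter> Od = {w, m w}" ..
  have m: "m w \<noteq> w \<and> N (e w) \<inter> Od = {w, m w}" if "w \<in> Od" for w using m' that by (rule bspec)
  have mO: "m w \<in> Od" if "w \<in> Od" for w using m[OF that] by blast
  have em: "e (m w) = e w" if w: "w \<in> Od" for w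
  proof -
    have "m w \<in> N (e w)" using m[OF w] by blast
    then have "e w \<in> N (m w)" using nbr_sym[of "e w" "m w"] E(1) e[OF w] by blast
    then show ?thesis using e_unique[OF mO[OF w], of "e w"] E(2)[of "e w"] e[OF w] by simp
  qed
  have mm: "m (m w) = w" if w: "w \<in> Od" for w
  proof -
    have "{m w, m (m w)} = {w, m w}" using m[OF mO[OF w]] m[OF w] em[OF w] by simp
    then show ?thesis using m[OF w] by (auto simp: doubleton_eq_iff)
  qed
  have Ne: "N (e w) = {w, m w, z}" if w: "w \<in> Od" for w
  proof -
    have "N (e w) = insert z {w, m w}" using E(4)[of "e w"] e[OF w] m[OF w] by simp
    then show ?thesis by (simp add: insert_commute)
  qed
  have "e ` Od = Ev2"
  proof
    show "e ` Od \<subseteq> Ev2" using e by blast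
    show "Ev2 \<subseteq> e ` Od"
    proof
      fix t assume t: "t \<in> Ev2"
      then have "N t \<inter> Od \<noteq> {}" using E(3)[OF t] by auto
      then obtain w where w: "w \<in> N t" "w \<in> Od" by blast
      then have "t = e w" using e_unique[of w t] nbr_sym[OF E(1)[OF t]] E(2)[OF t] by blast
      then show "t \<in> e ` Od" using w(2) by blast
    qed
  qed
  moreover have "V = Od \<union> (Ev2 \<union> {z})" using V_split(1) Od_subset z by blast
  ultimately have V_eq: "V = Od \<union> (e ` Od \<union> {z})" and Nz': "N z = e ` Od" using Nz by simp_all
  have card6: "card Od = 6" by (fact Od_eq(2))
  have Nw: "N w = insert (e w) A" if "w \<in> Od" "N w \<inter> Od = A" for w A using e[OF that(1)] that(2) by simp
  show False
  proof (rule C.hexagon_or_triangles[OF card6])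
    fix c1 c2 c3 c4 c5 c6
    assume d: "distinct [c1, c2, c3, c4, c5, c6]" and S: "Od = {c1, c2, c3, c4, c5, c6}"
      and M: "N c1 \<inter> Od = {c2, c6}" "N c2 \<inter> Od = {c1, c3}" "N c3 \<inter> Od = {c2, c4}"
        "N c4 \<inter> Od = {c3, c5}" "N c5 \<inter> Od = {c4, c6}" "N c6 \<inter> Od = {c1, c5}"
    have O: "c1 \<in> Od" "c2 \<in> Od" "c3 \<in> Od" "c4 \<in> Od" "c5 \<in> Od" "c6 \<in> Od" by (simp_all add: S)
    have V6: "V = {c1, c2, c3, c4, c5, c6, e c1, e c2, e c3, e c4, e c5, e c6, z}" using V_eq unfolding S by auto
    have Nz6: "N z = {e c1, e c2, e c3, e c4, e c5, e c6}" using Nz' unfolding S by simp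
    show False
      by (rule hexagon_with_spokes[OF card10 V6 d Nw[OF O(1) M(1)] Nw[OF O(2) M(2)] Nw[OF O(3) M(3)]
          Nw[OF O(4) M(4)] Nw[OF O(5) M(5)] Nw[OF O(6) M(6)] O[THEN Ne] Nz6 O[THEN em]],
        unfold S[symmetric]) (simp add: mO mm m)
  next
    fix c1 c2 c3 c4 c5 c6
    assume d: "distinct [c1, c2, c3, c4, c5, c6]" and S: "Od = {c1, c2, c3, c4, c5, c6}"
      and M: "N c1 \<inter> Od = {c2, c3}" "N c2 \<inter> Od = {c1, c3}" "N c3 \<inter> Od = {c1, c2}"
        "N c4 \<inter> Od = {c5, c6}" "N c5 \<inter> Od = {c4, c6}" "N c6 \<inter> Od = {c4, c5}"
    have O: "c1 \<in> Od" "c2 \<in> Od" "c3 \<in> Od" "c4 \<in> Od" "c5 \<in> Od" "c6 \<in> Od" by (simp_all add: S)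
    have V6: "V = {c1, c2, c3, c4, c5, c6, e c1, e c2, e c3, e c4, e c5, e c6, z}" using V_eq unfolding S by auto
    have Nz6: "N z = {e c1, e c2, e c3, e c4, e c5, e c6}" using Nz' unfolding S by simp
    show False
      by (rule triangles_with_spokes[OF card10 V6 d Nw[OF O(1) M(1)] Nw[OF O(2) M(2)] Nw[OF O(3) M(3)]
          Nw[OF O(4) M(4)] Nw[OF O(5) M(5)] Nw[OF O(6) M(6)] O[THEN Ne] Nz6 O[THEN em]],
        unfold S[symmetric]) (simp add: mO mm m)
  qed
qed

text \<open>Every even vertex subdivides an edge of a cubic multigraph on the four odd vertices. Without twins
  it has no triple edge, so it is the complete graph or has two disjoint double edges. The even vertices are
  matched among themselves by their third edges.\<close>

lemma not_four_isolated: "\<not> (card Iso = 4 \<and> card Cyc = 0 \<and> card Ev2 = 6 \<and> card Ev0 = 0)"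
proof
  assume c: "card Iso = 4 \<and> card Cyc = 0 \<and> card Ev2 = 6 \<and> card Ev0 = 0"
  then have Od_eq: "Od = Iso" "card Od = 4" using V_split(2) by auto
  have card10: "card V = 10" using order_split c by simp
  have "Ev0 = {}" using c by simp
  then have V_eq: "V = Od \<union> Ev2" using V_split(1) Od_subset by blast
  have O: "b \<in> V" "N b \<subseteq> Ev2" "card (N b) = 3" if b: "b \<in> Od" for b
  proof -
    show 1: "b \<in> V" using b Od_subset by blast
    have "b \<in> Iso" using b Od_eq(1) by blast
    then have "N b \<inter> Od = {}" by (simp add: Iso_def)
    then show "N b \<subseteq> Ev2" using odd_nbr_in_Ev2[OF b] by blast
    show "card (N b) = 3" using cubic[OF 1] .
  qed
  have E: "e \<in> V" "e \<notin> Od" "card (N e \<inter> Od) = 2" if "e \<in> Ev2" for e using that by (auto simp: Ev2_def)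
  have mem: "b \<in> N e \<longleftrightarrow> e \<in> N b" if "b \<in> Od" "e \<in> Ev2" for b e
    using nbr_commute[of b e] O(1)[OF that(1)] E(1)[OF that(2)] by blast
  have "\<exists>t. t \<in> Ev2 \<and> N e = insert t (N e \<inter> Od)" if e: "e \<in> Ev2" for e
  proof -
    have "card (N e - Od) = 1" using even_nbrs[OF E(1)[OF e]] E(3)[OF e] by simp
    then obtain t where t: "N e - Od = {t}" by (auto simp: card_1_singleton_iff)
    then have "t \<in> V" "t \<notin> Od" using N_subset[of e] by blast+
    then show ?thesis using t V_eq by blast
  qed
  then obtain m where m: "\<And>e. e \<in> Ev2 \<Longrightarrow> m e \<in> Ev2 \<and> N e = insert (m e) (N e \<inter> Od)"
    using bchoice[of Ev2 "\<lambda>e t. t \<in> Ev2 \<and> N e = insert t (N e \<inter> Od)"] by blast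
  have inv: "m e \<in> Ev2 \<and> m e \<noteq> e \<and> m (m e) = e" if e: "e \<in> Ev2" for e
  proof -
    have 1: "m e \<in> Ev2" "m e \<in> N e" using m[OF e] by blast+
    then have "e \<in> N (m e)" "m e \<noteq> e" using nbr_sym[OF E(1)[OF e]] not_self_nbr[of e] by metis+
    moreover have "N (m e) \<subseteq> insert (m (m e)) Od" using m[OF 1(1)] by blast
    ultimately have "e \<in> insert (m (m e)) Od" by (meson subsetD)
    then have "m (m e) = e" using E(2)[OF e] by auto
    then show ?thesis using 1(1) \<open>m e \<noteq> e\<close> by simp
  qed
  have Ne: "N e = {m e, p, q}" if "e \<in> Ev2" "N e \<inter> Od = {p, q}" for e p q using m[OF that(1)] that(2) by simp
  have twins: "N p \<noteq> N q" if "p \<in> Od" "q \<in> Od" "p \<noteq> q" for p q using cubic_twins[of p q] that O by blast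
  have pairI: "N e \<inter> Od = {p, q}" if "e \<in> Ev2" "N e \<inter> Od \<subseteq> {p, q}" for e p q
  proof -
    have "card {p, q} \<le> 2" by (simp add: card_insert_if)
    then show ?thesis using that(2) card_seteq[of "{p, q}" "N e \<inter> Od"] E(3)[OF that(1)] by simp
  qed
  have tripleI: "N b = {s, t, w}" if "b \<in> Od" "s \<in> N b" "t \<in> N b" "w \<in> N b" "distinct [s, t, w]" for b s t w
    using card_subset_eq[OF finite_N, of "{s, t, w}" b] that O(3)[OF that(1)] by simp
  have quad: "Od = {p, q, r, s}" if "p \<in> Od" "q \<in> Od" "r \<in> Od" "s \<in> Od" "distinct [p, q, r, s]" for p q r s
    using card_subset_eq[OF _ , of Od "{p, q, r, s}"] that Od_eq(2) finite_subset[OF Od_subset fin] by auto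
  have "Od \<noteq> {}" using Od_eq(2) by auto
  then obtain b where b: "b \<in> Od" by blast
  obtain e1 e2 e3 where e: "N b = {e1, e2, e3}" "e1 \<noteq> e2" "e1 \<noteq> e3" "e2 \<noteq> e3"
    using O(3)[OF b] by (auto simp: card_3_iff)
  have eE: "e1 \<in> Ev2" "e2 \<in> Ev2" "e3 \<in> Ev2" using O(2)[OF b] e(1) by auto
  have other: "\<exists>f. f \<in> Od \<and> f \<noteq> b \<and> N e \<inter> Od = {b, f}" if "e \<in> N b" for e
  proof -
    have "e \<in> Ev2" using O(2)[OF b] that by blast
    then have bN: "b \<in> N e \<inter> Od" "card (N e \<inter> Od) = 2" using mem[OF b] that b E(3) by blast+
    then obtain s t where st: "N e \<inter> Od = {s, t}" "s \<noteq> t" by (auto simp: card_2_iff)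
    then have "s \<in> Od" "t \<in> Od" "b = s \<or> b = t" using bN(1) by blast+
    then show ?thesis using st by (elim disjE) (auto simp: insert_commute)
  qed
  have necklace: False if N1: "N b = {e1, e2, e3}" and de: "e1 \<noteq> e2" "e1 \<noteq> e3" "e2 \<noteq> e3"
    and f: "f \<in> Od" "f \<noteq> b" and g: "g \<in> Od" "g \<noteq> b" "g \<noteq> f"
    and N_e: "N e1 \<inter> Od = {b, f}" "N e2 \<inter> Od = {b, f}" "N e3 \<inter> Od = {b, g}" for e1 e2 e3 f g
  proof -
    have eE: "e1 \<in> Ev2" "e2 \<in> Ev2" "e3 \<in> Ev2" using O(2)[OF b] N1 by auto
    have "card (Od - {b, f, g}) = 1" using Od_eq(2) b f g by (subst card_Diff_subset) auto
    then obtain k where "Od - {b, f, g} = {k}" by (auto simp: card_1_singleton_iff)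
    then have k: "k \<in> Od" "k \<noteq> b" "k \<noteq> f" "k \<noteq> g" by blast+
    have Od4: "Od = {b, f, g, k}" using quad[OF b f(1) g(1) k(1)] f(2) g(2,3) k(2-4) by simp
    define R where "R = Ev2 - {e1, e2, e3}"
    have R: "card R = 3" "finite R" "R \<subseteq> Ev2" using c eE de unfolding R_def by (subst card_Diff_subset; simp) auto
    have fk: "e1 \<in> N f" "e2 \<in> N f" "e3 \<notin> N f" "e3 \<in> N g" "e1 \<notin> N k" "e2 \<notin> N k" "e3 \<notin> N k"
      using mem[OF f(1) eE(1)] mem[OF f(1) eE(2)] mem[OF f(1) eE(3)] mem[OF g(1) eE(3)]
        mem[OF k(1) eE(1)] mem[OF k(1) eE(2)] mem[OF k(1) eE(3)] N_e f g k by blast+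
    have "N k \<subseteq> R" using O(2)[OF k(1)] fk(5-7) unfolding R_def by blast
    then have Nk: "N k = R" using O(3)[OF k(1)] R by (intro card_subset_eq) auto
    have "N f \<noteq> {e1, e2}" using O(3)[OF f(1)] de(1) by auto
    then obtain h where h: "h \<in> N f" "h \<noteq> e1" "h \<noteq> e2" using fk(1,2) by blast
    have hR: "h \<in> R" using O(2)[OF f(1)] h fk(3) unfolding R_def by blast
    have Nf: "N f = {e1, e2, h}" using tripleI[OF f(1) fk(1,2) h(1)] de(1) h(2,3) by simp
    have in_R: "e \<in> Ev2" "b \<notin> N e" "k \<in> N e" "e \<notin> {e1, e2, e3}" if "e \<in> R" for e
      using that mem[OF b, of e] mem[OF k(1), of e] N1 Nk unfolding R_def by blast+
    have "f \<in> N h" using mem[OF f(1), of h] h(1) in_R(1)[OF hR] by blast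
    then have Nh: "N h \<inter> Od = {f, k}"
      using card_subset_eq[of "N h \<inter> Od" "{f, k}"] E(3)[OF in_R(1)[OF hR]] in_R(3)[OF hR] f(1) k(1,3) by auto
    have "card (R - {h}) = 2" using R hR by simp
    then obtain g2 g3 where gg: "R - {h} = {g2, g3}" "g2 \<noteq> g3" by (auto simp: card_2_iff)
    have gR: "g2 \<in> R" "g3 \<in> R" "g2 \<noteq> h" "g3 \<noteq> h" using gg(1) by blast+
    have Ng': "N e \<inter> Od = {g, k}" if eR: "e \<in> R" "e \<noteq> h" for e
    proof (rule pairI[OF in_R(1)[OF eR(1)]])
      have "f \<notin> N e" using mem[OF f(1) in_R(1)[OF eR(1)]] Nf in_R(4)[OF eR(1)] eR(2) by blast
      then show "N e \<inter> Od \<subseteq> {g, k}" using in_R(2)[OF eR(1)] unfolding Od4 by blast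
    qed
    have "e \<in> N g" if "e \<in> R" "e \<noteq> h" for e using Ng'[OF that] mem[OF g(1) in_R(1)[OF that(1)]] by blast
    then have "g2 \<in> N g" "g3 \<in> N g" using gR by simp_all
    then have Ng: "N g = {g2, g3, e3}"
      using tripleI[OF g(1) _ _ fk(4)] gg(2) in_R(4)[OF gR(1)] in_R(4)[OF gR(2)] by simp
    have Reqs: "R = {g2, g3, h}" using gg(1) hR by blast
    have "Ev2 = {e1, e2, e3} \<union> R" using eE unfolding R_def by blast
    also have "\<dots> = {e1, e2, g2, g3, e3, h}" unfolding Reqs by blast
    finally have E6: "Ev2 = {e1, e2, g2, g3, e3, h}" .
    have "Od \<union> Ev2 = {b, f, g, k, e1, e2, g2, g3, e3, h}" unfolding Od4 E6 by auto
    with V_eq have V6: "V = {b, f, g, k, e1, e2, g2, g3, e3, h}" by (rule trans)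
    have d6: "distinct [e1, e2, g2, g3, e3, h]" using de gg(2) gR in_R(4)[OF gR(1)] in_R(4)[OF gR(2)] in_R(4)[OF hR] by auto
    have Nb: "N b = {e1, e2, e3}" "N f = {e1, e2, h}" "N k = {g2, g3, h}" using N1 Nf Nk Reqs by simp_all
    show False
      by (rule subdivided_necklace_with_mates[OF card10 V6 d6 Nb(1,2) Ng Nb(3) Ne[OF eE(1) N_e(1)] Ne[OF eE(2) N_e(2)]
          Ne[OF in_R(1)[OF gR(1)] Ng'[OF gR(1,3)]] Ne[OF in_R(1)[OF gR(2)] Ng'[OF gR(2,4)]]
          Ne[OF eE(3) N_e(3)] Ne[OF in_R(1)[OF hR] Nh]], unfold E6[symmetric]) (intro ballI inv)
  qed
  obtain f1 where f1: "f1 \<in> Od" "f1 \<noteq> b" "N e1 \<inter> Od = {b, f1}" using other[of e1] e(1) by auto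
  obtain f2 where f2: "f2 \<in> Od" "f2 \<noteq> b" "N e2 \<inter> Od = {b, f2}" using other[of e2] e(1) by auto
  obtain f3 where f3: "f3 \<in> Od" "f3 \<noteq> b" "N e3 \<inter> Od = {b, f3}" using other[of e3] e(1) by auto
  have eN: "e1 \<in> N f1" "e2 \<in> N f2" "e3 \<in> N f3"
    using mem[OF f1(1) eE(1)] mem[OF f2(1) eE(2)] mem[OF f3(1) eE(3)] f1 f2 f3 by blast+
  consider "f1 = f2" "f1 = f3" | "f1 = f2" "f3 \<noteq> f1" | "f1 = f3" "f2 \<noteq> f1" | "f2 = f3" "f1 \<noteq> f2"
    | "f1 \<noteq> f2" "f1 \<noteq> f3" "f2 \<noteq> f3" by blast
  then show False
  proof cases
    case 1
    then have "N f1 = N b" using tripleI[OF f1(1) eN(1), of e2 e3] eN e by simp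
    then show False using twins[OF f1(1) b f1(2)] by blast
  next
    case 2
    then show False using necklace[of e1 e2 e3 f1 f3] e f1 f2 f3 by auto
  next
    case 3
    then show False using necklace[of e1 e3 e2 f1 f2] e f1 f2 f3 by (auto simp: insert_commute)
  next
    case 4
    then show False using necklace[of e2 e3 e1 f2 f1] e f1 f2 f3 by (auto simp: insert_commute)
  next
    case 5
    have Od4: "Od = {b, f1, f2, f3}" using quad[OF b f1(1) f2(1) f3(1)] f1(2) f2(2) f3(2) 5 by simp
    define R where "R = Ev2 - {e1, e2, e3}"
    have R: "card R = 3" "finite R" using c eE e unfolding R_def by (subst card_Diff_subset; simp) auto
    have in_R: "t \<in> Ev2" "b \<notin> N t" "t \<notin> {e1, e2, e3}" if "t \<in> R" for t
      using that mem[OF b, of t] e(1) unfolding R_def by blast+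
    have missing: "\<exists>h. h \<in> R \<and> h \<notin> N f" if f: "f \<in> Od" "t \<in> N f" "t \<in> {e1, e2, e3}" for f t
    proof (rule ccontr)
      assume "\<not> ?thesis"
      then have "insert t R \<subseteq> N f" using f(2) by blast
      moreover have "card (insert t R) = 4" using R in_R(3) f(3) by (subst card_insert_disjoint) auto
      ultimately show False using card_mono[OF finite_N, of "insert t R" f] O(3)[OF f(1)] by simp
    qed
    obtain h1 where h1: "h1 \<in> R" "h1 \<notin> N f1" using missing[OF f1(1) eN(1)] by blast
    obtain h2 where h2: "h2 \<in> R" "h2 \<notin> N f2" using missing[OF f2(1) eN(2)] by blast
    obtain h3 where h3: "h3 \<in> R" "h3 \<notin> N f3" using missing[OF f3(1) eN(3)] by blast
    note hE = in_R(1)[OF h1(1)] in_R(1)[OF h2(1)] in_R(1)[OF h3(1)]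
    have "f1 \<notin> N h1" "f2 \<notin> N h2" "f3 \<notin> N h3"
      using mem[OF f1(1) hE(1)] mem[OF f2(1) hE(2)] mem[OF f3(1) hE(3)] h1(2) h2(2) h3(2) by simp_all
    then have "N h3 \<inter> Od \<subseteq> {f1, f2}" "N h2 \<inter> Od \<subseteq> {f1, f3}" "N h1 \<inter> Od \<subseteq> {f2, f3}"
      using in_R(2)[OF h1(1)] in_R(2)[OF h2(1)] in_R(2)[OF h3(1)] unfolding Od4 by blast+
    then have Nh: "N h3 \<inter> Od = {f1, f2}" "N h2 \<inter> Od = {f1, f3}" "N h1 \<inter> Od = {f2, f3}"
      using pairI hE by simp_all
    have mh: "h3 \<in> N f1" "h2 \<in> N f1" "h3 \<in> N f2" "h1 \<in> N f2" "h2 \<in> N f3" "h1 \<in> N f3"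
    proof -
      have "f1 \<in> N h3" "f1 \<in> N h2" "f2 \<in> N h3" "f2 \<in> N h1" "f3 \<in> N h2" "f3 \<in> N h1" using Nh by blast+
      then show "h3 \<in> N f1" "h2 \<in> N f1" "h3 \<in> N f2" "h1 \<in> N f2" "h2 \<in> N f3" "h1 \<in> N f3"
        using mem[OF f1(1)] mem[OF f2(1)] mem[OF f3(1)] hE by simp_all
    qed
    have dh: "h1 \<noteq> h2" "h1 \<noteq> h3" "h2 \<noteq> h3" using mh h1(2) h2(2) h3(2) by blast+
    have de: "e1 \<notin> {h1, h2, h3}" "e2 \<notin> {h1, h2, h3}" "e3 \<notin> {h1, h2, h3}"
      using in_R(3)[OF h1(1)] in_R(3)[OF h2(1)] in_R(3)[OF h3(1)] by blast+
    have Reqs: "R = {h1, h2, h3}" using h1(1) h2(1) h3(1) dh R by (intro card_subset_eq[symmetric]) auto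
    have "Ev2 = {e1, e2, e3} \<union> R" using eE unfolding R_def by blast
    also have "\<dots> = {e1, e2, e3, h3, h2, h1}" unfolding Reqs by blast
    finally have E6: "Ev2 = {e1, e2, e3, h3, h2, h1}" .
    have "Od \<union> Ev2 = {b, f1, f2, f3, e1, e2, e3, h3, h2, h1}" unfolding Od4 E6 by auto
    with V_eq have V6: "V = {b, f1, f2, f3, e1, e2, e3, h3, h2, h1}" by (rule trans)
    have d6: "distinct [e1, e2, e3, h3, h2, h1]" using e(2-4) dh de by auto
    have Nf: "N f1 = {e1, h3, h2}" "N f2 = {e2, h3, h1}" "N f3 = {e3, h2, h1}"
      using tripleI[OF f1(1) eN(1) mh(1,2)] tripleI[OF f2(1) eN(2) mh(3,4)] tripleI[OF f3(1) eN(3) mh(5,6)] dh de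
      by auto
    show False
      by (rule subdivided_K4_with_mates[OF card10 V6 d6 e(1) Nf Ne[OF eE(1) f1(3)] Ne[OF eE(2) f2(3)] Ne[OF eE(3) f3(3)]
          Ne[OF hE(3) Nh(1)] Ne[OF hE(2) Nh(2)] Ne[OF hE(1) Nh(3)]], unfold E6[symmetric]) (intro ballI inv)
  qed
qed

end

lemma cubic_order:
  assumes "nut_matrix V a x" "\<forall>u\<in>V. card (nbrs V a u) = 3"
  shows "10 < card V"
proof (rule ccontr)
  assume small: "\<not> 10 < card V"
  obtain a' x' where n: "normal_nut_matrix V a' x'" "nbrs V a' = nbrs V a" using normalise[OF assms(1)] by blast
  interpret normal_nut_matrix V a' x' by (rule n(1))
  interpret cubic_nut_matrix V a' x' by unfold_locales (use assms(2) n(2) in simp)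
  show False
    using small_order_cases small not_two_isolated not_four_isolated not_four_cycle not_six_cycle by linarith
qed

section \<open>The orders of regular sign-unbalanced nut graphs\<close>

lemma order_necessary:
  assumes "int k \<in> unbalanced_nut_orders \<rho>"
  shows "\<rho> < k" "even (\<rho> * k)" "\<rho> \<noteq> 1" "\<rho> \<noteq> 2" "k = Suc \<rho> \<Longrightarrow> 4 dvd \<rho>"
    "\<rho> = 3 \<Longrightarrow> 10 < k" "\<rho> = 4 \<Longrightarrow> k \<noteq> 6" "\<rho> = 5 \<Longrightarrow> k \<noteq> 8"
proof -
  obtain V :: "nat set" and a x where nut: "nut_matrix V a x" and reg: "\<forall>u\<in>V. card (nbrs V a u) = \<rho>"
    and "unbalanced V a" and k: "int (card V) = int k"
    using nut_order_matrix[OF assms] by metis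
  interpret nut_matrix V a x by (rule nut)
  have cardV: "card V = k" using k by simp
  obtain u where u: "u \<in> V" using nonempty by blast
  show "\<rho> < k" using order_gt_degree[OF u] reg u cardV by simp
  show "even (\<rho> * k)" using even_sum_degrees reg cardV by (simp add: mult.commute)
  show "\<rho> \<noteq> 1" "\<rho> \<noteq> 2" using not_1_regular not_2_regular reg by auto
  show "4 dvd \<rho>" if "k = Suc \<rho>" using complete_degree[OF nut reg] cardV that by simp
  show "10 < k" if "\<rho> = 3" using cubic_order[OF nut] reg cardV that by simp
  obtain a' x' where n: "normal_nut_matrix V a' x'" "nbrs V a' = nbrs V a" using normalise[OF nut] by blast
  show "k \<noteq> 6" if "\<rho> = 4"
    using normal_nut_matrix.not_4_regular_order_6[OF n(1)] n(2) reg cardV that by auto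
  show "k \<noteq> 8" if "\<rho> = 5"
    using normal_nut_matrix.not_5_regular_order_8[OF n(1)] n(2) reg cardV that by auto
qed

lemma unbalanced_nut_orders_eqI:
  assumes "\<And>k :: nat. \<lbrakk>\<rho> < k; even (\<rho> * k); \<rho> \<noteq> 1; \<rho> \<noteq> 2; k = Suc \<rho> \<Longrightarrow> 4 dvd \<rho>;
      \<rho> = 3 \<Longrightarrow> 10 < k; \<rho> = 4 \<Longrightarrow> k \<noteq> 6; \<rho> = 5 \<Longrightarrow> k \<noteq> 8\<rbrakk> \<Longrightarrow> int k \<in> S"
    and "\<And>k :: nat. int k \<in> S \<Longrightarrow> int k \<in> unbalanced_nut_orders \<rho>"
    and "\<And>n. n \<in> S \<Longrightarrow> 0 \<le> n"
  shows "unbalanced_nut_orders \<rho> = S"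
proof (intro equalityI subsetI)
  fix n assume n: "n \<in> unbalanced_nut_orders \<rho>"
  then obtain k where k: "n = int k" by (auto simp: unbalanced_nut_orders_def)
  show "n \<in> S" using order_necessary[OF n[unfolded k]] unfolding k by (rule assms(1))
next
  fix n assume "n \<in> S"
  then show "n \<in> unbalanced_nut_orders \<rho>" using assms(2)[of "nat n"] assms(3)[of n] by simp
qed

lemma int_mem_doubles: "int k \<in> {2 * j | j :: int. c \<le> j} \<longleftrightarrow> even k \<and> 2 * c \<le> int k"
  unfolding mem_Collect_eq by presburger

theorem theorem21:
  shows "unbalanced_nut_orders 1 = {}
    \<and> unbalanced_nut_orders 2 = {}
    \<and> unbalanced_nut_orders 3 = {2 * k | k :: int. k \<ge> 6}
    \<and> unbalanced_nut_orders 4 = {5} \<union> {k :: int. k \<ge> 7}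
    \<and> unbalanced_nut_orders 5 = {2 * k | k :: int. k \<ge> 5}
    \<and> unbalanced_nut_orders 6 = {k :: int. k \<ge> 8}
    \<and> unbalanced_nut_orders 7 = {2 * k | k :: int. k \<ge> 5}
    \<and> unbalanced_nut_orders 8 = {k :: int. k \<ge> 9}
    \<and> unbalanced_nut_orders 9 = {2 * k | k :: int. k \<ge> 6}
    \<and> unbalanced_nut_orders 10 = {k :: int. k \<ge> 12}
    \<and> unbalanced_nut_orders 11 = {2 * k | k :: int. k \<ge> 7}"
proof (intro conjI)
  show "unbalanced_nut_orders 1 = {}" "unbalanced_nut_orders 2 = {}"
    by (rule unbalanced_nut_orders_eqI; simp)+
  show "unbalanced_nut_orders 3 = {2 * k | k :: int. k \<ge> 6}"
    by (rule unbalanced_nut_orders_eqI, unfold int_mem_doubles, presburger) (use orders_3 in auto)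
  show "unbalanced_nut_orders 4 = {5} \<union> {k :: int. k \<ge> 7}"
    by (rule unbalanced_nut_orders_eqI, simp, presburger) (use orders_4 order_4_5 in auto)
  show "unbalanced_nut_orders 5 = {2 * k | k :: int. k \<ge> 5}"
    by (rule unbalanced_nut_orders_eqI, unfold int_mem_doubles, presburger) (use orders_5 in auto)
  show "unbalanced_nut_orders 6 = {k :: int. k \<ge> 8}"
    by (rule unbalanced_nut_orders_eqI, simp, presburger) (use orders_6 in auto)
  show "unbalanced_nut_orders 7 = {2 * k | k :: int. k \<ge> 5}"
    by (rule unbalanced_nut_orders_eqI, unfold int_mem_doubles, presburger) (use orders_7 in auto)
  show "unbalanced_nut_orders 8 = {k :: int. k \<ge> 9}"
    by (rule unbalanced_nut_orders_eqI, simp) (use orders_8 in auto)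
  show "unbalanced_nut_orders 9 = {2 * k | k :: int. k \<ge> 6}"
    by (rule unbalanced_nut_orders_eqI, unfold int_mem_doubles, presburger) (use orders_9 in auto)
  show "unbalanced_nut_orders 10 = {k :: int. k \<ge> 12}"
    by (rule unbalanced_nut_orders_eqI, simp, presburger) (use orders_10 in auto)
  show "unbalanced_nut_orders 11 = {2 * k | k :: int. k \<ge> 7}"
    by (rule unbalanced_nut_orders_eqI, unfold int_mem_doubles, presburger) (use orders_11 in auto)
qed

end
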